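(* Let $\beta>0$, $h\ge 0$, and let $h_1,h_2,\ldots$ be any sequence of (deterministic) vectors with $h_N\in\mathbb{R}^N$ and $|h_N|=h$ for all $N$. Then $$F_N(\beta,h_N)\longrightarrow\sup_{q\in[0,1]:\,\beta(1-q)\le\frac1{\sqrt2}}\mathcal{B}(q)\quad\text{in probability as }N\to\infty,$$ where $$\mathcal{B}(q)=\sqrt{h^2q+2\beta^2q^2}+\frac12\log(1-q)+\frac{\beta^2}{2}(1-q)^2 .$$
   Context: Let $J_{ij}$, $i,j\ge1$, be iid standard Gaussian random variables on a probability space $(\Omega,\mathcal{A},\mathbb{P})$, and for $\sigma\in\mathbb{R}^N$ let $H_N(\sigma)=\sqrt N\sum_{i,j=1}^N J_{ij}\sigma_i\sigma_j$. Let $E$ be the uniform probability measure (and its expectation) on the unit sphere of $\mathbb{R}^N$, and let $$F_N(\beta,h_N)=\frac1N\log E\left[e^{\beta H_N(\sigma)+N h_N\cdot\sigma}\right].$$ The convention $\log 0=-\infty$ is used, so $\mathcal{B}(1)=-\infty$. *)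

theory Defs
  imports "HOL-Probability.Probability"
begin

text \<open>
  The dimension \<open>N\<close> varies inside the statement, so a vector of \<open>\<real>\<^sup>N\<close> is given by its values on
  the index set \<open>{1..N}\<close>, its Euclidean norm is \<^term>\<open>L2_set x {1..N}\<close>, and Lebesgue measure on
  \<open>\<real>\<^sup>N\<close> is the product measure below.
\<close>

definition lebesgue_R :: "nat \<Rightarrow> (nat \<Rightarrow> real) measure" where
  "lebesgue_R N = (\<Pi>\<^sub>M i\<in>{1..N}. lborel)"

definition unit_ball :: "nat \<Rightarrow> (nat \<Rightarrow> real) set" where
  "unit_ball N = {x \<in> space (lebesgue_R N). L2_set x {1..N} \<le> 1}"

definition radial_proj :: "nat \<Rightarrow> (nat \<Rightarrow> real) \<Rightarrow> nat \<Rightarrow> real" where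
  "radial_proj N x = (\<lambda>i\<in>{1..N}. x i / L2_set x {1..N})"

text \<open>
  Uniform distribution on the unit sphere of \<open>\<real>\<^sup>N\<close> as normalised cone measure: the mass of a set \<open>A\<close>
  of unit vectors is the volume of the cone \<open>{r x | 0 < r \<le> 1, x \<in> A}\<close> divided by the volume of the
  unit ball.  It lives on all of \<open>\<real>\<^sup>N\<close>; see \<open>AE_uniform_sphere\<close> for its concentration on the sphere.
\<close>

definition uniform_sphere :: "nat \<Rightarrow> (nat \<Rightarrow> real) measure" where
  "uniform_sphere N =
     distr (uniform_measure (lebesgue_R N) (unit_ball N)) (lebesgue_R N) (radial_proj N)"

definition hamiltonian :: "(nat \<Rightarrow> nat \<Rightarrow> real) \<Rightarrow> nat \<Rightarrow> (nat \<Rightarrow> real) \<Rightarrow> real" where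
  "hamiltonian J N \<sigma> = sqrt (real N) * (\<Sum>i=1..N. \<Sum>j=1..N. J i j * \<sigma> i * \<sigma> j)"

definition free_energy :: "(nat \<Rightarrow> nat \<Rightarrow> real) \<Rightarrow> nat \<Rightarrow> real \<Rightarrow> (nat \<Rightarrow> real) \<Rightarrow> real" where
  "free_energy J N \<beta> v =
     1 / real N * ln (\<integral>\<sigma>. exp (\<beta> * hamiltonian J N \<sigma> + real N * (\<Sum>i=1..N. v i * \<sigma> i))
                        \<partial>uniform_sphere N)"

text \<open>The library's real \<^const>\<open>ln\<close> has \<open>ln 0 = 0\<close>; here the value at \<open>0\<close> is \<open>-\<infinity>\<close>.\<close>

definition log_ext :: "real \<Rightarrow> ereal" where
  "log_ext x = (if x = 0 then -\<infinity> else ereal (ln x))"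

definition TAP_fun :: "real \<Rightarrow> real \<Rightarrow> real \<Rightarrow> ereal" where
  "TAP_fun \<beta> h q =
     ereal (sqrt (h\<^sup>2 * q + 2 * \<beta>\<^sup>2 * q\<^sup>2)) + ereal (1/2) * log_ext (1 - q)
       + ereal (\<beta>\<^sup>2 / 2 * (1 - q)\<^sup>2)"

text \<open>
  An extended-real limit is allowed so that a supremum of extended reals can be used directly.  If
  \<open>L = \<plusminus>\<infinity>\<close> the distance is always \<open>\<infinity>\<close>, so on a probability space the predicate is false:
  it entails that \<open>L\<close> is finite.
\<close>

definition converges_in_probability ::
    "'a measure \<Rightarrow> (nat \<Rightarrow> 'a \<Rightarrow> real) \<Rightarrow> ereal \<Rightarrow> bool" where
  "converges_in_probability M X L \<longleftrightarrow>
     (\<forall>n. X n \<in> borel_measurable M) \<and>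
     (\<forall>\<epsilon>>0. (\<lambda>n. measure M {\<omega> \<in> space M. ereal \<epsilon> \<le> \<bar>ereal (X n \<omega>) - L\<bar>}) \<longlonglongrightarrow> 0)"


lemma product_sigma_finite_lborel: "product_sigma_finite (\<lambda>_::nat. lborel :: real measure)"
  by standard

lemma measurable_component_lebesgue_R [measurable]:
  "i \<in> {1..N} \<Longrightarrow> (\<lambda>x. x i) \<in> borel_measurable (lebesgue_R N)"
  unfolding lebesgue_R_def by measurable

lemma measurable_L2_set [measurable]:
  "(\<lambda>x. L2_set x {1..N}) \<in> borel_measurable (lebesgue_R N)"
  unfolding L2_set_def by measurable

lemma unit_ball_sets [measurable]: "unit_ball N \<in> sets (lebesgue_R N)"
  unfolding unit_ball_def by measurable

lemma measurable_radial_proj [measurable]: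
  "radial_proj N \<in> measurable (lebesgue_R N) (lebesgue_R N)"
proof -
  have "(\<lambda>x. \<lambda>i\<in>{1..N}. x i / L2_set x {1..N})
          \<in> measurable (lebesgue_R N) (\<Pi>\<^sub>M i\<in>{1..N}. lborel)"
  proof (rule measurable_restrict)
    fix i assume i [measurable]: "i \<in> {1..N}"
    show "(\<lambda>x. x i / L2_set x {1..N}) \<in> measurable (lebesgue_R N) lborel"
      by (simp only: measurable_lborel1) measurable
  qed
  thus ?thesis unfolding radial_proj_def[abs_def] by (simp add: lebesgue_R_def)
qed

lemma emeasure_box:
  assumes "\<And>i. i \<in> {1..N} \<Longrightarrow> A i \<in> sets borel"
  shows "emeasure (lebesgue_R N) (PiE {1..N} A) = (\<Prod>i=1..N. emeasure lborel (A i))"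
proof -
  interpret product_sigma_finite "\<lambda>_::nat. lborel :: real measure"
    by (rule product_sigma_finite_lborel)
  show ?thesis unfolding lebesgue_R_def using assms by (subst emeasure_PiM) auto
qed

lemma emeasure_unit_ball:
  "emeasure (lebesgue_R N) (unit_ball N) \<noteq> 0" "emeasure (lebesgue_R N) (unit_ball N) \<noteq> \<infinity>"
proof -
  let ?l = "\<Pi>\<^sub>E i\<in>{1..N}. {0..1 / real N}" and ?u = "\<Pi>\<^sub>E i\<in>{1..N}. {-1..1::real}"
  have "L2_set x {1..N} \<le> 1" if "x \<in> ?l" for x
  proof -
    have "L2_set x {1..N} \<le> (\<Sum>i=1..N. x i)"
      by (rule L2_set_le_sum) (use that in \<open>auto simp: PiE_iff\<close>)
    also have "\<dots> \<le> (\<Sum>i=1..N. 1 / real N)"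
      by (rule sum_mono) (use that in \<open>auto simp: PiE_iff\<close>)
    also have "\<dots> \<le> 1" by simp
    finally show ?thesis .
  qed
  hence "?l \<subseteq> unit_ball N"
    by (auto simp: unit_ball_def lebesgue_R_def space_PiM PiE_iff)
  hence "emeasure (lebesgue_R N) ?l \<le> emeasure (lebesgue_R N) (unit_ball N)"
    by (rule emeasure_mono) measurable
  moreover have "emeasure (lebesgue_R N) ?l = (\<Prod>i=1..N. ennreal (1 / real N))"
    by (subst emeasure_box) auto
  moreover have "(\<Prod>i=1..N. ennreal (1 / real N)) \<noteq> 0"
    by (cases "N = 0") auto
  ultimately show "emeasure (lebesgue_R N) (unit_ball N) \<noteq> 0" by (metis le_zero_eq)
  have "\<bar>x i\<bar> \<le> 1" if "x \<in> unit_ball N" "i \<in> {1..N}" for x i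
  proof -
    have "\<bar>x i\<bar> \<le> L2_set (\<lambda>i. \<bar>x i\<bar>) {1..N}" by (rule member_le_L2_set) (use that in auto)
    also have "\<dots> = L2_set x {1..N}" by (simp add: L2_set_def)
    also have "\<dots> \<le> 1" using that by (simp add: unit_ball_def)
    finally show ?thesis .
  qed
  hence "unit_ball N \<subseteq> ?u"
    by (fastforce simp: unit_ball_def lebesgue_R_def space_PiM PiE_iff abs_le_iff minus_le_iff
          extensional_def)
  hence "emeasure (lebesgue_R N) (unit_ball N) \<le> emeasure (lebesgue_R N) ?u"
    by (rule emeasure_mono) (auto simp: lebesgue_R_def intro!: sets_PiM_I_finite)
  also have "\<dots> = (\<Prod>i=1..N. ennreal 2)" by (subst emeasure_box) auto
  also have "\<dots> < \<infinity>" by (simp add: power_less_top_ennreal)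
  finally show "emeasure (lebesgue_R N) (unit_ball N) \<noteq> \<infinity>" by simp
qed

lemma prob_space_uniform_sphere: "prob_space (uniform_sphere N)"
  unfolding uniform_sphere_def
  by (intro prob_space.prob_space_distr prob_space_uniform_measure emeasure_unit_ball) measurable

lemma AE_uniform_sphere:
  assumes "N \<ge> 1"
  shows "AE \<sigma> in uniform_sphere N. L2_set \<sigma> {1..N} = 1"
proof -
  have z: "L2_set (radial_proj N x) {1..N} = 1" if "L2_set x {1..N} \<noteq> 0" for x
  proof -
    have "L2_set (radial_proj N x) {1..N} = L2_set (\<lambda>i. inverse (L2_set x {1..N}) * x i) {1..N}"
      by (rule L2_set_cong) (auto simp: radial_proj_def field_simps)
    also have "\<dots> = inverse (L2_set x {1..N}) * L2_set x {1..N}"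
      by (rule L2_set_right_distrib[symmetric]) (simp add: L2_set_nonneg)
    finally show ?thesis using that by simp
  qed
  have "emeasure (lebesgue_R N) (\<Pi>\<^sub>E i\<in>{1..N}. {0::real}) = 0"
    using assms by (subst emeasure_box) auto
  moreover have "(\<Pi>\<^sub>E i\<in>{1..N}. {0::real}) \<in> sets (lebesgue_R N)"
    unfolding lebesgue_R_def by (rule sets_PiM_I_finite) auto
  ultimately have "AE x in lebesgue_R N. x \<notin> (\<Pi>\<^sub>E i\<in>{1..N}. {0::real})"
    by (intro AE_not_in) (auto simp: null_sets_def)
  hence "AE x in lebesgue_R N. L2_set x {1..N} \<noteq> 0"
    using AE_space
  proof eventually_elim
    case (elim x)
    hence "\<not> (\<forall>i\<in>{1..N}. x i = 0)"
      unfolding lebesgue_R_def space_PiM PiE_iff by blast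
    thus ?case by (simp add: L2_set_eq_0_iff)
  qed
  hence "AE x in lebesgue_R N. x \<in> unit_ball N \<longrightarrow> L2_set (radial_proj N x) {1..N} = 1"
    by eventually_elim (use z in blast)
  hence "AE x in uniform_measure (lebesgue_R N) (unit_ball N). L2_set (radial_proj N x) {1..N} = 1"
    using emeasure_unit_ball[of N] by (subst AE_uniform_measure) (auto simp: less_top)
  thus ?thesis
    unfolding uniform_sphere_def by (subst AE_distr_iff) measurable
qed

text \<open>The partition function is a genuine (not a junk-value) Bochner integral.\<close>

lemma integrable_partition_function:
  assumes "N \<ge> 1"
  shows "integrable (uniform_sphere N)
    (\<lambda>\<sigma>. exp (\<beta> * hamiltonian J N \<sigma> + real N * (\<Sum>i=1..N. v i * \<sigma> i)))" (is "integrable _ ?f")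
proof -
  interpret prob_space "uniform_sphere N" by (rule prob_space_uniform_sphere)
  define C where "C = exp (\<bar>\<beta>\<bar> * (sqrt (real N) * (\<Sum>i=1..N. \<Sum>j=1..N. \<bar>J i j\<bar>))
                        + real N * (\<Sum>i=1..N. \<bar>v i\<bar>))"
  have meas: "?f \<in> borel_measurable (uniform_sphere N)"
  proof -
    have "?f \<in> borel_measurable (lebesgue_R N)"
      unfolding hamiltonian_def
      by (intro borel_measurable_exp[THEN measurable_compose[rotated]] borel_measurable_add
            borel_measurable_times borel_measurable_sum borel_measurable_const
            measurable_component_lebesgue_R)
    thus ?thesis by (simp add: uniform_sphere_def)
  qed
  have "AE \<sigma> in uniform_sphere N. norm (?f \<sigma>) \<le> C"
    using AE_uniform_sphere[OF assms]
  proof eventually_elim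
    case (elim \<sigma>)
    have b: "\<bar>\<sigma> i\<bar> \<le> 1" if "i \<in> {1..N}" for i
    proof -
      have "\<bar>\<sigma> i\<bar> \<le> L2_set (\<lambda>i. \<bar>\<sigma> i\<bar>) {1..N}" by (rule member_le_L2_set) (use that in auto)
      thus ?thesis using elim by (simp add: L2_set_def)
    qed
    have "\<bar>\<Sum>i=1..N. v i * \<sigma> i\<bar> \<le> (\<Sum>i=1..N. \<bar>v i\<bar>)"
      by (rule order_trans[OF sum_abs], rule sum_mono)
         (use b in \<open>auto simp: abs_mult intro!: mult_left_le\<close>)
    hence 1: "real N * (\<Sum>i=1..N. v i * \<sigma> i) \<le> real N * (\<Sum>i=1..N. \<bar>v i\<bar>)"
      by (intro mult_left_mono) auto
    have "\<bar>\<Sum>i=1..N. \<Sum>j=1..N. J i j * \<sigma> i * \<sigma> j\<bar> \<le> (\<Sum>i=1..N. \<Sum>j=1..N. \<bar>J i j\<bar>)"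
    proof (rule order_trans[OF sum_abs], rule sum_mono, rule order_trans[OF sum_abs], rule sum_mono)
      fix i j assume ij: "i \<in> {1..N}" "j \<in> {1..N}"
      have "\<bar>J i j\<bar> * \<bar>\<sigma> i\<bar> * \<bar>\<sigma> j\<bar> \<le> \<bar>J i j\<bar> * 1 * 1"
        by (intro mult_mono) (use b ij in auto)
      thus "\<bar>J i j * \<sigma> i * \<sigma> j\<bar> \<le> \<bar>J i j\<bar>" by (simp add: abs_mult)
    qed
    hence "\<bar>\<beta>\<bar> * (sqrt (real N) * \<bar>\<Sum>i=1..N. \<Sum>j=1..N. J i j * \<sigma> i * \<sigma> j\<bar>)
           \<le> \<bar>\<beta>\<bar> * (sqrt (real N) * (\<Sum>i=1..N. \<Sum>j=1..N. \<bar>J i j\<bar>))"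
      by (intro mult_left_mono) auto
    moreover have "\<beta> * hamiltonian J N \<sigma> \<le> \<bar>\<beta> * hamiltonian J N \<sigma>\<bar>" by simp
    moreover have "\<bar>\<beta> * hamiltonian J N \<sigma>\<bar>
        = \<bar>\<beta>\<bar> * (sqrt (real N) * \<bar>\<Sum>i=1..N. \<Sum>j=1..N. J i j * \<sigma> i * \<sigma> j\<bar>)"
      by (simp add: hamiltonian_def abs_mult)
    ultimately show ?case using 1 by (simp add: C_def)
  qed
  thus ?thesis using meas by (intro integrable_const_bound) auto
qed

end

theory Submission imports Defs
begin

text \<open>
  The free energy is \<open>Phi N b v x / N\<close>, where \<open>Phi\<close> is the logarithm of an exponential average over
  the sphere at the disorder \<open>x\<close>, with \<open>b = \<beta> sqrt N\<close> and \<open>v = N h_N\<close>.  For \<open>h > 0\<close> the limit is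
  \<open>value_at \<beta> q\<close>, the value of \<open>B\<close> at its critical point, the solution \<open>q\<close> of
  \<open>q / (1 - q)\<^sup>2 = h\<^sup>2 + 2 \<beta>\<^sup>2 q\<close>.

  Upper bound (\<open>Phi_upper\<close>).  The quadratic energy is a Gaussian field on the sphere whose covariance is
  \<open>b\<^sup>2 R\<^sup>2\<close>, with \<open>R\<close> the overlap of two spins.  As \<open>R\<^sup>2\<close> is at least \<open>2 q R - q\<^sup>2\<close>, Gaussian interpolation
  exchanges it for a random linear field with covariance \<open>2 b\<^sup>2 q R\<close> at the cost \<open>b\<^sup>2 (1 - q)\<^sup>2 / 2\<close>
  (\<open>guerra_bound\<close>).  The exponential average of a linear function over the sphere is then bounded by
  comparison with a Gaussian measure on space (\<open>sphere_linear\<close>).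

  Lower bound (\<open>lower_limit_value\<close>).  By rotation invariance only the length of a field matters, so it may
  point in the last coordinate direction.  Keep only the spins whose last coordinate is close to \<open>s\<close>:
  the others form a vector of length \<open>sqrt (1 - s\<^sup>2)\<close> in one dimension less, which sees the same model at
  inverse temperature \<open>\<beta> (1 - s\<^sup>2)\<close>, in the Gaussian field that comes from the last row and column of the
  disorder and is independent of the remaining disorder.  Its length is close to
  \<open>N sqrt 2 \<beta> s sqrt (1 - s\<^sup>2)\<close>, and the gain per spin is \<open>h s + ln (1 - s\<^sup>2) / 2\<close> (\<open>lower_limit_step\<close>).
  For \<open>s = h (1 - q)\<close> the critical point is mapped to the critical point of the new model, the total value
  is unchanged, \<open>\<beta> (1 - q) < 1 / sqrt 2\<close> is unchanged, and \<open>q\<close> shrinks by a factor below \<open>1\<close>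
  (\<open>lower_limit_chain\<close>).  After finitely many steps \<open>q\<close> is almost \<open>0\<close>: the field is negligible and
  \<open>\<beta>\<^sup>2 < 1/2\<close>.  In that range the free energy is \<open>\<beta>\<^sup>2/2\<close>, because a quadratic coupling of two replicas
  controls their overlap (\<open>high_temperature\<close>).

  Supremum (\<open>tap_le_value\<close>).  The arithmetic-geometric mean inequality replaces the square root in \<open>B\<close> by
  its tangent at the critical point, and the condition \<open>\<beta> (1 - p) \<le> 1 / sqrt 2\<close> makes the resulting
  function of \<open>p\<close> maximal there.  To include \<open>h = 0\<close>, the field strength is enlarged by a small
  \<open>\<eta> > 0\<close>, which moves both the free energy and the supremum by at most \<open>\<eta>\<close>.

  Convergence.  The lower bound is stated as \<open>E (max 0 (c - F)) \<longlonglongrightarrow> 0\<close> for the free energy \<open>F\<close>.  Together with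
  the upper bound on \<open>E F\<close> it gives convergence in the mean, hence in probability, without a
  concentration inequality.
\<close>

section \<open>Logarithms of exponential averages\<close>

text \<open>
  Bounded measurable functions are closed under all operations that occur below, so that integrability
  over a probability measure is always immediate.
\<close>

definition bdm :: "'a measure \<Rightarrow> ('a \<Rightarrow> real) \<Rightarrow> bool" where
  "bdm \<mu> f \<longleftrightarrow> f \<in> borel_measurable \<mu> \<and> (\<exists>B. \<forall>\<omega>\<in>space \<mu>. \<bar>f \<omega>\<bar> \<le> B)"

definition log_avg :: "'a measure \<Rightarrow> ('a \<Rightarrow> real) \<Rightarrow> real" where
  "log_avg \<mu> f = ln (\<integral>\<omega>. exp (f \<omega>) \<partial>\<mu>)"

text \<open>
  The Gibbs measure of the energy \<open>f\<close>.
\<close>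

definition tilt :: "'a measure \<Rightarrow> ('a \<Rightarrow> real) \<Rightarrow> 'a measure" where
  "tilt \<mu> f = density \<mu> (\<lambda>\<omega>. ennreal (exp (f \<omega>) / (\<integral>\<omega>. exp (f \<omega>) \<partial>\<mu>)))"

lemma bdmI: "f \<in> borel_measurable \<mu> \<Longrightarrow> (\<And>\<omega>. \<omega> \<in> space \<mu> \<Longrightarrow> \<bar>f \<omega>\<bar> \<le> B) \<Longrightarrow> bdm \<mu> f"
  unfolding bdm_def by blast

lemma bdm_meas: "bdm \<mu> f \<Longrightarrow> f \<in> borel_measurable \<mu>"
  unfolding bdm_def by blast

lemma bdm_const [simp]: "bdm \<mu> (\<lambda>_. c)"
  by (rule bdmI[where B = "\<bar>c\<bar>"]) auto

lemma bdm_add: assumes "bdm \<mu> f" "bdm \<mu> g" shows "bdm \<mu> (\<lambda>\<omega>. f \<omega> + g \<omega>)"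
proof -
  obtain B where B: "\<forall>\<omega>\<in>space \<mu>. \<bar>f \<omega>\<bar> \<le> B" using assms(1) unfolding bdm_def by (elim conjE exE)
  obtain C where C: "\<forall>\<omega>\<in>space \<mu>. \<bar>g \<omega>\<bar> \<le> C" using assms(2) unfolding bdm_def by (elim conjE exE)
  thus ?thesis using B assms[THEN bdm_meas]
    by (intro bdmI[where B = "B + C"]) (auto intro!: order_trans[OF abs_triangle_ineq add_mono])
qed

lemma bdm_mult: assumes "bdm \<mu> f" "bdm \<mu> g" shows "bdm \<mu> (\<lambda>\<omega>. f \<omega> * g \<omega>)"
proof -
  obtain B where B: "\<forall>\<omega>\<in>space \<mu>. \<bar>f \<omega>\<bar> \<le> B" using assms(1) unfolding bdm_def by (elim conjE exE)
  obtain C where C: "\<forall>\<omega>\<in>space \<mu>. \<bar>g \<omega>\<bar> \<le> C" using assms(2) unfolding bdm_def by (elim conjE exE)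
  have "\<bar>f \<omega> * g \<omega>\<bar> \<le> \<bar>B\<bar> * \<bar>C\<bar>" if "\<omega> \<in> space \<mu>" for \<omega>
    unfolding abs_mult using B[rule_format, OF that] C[rule_format, OF that] by (intro mult_mono) auto
  thus ?thesis using assms[THEN bdm_meas] by (intro bdmI[where B = "\<bar>B\<bar> * \<bar>C\<bar>"]) auto
qed

lemma bdm_cmult: "bdm \<mu> f \<Longrightarrow> bdm \<mu> (\<lambda>\<omega>. c * f \<omega>)"
  by (intro bdm_mult bdm_const)

lemma bdm_diff: "bdm \<mu> f \<Longrightarrow> bdm \<mu> g \<Longrightarrow> bdm \<mu> (\<lambda>\<omega>. f \<omega> - g \<omega>)"
  using bdm_add[of \<mu> f "\<lambda>\<omega>. (-1) * g \<omega>"] bdm_cmult[of \<mu> g "-1"] by simp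

lemma bdm_sum: "(\<And>k. k \<in> K \<Longrightarrow> bdm \<mu> (f k)) \<Longrightarrow> bdm \<mu> (\<lambda>\<omega>. \<Sum>k\<in>K. f k \<omega>)"
  by (induction K rule: infinite_finite_induct) (auto intro: bdm_add)

lemma bdm_exp: assumes "bdm \<mu> f" shows "bdm \<mu> (\<lambda>\<omega>. exp (f \<omega>))"
proof -
  obtain B where B: "\<forall>\<omega>\<in>space \<mu>. \<bar>f \<omega>\<bar> \<le> B" using assms unfolding bdm_def by (elim conjE exE)
  have "exp (f \<omega>) \<le> exp B" if "\<omega> \<in> space \<mu>" for \<omega>
    using B[rule_format, OF that] by simp
  thus ?thesis using bdm_meas[OF assms] by (intro bdmI[where B = "exp B"]) auto
qed

lemma bdm_power: "bdm \<mu> f \<Longrightarrow> bdm \<mu> (\<lambda>\<omega>. f \<omega> ^ n)"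
  by (induction n) (auto intro: bdm_mult)

lemmas bdm_intros = bdm_const bdm_add bdm_diff bdm_sum bdm_exp bdm_power bdm_mult

lemma bdm_integrable: "prob_space \<mu> \<Longrightarrow> bdm \<mu> f \<Longrightarrow> integrable \<mu> f"
  unfolding bdm_def prob_space_def
  by (auto intro!: finite_measure.integrable_const_bound AE_I2)

lemma exp_avg_pos: assumes "prob_space \<mu>" "bdm \<mu> f" shows "0 < (\<integral>\<omega>. exp (f \<omega>) \<partial>\<mu>)"
proof -
  interpret prob_space \<mu> by fact
  obtain B where B: "\<forall>\<omega>\<in>space \<mu>. \<bar>f \<omega>\<bar> \<le> B" using assms(2) unfolding bdm_def by (elim conjE exE)
  have "0 < exp (- B)" by simp
  also have "\<dots> = (\<integral>\<omega>. exp (- B) \<partial>\<mu>)" by (simp add: prob_space)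
  also have "\<dots> \<le> (\<integral>\<omega>. exp (f \<omega>) \<partial>\<mu>)"
  proof (rule integral_mono)
    show "exp (- B) \<le> exp (f \<omega>)" if "\<omega> \<in> space \<mu>" for \<omega> using B[rule_format, OF that] by simp
  qed (use assms bdm_exp bdm_integrable in auto)
  finally show ?thesis .
qed

lemma space_tilt [simp]: "space (tilt \<mu> f) = space \<mu>"
  and sets_tilt [simp]: "sets (tilt \<mu> f) = sets \<mu>"
  unfolding tilt_def by auto

lemma bdm_tilt [simp]: "bdm (tilt \<mu> f) g \<longleftrightarrow> bdm \<mu> g"
proof -
  have "g \<in> borel_measurable (tilt \<mu> f) \<longleftrightarrow> g \<in> borel_measurable \<mu>"
    by (rule arg_cong[where f = "(\<in>) g"], rule measurable_cong_sets) auto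
  thus ?thesis unfolding bdm_def by simp
qed

lemma integral_tilt:
  assumes "prob_space \<mu>" "bdm \<mu> f" "bdm \<mu> g"
  shows "(\<integral>\<omega>. g \<omega> \<partial>tilt \<mu> f) = (\<integral>\<omega>. exp (f \<omega>) * g \<omega> \<partial>\<mu>) / (\<integral>\<omega>. exp (f \<omega>) \<partial>\<mu>)"
proof -
  have [measurable]: "f \<in> borel_measurable \<mu>" "g \<in> borel_measurable \<mu>"
    using assms bdm_meas by auto
  have "(\<integral>\<omega>. g \<omega> \<partial>tilt \<mu> f) = (\<integral>\<omega>. (exp (f \<omega>) / (\<integral>\<omega>. exp (f \<omega>) \<partial>\<mu>)) *\<^sub>R g \<omega> \<partial>\<mu>)"
    unfolding tilt_def using exp_avg_pos[OF assms(1,2)]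
    by (intro integral_density) auto
  thus ?thesis by simp
qed

lemma prob_space_tilt:
  assumes "prob_space \<mu>" "bdm \<mu> f" shows "prob_space (tilt \<mu> f)"
proof
  interpret prob_space \<mu> by fact
  have [measurable]: "f \<in> borel_measurable \<mu>"
    using assms bdm_meas by auto
  let ?Z = "\<integral>\<omega>. exp (f \<omega>) \<partial>\<mu>"
  have "emeasure (tilt \<mu> f) (space (tilt \<mu> f)) = (\<integral>\<^sup>+\<omega>. ennreal (exp (f \<omega>) / ?Z) \<partial>\<mu>)"
    by (subst space_tilt) (simp add: tilt_def emeasure_density cong: nn_integral_cong)
  also have "\<dots> = ennreal (\<integral>\<omega>. exp (f \<omega>) / ?Z \<partial>\<mu>)"
    using exp_avg_pos[OF assms] bdm_integrable[OF assms(1) bdm_exp[OF assms(2)]]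
    by (intro nn_integral_eq_integral) auto
  also have "\<dots> = 1" using exp_avg_pos[OF assms] by simp
  finally show "emeasure (tilt \<mu> f) (space (tilt \<mu> f)) = 1" .
qed

lemma log_avg_add:
  assumes "prob_space \<mu>" "bdm \<mu> f" "bdm \<mu> g"
  shows "log_avg \<mu> (\<lambda>\<omega>. f \<omega> + g \<omega>) = log_avg \<mu> f + log_avg (tilt \<mu> f) g"
proof -
  have p: "0 < (\<integral>\<omega>. exp (g \<omega>) \<partial>tilt \<mu> f)"
    using assms by (intro exp_avg_pos prob_space_tilt) auto
  have "(\<integral>\<omega>. exp (f \<omega> + g \<omega>) \<partial>\<mu>) = (\<integral>\<omega>. exp (f \<omega>) \<partial>\<mu>) * (\<integral>\<omega>. exp (g \<omega>) \<partial>tilt \<mu> f)"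
    using exp_avg_pos[OF assms(1,2)] assms by (subst integral_tilt) (auto intro: bdm_exp simp: exp_add)
  thus ?thesis unfolding log_avg_def using exp_avg_pos[OF assms(1,2)] p by (simp add: ln_mult)
qed

lemma log_avg_le:
  assumes "prob_space \<mu>" "bdm \<mu> f" "bdm \<mu> g" "\<And>\<omega>. \<omega> \<in> space \<mu> \<Longrightarrow> f \<omega> \<le> g \<omega> + c"
  shows "log_avg \<mu> f \<le> log_avg \<mu> g + c"
proof -
  have "(\<integral>\<omega>. exp (f \<omega>) \<partial>\<mu>) \<le> (\<integral>\<omega>. exp c * exp (g \<omega>) \<partial>\<mu>)"
    using assms by (intro integral_mono bdm_integrable bdm_intros) (auto simp: exp_add[symmetric] add.commute)
  hence "log_avg \<mu> f \<le> ln (exp c * (\<integral>\<omega>. exp (g \<omega>) \<partial>\<mu>))"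
    unfolding log_avg_def using exp_avg_pos[OF assms(1,2)] by (subst ln_le_cancel_iff) auto
  also have "\<dots> = log_avg \<mu> g + c"
    unfolding log_avg_def using exp_avg_pos[OF assms(1,3)] by (simp add: ln_mult)
  finally show ?thesis .
qed

text \<open>
  Jensen's inequality, with the tangent of the exponential function at the mean.
\<close>

lemma log_avg_ge_integral:
  assumes "prob_space \<mu>" "bdm \<mu> g" shows "(\<integral>\<omega>. g \<omega> \<partial>\<mu>) \<le> log_avg \<mu> g"
proof -
  interpret prob_space \<mu> by fact
  let ?m = "\<integral>\<omega>. g \<omega> \<partial>\<mu>"
  have "(\<integral>\<omega>. exp ?m * (1 + (g \<omega> - ?m)) \<partial>\<mu>) \<le> (\<integral>\<omega>. exp (g \<omega>) \<partial>\<mu>)"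
  proof (rule integral_mono)
    show "exp ?m * (1 + (g \<omega> - ?m)) \<le> exp (g \<omega>)" for \<omega>
      using mult_left_mono[OF exp_ge_add_one_self[of "g \<omega> - ?m"], of "exp ?m"]
      by (simp add: exp_add[symmetric])
  qed (use assms in \<open>auto intro!: bdm_integrable bdm_intros\<close>)
  moreover have "(\<integral>\<omega>. exp ?m * (1 + (g \<omega> - ?m)) \<partial>\<mu>) = exp ?m"
    using bdm_integrable[OF assms] by (simp add: prob_space)
  ultimately show ?thesis unfolding log_avg_def
    using ln_ge_iff[OF exp_avg_pos[OF assms]] by simp
qed

lemma log_avg_abs:
  assumes "prob_space \<mu>" "g \<in> borel_measurable \<mu>" "\<And>\<omega>. \<omega> \<in> space \<mu> \<Longrightarrow> \<bar>g \<omega>\<bar> \<le> A"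
  shows "\<bar>log_avg \<mu> g\<bar> \<le> A"
proof -
  interpret prob_space \<mu> by fact
  have 1: "bdm \<mu> g" using assms(2,3) by (rule bdmI)
  have 0: "log_avg \<mu> (\<lambda>_. 0) = 0" by (simp add: log_avg_def prob_space)
  have "log_avg \<mu> g \<le> log_avg \<mu> (\<lambda>_. 0) + A"
    using assms(1) 1 by (rule log_avg_le) (use assms(3) in \<open>auto simp: abs_le_iff\<close>)
  moreover have "log_avg \<mu> (\<lambda>_. 0) \<le> log_avg \<mu> g + A"
    using assms(1) bdm_const 1
  proof (rule log_avg_le)
    show "0 \<le> g \<omega> + A" if "\<omega> \<in> space \<mu>" for \<omega> using assms(3)[OF that] by linarith
  qed
  ultimately show ?thesis using 0 by simp
qed

lemma exp_minus_taylor2: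
  fixes d :: real assumes "\<bar>d\<bar> \<le> 1"
  shows "\<bar>exp d - 1 - d - d\<^sup>2 / 2\<bar> \<le> \<bar>d\<bar> ^ 3 / 2"
proof -
  obtain t where t: "\<bar>t\<bar> \<le> \<bar>d\<bar>" "exp d = (\<Sum>m<3. d ^ m / fact m) + exp t / fact 3 * d ^ 3"
    using Maclaurin_exp_le by blast
  have "exp t \<le> exp 1" using t(1) assms by simp
  also have "exp 1 \<le> (3::real)" by (rule exp_le)
  finally have e: "exp t \<le> 3" .
  have "exp d - 1 - d - d\<^sup>2 / 2 = exp t / 6 * d ^ 3"
    using t(2) by (simp add: numeral_eq_Suc)
  hence "\<bar>exp d - 1 - d - d\<^sup>2 / 2\<bar> = exp t / 6 * \<bar>d\<bar> ^ 3"
    by (simp only: abs_mult power_abs abs_divide) simp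
  also have "\<dots> \<le> 3 / 6 * \<bar>d\<bar> ^ 3" using e by (intro mult_right_mono) auto
  finally show ?thesis by simp
qed

lemma ln_one_plus_bound:
  fixes u :: real assumes "0 \<le> u" shows "\<bar>ln (1 + u) - u\<bar> \<le> u\<^sup>2"
proof -
  have "ln (1 + u) \<le> u" using assms by (rule ln_add_one_self_le_self)
  moreover have "u - u\<^sup>2 \<le> ln (1 + u)" 
  proof (cases "u \<le> 1")
    case True thus ?thesis using ln_one_plus_pos_lower_bound[of u] assms by (simp add: power2_eq_square)
  next
    case False
    hence "u * 1 \<le> u * u" by (intro mult_left_mono) auto
    hence "u - u\<^sup>2 \<le> 0" by (simp add: power2_eq_square)
    also have "0 \<le> ln (1 + u)" using assms by simp
    finally show ?thesis .
  qed
  ultimately show ?thesis by auto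
qed

lemma log_avg_taylor_centred:
  assumes "prob_space \<mu>" "d \<in> borel_measurable \<mu>" "\<And>\<omega>. \<omega> \<in> space \<mu> \<Longrightarrow> \<bar>d \<omega>\<bar> \<le> D"
    and "(\<integral>\<omega>. d \<omega> \<partial>\<mu>) = 0"
  shows "\<bar>log_avg \<mu> d - (\<integral>\<omega>. (d \<omega>)\<^sup>2 \<partial>\<mu>) / 2\<bar> \<le> 2 * D ^ 3"
proof -
  interpret prob_space \<mu> by fact
  have b: "bdm \<mu> d" using assms(2,3) by (rule bdmI)
  let ?V = "\<integral>\<omega>. (d \<omega>)\<^sup>2 \<partial>\<mu>"
  obtain w where "w \<in> space \<mu>" using not_empty by blast
  hence D0: "0 \<le> D" using assms(3) by force
  have V0: "0 \<le> ?V" by simp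
  have V1: "?V \<le> D\<^sup>2"
  proof -
    have "?V \<le> (\<integral>\<omega>. D\<^sup>2 \<partial>\<mu>)"
      by (intro integral_mono bdm_integrable assms bdm_intros b)
         (use assms(3) D0 in \<open>auto intro: power2_le_iff_abs_le[THEN iffD2]\<close>)
    thus ?thesis by (simp add: prob_space)
  qed
  show ?thesis
  proof (cases "D \<le> 1")
    case False
    have "D ^ 2 * 1 \<le> D ^ 2 * D" using False by (intro mult_left_mono) auto
    moreover have "D * 1 \<le> D * (D * D)" using False mult_mono[of 1 D 1 D] by (intro mult_left_mono) auto
    ultimately have "D\<^sup>2 \<le> D ^ 3" "D \<le> D ^ 3" by (simp_all add: power2_eq_square power3_eq_cube)
    moreover have "\<bar>log_avg \<mu> d\<bar> \<le> D" using assms(1-3) by (rule log_avg_abs)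
    ultimately show ?thesis using V0 V1 by linarith
  next
    case True
    let ?u = "(\<integral>\<omega>. exp (d \<omega>) \<partial>\<mu>) - 1"
    have r: "\<bar>?u - ?V / 2\<bar> \<le> D ^ 3 / 2"
    proof -
      have i [simp]: "integrable \<mu> (\<lambda>\<omega>. exp (d \<omega>))" "integrable \<mu> d" "integrable \<mu> (\<lambda>\<omega>. (d \<omega>)\<^sup>2)"
        using assms(1) b by (auto intro: bdm_integrable bdm_exp bdm_power)
      have "?u - ?V / 2 = (\<integral>\<omega>. exp (d \<omega>) - 1 - d \<omega> - (d \<omega>)\<^sup>2 / 2 \<partial>\<mu>)"
        using i assms(4) by (simp add: prob_space)
      also have "\<bar>\<dots>\<bar> \<le> (\<integral>\<omega>. \<bar>exp (d \<omega>) - 1 - d \<omega> - (d \<omega>)\<^sup>2 / 2\<bar> \<partial>\<mu>)"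
        by (rule integral_abs_bound)
      also have "\<dots> \<le> (\<integral>\<omega>. D ^ 3 / 2 \<partial>\<mu>)"
      proof (rule integral_mono)
        fix \<omega> assume w: "\<omega> \<in> space \<mu>"
        have "\<bar>exp (d \<omega>) - 1 - d \<omega> - (d \<omega>)\<^sup>2 / 2\<bar> \<le> \<bar>d \<omega>\<bar> ^ 3 / 2"
          using assms(3)[OF w] True by (intro exp_minus_taylor2) auto
        also have "\<dots> \<le> D ^ 3 / 2" using assms(3)[OF w] by (intro divide_right_mono power_mono) auto
        finally show "\<bar>exp (d \<omega>) - 1 - d \<omega> - (d \<omega>)\<^sup>2 / 2\<bar> \<le> D ^ 3 / 2" .
      qed auto
      finally show ?thesis by (simp add: prob_space)
    qed
    have u0: "0 \<le> ?u"
    proof -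
      have "(\<integral>\<omega>. 1 + d \<omega> \<partial>\<mu>) \<le> (\<integral>\<omega>. exp (d \<omega>) \<partial>\<mu>)"
        using assms(1) b by (intro integral_mono bdm_integrable bdm_intros) auto
      moreover have "(\<integral>\<omega>. 1 + d \<omega> \<partial>\<mu>) = 1"
        using assms(1,4) b by (subst Bochner_Integration.integral_add) (auto intro: bdm_integrable simp: prob_space)
      ultimately show ?thesis by simp
    qed
    have D3: "D ^ 3 \<le> D\<^sup>2" using True D0 by (intro power_decreasing) auto
    have "?u \<le> D\<^sup>2" using r V1 D3 unfolding abs_le_iff by linarith
    hence "?u\<^sup>2 \<le> (D\<^sup>2)\<^sup>2" using u0 by (rule power_mono)
    also have "\<dots> \<le> D ^ 3" unfolding power_mult[symmetric] using True D0 by (intro power_decreasing) auto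
    finally have "?u\<^sup>2 \<le> D ^ 3" .
    moreover have "\<bar>log_avg \<mu> d - ?u\<bar> \<le> ?u\<^sup>2"
      using ln_one_plus_bound[OF u0] unfolding log_avg_def by simp
    ultimately show ?thesis using r zero_le_power[OF D0, of 3] unfolding abs_le_iff by linarith
  qed
qed

text \<open>
  The second cumulant expansion.  The error is cubic: with the field that is switched on during a time
  \<open>r\<close>, which has size \<open>sqrt r\<close>, it stays negligible after the summation over \<open>1/r\<close> time steps.
\<close>

lemma log_avg_taylor:
  assumes "prob_space \<mu>" "a \<in> borel_measurable \<mu>" "\<And>\<omega>. \<omega> \<in> space \<mu> \<Longrightarrow> \<bar>a \<omega>\<bar> \<le> A"
  shows "\<bar>log_avg \<mu> a - (\<integral>\<omega>. a \<omega> \<partial>\<mu>) - ((\<integral>\<omega>. (a \<omega>)\<^sup>2 \<partial>\<mu>) - (\<integral>\<omega>. a \<omega> \<partial>\<mu>)\<^sup>2) / 2\<bar> \<le> 16 * A ^ 3"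
proof -
  interpret prob_space \<mu> by fact
  let ?m = "\<integral>\<omega>. a \<omega> \<partial>\<mu>"
  have b: "bdm \<mu> a" using assms(2,3) by (rule bdmI)
  have m: "\<bar>?m\<bar> \<le> A"
  proof -
    have "\<bar>?m\<bar> \<le> (\<integral>\<omega>. \<bar>a \<omega>\<bar> \<partial>\<mu>)" by (rule integral_abs_bound)
    also have "\<dots> \<le> (\<integral>\<omega>. A \<partial>\<mu>)"
      using assms b by (intro integral_mono integrable_abs bdm_integrable) auto
    finally show ?thesis by (simp add: prob_space)
  qed
  have i: "integrable \<mu> a" "integrable \<mu> (\<lambda>\<omega>. (a \<omega>)\<^sup>2)" using assms(1) b by (auto intro: bdm_integrable bdm_power)
  have 1: "\<bar>log_avg \<mu> (\<lambda>\<omega>. a \<omega> - ?m) - (\<integral>\<omega>. (a \<omega> - ?m)\<^sup>2 \<partial>\<mu>) / 2\<bar> \<le> 2 * (2 * A) ^ 3"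
  proof (rule log_avg_taylor_centred[OF assms(1)])
    show "\<bar>a \<omega> - ?m\<bar> \<le> 2 * A" if "\<omega> \<in> space \<mu>" for \<omega>
      using assms(3)[OF that] m by (auto simp: abs_le_iff)
  qed (use assms i in \<open>auto simp: prob_space\<close>)
  have 2: "log_avg \<mu> (\<lambda>\<omega>. a \<omega> - ?m) = log_avg \<mu> a - ?m"
    unfolding log_avg_def exp_diff using exp_avg_pos[OF assms(1) b] by (simp add: ln_div)
  have 3: "(\<integral>\<omega>. (a \<omega> - ?m)\<^sup>2 \<partial>\<mu>) = (\<integral>\<omega>. (a \<omega>)\<^sup>2 \<partial>\<mu>) - ?m\<^sup>2"
    using i by (simp add: variance_eq)
  show ?thesis using 1 unfolding 2 3 by (simp add: power_mult_distrib)
qed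

declare measurable_component_lebesgue_R [measurable del]

section \<open>Lebesgue and Gaussian measure on coordinate spaces\<close>

abbreviation leb :: "'i set \<Rightarrow> ('i \<Rightarrow> real) measure" where
  "leb I \<equiv> PiM I (\<lambda>_. lborel)"

definition gauss :: "'i set \<Rightarrow> ('i \<Rightarrow> real) measure" where
  "gauss I = PiM I (\<lambda>_. std_normal_distribution)"

lemma product_sigma_finite_lb: "product_sigma_finite (\<lambda>_::'i. lborel :: real measure)"
  by standard

lemma product_prob_space_gauss: "product_prob_space (\<lambda>_::'i. std_normal_distribution)"
  by (intro product_prob_spaceI prob_space_normal_density) auto

lemma space_gauss: "space (gauss I) = PiE I (\<lambda>_. UNIV)"
  by (simp add: gauss_def space_PiM)

lemma sets_gauss [measurable_cong]: "sets (gauss I) = sets (PiM I (\<lambda>_. borel))"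
  unfolding gauss_def by (rule sets_PiM_cong) auto

lemma prob_space_gauss: "prob_space (gauss I)"
  unfolding gauss_def by (intro prob_space_PiM prob_space_normal_density) auto

lemma measurable_leb_component:
  "i \<in> I \<Longrightarrow> (\<lambda>x. x i) \<in> borel_measurable (leb I)"
  using measurable_component_singleton[of i I "\<lambda>_. lborel :: real measure"] by simp

lemma measurable_gauss_component:
  "i \<in> I \<Longrightarrow> (\<lambda>x. x i) \<in> borel_measurable (gauss I)"
  using measurable_component_singleton[of i I "\<lambda>_. borel :: real measure"]
  by (simp add: measurable_cong_sets[OF sets_gauss])

lemma nn_integral_leb_affine:
  fixes c :: real
  assumes I: "finite I" "i \<in> I" and c: "c \<noteq> 0"
    and f [measurable]: "f \<in> borel_measurable (leb I)" and g [measurable]: "g \<in> borel_measurable (leb I)"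
    and gi: "\<And>x y. g (x(i := y)) = g x"
  shows "(\<integral>\<^sup>+x. f x \<partial>leb I) = ennreal \<bar>c\<bar> * (\<integral>\<^sup>+x. f (x(i := c * x i + g x)) \<partial>leb I)"
proof -
  interpret product_sigma_finite "\<lambda>_::'a. lborel :: real measure" by (rule product_sigma_finite_lb)
  define K where "K = I - {i}"
  have K: "finite K" "i \<notin> K" "insert i K = I" using I by (auto simp: K_def)
  note ins = product_nn_integral_insert[OF K(1,2), unfolded K(3)]
  have m: "(\<lambda>x. f (x(i := c * x i + g x))) \<in> borel_measurable (leb I)"
  proof (rule measurable_compose[OF _ f])
    show "(\<lambda>x. x(i := c * x i + g x)) \<in> measurable (leb I) (leb I)"
      by (rule measurable_fun_upd[where J = I]) (use I(2) in \<open>auto simp: insert_absorb\<close>)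
  qed
  have "(\<integral>\<^sup>+x. f (x(i := c * x i + g x)) \<partial>leb I)
      = (\<integral>\<^sup>+x. (\<integral>\<^sup>+y. f (x(i := g x + c * y)) \<partial>lborel) \<partial>leb K)"
    by (subst ins[OF m]) (simp add: gi add.commute)
  also have "ennreal \<bar>c\<bar> * \<dots> = (\<integral>\<^sup>+x. ennreal \<bar>c\<bar> * (\<integral>\<^sup>+y. f (x(i := g x + c * y)) \<partial>lborel) \<partial>leb K)"
  proof (rule nn_integral_cmult[symmetric])
    have upd: "(\<lambda>p. (fst p)(i := snd p)) \<in> measurable (leb K \<Otimes>\<^sub>M lborel) (leb I)"
      by (rule measurable_fun_upd[where J = K]) (use K(3) in auto)
    have gK [measurable]: "g \<in> borel_measurable (leb K)"
    proof -
      have "(\<lambda>x. x(i := 0)) \<in> measurable (leb K) (leb I)"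
        by (rule measurable_fun_upd[where J = K]) (use K(3) in auto)
      from measurable_compose[OF this g] show ?thesis unfolding gi .
    qed
    have "(\<lambda>p. (fst p, g (fst p) + c * snd p)) \<in> measurable (leb K \<Otimes>\<^sub>M lborel) (leb K \<Otimes>\<^sub>M lborel)"
      using gK by measurable
    from measurable_compose[OF measurable_compose[OF this upd] f]
    have "(\<lambda>(x, y). f (x(i := g x + c * y))) \<in> borel_measurable (leb K \<Otimes>\<^sub>M lborel)"
      by (simp add: case_prod_beta')
    thus "(\<lambda>x. \<integral>\<^sup>+y. f (x(i := g x + c * y)) \<partial>lborel) \<in> borel_measurable (leb K)"
      by (rule lborel.borel_measurable_nn_integral[of "\<lambda>x y. f (x(i := g x + c * y))", simplified])
  qed
  also have "\<dots> = (\<integral>\<^sup>+x. (\<integral>\<^sup>+y. f (x(i := y)) \<partial>lborel) \<partial>leb K)"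
  proof (rule nn_integral_cong)
    fix x assume x: "x \<in> space (leb K)"
    have "(\<lambda>y. x(i := y)) \<in> measurable lborel (leb I)"
      by (rule measurable_fun_upd[where J = K]) (use x K(3) in auto)
    from measurable_compose[OF this f] have "(\<lambda>y. f (x(i := y))) \<in> borel_measurable borel" by simp
    from nn_integral_real_affine[OF this c, of "g x"]
    show "ennreal \<bar>c\<bar> * (\<integral>\<^sup>+y. f (x(i := g x + c * y)) \<partial>lborel) = (\<integral>\<^sup>+y. f (x(i := y)) \<partial>lborel)" by simp
  qed
  also have "\<dots> = (\<integral>\<^sup>+x. f x \<partial>leb I)" by (rule ins[OF f, symmetric])
  finally show ?thesis by simp
qed

definition refl :: "'i set \<Rightarrow> ('i \<Rightarrow> real) \<Rightarrow> ('i \<Rightarrow> real) \<Rightarrow> 'i \<Rightarrow> real" where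
  "refl I w x = (\<lambda>i\<in>I. x i - 2 * (\<Sum>j\<in>I. w j * x j) * w i)"

lemma measurable_refl [measurable]: "refl I w \<in> measurable (leb I) (leb I)"
  unfolding refl_def by (rule measurable_restrict, simp only: measurable_lborel1) measurable

lemma sum_mult_refl:
  assumes "finite I" "(\<Sum>i\<in>I. (w i)\<^sup>2) = 1"
  shows "(\<Sum>i\<in>I. v i * refl I w x i) = (\<Sum>i\<in>I. v i * x i) - 2 * (\<Sum>i\<in>I. w i * x i) * (\<Sum>i\<in>I. v i * w i)"
proof -
  have "(\<Sum>i\<in>I. v i * refl I w x i) = (\<Sum>i\<in>I. v i * x i - 2 * (\<Sum>j\<in>I. w j * x j) * (v i * w i))"
    by (rule sum.cong) (auto simp: refl_def algebra_simps)
  thus ?thesis by (simp add: sum_subtractf sum_distrib_left)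
qed

lemma nn_integral_leb_shears:
  assumes I: "finite I" "i \<in> I" and S: "S \<subseteq> I - {i}"
    and f [measurable]: "f \<in> borel_measurable (leb I)"
  shows "(\<integral>\<^sup>+x. f (\<lambda>k\<in>I. if k \<in> S then x k - 2 * x i * w k else x k) \<partial>leb I) = (\<integral>\<^sup>+x. f x \<partial>leb I)"
proof -
  have "finite S" using S I by (meson finite_Diff finite_subset)
  thus ?thesis using S
  proof (induction S)
    case empty
    show ?case by (intro nn_integral_cong arg_cong[where f = f]) (auto simp: space_PiM)
  next
    case (insert j S)
    let ?B = "\<lambda>x. \<lambda>k\<in>I. if k \<in> S then x k - 2 * x i * w k else x k"
    have B: "?B \<in> measurable (leb I) (leb I)"
    proof (rule measurable_restrict)
      fix k assume k [measurable]: "k \<in> I"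
      note I(2) [measurable]
      show "(\<lambda>x. if k \<in> S then x k - 2 * x i * w k else x k) \<in> measurable (leb I) lborel"
        by (cases "k \<in> S"; simp only: measurable_lborel1 if_True if_False) measurable
    qed
    have j: "j \<in> I" "j \<noteq> i" using insert.prems by auto
    have eq: "?B (x(j := 1 * x j + (- 2 * x i * w j)))
        = (\<lambda>k\<in>I. if k \<in> insert j S then x k - 2 * x i * w k else x k)" for x
      using insert.hyps j by (auto simp: restrict_def fun_eq_iff)
    have "(\<integral>\<^sup>+x. f x \<partial>leb I) = (\<integral>\<^sup>+x. f (?B x) \<partial>leb I)"
      by (rule insert.IH[symmetric]) (use insert.prems in auto)
    also have "\<dots> = ennreal \<bar>1\<bar> * (\<integral>\<^sup>+x. f (?B (x(j := 1 * x j + (- 2 * x i * w j)))) \<partial>leb I)"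
    proof (rule nn_integral_leb_affine[OF I(1) j(1), where c = 1 and g = "\<lambda>x. - 2 * x i * w j"])
      show "(\<lambda>x. f (?B x)) \<in> borel_measurable (leb I)" by (rule measurable_compose[OF B f])
      show "(\<lambda>x. - 2 * x i * w j) \<in> borel_measurable (leb I)" using I(2) by measurable
    qed (use j in auto)
    also have "\<dots> = (\<integral>\<^sup>+x. f (\<lambda>k\<in>I. if k \<in> insert j S then x k - 2 * x i * w k else x k) \<partial>leb I)"
      unfolding eq by simp
    finally show ?case by (rule sym)
  qed
qed

text \<open>
  A Householder reflection is a product of shears and of one sign change once the coordinate \<open>i\<close>
  has been replaced by the inner product with \<open>w\<close>.
\<close>

lemma nn_integral_leb_refl:
  assumes I: "finite I" and w: "(\<Sum>i\<in>I. (w i)\<^sup>2) = 1"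
    and f [measurable]: "f \<in> borel_measurable (leb I)"
  shows "(\<integral>\<^sup>+x. f (refl I w x) \<partial>leb I) = (\<integral>\<^sup>+x. f x \<partial>leb I)"
proof -
  obtain i where i: "i \<in> I" "w i \<noteq> 0"
    using w by (metis (mono_tags, lifting) power_zero_numeral sum.neutral zero_neq_one)
  note i(1) [measurable]
  define g where "g x = (\<Sum>j\<in>I - {i}. w j * x j)" for x :: "'a \<Rightarrow> real"
  have g [measurable]: "g \<in> borel_measurable (leb I)"
    unfolding g_def by (intro borel_measurable_sum) (auto intro!: borel_measurable_times measurable_leb_component)
  have gi: "g (x(i := y)) = g x" for x y unfolding g_def by (rule sum.cong) auto
  have g_sum: "(\<Sum>j\<in>I. w j * x j) = w i * x i + g x" for x
    unfolding g_def using I i by (simp add: sum.remove)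
  let ?T = "\<lambda>x. x(i := w i * x i + g x)"
  let ?U = "\<lambda>y. y(i := (1 / w i) * y i + (- (g y / w i)))"
  let ?B = "\<lambda>x. \<lambda>k\<in>I. if k \<in> I - {i} then x k - 2 * x i * w k else x k"
  let ?N = "\<lambda>y. y(i := (-1) * y i + 0)"
  have upd: "(\<lambda>x. x(i := h x)) \<in> measurable (leb I) (leb I)" if "h \<in> borel_measurable (leb I)" for h
    by (rule measurable_fun_upd[where J = I]) (use i that in \<open>auto simp: insert_absorb\<close>)
  have "(\<lambda>y. (1 / w i) * y i + (- (g y / w i))) \<in> borel_measurable (leb I)"
    by (intro borel_measurable_add borel_measurable_times borel_measurable_const borel_measurable_uminus
        borel_measurable_divide g measurable_leb_component i)
  hence U: "?U \<in> measurable (leb I) (leb I)" by (rule upd)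
  have "(\<lambda>y. (-1) * y i + 0) \<in> borel_measurable (leb I)"
    by (intro borel_measurable_add borel_measurable_times borel_measurable_const measurable_leb_component i)
  hence N: "?N \<in> measurable (leb I) (leb I)" by (rule upd)
  have B: "?B \<in> measurable (leb I) (leb I)"
  proof (rule measurable_restrict)
    fix k assume k [measurable]: "k \<in> I"
    show "(\<lambda>x. if k \<in> I - {i} then x k - 2 * x i * w k else x k) \<in> measurable (leb I) lborel"
      by (cases "k \<in> I - {i}"; simp only: measurable_lborel1 if_True if_False) measurable
  qed
  let ?F = "\<lambda>x. f (?U (?N (?B x)))"
  have "(\<integral>\<^sup>+x. ?F x \<partial>leb I) = (\<integral>\<^sup>+x. f (?U (?N x)) \<partial>leb I)"
    using measurable_compose[OF N measurable_compose[OF U f]]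
    by (rule nn_integral_leb_shears[OF I i(1) subset_refl, of "\<lambda>x. f (?U (?N x))"])
  also have "\<dots> = ennreal \<bar>-1\<bar> * \<dots>" by simp
  also have "\<dots> = (\<integral>\<^sup>+x. f (?U x) \<partial>leb I)"
    by (rule nn_integral_leb_affine[symmetric, OF I i(1) _ measurable_compose[OF U f]]) auto
  finally have F: "(\<integral>\<^sup>+x. ?F x \<partial>leb I) = (\<integral>\<^sup>+x. f (?U x) \<partial>leb I)" .
  have 1: "(\<integral>\<^sup>+x. ?F x \<partial>leb I) = ennreal \<bar>w i\<bar> * (\<integral>\<^sup>+x. ?F (?T x) \<partial>leb I)"
    by (rule nn_integral_leb_affine[OF I i _ g gi])
       (rule measurable_compose[OF B measurable_compose[OF N measurable_compose[OF U f]]])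
  have 2: "(\<integral>\<^sup>+x. f x \<partial>leb I) = ennreal \<bar>1 / w i\<bar> * (\<integral>\<^sup>+x. f (?U x) \<partial>leb I)"
    by (rule nn_integral_leb_affine[OF I i(1) _ f]) (use i gi in auto)
  have 3: "?F (?T x) = f (refl I w x)" if "x \<in> space (leb I)" for x
  proof (rule arg_cong[where f = f], rule ext)
    fix k
    let ?s = "w i * x i + g x"
    have "g (?N (?B (?T x))) = (\<Sum>j\<in>I - {i}. w j * (x j - 2 * ?s * w j))"
      unfolding g_def by (rule sum.cong) auto
    also have "\<dots> = g x - 2 * ?s * (\<Sum>j\<in>I - {i}. (w j)\<^sup>2)"
    proof -
      have "(\<Sum>j\<in>I - {i}. w j * (x j - 2 * t * w j)) = (\<Sum>j\<in>I - {i}. w j * x j) - 2 * t * (\<Sum>j\<in>I - {i}. (w j)\<^sup>2)" for t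
        by (simp add: sum_subtractf right_diff_distrib sum_distrib_left power2_eq_square mult_ac)
      thus ?thesis unfolding g_def .
    qed
    also have "(\<Sum>j\<in>I - {i}. (w j)\<^sup>2) = 1 - (w i)\<^sup>2"
      using w I i by (simp add: sum_diff1)
    finally have gg: "g (?N (?B (?T x))) = g x - 2 * ?s * (1 - (w i)\<^sup>2)" .
    show "?U (?N (?B (?T x))) k = refl I w x k"
    proof (cases "k = i")
      case True
      have "?U (?N (?B (?T x))) k = (- ?s - (g x - 2 * ?s * (1 - (w i)\<^sup>2))) / w i"
        unfolding gg[symmetric] using True i by (simp add: diff_divide_distrib)
      also have "\<dots> = x i - 2 * ?s * w i" using i(2) by (simp add: field_simps power2_eq_square)
      finally show ?thesis using True i by (simp add: refl_def g_sum)
    next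
      case False
      thus ?thesis using that by (auto simp: refl_def g_sum space_PiM PiE_def extensional_def)
    qed
  qed
  have wi: "ennreal \<bar>1 / w i\<bar> * ennreal \<bar>w i\<bar> = 1"
    using i by (simp add: ennreal_mult'[symmetric])
  have "(\<integral>\<^sup>+x. f x \<partial>leb I) = ennreal \<bar>1 / w i\<bar> * (ennreal \<bar>w i\<bar> * (\<integral>\<^sup>+x. ?F (?T x) \<partial>leb I))"
    using 1 2 F by simp
  also have "\<dots> = (\<integral>\<^sup>+x. ?F (?T x) \<partial>leb I)" using wi by (simp add: mult.assoc[symmetric])
  also have "\<dots> = (\<integral>\<^sup>+x. f (refl I w x) \<partial>leb I)" by (rule nn_integral_cong) (rule 3)
  finally show ?thesis ..
qed

lemma gauss_density:
  assumes "finite I"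
  shows "gauss I = density (leb I) (\<lambda>x. \<Prod>i\<in>I. ennreal (std_normal_density (x i)))"
proof -
  interpret P: product_prob_space "\<lambda>_::'a. std_normal_distribution" by (rule product_prob_space_gauss)
  interpret L: product_sigma_finite "\<lambda>_::'a. lborel :: real measure" by (rule product_sigma_finite_lb)
  have m: "(\<lambda>x. \<Prod>i\<in>I. ennreal (std_normal_density (x i))) \<in> borel_measurable (leb I)"
    by measurable
  show ?thesis unfolding gauss_def
  proof (rule P.PiM_eqI[symmetric, OF assms])
    fix A :: "'a \<Rightarrow> real set" assume A: "\<And>i. i \<in> I \<Longrightarrow> A i \<in> sets std_normal_distribution"
    hence A': "\<And>i. i \<in> I \<Longrightarrow> A i \<in> sets borel" by simp
    have "emeasure (density (leb I) (\<lambda>x. \<Prod>i\<in>I. ennreal (std_normal_density (x i)))) (PiE I A)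
        = (\<integral>\<^sup>+x. (\<Prod>i\<in>I. ennreal (std_normal_density (x i))) * indicator (PiE I A) x \<partial>leb I)"
      using A' m assms by (intro emeasure_density) (auto intro!: sets_PiM_I_finite)
    also have "\<dots> = (\<integral>\<^sup>+x. (\<Prod>i\<in>I. ennreal (std_normal_density (x i)) * indicator (A i) (x i)) \<partial>leb I)"
      by (rule nn_integral_cong)
         (use assms in \<open>auto simp: prod.distrib indicator_def PiE_iff space_PiM split: if_splits intro!: prod_zero_iff[THEN iffD2]\<close>)
    also have "\<dots> = (\<Prod>i\<in>I. \<integral>\<^sup>+t. ennreal (std_normal_density t) * indicator (A i) t \<partial>lborel)"
      using assms A' by (intro L.product_nn_integral_prod) auto
    also have "\<dots> = (\<Prod>i\<in>I. emeasure std_normal_distribution (A i))"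
      by (rule prod.cong) (use A' in \<open>auto simp: emeasure_density\<close>)
    finally show "emeasure (density (leb I) (\<lambda>x. \<Prod>i\<in>I. ennreal (std_normal_density (x i)))) (PiE I A)
        = (\<Prod>i\<in>I. emeasure std_normal_distribution (A i))" .
  next
    show "sets (density (leb I) (\<lambda>x. \<Prod>i\<in>I. ennreal (std_normal_density (x i)))) = sets (PiM I (\<lambda>_. std_normal_distribution))"
      by (simp, rule sets_PiM_cong) auto
  qed
qed

lemma sum_squares_refl:
  assumes "finite I" "(\<Sum>i\<in>I. (w i)\<^sup>2) = 1"
  shows "(\<Sum>i\<in>I. (refl I w x i)\<^sup>2) = (\<Sum>i\<in>I. (x i)\<^sup>2)"
proof -
  let ?s = "\<Sum>i\<in>I. w i * x i"
  have "(\<Sum>i\<in>I. (refl I w x i)\<^sup>2) = (\<Sum>i\<in>I. (x i)\<^sup>2 - 4 * ?s * (w i * x i) + 4 * ?s\<^sup>2 * (w i)\<^sup>2)"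
    by (rule sum.cong) (auto simp: refl_def power2_eq_square algebra_simps)
  also have "\<dots> = (\<Sum>i\<in>I. (x i)\<^sup>2) - 4 * ?s * ?s + 4 * ?s\<^sup>2 * 1"
    by (simp only: sum.distrib sum_subtractf sum_distrib_left[symmetric] assms)
  finally show ?thesis by (simp add: power2_eq_square)
qed

lemma nn_integral_gauss_refl:
  assumes I: "finite I" and w: "(\<Sum>i\<in>I. (w i)\<^sup>2) = 1"
    and f: "f \<in> borel_measurable (gauss I)"
  shows "(\<integral>\<^sup>+x. f (refl I w x) \<partial>gauss I) = (\<integral>\<^sup>+x. f x \<partial>gauss I)"
proof -
  have s: "sets (leb I) = sets (gauss I)" unfolding gauss_def by (rule sets_PiM_cong) auto
  have f' [measurable]: "f \<in> borel_measurable (leb I)"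
    using f measurable_cong_sets[OF s refl] by blast
  let ?d = "\<lambda>x. \<Prod>i\<in>I. ennreal (std_normal_density (x i))"
  have d: "?d x = ennreal ((1 / sqrt (2 * pi)) ^ card I * exp (- (\<Sum>i\<in>I. (x i)\<^sup>2) / 2))" for x
    by (subst prod_ennreal)
       (auto simp: std_normal_density_def prod.distrib exp_sum[symmetric] I sum_divide_distrib sum_negf[symmetric]
             prod_dividef power_divide)
  have "(\<integral>\<^sup>+x. f (refl I w x) \<partial>gauss I) = (\<integral>\<^sup>+x. ?d x * f (refl I w x) \<partial>leb I)"
    unfolding gauss_density[OF I] by (rule nn_integral_density) measurable
  also have "\<dots> = (\<integral>\<^sup>+x. ?d (refl I w x) * f (refl I w x) \<partial>leb I)"
    unfolding d sum_squares_refl[OF I w] ..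
  also have "\<dots> = (\<integral>\<^sup>+x. ?d x * f x \<partial>leb I)"
    by (rule nn_integral_leb_refl[OF I w, of "\<lambda>x. ?d x * f x"]) measurable
  also have "\<dots> = (\<integral>\<^sup>+x. f x \<partial>gauss I)"
    unfolding gauss_density[OF I] by (rule nn_integral_density[symmetric]) measurable
  finally show ?thesis .
qed

subsection \<open>Moments, convolution and rotations of the Gaussian measure\<close>

lemma integral_std_normal:
  fixes f :: "real \<Rightarrow> real" assumes "f \<in> borel_measurable borel"
  shows "(\<integral>t. f t \<partial>std_normal_distribution) = (\<integral>t. std_normal_density t * f t \<partial>lborel)"
    and "integrable std_normal_distribution f \<longleftrightarrow> integrable lborel (\<lambda>t. std_normal_density t * f t)"
proof -
  have [measurable]: "std_normal_density \<in> borel_measurable lborel" by simp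
  have "f \<in> borel_measurable lborel" using assms by simp
  thus "(\<integral>t. f t \<partial>std_normal_distribution) = (\<integral>t. std_normal_density t * f t \<partial>lborel)"
    "integrable std_normal_distribution f \<longleftrightarrow> integrable lborel (\<lambda>t. std_normal_density t * f t)"
    using integral_density[of f lborel std_normal_density] integrable_density[of f lborel std_normal_density]
    by auto
qed

lemma distr_gauss_component:
  assumes "i \<in> I" shows "distr (gauss I) borel (\<lambda>x. x i) = std_normal_distribution"
proof -
  have "distr (gauss I) borel (\<lambda>x. x i) = distr (gauss I) std_normal_distribution (\<lambda>x. x i)"
    by (rule distr_cong) auto
  thus ?thesis unfolding gauss_def
    using distr_PiM_component[of I "\<lambda>_. std_normal_distribution" i] assms prob_space_normal_density by auto
qed

lemma integral_gauss_component:
  fixes f :: "real \<Rightarrow> real" assumes "i \<in> I" and [measurable]: "f \<in> borel_measurable borel"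
  shows "(\<integral>x. f (x i) \<partial>gauss I) = (\<integral>t. f t \<partial>std_normal_distribution)"
    and "integrable (gauss I) (\<lambda>x. f (x i)) \<longleftrightarrow> integrable std_normal_distribution f"
  using assms(1)
  by (simp_all add: distr_gauss_component[of i I, symmetric] integral_distr integrable_distr_eq)

lemma integrable_gauss_abs_power:
  assumes "i \<in> I" shows "integrable (gauss I) (\<lambda>x. \<bar>x i\<bar> ^ n)"
  using assms integrable_std_normal_moment_abs[of n]
  by (subst integral_gauss_component(2)[where f = "\<lambda>t. \<bar>t\<bar> ^ n"]) (auto simp: integral_std_normal)

lemma integrable_gauss_power:
  assumes "i \<in> I" shows "integrable (gauss I) (\<lambda>x. x i ^ n)"
  using assms integrable_std_normal_moment[of n]
  by (subst integral_gauss_component(2)[where f = "\<lambda>t. t ^ n"]) (auto simp: integral_std_normal)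

lemma integrable_gauss_id [simp]: "i \<in> I \<Longrightarrow> integrable (gauss I) (\<lambda>x. x i)"
  using integrable_gauss_power[of i I 1] by simp

lemma std_normal_moments:
  "(\<integral>t. t \<partial>std_normal_distribution) = 0"
  "(\<integral>t. t ^ 2 \<partial>std_normal_distribution) = 1"
  "(\<integral>t. t ^ 4 \<partial>std_normal_distribution) = 3"
  "integrable std_normal_distribution (\<lambda>t. t ^ n)"
  using integral_std_normal_moment_odd[of 0] integral_std_normal_moment_even[of 1]
    integral_std_normal_moment_even[of 2] integrable_std_normal_moment[of n]
  by (auto simp: integral_std_normal fact_numeral)

lemma gauss_mean: "i \<in> I \<Longrightarrow> (\<integral>x. x i \<partial>gauss I) = 0"
  using integral_gauss_component(1)[of i I "\<lambda>t. t"] std_normal_moments(1) by simp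

lemma gauss_square: "i \<in> I \<Longrightarrow> (\<integral>x. (x i)\<^sup>2 \<partial>gauss I) = 1"
  using integral_gauss_component(1)[of i I "\<lambda>t. t\<^sup>2"] std_normal_moments(2) by simp

lemma gauss_abs_le: assumes "i \<in> I" shows "(\<integral>x. \<bar>x i\<bar> \<partial>gauss I) \<le> 1"
proof -
  interpret prob_space "gauss I" by (rule prob_space_gauss)
  have "(\<integral>x. \<bar>x i\<bar> \<partial>gauss I) \<le> (\<integral>x. (1 + (x i)\<^sup>2) / 2 \<partial>gauss I)"
  proof (rule integral_mono)
    show "\<bar>x i\<bar> \<le> (1 + (x i)\<^sup>2) / 2" for x :: "'a \<Rightarrow> real"
      using zero_le_power2[of "\<bar>x i\<bar> - 1"] by (simp add: power2_diff)
  qed (use assms integrable_gauss_abs_power[OF assms, of 1] integrable_gauss_power[OF assms, of 2] in auto)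
  also have "\<dots> = 1" using gauss_square[OF assms] integrable_gauss_power[OF assms, of 2] by (simp add: prob_space)
  finally show ?thesis .
qed

lemma gauss_prod2:
  fixes f g :: "real \<Rightarrow> real"
  assumes I: "finite I" "i \<in> I" "j \<in> I" "i \<noteq> j"
    and f: "integrable std_normal_distribution f" and g: "integrable std_normal_distribution g"
  shows "integrable (gauss I) (\<lambda>x. f (x i) * g (x j))"
    and "(\<integral>x. f (x i) * g (x j) \<partial>gauss I)
      = (\<integral>t. f t \<partial>std_normal_distribution) * (\<integral>t. g t \<partial>std_normal_distribution)"
proof -
  interpret product_prob_space "\<lambda>_::'a. std_normal_distribution" by (rule product_prob_space_gauss)
  define F where "F k = (if k = i then f else if k = j then g else (\<lambda>_. 1))" for k
  have F: "integrable std_normal_distribution (F k)" for k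
    using f g by (auto simp: F_def intro: finite_measure.integrable_const
        prob_space.finite_measure[OF prob_space_normal_density])
  have Fi: "F i = f" "F j = g" and F1: "\<And>k. k \<in> I - {i} - {j} \<Longrightarrow> F k = (\<lambda>_. 1)" using I by (auto simp: F_def)
  have p: "(\<Prod>k\<in>I. h k) = h i * h j * (\<Prod>k\<in>I - {i} - {j}. h k)" for h :: "'a \<Rightarrow> real"
    using I prod.remove[of I i h] prod.remove[of "I - {i}" j h] by (simp add: mult_ac)
  have e: "(\<Prod>k\<in>I. F k (x k)) = f (x i) * g (x j)" for x
    using F1 by (subst p) (simp add: Fi)
  show "integrable (gauss I) (\<lambda>x. f (x i) * g (x j))"
    using product_integrable_prod[of I F] I F unfolding gauss_def e by simp
  show "(\<integral>x. f (x i) * g (x j) \<partial>gauss I)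
      = (\<integral>t. f t \<partial>std_normal_distribution) * (\<integral>t. g t \<partial>std_normal_distribution)"
    using product_integral_prod[of I F] I F prob_space.prob_space[OF prob_space_normal_density[of 1 0]]
    unfolding gauss_def e by (simp add: p Fi F1)
qed

lemma gauss_covariance:
  assumes I: "finite I" "i \<in> I" "j \<in> I"
  shows "integrable (gauss I) (\<lambda>x. x i * x j)"
    and "(\<integral>x. x i * x j \<partial>gauss I) = (if i = j then 1 else 0)"
proof -
  have "integrable std_normal_distribution (\<lambda>t. t)" using std_normal_moments(4)[of 1] by simp
  thus "integrable (gauss I) (\<lambda>x. x i * x j)" "(\<integral>x. x i * x j \<partial>gauss I) = (if i = j then 1 else 0)"
    using gauss_prod2[of I i j "\<lambda>t. t" "\<lambda>t. t"] I integrable_gauss_power[of i I 2] gauss_square[of i I]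
    by (cases "i = j"; simp add: std_normal_moments(1) power2_eq_square)+
qed

lemma gauss_linear_square:
  assumes "finite I"
  shows "integrable (gauss I) (\<lambda>x. (\<Sum>i\<in>I. x i * u i)\<^sup>2)"
    and "(\<integral>x. (\<Sum>i\<in>I. x i * u i)\<^sup>2 \<partial>gauss I) = (\<Sum>i\<in>I. (u i)\<^sup>2)"
proof -
  have e: "(\<Sum>i\<in>I. x i * u i)\<^sup>2 = (\<Sum>i\<in>I. \<Sum>j\<in>I. u i * u j * (x i * x j))" for x
    by (simp add: power2_eq_square sum_product mult_ac)
  show "integrable (gauss I) (\<lambda>x. (\<Sum>i\<in>I. x i * u i)\<^sup>2)"
    unfolding e using assms gauss_covariance(1) by (intro Bochner_Integration.integrable_sum integrable_mult_right) auto
  have i: "integrable (gauss I) (\<lambda>x. u i * u j * (x i * x j))" if "i \<in> I" "j \<in> I" for i j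
    using assms gauss_covariance(1) that by (intro integrable_mult_right) auto
  have "(\<integral>x. (\<Sum>i\<in>I. x i * u i)\<^sup>2 \<partial>gauss I) = (\<Sum>i\<in>I. \<integral>x. (\<Sum>j\<in>I. u i * u j * (x i * x j)) \<partial>gauss I)"
    unfolding e by (intro Bochner_Integration.integral_sum Bochner_Integration.integrable_sum i)
  also have "\<dots> = (\<Sum>i\<in>I. \<Sum>j\<in>I. \<integral>x. u i * u j * (x i * x j) \<partial>gauss I)"
    by (intro sum.cong refl Bochner_Integration.integral_sum i)
  also have "\<dots> = (\<Sum>i\<in>I. \<Sum>j\<in>I. u i * u j * (if i = j then 1 else 0))"
    using gauss_covariance(2)[OF assms] by (intro sum.cong refl) simp
  also have "\<dots> = (\<Sum>i\<in>I. (u i)\<^sup>2)"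
    using assms by (intro sum.cong) (auto simp: if_distrib sum.If_cases power2_eq_square cong: if_cong)
  finally show "(\<integral>x. (\<Sum>i\<in>I. x i * u i)\<^sup>2 \<partial>gauss I) = (\<Sum>i\<in>I. (u i)\<^sup>2)" .
qed

lemma integrable_gauss_linear: "finite I \<Longrightarrow> integrable (gauss I) (\<lambda>x. \<Sum>i\<in>I. x i * u i)"
  by (intro Bochner_Integration.integrable_sum integrable_mult_left integrable_gauss_id)

lemma gauss_linear_mean: "finite I \<Longrightarrow> (\<integral>x. (\<Sum>i\<in>I. x i * u i) \<partial>gauss I) = 0"
  by (subst Bochner_Integration.integral_sum) (auto simp: gauss_mean)

lemma integrable_gauss_cube:
  assumes "finite I" shows "integrable (gauss I) (\<lambda>x. (\<Sum>i\<in>I. \<bar>x i\<bar>) ^ 3)"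
proof (rule Bochner_Integration.integrable_bound)
  show "integrable (gauss I) (\<lambda>x. real (card I) ^ 3 * (\<Sum>i\<in>I. \<bar>x i\<bar> ^ 3))"
    by (intro integrable_mult_right Bochner_Integration.integrable_sum integrable_gauss_abs_power)
  show "(\<lambda>x. (\<Sum>i\<in>I. \<bar>x i\<bar>) ^ 3) \<in> borel_measurable (gauss I)"
    by (intro borel_measurable_power borel_measurable_sum borel_measurable_abs measurable_gauss_component)
  have "(\<Sum>i\<in>I. \<bar>x i\<bar>) ^ 3 \<le> real (card I) ^ 3 * (\<Sum>i\<in>I. \<bar>x i\<bar> ^ 3)" for x :: "'a \<Rightarrow> real"
  proof (cases "I = {}")
    case False
    define m where "m = Max ((\<lambda>i. \<bar>x i\<bar>) ` I)"
    have m: "\<And>i. i \<in> I \<Longrightarrow> \<bar>x i\<bar> \<le> m" using assms by (auto simp: m_def)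
    have "m \<in> (\<lambda>i. \<bar>x i\<bar>) ` I" unfolding m_def using assms False by (intro Max_in) auto
    then obtain k where k: "k \<in> I" "m = \<bar>x k\<bar>" by blast
    have "(\<Sum>i\<in>I. \<bar>x i\<bar>) \<le> real (card I) * m" using m by (rule sum_bounded_above)
    hence "(\<Sum>i\<in>I. \<bar>x i\<bar>) ^ 3 \<le> (real (card I) * m) ^ 3" by (intro power_mono sum_nonneg) auto
    also have "\<dots> = real (card I) ^ 3 * \<bar>x k\<bar> ^ 3" by (simp add: power_mult_distrib k)
    also have "\<dots> \<le> real (card I) ^ 3 * (\<Sum>i\<in>I. \<bar>x i\<bar> ^ 3)"
      using assms k by (intro mult_left_mono member_le_sum) auto
    finally show ?thesis .
  qed auto
  thus "AE x in gauss I. norm ((\<Sum>i\<in>I. \<bar>x i\<bar>) ^ 3) \<le> norm (real (card I) ^ 3 * (\<Sum>i\<in>I. \<bar>x i\<bar> ^ 3))"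
    by (intro AE_I2) (simp add: sum_nonneg abs_mult)
qed

text \<open>
  A reflection of the plane maps the first coordinate \<open>a\<close> to \<open>c a + s b\<close>.
\<close>

lemma gauss1_rotation:
  fixes c s :: real
  assumes cs: "c\<^sup>2 + s\<^sup>2 = 1" "0 \<le> s" and f [measurable]: "f \<in> borel_measurable borel"
  shows "(\<integral>\<^sup>+a. (\<integral>\<^sup>+b. f (c * a + s * b) \<partial>std_normal_distribution) \<partial>std_normal_distribution)
    = (\<integral>\<^sup>+t. f t \<partial>std_normal_distribution)"
proof -
  interpret product_prob_space "\<lambda>_::bool. std_normal_distribution" by (rule product_prob_space_gauss)
  define w where "w b = (if b then sqrt ((1 - c) / 2) else - sqrt ((1 + c) / 2))" for b :: bool
  have c1: "\<bar>c\<bar> \<le> 1" using cs by (metis abs_le_square_iff abs_one le_add_same_cancel1 one_power2 power2_abs zero_le_power2)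
  hence c2: "c \<le> 1" "-1 \<le> c" by auto
  have sw: "sqrt ((1 - c) / 2) * sqrt ((1 + c) / 2) = s / 2"
  proof -
    have "(1 - c) / 2 * ((1 + c) / 2) = (s / 2)\<^sup>2" using cs by (simp add: power2_eq_square field_simps)
    thus ?thesis using cs(2) by (simp flip: real_sqrt_mult)
  qed
  have w1: "(\<Sum>i\<in>UNIV. (w i)\<^sup>2) = 1" using c2 by (simp add: UNIV_bool w_def field_simps)
  have r: "refl UNIV w x True = c * x True + s * x False" for x
    using c2 sw by (simp add: refl_def UNIV_bool w_def field_simps)
  have "(\<integral>\<^sup>+x. f (refl UNIV w x True) \<partial>gauss UNIV) = (\<integral>\<^sup>+x. f (x True) \<partial>gauss UNIV)"
    by (rule nn_integral_gauss_refl[OF _ w1]) auto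
  also have "\<dots> = (\<integral>\<^sup>+t. f t \<partial>std_normal_distribution)"
    by (subst distr_gauss_component[of True UNIV, symmetric]) (auto simp: nn_integral_distr)
  finally have 1: "(\<integral>\<^sup>+x. f (c * x True + s * x False) \<partial>gauss UNIV) = (\<integral>\<^sup>+t. f t \<partial>std_normal_distribution)"
    unfolding r .
  have U: "UNIV = {True, False}" by auto
  have "(\<integral>\<^sup>+x. f (c * x True + s * x False) \<partial>gauss UNIV)
    = (\<integral>\<^sup>+z. f (c * fst z + s * snd z) \<partial>(std_normal_distribution \<Otimes>\<^sub>M std_normal_distribution))"
    unfolding gauss_def U
    by (rule product_nn_integral_pair[where f = "\<lambda>a b. f (c * a + s * b)"]) auto
  also have "\<dots> = (\<integral>\<^sup>+a. (\<integral>\<^sup>+b. f (c * a + s * b) \<partial>std_normal_distribution) \<partial>std_normal_distribution)"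
    by (subst sigma_finite_measure.nn_integral_fst[symmetric])
       (auto intro!: prob_space_imp_sigma_finite prob_space_normal_density)
  finally show ?thesis using 1 by simp
qed

lemma distr_gauss_convolution:
  fixes c s :: real
  assumes K: "finite K" and cs: "c\<^sup>2 + s\<^sup>2 = 1" "0 \<le> s"
  shows "distr (gauss K \<Otimes>\<^sub>M gauss K) (gauss K) (\<lambda>(x, y). \<lambda>k\<in>K. c * x k + s * y k) = gauss K"
proof -
  interpret P: product_prob_space "\<lambda>_::'a. std_normal_distribution" by (rule product_prob_space_gauss)
  interpret K: prob_space "gauss K" by (rule prob_space_gauss)
  let ?h = "\<lambda>(x, y). \<lambda>k\<in>K. c * x k + s * y k"
  have h: "?h \<in> measurable (gauss K \<Otimes>\<^sub>M gauss K) (gauss K)"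
  proof (subst measurable_cong_sets[OF refl sets_gauss], unfold case_prod_beta', rule measurable_restrict)
    fix k assume [measurable]: "k \<in> K"
    show "(\<lambda>p. c * fst p k + s * snd p k) \<in> borel_measurable (gauss K \<Otimes>\<^sub>M gauss K)" by measurable
  qed
  have "distr (gauss K \<Otimes>\<^sub>M gauss K) (gauss K) ?h = PiM K (\<lambda>_. std_normal_distribution)"
  proof (rule P.PiM_eqI[OF K])
    show "sets (distr (gauss K \<Otimes>\<^sub>M gauss K) (gauss K) ?h) = sets (PiM K (\<lambda>_. std_normal_distribution))"
      by (simp add: gauss_def)
    fix A :: "'a \<Rightarrow> real set" assume A: "\<And>i. i \<in> K \<Longrightarrow> A i \<in> sets std_normal_distribution"
    hence A': "\<And>i. i \<in> K \<Longrightarrow> A i \<in> sets borel" by simp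
    have box: "PiE K A \<in> sets (gauss K)"
      unfolding gauss_def using K A by (intro sets_PiM_I_finite) auto
    have "emeasure (distr (gauss K \<Otimes>\<^sub>M gauss K) (gauss K) ?h) (PiE K A)
       = (\<integral>\<^sup>+p. indicator (PiE K A) (?h p) \<partial>(gauss K \<Otimes>\<^sub>M gauss K))"
      using box h by (simp add: nn_integral_distr flip: nn_integral_indicator)
    also have "\<dots> = (\<integral>\<^sup>+x. (\<integral>\<^sup>+y. indicator (PiE K A) (?h (x, y)) \<partial>gauss K) \<partial>gauss K)"
      by (rule K.nn_integral_fst[symmetric], rule measurable_compose[OF h]) (use box in auto)
    also have "\<dots> = (\<integral>\<^sup>+x. (\<integral>\<^sup>+y. (\<Prod>k\<in>K. indicator (A k) (c * x k + s * y k)) \<partial>gauss K) \<partial>gauss K)"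
      using K by (intro nn_integral_cong) (auto simp: indicator_def PiE_iff prod_zero_iff split: if_splits)
    also have "\<dots> = (\<integral>\<^sup>+x. (\<Prod>k\<in>K. \<integral>\<^sup>+b. indicator (A k) (c * x k + s * b) \<partial>std_normal_distribution) \<partial>gauss K)"
      unfolding gauss_def using K A' by (intro nn_integral_cong P.product_nn_integral_prod) auto
    also have "\<dots> = (\<Prod>k\<in>K. \<integral>\<^sup>+a. (\<integral>\<^sup>+b. indicator (A k) (c * a + s * b) \<partial>std_normal_distribution) \<partial>std_normal_distribution)"
    proof -
      have "(\<lambda>a. \<integral>\<^sup>+b. indicator (A k) (c * a + s * b) \<partial>std_normal_distribution) \<in> borel_measurable std_normal_distribution"
        if "k \<in> K" for k
        using A'[OF that]
        by (intro sigma_finite_measure.borel_measurable_nn_integral prob_space_imp_sigma_finite prob_space_normal_density) auto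
      thus ?thesis unfolding gauss_def using K
        by (intro P.product_nn_integral_prod[where f = "\<lambda>k a. \<integral>\<^sup>+b. indicator (A k) (c * a + s * b) \<partial>std_normal_distribution"])
    qed
    also have "\<dots> = (\<Prod>k\<in>K. emeasure std_normal_distribution (A k))"
      using A' cs by (intro prod.cong refl, subst gauss1_rotation) auto
    finally show "emeasure (distr (gauss K \<Otimes>\<^sub>M gauss K) (gauss K) ?h) (PiE K A)
       = (\<Prod>k\<in>K. emeasure std_normal_distribution (A k))" .
  qed
  thus ?thesis by (simp only: gauss_def)
qed

lemma gauss_convolution:
  fixes t r :: real and G :: "('k \<Rightarrow> real) \<Rightarrow> real"
  assumes K: "finite K" and tr: "0 \<le> t" "0 \<le> r"
    and G [measurable]: "G \<in> borel_measurable (gauss K)"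
    and ext: "\<And>x. G (restrict x K) = G x"
    and i: "integrable (gauss K) (\<lambda>x. G (\<lambda>k. sqrt (t + r) * x k))"
  shows "integrable (gauss K \<Otimes>\<^sub>M gauss K) (\<lambda>(x, y). G (\<lambda>k. sqrt t * x k + sqrt r * y k))"
    and "(\<integral>x. (\<integral>y. G (\<lambda>k. sqrt t * x k + sqrt r * y k) \<partial>gauss K) \<partial>gauss K) = (\<integral>x. G (\<lambda>k. sqrt (t + r) * x k) \<partial>gauss K)"
    and "integrable (gauss K) (\<lambda>x. \<integral>y. G (\<lambda>k. sqrt t * x k + sqrt r * y k) \<partial>gauss K)"
proof -
  interpret K: prob_space "gauss K" by (rule prob_space_gauss)
  interpret KK: pair_prob_space "gauss K" "gauss K" ..
  define c s where "c = (if t + r = 0 then 1 else sqrt (t / (t + r)))" and "s = (if t + r = 0 then 0 else sqrt (r / (t + r)))"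
  have cs: "c\<^sup>2 + s\<^sup>2 = 1" "0 \<le> s" using tr
    by (auto simp: c_def s_def add_divide_distrib[symmetric])
  have ct: "sqrt (t + r) * c = sqrt t" "sqrt (t + r) * s = sqrt r"
    using tr by (auto simp: c_def s_def real_sqrt_mult[symmetric])
  define h where "h = (\<lambda>(x, y). \<lambda>k\<in>K. c * x k + s * y k)"
  define g where "g x = G (\<lambda>k. sqrt (t + r) * x k)" for x
  have h: "h \<in> measurable (gauss K \<Otimes>\<^sub>M gauss K) (gauss K)"
  proof (subst measurable_cong_sets[OF refl sets_gauss], unfold h_def case_prod_beta', rule measurable_restrict)
    fix k assume [measurable]: "k \<in> K"
    show "(\<lambda>p. c * fst p k + s * snd p k) \<in> borel_measurable (gauss K \<Otimes>\<^sub>M gauss K)" by measurable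
  qed
  have gi: "integrable (gauss K) g" using i unfolding g_def[abs_def] .
  have g: "g \<in> borel_measurable (gauss K)" using gi by (rule borel_measurable_integrable)
  have gh: "G (\<lambda>k. sqrt t * x k + sqrt r * y k) = g (h (x, y))" for x y
  proof -
    have "restrict (\<lambda>k. sqrt (t + r) * h (x, y) k) K = restrict (\<lambda>k. sqrt t * x k + sqrt r * y k) K"
      unfolding ct[symmetric] h_def by (auto simp: restrict_def fun_eq_iff algebra_simps)
    thus ?thesis unfolding g_def by (metis ext)
  qed
  have gh': "(\<lambda>(x, y). G (\<lambda>k. sqrt t * x k + sqrt r * y k)) = (\<lambda>p. g (h p))"
    by (rule HOL.ext) (simp only: split_paired_all prod.case gh)
  note D = distr_gauss_convolution[OF K cs, folded h_def]
  have 1: "integrable (gauss K \<Otimes>\<^sub>M gauss K) (\<lambda>p. g (h p))"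
    using gi g h by (subst (asm) D[symmetric]) (simp add: integrable_distr_eq)
  thus 2: "integrable (gauss K \<Otimes>\<^sub>M gauss K) (\<lambda>(x, y). G (\<lambda>k. sqrt t * x k + sqrt r * y k))"
    unfolding gh' .
  have "(\<integral>x. g x \<partial>gauss K) = (\<integral>p. g (h p) \<partial>(gauss K \<Otimes>\<^sub>M gauss K))"
    using g h by (subst D[symmetric]) (simp add: integral_distr)
  also have "\<dots> = (\<integral>x. (\<integral>y. g (h (x, y)) \<partial>gauss K) \<partial>gauss K)"
    by (rule KK.integral_fst'[OF 1, symmetric])
  finally show "(\<integral>x. (\<integral>y. G (\<lambda>k. sqrt t * x k + sqrt r * y k) \<partial>gauss K) \<partial>gauss K) = (\<integral>x. G (\<lambda>k. sqrt (t + r) * x k) \<partial>gauss K)"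
    unfolding gh g_def by (rule sym)
  show "integrable (gauss K) (\<lambda>x. \<integral>y. G (\<lambda>k. sqrt t * x k + sqrt r * y k) \<partial>gauss K)"
    using KK.integrable_fst[OF 2] .
qed

text \<open>
  Reflections along pairwise orthogonal directions commute and compose to this map.
\<close>

lemma nn_integral_gauss_orthonormal_refl:
  assumes I: "finite I" and S: "finite S"
    and W1: "\<And>a. a \<in> S \<Longrightarrow> (\<Sum>i\<in>I. (W a i)\<^sup>2) = 1"
    and W0: "\<And>a b. a \<in> S \<Longrightarrow> b \<in> S \<Longrightarrow> a \<noteq> b \<Longrightarrow> (\<Sum>i\<in>I. W a i * W b i) = 0"
    and f [measurable]: "f \<in> borel_measurable (gauss I)"
  shows "(\<integral>\<^sup>+x. f (\<lambda>i\<in>I. x i - 2 * (\<Sum>a\<in>S. (\<Sum>j\<in>I. W a j * x j) * W a i)) \<partial>gauss I) = (\<integral>\<^sup>+x. f x \<partial>gauss I)"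
  using S W1 W0
proof (induction S)
  case empty
  show ?case by (intro nn_integral_cong arg_cong[where f = f]) (auto simp: space_gauss)
next
  case (insert b S)
  let ?T = "\<lambda>S x. \<lambda>i\<in>I. x i - 2 * (\<Sum>a\<in>S. (\<Sum>j\<in>I. W a j * x j) * W a i)"
  have T: "?T S \<in> measurable (gauss I) (gauss I)"
  proof (subst measurable_cong_sets[OF refl sets_gauss], rule measurable_restrict)
    fix i assume [measurable]: "i \<in> I"
    show "(\<lambda>x. x i - 2 * (\<Sum>a\<in>S. (\<Sum>j\<in>I. W a j * x j) * W a i)) \<in> borel_measurable (gauss I)"
      by measurable
  qed
  have "(\<integral>\<^sup>+x. f x \<partial>gauss I) = (\<integral>\<^sup>+x. f (?T S x) \<partial>gauss I)"
    by (rule insert.IH[symmetric]) (use insert.prems in auto)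
  also have "\<dots> = (\<integral>\<^sup>+x. f (?T S (refl I (W b) x)) \<partial>gauss I)"
    using insert.prems(1)[of b] by (intro nn_integral_gauss_refl[symmetric, OF I] measurable_compose[OF T f]) auto
  also have "\<dots> = (\<integral>\<^sup>+x. f (?T (insert b S) x) \<partial>gauss I)"
  proof (intro nn_integral_cong arg_cong[where f = f] ext)
    fix x i
    have "(\<Sum>j\<in>I. W a j * refl I (W b) x j) = (\<Sum>j\<in>I. W a j * x j)" if "a \<in> S" for a
    proof -
      have "a \<noteq> b" using that insert.hyps by auto
      thus ?thesis using insert.prems that by (subst sum_mult_refl[OF I]) auto
    qed
    hence "(\<Sum>a\<in>S. (\<Sum>j\<in>I. W a j * refl I (W b) x j) * W a i) = (\<Sum>a\<in>S. (\<Sum>j\<in>I. W a j * x j) * W a i)"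
      by (intro sum.cong) auto
    thus "?T S (refl I (W b) x) i = ?T (insert b S) x i"
      using insert.hyps by (auto simp: restrict_def refl_def algebra_simps)
  qed
  finally show ?case by (rule sym)
qed

section \<open>Gaussian interpolation\<close>

locale gfamily = prob_space \<mu> for \<mu> :: "'a measure" +
  fixes K :: "'k set" and a :: "'k \<Rightarrow> 'a \<Rightarrow> real" and A :: real
  assumes finK: "finite K" and A0: "0 \<le> A"
    and a_meas: "\<And>k. k \<in> K \<Longrightarrow> a k \<in> borel_measurable \<mu>"
    and a_bound: "\<And>k \<omega>. k \<in> K \<Longrightarrow> \<omega> \<in> space \<mu> \<Longrightarrow> \<bar>a k \<omega>\<bar> \<le> A"
begin

definition lin :: "('k \<Rightarrow> real) \<Rightarrow> 'a \<Rightarrow> real" where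
  "lin x \<omega> = (\<Sum>k\<in>K. x k * a k \<omega>)"

text \<open>
  The expected log-partition function after switching on the Gaussian field for time \<open>t\<close>.  The field is
  treated as a semigroup acting on \<open>f\<close>, and derivatives in \<open>t\<close> are replaced by difference
  inequalities, so that no differentiation under the integral is needed.
\<close>

definition heat :: "real \<Rightarrow> ('a \<Rightarrow> real) \<Rightarrow> real" where
  "heat t f = (\<integral>x. log_avg \<mu> (\<lambda>\<omega>. f \<omega> + lin (\<lambda>k. sqrt t * x k) \<omega>) \<partial>gauss K)"

text \<open>
  The sum of the Gibbs variances; half of it is the rate of change of \<open>heat\<close>.
\<close>

definition gvar :: "('a \<Rightarrow> real) \<Rightarrow> real" where
  "gvar f = (\<Sum>k\<in>K. (\<integral>\<omega>. (a k \<omega>)\<^sup>2 \<partial>tilt \<mu> f) - (\<integral>\<omega>. a k \<omega> \<partial>tilt \<mu> f)\<^sup>2)"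

definition err :: real where
  "err = 16 * A ^ 3 * (\<integral>x. (\<Sum>k\<in>K. \<bar>x k\<bar>) ^ 3 \<partial>gauss K)"

lemma bdm_a: "k \<in> K \<Longrightarrow> bdm \<mu> (a k)"
  using a_meas a_bound by (rule bdmI)

lemma bdm_lin: "bdm \<mu> (lin x)"
  unfolding lin_def[abs_def] by (intro bdm_sum bdm_cmult bdm_a)

lemma lin_abs: "\<omega> \<in> space \<mu> \<Longrightarrow> \<bar>lin x \<omega>\<bar> \<le> A * (\<Sum>k\<in>K. \<bar>x k\<bar>)"
proof -
  assume w: "\<omega> \<in> space \<mu>"
  have "\<bar>lin x \<omega>\<bar> \<le> (\<Sum>k\<in>K. \<bar>x k * a k \<omega>\<bar>)" unfolding lin_def by (rule sum_abs)
  also have "\<dots> \<le> (\<Sum>k\<in>K. A * \<bar>x k\<bar>)"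
    using a_bound w by (intro sum_mono) (auto simp: abs_mult mult.commute[of A] intro!: mult_left_mono)
  finally show ?thesis by (simp add: sum_distrib_left)
qed

lemma lin_add: "lin (\<lambda>k. x k + y k) \<omega> = lin x \<omega> + lin y \<omega>"
  unfolding lin_def by (simp add: distrib_right sum.distrib)

lemma lin_restrict: "lin (restrict x K) = lin x"
  unfolding lin_def by (intro ext sum.cong) auto

lemma log_avg_measurable:
  assumes f: "bdm \<mu> f" and X: "\<And>k. k \<in> K \<Longrightarrow> (\<lambda>z. X z k) \<in> borel_measurable N"
  shows "(\<lambda>z. log_avg \<mu> (\<lambda>\<omega>. f \<omega> + lin (X z) \<omega>)) \<in> borel_measurable N"
proof -
  have f' [measurable]: "f \<in> borel_measurable \<mu>" using f by (rule bdm_meas)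
  have "(\<lambda>p. X (fst p) k) \<in> borel_measurable (N \<Otimes>\<^sub>M \<mu>)" if "k \<in> K" for k
    by (rule measurable_compose[OF measurable_fst X[OF that]])
  moreover have "(\<lambda>p. a k (snd p)) \<in> borel_measurable (N \<Otimes>\<^sub>M \<mu>)" if "k \<in> K" for k
    by (rule measurable_compose[OF measurable_snd a_meas[OF that]])
  moreover have "(\<lambda>p. f (snd p)) \<in> borel_measurable (N \<Otimes>\<^sub>M \<mu>)"
    by (rule measurable_compose[OF measurable_snd f'])
  ultimately have "(\<lambda>(z, \<omega>). exp (f \<omega> + lin (X z) \<omega>)) \<in> borel_measurable (N \<Otimes>\<^sub>M \<mu>)"
    unfolding lin_def case_prod_beta'
    by (intro borel_measurable_exp[THEN measurable_compose[rotated]] borel_measurable_add borel_measurable_sum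
          borel_measurable_times)
  hence "(\<lambda>z. \<integral>\<omega>. exp (f \<omega> + lin (X z) \<omega>) \<partial>\<mu>) \<in> borel_measurable N"
    by (rule borel_measurable_lebesgue_integral)
  thus ?thesis unfolding log_avg_def by measurable
qed

lemma log_avg_lipschitz:
  assumes f: "bdm \<mu> f"
  shows "\<bar>log_avg \<mu> (\<lambda>\<omega>. f \<omega> + lin x \<omega>) - log_avg \<mu> f\<bar> \<le> A * (\<Sum>k\<in>K. \<bar>x k\<bar>)"
proof -
  have b: "bdm \<mu> (\<lambda>\<omega>. f \<omega> + lin x \<omega>)" using f bdm_lin by (rule bdm_add)
  have "log_avg \<mu> (\<lambda>\<omega>. f \<omega> + lin x \<omega>) \<le> log_avg \<mu> f + A * (\<Sum>k\<in>K. \<bar>x k\<bar>)"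
    by (rule log_avg_le[OF prob_space_axioms b f]) (use lin_abs[of _ x] in \<open>fastforce simp: abs_le_iff\<close>)
  moreover have "log_avg \<mu> f \<le> log_avg \<mu> (\<lambda>\<omega>. f \<omega> + lin x \<omega>) + A * (\<Sum>k\<in>K. \<bar>x k\<bar>)"
  proof (rule log_avg_le[OF prob_space_axioms f b])
    show "f \<omega> \<le> f \<omega> + lin x \<omega> + A * (\<Sum>k\<in>K. \<bar>x k\<bar>)" if "\<omega> \<in> space \<mu>" for \<omega>
      using lin_abs[OF that, of x] by linarith
  qed
  ultimately show ?thesis by (simp add: abs_le_iff)
qed

lemma integrable_log_avg:
  assumes f: "bdm \<mu> f"
  shows "integrable (gauss K) (\<lambda>x. log_avg \<mu> (\<lambda>\<omega>. f \<omega> + lin (\<lambda>k. c * x k) \<omega>))"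
proof (rule Bochner_Integration.integrable_bound)
  interpret G: prob_space "gauss K" by (rule prob_space_gauss)
  show "integrable (gauss K) (\<lambda>x. \<bar>log_avg \<mu> f\<bar> + A * (\<Sum>k\<in>K. \<bar>c\<bar> * \<bar>x k\<bar>))"
    using integrable_gauss_abs_power[of _ K 1]
    by (intro Bochner_Integration.integrable_add integrable_mult_right Bochner_Integration.integrable_sum) auto
  show "(\<lambda>x. log_avg \<mu> (\<lambda>\<omega>. f \<omega> + lin (\<lambda>k. c * x k) \<omega>)) \<in> borel_measurable (gauss K)"
    using f by (rule log_avg_measurable) (intro borel_measurable_times borel_measurable_const measurable_gauss_component)
  have "\<bar>log_avg \<mu> (\<lambda>\<omega>. f \<omega> + lin (\<lambda>k. c * x k) \<omega>)\<bar> \<le> \<bar>\<bar>log_avg \<mu> f\<bar> + A * (\<Sum>k\<in>K. \<bar>c\<bar> * \<bar>x k\<bar>)\<bar>" for x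
    using log_avg_lipschitz[OF f, of "\<lambda>k. c * x k"] by (simp add: abs_mult)
  thus "AE x in gauss K. norm (log_avg \<mu> (\<lambda>\<omega>. f \<omega> + lin (\<lambda>k. c * x k) \<omega>))
      \<le> norm (\<bar>log_avg \<mu> f\<bar> + A * (\<Sum>k\<in>K. \<bar>c\<bar> * \<bar>x k\<bar>))" by simp
qed

lemma heat_0: "heat 0 f = log_avg \<mu> f"
  using prob_space.prob_space[OF prob_space_gauss[of K]] unfolding heat_def by (simp add: lin_def)

text \<open>
  The sum of independent Gaussian fields of variances \<open>t\<close> and \<open>r\<close> has variance \<open>t + r\<close>.
\<close>

lemma heat_add:
  assumes f: "bdm \<mu> f" and tr: "0 \<le> t" "0 \<le> r"
  shows "heat (t + r) f = (\<integral>x. heat r (\<lambda>\<omega>. f \<omega> + lin (\<lambda>k. sqrt t * x k) \<omega>) \<partial>gauss K)"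
    and "integrable (gauss K) (\<lambda>x. heat r (\<lambda>\<omega>. f \<omega> + lin (\<lambda>k. sqrt t * x k) \<omega>))"
proof -
  define G where "G y = log_avg \<mu> (\<lambda>\<omega>. f \<omega> + lin y \<omega>)" for y
  have G: "G \<in> borel_measurable (gauss K)"
    unfolding G_def using f by (rule log_avg_measurable) (rule measurable_gauss_component)
  have ext: "G (restrict x K) = G x" for x unfolding G_def lin_restrict ..
  have i: "integrable (gauss K) (\<lambda>x. G (\<lambda>k. sqrt (t + r) * x k))"
    unfolding G_def by (rule integrable_log_avg[OF f])
  have h: "heat r (\<lambda>\<omega>. f \<omega> + lin (\<lambda>k. sqrt t * x k) \<omega>) = (\<integral>y. G (\<lambda>k. sqrt t * x k + sqrt r * y k) \<partial>gauss K)" for x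
    unfolding heat_def G_def lin_add by (simp add: add.assoc)
  have h1: "heat (t + r) f = (\<integral>x. G (\<lambda>k. sqrt (t + r) * x k) \<partial>gauss K)"
    unfolding heat_def G_def ..
  note C = gauss_convolution[OF finK tr G ext i]
  show "heat (t + r) f = (\<integral>x. heat r (\<lambda>\<omega>. f \<omega> + lin (\<lambda>k. sqrt t * x k) \<omega>) \<partial>gauss K)"
    unfolding h h1 C(2) ..
  show "integrable (gauss K) (\<lambda>x. heat r (\<lambda>\<omega>. f \<omega> + lin (\<lambda>k. sqrt t * x k) \<omega>))"
    unfolding h by (rule C(3))
qed

text \<open>
  In the expansion of \<open>log_avg\<close> the term that is linear in the field has mean \<open>0\<close>, and the mean of the
  quadratic term is the sum over the independent coordinates.
\<close>

lemma heat_step: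
  assumes f: "bdm \<mu> f" and r: "0 \<le> r"
  shows "\<bar>heat r f - log_avg \<mu> f - r / 2 * gvar f\<bar> \<le> err * (r * sqrt r)"
proof -
  interpret G: prob_space "gauss K" by (rule prob_space_gauss)
  interpret T: prob_space "tilt \<mu> f" by (rule prob_space_tilt[OF prob_space_axioms f])
  let ?\<nu> = "tilt \<mu> f"
  define m where "m k = (\<integral>\<omega>. a k \<omega> \<partial>?\<nu>)" for k
  define c where "c k l = (\<integral>\<omega>. a k \<omega> * a l \<omega> \<partial>?\<nu>)" for k l
  have ia: "integrable ?\<nu> (a k)" if "k \<in> K" for k
    by (rule bdm_integrable[OF T.prob_space_axioms]) (simp add: bdm_a that)
  have iaa: "integrable ?\<nu> (\<lambda>\<omega>. a k \<omega> * a l \<omega>)" if "k \<in> K" "l \<in> K" for k l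
    by (rule bdm_integrable[OF T.prob_space_axioms]) (simp add: bdm_mult bdm_a that)
  define L where "L x = log_avg \<mu> (\<lambda>\<omega>. f \<omega> + lin (\<lambda>k. sqrt r * x k) \<omega>)" for x
  define M where "M x = sqrt r * (\<Sum>k\<in>K. x k * m k)" for x
  define Q where "Q x = r * (\<Sum>k\<in>K. \<Sum>l\<in>K. c k l * (x k * x l))" for x
  define R where "R x = 16 * A ^ 3 * (r * sqrt r) * (\<Sum>k\<in>K. \<bar>x k\<bar>) ^ 3" for x :: "'k \<Rightarrow> real"
  have R: "\<bar>L x - log_avg \<mu> f - M x - (Q x - (M x)\<^sup>2) / 2\<bar> \<le> R x" for x
  proof -
    let ?l = "lin (\<lambda>k. sqrt r * x k)"
    have l: "L x = log_avg \<mu> f + log_avg ?\<nu> ?l"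
      unfolding L_def by (rule log_avg_add[OF prob_space_axioms f bdm_lin])
    have "(\<integral>\<omega>. ?l \<omega> \<partial>?\<nu>) = (\<Sum>k\<in>K. \<integral>\<omega>. sqrt r * x k * a k \<omega> \<partial>?\<nu>)"
      unfolding lin_def by (intro Bochner_Integration.integral_sum integrable_mult_right ia)
    hence M: "(\<integral>\<omega>. ?l \<omega> \<partial>?\<nu>) = M x"
      by (simp add: M_def m_def sum_distrib_left mult_ac)
    have "(?l \<omega>)\<^sup>2 = (\<Sum>k\<in>K. \<Sum>l\<in>K. (r * (x k * x l)) * (a k \<omega> * a l \<omega>))" for \<omega>
    proof -
      have "(?l \<omega>)\<^sup>2 = (\<Sum>k\<in>K. \<Sum>l\<in>K. (sqrt r * sqrt r) * ((x k * x l) * (a k \<omega> * a l \<omega>)))"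
        unfolding lin_def power2_eq_square sum_product by (simp only: mult_ac)
      thus ?thesis using r by (simp add: mult.assoc)
    qed
    hence "(\<integral>\<omega>. (?l \<omega>)\<^sup>2 \<partial>?\<nu>) = (\<integral>\<omega>. (\<Sum>k\<in>K. \<Sum>l\<in>K. (r * (x k * x l)) * (a k \<omega> * a l \<omega>)) \<partial>?\<nu>)" by simp
    also have "\<dots> = (\<Sum>k\<in>K. \<integral>\<omega>. (\<Sum>l\<in>K. (r * (x k * x l)) * (a k \<omega> * a l \<omega>)) \<partial>?\<nu>)"
      by (intro Bochner_Integration.integral_sum Bochner_Integration.integrable_sum integrable_mult_right iaa)
    also have "\<dots> = (\<Sum>k\<in>K. \<Sum>l\<in>K. \<integral>\<omega>. (r * (x k * x l)) * (a k \<omega> * a l \<omega>) \<partial>?\<nu>)"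
      by (intro sum.cong refl Bochner_Integration.integral_sum integrable_mult_right iaa)
    also have "\<dots> = Q x" unfolding Q_def c_def by (simp add: sum_distrib_left mult_ac)
    finally have Q: "(\<integral>\<omega>. (?l \<omega>)\<^sup>2 \<partial>?\<nu>) = Q x" .
    have "\<bar>log_avg ?\<nu> ?l - M x - (Q x - (M x)\<^sup>2) / 2\<bar> \<le> 16 * (A * (\<Sum>k\<in>K. \<bar>sqrt r * x k\<bar>)) ^ 3"
      unfolding M[symmetric] Q[symmetric]
    proof (rule log_avg_taylor[OF T.prob_space_axioms])
      show "?l \<in> borel_measurable ?\<nu>" by (rule bdm_meas) (simp add: bdm_lin)
    qed (use lin_abs in simp)
    also have "(\<Sum>k\<in>K. \<bar>sqrt r * x k\<bar>) = sqrt r * (\<Sum>k\<in>K. \<bar>x k\<bar>)"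
      using r by (simp add: abs_mult sum_distrib_left)
    also have "16 * (A * (sqrt r * (\<Sum>k\<in>K. \<bar>x k\<bar>))) ^ 3 = R x"
      using r by (simp add: R_def power_mult_distrib power3_eq_cube mult_ac)
    finally show ?thesis unfolding l by simp
  qed
  have iL: "integrable (gauss K) L" unfolding L_def by (rule integrable_log_avg[OF f])
  have iM: "integrable (gauss K) M" unfolding M_def by (intro integrable_mult_right integrable_gauss_linear finK)
  have iM2: "integrable (gauss K) (\<lambda>x. (M x)\<^sup>2)" unfolding M_def power_mult_distrib
    by (intro integrable_mult_right gauss_linear_square finK)
  have icx: "integrable (gauss K) (\<lambda>x. c k l * (x k * x l))" if "k \<in> K" "l \<in> K" for k l
    by (intro integrable_mult_right gauss_covariance finK that)
  have iQ: "integrable (gauss K) Q" unfolding Q_def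
    by (intro integrable_mult_right Bochner_Integration.integrable_sum icx)
  have iR: "integrable (gauss K) R" unfolding R_def by (intro integrable_mult_right integrable_gauss_cube finK)
  have EM: "(\<integral>x. M x \<partial>gauss K) = 0" unfolding M_def integral_mult_right_zero gauss_linear_mean[OF finK] by simp
  have EM2: "(\<integral>x. (M x)\<^sup>2 \<partial>gauss K) = r * (\<Sum>k\<in>K. (m k)\<^sup>2)"
    unfolding M_def power_mult_distrib using r by (simp add: gauss_linear_square finK)
  have "(\<integral>x. Q x \<partial>gauss K) = r * (\<Sum>k\<in>K. \<integral>x. (\<Sum>l\<in>K. c k l * (x k * x l)) \<partial>gauss K)"
    unfolding Q_def integral_mult_right_zero
    by (subst Bochner_Integration.integral_sum) (intro Bochner_Integration.integrable_sum icx refl | assumption)+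
  also have "\<dots> = r * (\<Sum>k\<in>K. \<Sum>l\<in>K. \<integral>x. c k l * (x k * x l) \<partial>gauss K)"
    by (intro arg_cong[where f = "\<lambda>z. r * z"] sum.cong refl Bochner_Integration.integral_sum icx)
  also have "\<dots> = r * (\<Sum>k\<in>K. \<Sum>l\<in>K. c k l * (if k = l then 1 else 0))"
    by (intro arg_cong[where f = "\<lambda>z. r * z"] sum.cong refl) (simp add: gauss_covariance finK)
  also have "\<dots> = r * (\<Sum>k\<in>K. c k k)"
    using finK by (intro arg_cong[where f = "\<lambda>z. r * z"] sum.cong refl) (simp add: if_distrib cong: if_cong)
  finally have EQ: "(\<integral>x. Q x \<partial>gauss K) = r * (\<Sum>k\<in>K. c k k)" .
  have ckk: "c k k = (\<integral>\<omega>. (a k \<omega>)\<^sup>2 \<partial>?\<nu>)" for k by (simp add: c_def power2_eq_square)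
  have "(\<integral>x. L x - log_avg \<mu> f - M x - (Q x - (M x)\<^sup>2) / 2 \<partial>gauss K)
      = heat r f - log_avg \<mu> f - r / 2 * gvar f"
    using iL iM iQ iM2
    by (simp add: EM EM2 EQ G.prob_space gvar_def heat_def L_def[symmetric] m_def[symmetric] sum_subtractf
        ckk right_diff_distrib diff_divide_distrib)
  hence "\<bar>heat r f - log_avg \<mu> f - r / 2 * gvar f\<bar>
      = \<bar>\<integral>x. L x - log_avg \<mu> f - M x - (Q x - (M x)\<^sup>2) / 2 \<partial>gauss K\<bar>" by simp
  also have "\<dots> \<le> (\<integral>x. \<bar>L x - log_avg \<mu> f - M x - (Q x - (M x)\<^sup>2) / 2\<bar> \<partial>gauss K)"
    by (rule integral_abs_bound)
  also have "\<dots> \<le> (\<integral>x. R x \<partial>gauss K)"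
    using iL iM iQ iM2 iR R by (intro integral_mono integrable_abs) auto
  also have "\<dots> = err * (r * sqrt r)" unfolding R_def err_def by simp
  finally show ?thesis .
qed

lemma err_nonneg: "0 \<le> err"
  unfolding err_def using A0 by (intro mult_nonneg_nonneg integral_nonneg) (auto intro!: sum_nonneg)

end

text \<open>
  The total error of \<open>n\<close> time steps of length \<open>1/n\<close> is of order \<open>1 / sqrt n\<close>.
\<close>

lemma real_le_by_inverse_sqrt:
  fixes x y c :: real assumes "\<And>n. 1 \<le> n \<Longrightarrow> x \<le> y + c / sqrt (real n)"
  shows "x \<le> y"
proof (rule LIMSEQ_le_const)
  have "(\<lambda>n. y + c / sqrt (real n)) \<longlonglongrightarrow> y + 0"
    by (intro tendsto_add tendsto_const tendsto_divide_0[OF tendsto_const]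
        filterlim_at_top_imp_at_infinity filterlim_compose[OF sqrt_at_top filterlim_real_sequentially])
  thus "(\<lambda>n. y + c / sqrt (real n)) \<longlonglongrightarrow> y" by simp
qed (use assms in blast)

text \<open>
  The field \<open>a\<close> is exchanged for the field \<open>b\<close> in \<open>n\<close> steps of length \<open>1/n\<close>.  By \<open>heat_step\<close> and the
  domination of variances a step costs \<open>C/n\<close>, up to an error that vanishes in the sum.
\<close>

lemma gaussian_comparison:
  fixes K :: "'k set" and K' :: "'l set"
  assumes "gfamily \<mu> K a A" and "gfamily \<mu> K' b B" and f: "bdm \<mu> f"
    and dom: "\<And>g. bdm \<mu> g \<Longrightarrow> (gfamily.gvar \<mu> K a g - gfamily.gvar \<mu> K' b g) / 2 \<le> C"
  shows "gfamily.heat \<mu> K a 1 f \<le> gfamily.heat \<mu> K' b 1 f + C"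
proof -
  interpret a: gfamily \<mu> K a A by fact
  interpret b: gfamily \<mu> K' b B by fact
  interpret GK: prob_space "gauss K" by (rule prob_space_gauss)
  interpret GK': prob_space "gauss K'" by (rule prob_space_gauss)
  interpret PP: pair_prob_space "gauss K" "gauss K'" ..
  interpret QQ: pair_prob_space "gauss K'" "gauss K" ..
  define e where "e r = r * C + (a.err + b.err) * (r * sqrt r)" for r
  have step: "a.heat r g \<le> b.heat r g + e r" if "bdm \<mu> g" "0 \<le> r" for g r
  proof -
    have "r * ((a.gvar g - b.gvar g) / 2) \<le> r * C" using dom[OF that(1)] that(2) by (rule mult_left_mono)
    thus ?thesis using a.heat_step[OF that] b.heat_step[OF that]
      unfolding e_def abs_le_iff distrib_right right_diff_distrib by (simp add: field_simps)
  qed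
  have main: "a.heat (real m * r) g \<le> b.heat (real m * r) g + real m * e r" if "bdm \<mu> g" "0 \<le> r" for g r m
    using that(1)
  proof (induction m arbitrary: g)
    case 0 show ?case by (simp add: a.heat_0 b.heat_0)
  next
    case (Suc m)
    have mr: "0 \<le> real m * r" using that by simp
    have S: "real (Suc m) * r = r + real m * r" by (simp add: algebra_simps)
    let ?A = "\<lambda>x \<omega>. g \<omega> + a.lin (\<lambda>k. sqrt r * x k) \<omega>"
    let ?B = "\<lambda>y \<omega>. g \<omega> + b.lin (\<lambda>k. sqrt (real m * r) * y k) \<omega>"
    have bA: "bdm \<mu> (?A x)" for x by (intro bdm_add Suc.prems a.bdm_lin)
    have bB: "bdm \<mu> (?B y)" for y by (intro bdm_add Suc.prems b.bdm_lin)
    define H where "H x y = log_avg \<mu> (\<lambda>\<omega>. g \<omega> + a.lin (\<lambda>k. sqrt r * x k) \<omega> + b.lin (\<lambda>k. sqrt (real m * r) * y k) \<omega>)" for x y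
    have Hb: "b.heat (real m * r) (?A x) = (\<integral>y. H x y \<partial>gauss K')" for x
      unfolding b.heat_def H_def ..
    have Ha: "a.heat r (?B y) = (\<integral>x. H x y \<partial>gauss K)" for y
      unfolding a.heat_def H_def by (simp add: add_ac)
    have Hi: "integrable (gauss K \<Otimes>\<^sub>M gauss K') (\<lambda>(x, y). H x y)"
    proof -
      define AB where "AB = (\<lambda>(p :: ('k \<Rightarrow> real) \<times> ('l \<Rightarrow> real)) k. case k of Inl k \<Rightarrow> sqrt r * fst p k | Inr k \<Rightarrow> sqrt (real m * r) * snd p k)"
      interpret u: gfamily \<mu> "Inl ` K \<union> Inr ` K'" "case_sum a b" "max A B"
        using a.finK b.finK a.A0 b.A0 a.a_meas b.a_meas a.a_bound b.a_bound
        by unfold_locales (auto simp: le_max_iff_disj)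
      have AB: "a.lin (\<lambda>k. sqrt r * fst p k) \<omega> + b.lin (\<lambda>k. sqrt (real m * r) * snd p k) \<omega> = u.lin (AB p) \<omega>" for p \<omega>
        unfolding a.lin_def b.lin_def u.lin_def using a.finK b.finK
        by (subst sum.union_disjoint) (auto simp: sum.reindex AB_def)
      have HAB: "H (fst p) (snd p) = log_avg \<mu> (\<lambda>\<omega>. g \<omega> + u.lin (AB p) \<omega>)" for p
        unfolding H_def AB[symmetric] by (simp add: add_ac)
      have ABm: "(\<lambda>p. AB p k) \<in> borel_measurable (gauss K \<Otimes>\<^sub>M gauss K')" if "k \<in> Inl ` K \<union> Inr ` K'" for k
        using that measurable_compose[OF measurable_fst measurable_gauss_component]
          measurable_compose[OF measurable_snd measurable_gauss_component]
        by (auto simp: AB_def intro!: borel_measurable_times)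
      show ?thesis unfolding case_prod_beta' HAB
      proof (rule Bochner_Integration.integrable_bound)
        show "(\<lambda>p. log_avg \<mu> (\<lambda>\<omega>. g \<omega> + u.lin (AB p) \<omega>)) \<in> borel_measurable (gauss K \<Otimes>\<^sub>M gauss K')"
          by (rule u.log_avg_measurable[OF Suc.prems]) (rule ABm)
        have 1: "integrable (gauss K \<Otimes>\<^sub>M gauss K') (\<lambda>p. fst p k)" if "k \<in> K" for k
          by (rule integrable_distr[OF measurable_fst]) (simp add: GK'.distr_pair_fst that)
        have "integrable (gauss K' \<Otimes>\<^sub>M gauss K) (\<lambda>p. fst p k)" if "k \<in> K'" for k
          by (rule integrable_distr[OF measurable_fst]) (simp add: GK.distr_pair_fst that)
        hence 2: "integrable (gauss K \<Otimes>\<^sub>M gauss K') (\<lambda>p. snd p k)" if "k \<in> K'" for k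
          using QQ.integrable_product_swap[of "\<lambda>p. fst p k"] that by (simp add: case_prod_beta')
        have "integrable (gauss K \<Otimes>\<^sub>M gauss K') (\<lambda>p. AB p k)" if "k \<in> Inl ` K \<union> Inr ` K'" for k
          using that 1 2 by (auto simp: AB_def)
        thus "integrable (gauss K \<Otimes>\<^sub>M gauss K') (\<lambda>p. \<bar>log_avg \<mu> g\<bar> + max A B * (\<Sum>k\<in>Inl ` K \<union> Inr ` K'. \<bar>AB p k\<bar>))"
          by (intro Bochner_Integration.integrable_add integrable_mult_right Bochner_Integration.integrable_sum integrable_abs) auto
        have "\<bar>log_avg \<mu> (\<lambda>\<omega>. g \<omega> + u.lin (AB p) \<omega>)\<bar>
            \<le> \<bar>\<bar>log_avg \<mu> g\<bar> + max A B * (\<Sum>k\<in>Inl ` K \<union> Inr ` K'. \<bar>AB p k\<bar>)\<bar>" for p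
          using u.log_avg_lipschitz[OF Suc.prems, of "AB p"] by linarith
        thus "AE p in gauss K \<Otimes>\<^sub>M gauss K'. norm (log_avg \<mu> (\<lambda>\<omega>. g \<omega> + u.lin (AB p) \<omega>))
            \<le> norm (\<bar>log_avg \<mu> g\<bar> + max A B * (\<Sum>k\<in>Inl ` K \<union> Inr ` K'. \<bar>AB p k\<bar>))" by simp
      qed
    qed
    have "a.heat (real (Suc m) * r) g = (\<integral>x. a.heat (real m * r) (?A x) \<partial>gauss K)"
      unfolding S by (rule a.heat_add[OF Suc.prems that(2) mr])
    also have "\<dots> \<le> (\<integral>x. b.heat (real m * r) (?A x) + real m * e r \<partial>gauss K)"
    proof (rule integral_mono)
      show "integrable (gauss K) (\<lambda>x. a.heat (real m * r) (?A x))" by (rule a.heat_add[OF Suc.prems that(2) mr])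
      show "integrable (gauss K) (\<lambda>x. b.heat (real m * r) (?A x) + real m * e r)"
        unfolding Hb using PP.integrable_fst[OF Hi] by simp
    qed (rule Suc.IH[OF bA])
    also have "\<dots> = (\<integral>x. (\<integral>y. H x y \<partial>gauss K') \<partial>gauss K) + real m * e r"
      unfolding Hb using PP.integrable_fst[OF Hi] by (simp add: GK.prob_space)
    also have "(\<integral>x. (\<integral>y. H x y \<partial>gauss K') \<partial>gauss K) = (\<integral>y. (\<integral>x. H x y \<partial>gauss K) \<partial>gauss K')"
      by (rule PP.Fubini_integral[OF Hi, symmetric])
    also have "\<dots> = (\<integral>y. a.heat r (?B y) \<partial>gauss K')" unfolding Ha ..
    also have "\<dots> \<le> (\<integral>y. b.heat r (?B y) + e r \<partial>gauss K')"
    proof (rule integral_mono)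
      show "integrable (gauss K') (\<lambda>y. a.heat r (?B y))"
        unfolding Ha using PP.integrable_snd[OF Hi] by simp
      show "integrable (gauss K') (\<lambda>y. b.heat r (?B y) + e r)"
        using b.heat_add(2)[OF Suc.prems mr that(2)] by simp
    qed (rule step[OF bB that(2)])
    also have "\<dots> = b.heat (real m * r + r) g + e r"
      using b.heat_add[OF Suc.prems mr that(2)] by (simp add: GK'.prob_space)
    finally show ?case unfolding S by (simp add: algebra_simps)
  qed
  show ?thesis
  proof (rule real_le_by_inverse_sqrt)
    fix n :: nat assume n: "1 \<le> n"
    have "real n * e (1 / real n) = C + (a.err + b.err) / sqrt (real n)"
      using n unfolding e_def by (simp add: real_sqrt_divide field_simps)
    thus "a.heat 1 f \<le> b.heat 1 f + C + (a.err + b.err) / sqrt (real n)"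
      using main[OF f, of "1 / real n" n] n by simp
  qed
qed

section \<open>The sphere\<close>

declare One_nat_def [simp del]

text \<open>
  A unit vector is obtained from every point of the ball: the value at the centre is an arbitrary
  unit vector, which makes all functions of it bounded everywhere.
\<close>

definition sph :: "nat \<Rightarrow> (nat \<Rightarrow> real) \<Rightarrow> nat \<Rightarrow> real" where
  "sph N x i = (if L2_set x {1..N} = 0 then (if i = 1 then 1 else 0) else x i / L2_set x {1..N})"

definition uball :: "nat \<Rightarrow> (nat \<Rightarrow> real) measure" where
  "uball N = uniform_measure (lebesgue_R N) (unit_ball N)"

definition vol :: "nat \<Rightarrow> real" where
  "vol N = measure (lebesgue_R N) (unit_ball N)"

lemma lebesgue_R_leb: "lebesgue_R N = leb {1..N}"
  by (simp add: lebesgue_R_def)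

lemma space_leb [simp]: "space (leb I) = PiE I (\<lambda>_. UNIV)"
  by (simp add: space_PiM)

lemma sets_uball: "sets (uball N) = sets (leb {1..N})"
  by (simp add: uball_def lebesgue_R_leb)

lemma measurable_uball: "measurable (uball N) M = measurable (leb {1..N}) M"
  by (rule measurable_cong_sets[OF sets_uball refl])

lemma prob_space_uball: "prob_space (uball N)"
  unfolding uball_def using emeasure_unit_ball by (intro prob_space_uniform_measure) auto

lemma vol_pos: "0 < vol N"
  using emeasure_unit_ball[of N] unfolding vol_def
  by (simp add: zero_less_measure_iff emeasure_eq_ennreal_measure)

lemma emeasure_vol: "emeasure (lebesgue_R N) (unit_ball N) = ennreal (vol N)"
  unfolding vol_def using emeasure_unit_ball[of N] by (intro emeasure_eq_ennreal_measure) auto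

lemma measurable_L2 [measurable]: "(\<lambda>x. L2_set x {1..N::nat}) \<in> borel_measurable (leb {1..N})"
  using measurable_L2_set[of N] unfolding lebesgue_R_leb .

lemma measurable_sph: "i \<in> {1..N} \<Longrightarrow> (\<lambda>x. sph N x i) \<in> borel_measurable (leb {1..N})"
  unfolding sph_def
  by (intro measurable_If borel_measurable_divide measurable_leb_component measurable_L2
        borel_measurable_const) measurable

lemma L2_square: "(L2_set x A)\<^sup>2 = (\<Sum>i\<in>A. (x i)\<^sup>2)"
  unfolding L2_set_def by (simp add: sum_nonneg)

lemma sph_norm: "1 \<le> (N::nat) \<Longrightarrow> (\<Sum>i=1..N. (sph N x i)\<^sup>2) = 1"
proof (cases "L2_set x {1..N} = 0")
  case True
  assume "1 \<le> N"
  moreover have "(\<Sum>i=1..N. (sph N x i)\<^sup>2) = (\<Sum>i=1..N. if i = 1 then 1 else 0)"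
    using True by (intro sum.cong) (auto simp: sph_def)
  ultimately show ?thesis by simp
next
  case False
  have "(\<Sum>i=1..N. (sph N x i)\<^sup>2) = (\<Sum>i=1..N. (x i)\<^sup>2) / (L2_set x {1..N})\<^sup>2"
    using False by (simp add: sph_def power_divide sum_divide_distrib)
  thus ?thesis using False by (simp add: L2_square[symmetric])
qed

lemma sph_abs: assumes "i \<in> {1..N}" shows "\<bar>sph N x i\<bar> \<le> 1"
proof -
  have "(sph N x i)\<^sup>2 \<le> (\<Sum>i=1..N. (sph N x i)\<^sup>2)"
    using assms by (intro member_le_sum) auto
  also have "\<dots> = 1" using assms by (intro sph_norm) auto
  finally show ?thesis by (simp add: abs_square_le_1)
qed

lemma AE_leb_norm: assumes "1 \<le> (N::nat)" shows "AE x in leb {1..N}. L2_set x {1..N} \<noteq> 0"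
proof -
  have "emeasure (lebesgue_R N) (\<Pi>\<^sub>E i\<in>{1..N}. {0::real}) = 0"
    using assms by (subst emeasure_box) auto
  moreover have "(\<Pi>\<^sub>E i\<in>{1..N}. {0::real}) \<in> sets (lebesgue_R N)"
    unfolding lebesgue_R_def by (rule sets_PiM_I_finite) auto
  ultimately have "AE x in lebesgue_R N. x \<notin> (\<Pi>\<^sub>E i\<in>{1..N}. {0::real})"
    by (intro AE_not_in) (auto simp: null_sets_def)
  hence "AE x in lebesgue_R N. L2_set x {1..N} \<noteq> 0"
    using AE_space
  proof eventually_elim
    case (elim x)
    hence "\<not> (\<forall>i\<in>{1..N}. x i = 0)"
      unfolding lebesgue_R_def space_PiM PiE_iff by blast
    thus ?case by (simp add: L2_set_eq_0_iff)
  qed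
  thus ?thesis unfolding lebesgue_R_leb .
qed

text \<open>
  The two projections differ only at the centre, a null set.
\<close>

lemma integral_uniform_sphere:
  fixes F :: "(nat \<Rightarrow> real) \<Rightarrow> real"
  assumes N: "1 \<le> N" and F: "F \<in> borel_measurable (lebesgue_R N)"
    and dep: "\<And>x y. (\<And>i. i \<in> {1..N} \<Longrightarrow> x i = y i) \<Longrightarrow> F x = F y"
  shows "(\<integral>\<sigma>. F \<sigma> \<partial>uniform_sphere N) = (\<integral>x. F (sph N x) \<partial>uball N)"
proof -
  have r: "F (radial_proj N x) = F (sph N x)" if "L2_set x {1..N} \<noteq> 0" for x
    using that by (intro dep) (simp add: radial_proj_def sph_def)
  have sphF: "(\<lambda>x. F (sph N x)) \<in> borel_measurable (uball N)"
  proof -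
    have "(\<lambda>x. \<lambda>i\<in>{1..N}. sph N x i) \<in> measurable (leb {1..N}) (leb {1..N})"
      by (rule measurable_restrict) (simp only: measurable_lborel1 measurable_sph)
    from measurable_compose[OF this F[unfolded lebesgue_R_leb]]
    have "(\<lambda>x. F (\<lambda>i\<in>{1..N}. sph N x i)) \<in> borel_measurable (leb {1..N})" .
    moreover have "F (\<lambda>i\<in>{1..N}. sph N x i) = F (sph N x)" for x by (rule dep) simp
    ultimately show ?thesis unfolding measurable_uball by simp
  qed
  have m: "radial_proj N \<in> measurable (uball N) (lebesgue_R N)"
    unfolding measurable_uball using measurable_radial_proj[of N] by (simp add: lebesgue_R_leb)
  have "AE x in lebesgue_R N. x \<in> unit_ball N \<longrightarrow> L2_set x {1..N} \<noteq> 0"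
    using AE_leb_norm[OF N] unfolding lebesgue_R_leb by eventually_elim simp
  hence AE: "AE x in uball N. L2_set x {1..N} \<noteq> 0"
    using emeasure_unit_ball[of N] unfolding uball_def
    by (subst AE_uniform_measure) (auto simp: less_top)
  have "(\<integral>\<sigma>. F \<sigma> \<partial>uniform_sphere N) = (\<integral>x. F (radial_proj N x) \<partial>uball N)"
    unfolding uniform_sphere_def uball_def[symmetric] by (rule integral_distr[OF m F])
  also have "\<dots> = (\<integral>x. F (sph N x) \<partial>uball N)"
  proof (rule integral_cong_AE)
    show "(\<lambda>x. F (radial_proj N x)) \<in> borel_measurable (uball N)" by (rule measurable_compose[OF m F])
    show "AE x in uball N. F (radial_proj N x) = F (sph N x)" using AE by eventually_elim (rule r)
  qed (rule sphF)
  finally show ?thesis .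
qed

lemma nn_integral_cone:
  assumes "f \<in> borel_measurable (leb {1..N})"
  shows "(\<integral>\<^sup>+x. f x * indicator {x. L2_set x {1..N} \<le> 1} x \<partial>leb {1..N}) = ennreal (vol N) * (\<integral>\<^sup>+x. f x \<partial>uball N)"
proof -
  have "(\<integral>\<^sup>+x. f x \<partial>uball N) = (\<integral>\<^sup>+x. f x * indicator (unit_ball N) x \<partial>lebesgue_R N) / ennreal (vol N)"
    unfolding uball_def emeasure_vol[symmetric] using assms unit_ball_sets[of N]
    by (intro nn_integral_uniform_measure) (simp_all add: lebesgue_R_leb)
  also have "(\<integral>\<^sup>+x. f x * indicator (unit_ball N) x \<partial>lebesgue_R N)
      = (\<integral>\<^sup>+x. f x * indicator {x. L2_set x {1..N} \<le> 1} x \<partial>leb {1..N})"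
    unfolding lebesgue_R_leb
    by (intro nn_integral_cong) (auto simp: unit_ball_def lebesgue_R_leb indicator_def)
  finally show ?thesis using vol_pos[of N]
    by (simp add: ennreal_times_divide mult.commute[of "ennreal (vol N)"] ennreal_mult_divide_eq)
qed

subsection \<open>Scaling\<close>

lemma nn_integral_leb_scale:
  assumes I: "finite I" and r: "0 < r" and f: "f \<in> borel_measurable (leb I)"
  shows "(\<integral>\<^sup>+x. f x \<partial>leb I) = ennreal (r ^ card I) * (\<integral>\<^sup>+x. f (\<lambda>i\<in>I. r * x i) \<partial>leb I)"
proof -
  have "(\<integral>\<^sup>+x. f x \<partial>leb I) = ennreal (r ^ card S) * (\<integral>\<^sup>+x. f (\<lambda>i\<in>I. if i \<in> S then r * x i else x i) \<partial>leb I)"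
    if "finite S" "S \<subseteq> I" for S using that
  proof (induction S)
    case empty
    have "(\<integral>\<^sup>+x. f (\<lambda>i\<in>I. if i \<in> {} then r * x i else x i) \<partial>leb I) = (\<integral>\<^sup>+x. f x \<partial>leb I)"
      by (intro nn_integral_cong arg_cong[where f = f]) (auto simp: space_PiM)
    thus ?case by (simp only: card.empty power_0 ennreal_1 mult_1)
  next
    case (insert j S)
    let ?B = "\<lambda>x. \<lambda>i\<in>I. if i \<in> S then r * x i else x i"
    have B: "?B \<in> measurable (leb I) (leb I)"
    proof (rule measurable_restrict)
      fix i assume [measurable]: "i \<in> I"
      show "(\<lambda>x. if i \<in> S then r * x i else x i) \<in> measurable (leb I) lborel"
        by (cases "i \<in> S"; simp only: measurable_lborel1 if_True if_False) measurable
    qed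
    have e: "?B (x(j := r * x j + 0)) = (\<lambda>i\<in>I. if i \<in> insert j S then r * x i else x i)" for x
      using insert.hyps insert.prems by (auto simp: restrict_def fun_eq_iff)
    have "(\<integral>\<^sup>+x. f (?B x) \<partial>leb I) = ennreal \<bar>r\<bar> * (\<integral>\<^sup>+x. f (?B (x(j := r * x j + 0))) \<partial>leb I)"
      by (rule nn_integral_leb_affine[OF I _ _ measurable_compose[OF B f]]) (use insert.prems r in auto)
    hence 1: "(\<integral>\<^sup>+x. f (?B x) \<partial>leb I)
        = ennreal r * (\<integral>\<^sup>+x. f (\<lambda>i\<in>I. if i \<in> insert j S then r * x i else x i) \<partial>leb I)"
      unfolding e using r by (simp only: abs_of_pos)
    have "(\<integral>\<^sup>+x. f x \<partial>leb I) = ennreal (r ^ card S) * (\<integral>\<^sup>+x. f (?B x) \<partial>leb I)"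
      by (rule insert.IH) (use insert.prems in auto)
    also have "\<dots> = ennreal (r ^ card S) * (ennreal r * (\<integral>\<^sup>+x. f (\<lambda>i\<in>I. if i \<in> insert j S then r * x i else x i) \<partial>leb I))"
      unfolding 1 ..
    also have "\<dots> = ennreal (r ^ card (insert j S)) * (\<integral>\<^sup>+x. f (\<lambda>i\<in>I. if i \<in> insert j S then r * x i else x i) \<partial>leb I)"
    proof -
      have "ennreal (r ^ card (insert j S)) = ennreal (r ^ card S) * ennreal r"
        using insert.hyps r by (simp add: ennreal_mult'' mult.commute)
      thus ?thesis by (simp only: mult.assoc)
    qed
    finally show ?case .
  qed
  from this[OF I subset_refl] show ?thesis
    by (simp cong: restrict_cong)
qed

lemma L2_scale: "0 \<le> r \<Longrightarrow> L2_set (\<lambda>i\<in>A. r * x i) A = r * L2_set x A"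
  by (simp add: L2_set_right_distrib cong: L2_set_cong)

lemma sph_scale: "0 < r \<Longrightarrow> i \<in> {1..N} \<Longrightarrow> sph N (\<lambda>i\<in>{1..N}. r * x i) i = sph N x i"
  unfolding sph_def by (simp add: L2_scale)

lemma measurable_L2_indicator [measurable]:
  "(\<lambda>x. indicator {x. L2_set x {1..N::nat} \<le> r} x :: ennreal) \<in> borel_measurable (leb {1..N})"
  "(\<lambda>x. indicator {x. r < L2_set x {1..N} \<and> L2_set x {1..N} \<le> r'} x :: ennreal) \<in> borel_measurable (leb {1..N})"
  unfolding indicator_def of_bool_def mem_Collect_eq by measurable

lemma nn_integral_cone_scale:
  assumes r: "0 < r" and h: "h \<in> borel_measurable (leb {1..N})"
    and hom: "\<And>x. h (\<lambda>i\<in>{1..N}. r * x i) = h x"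
  shows "(\<integral>\<^sup>+x. h x * indicator {x. L2_set x {1..N} \<le> r} x \<partial>leb {1..N}) = ennreal (r ^ N * vol N) * (\<integral>\<^sup>+x. h x \<partial>uball N)"
proof -
  have "(\<integral>\<^sup>+x. h x * indicator {x. L2_set x {1..N} \<le> r} x \<partial>leb {1..N})
    = ennreal (r ^ card {1..N}) * (\<integral>\<^sup>+x. h (\<lambda>i\<in>{1..N}. r * x i) * indicator {x. L2_set x {1..N} \<le> r} (\<lambda>i\<in>{1..N}. r * x i) \<partial>leb {1..N})"
    using h r by (intro nn_integral_leb_scale) (simp_all add: borel_measurable_times_ennreal measurable_L2_indicator)
  also have "(\<integral>\<^sup>+x. h (\<lambda>i\<in>{1..N}. r * x i) * indicator {x. L2_set x {1..N} \<le> r} (\<lambda>i\<in>{1..N}. r * x i) \<partial>leb {1..N})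
     = (\<integral>\<^sup>+x. h x * indicator {x. L2_set x {1..N} \<le> 1} x \<partial>leb {1..N})"
    using r by (intro nn_integral_cong) (auto simp: hom L2_scale indicator_def)
  finally show ?thesis using r by (simp add: nn_integral_cone[OF h] ennreal_mult' mult.assoc)
qed

lemma nn_integral_annulus:
  assumes r: "0 < r" "r < r'" and h: "h \<in> borel_measurable (leb {1..N})"
    and hom: "\<And>r x. 0 < r \<Longrightarrow> h (\<lambda>i\<in>{1..N}. r * x i) = h x"
    and fin: "(\<integral>\<^sup>+x. h x \<partial>uball N) < \<infinity>"
  shows "(\<integral>\<^sup>+x. h x * indicator {x. r < L2_set x {1..N} \<and> L2_set x {1..N} \<le> r'} x \<partial>leb {1..N})
    = ennreal ((r' ^ N - r ^ N) * vol N) * (\<integral>\<^sup>+x. h x \<partial>uball N)"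
proof -
  let ?A = "\<integral>\<^sup>+x. h x * indicator {x. r < L2_set x {1..N} \<and> L2_set x {1..N} \<le> r'} x \<partial>leb {1..N}"
  let ?B = "\<integral>\<^sup>+x. h x * indicator {x. L2_set x {1..N} \<le> r} x \<partial>leb {1..N}"
  obtain E where E: "(\<integral>\<^sup>+x. h x \<partial>uball N) = ennreal E" "0 \<le> E"
    using fin by (cases "\<integral>\<^sup>+x. h x \<partial>uball N") auto
  have "?B + ?A = (\<integral>\<^sup>+x. h x * indicator {x. L2_set x {1..N} \<le> r'} x \<partial>leb {1..N})"
  proof (subst nn_integral_add[symmetric])
    show "(\<integral>\<^sup>+x. h x * indicator {x. L2_set x {1..N} \<le> r} x + h x * indicator {x. r < L2_set x {1..N} \<and> L2_set x {1..N} \<le> r'} x \<partial>leb {1..N})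
        = (\<integral>\<^sup>+x. h x * indicator {x. L2_set x {1..N} \<le> r'} x \<partial>leb {1..N})"
      using r by (intro nn_integral_cong) (auto simp: indicator_def)
  qed (use h in measurable)
  hence "ennreal (r ^ N * vol N * E) + ?A = ennreal (r' ^ N * vol N * E)"
    using r h hom vol_pos[of N] E(2) by (simp add: nn_integral_cone_scale E(1) ennreal_mult'')
  hence "ennreal (r ^ N * vol N * E) + ?A = ennreal (r ^ N * vol N * E) + ennreal ((r' ^ N - r ^ N) * vol N * E)"
    using r vol_pos[of N] E(2) power_mono[of r r' N]
    by (subst ennreal_plus[symmetric]) (auto simp: algebra_simps intro!: mult_left_mono)
  hence "?A = ennreal ((r' ^ N - r ^ N) * vol N * E)" by (simp add: ennreal_add_left_cancel)
  thus ?thesis unfolding E(1) using E(2) by (simp add: ennreal_mult'')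
qed

subsection \<open>An upper bound for the Laplace transform\<close>

lemma nn_integral_gaussian_1d:
  fixes c v :: real assumes c: "0 < c"
  shows "(\<integral>\<^sup>+t. ennreal (exp (- c * t\<^sup>2 + v * t)) \<partial>lborel) = ennreal (sqrt (pi / c) * exp (v\<^sup>2 / (4 * c)))"
proof -
  define s where "s = sqrt (1 / (2 * c))"
  define m where "m = v / (2 * c)"
  have s: "0 < s" "s\<^sup>2 = 1 / (2 * c)" using c by (auto simp: s_def)
  have e: "exp (- c * t\<^sup>2 + v * t) = (sqrt (pi / c) * exp (v\<^sup>2 / (4 * c))) * normal_density m s t" for t
  proof -
    have "normal_density m s t = 1 / sqrt (pi / c) * exp (- (t - m)\<^sup>2 * c)"
      unfolding normal_density_def s(2) using c by (simp add: field_simps)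
    moreover have "- c * t\<^sup>2 + v * t = v\<^sup>2 / (4 * c) + - (t - m)\<^sup>2 * c"
      using c unfolding m_def by (simp add: field_simps power2_eq_square)
    moreover have "exp (v\<^sup>2 / (4 * c) + - (t - m)\<^sup>2 * c) = exp (v\<^sup>2 / (4 * c)) * exp (- (t - m)\<^sup>2 * c)"
      by (rule exp_add)
    ultimately show ?thesis using c by simp
  qed
  have "(\<integral>\<^sup>+t. ennreal (exp (- c * t\<^sup>2 + v * t)) \<partial>lborel)
     = ennreal (sqrt (pi / c) * exp (v\<^sup>2 / (4 * c))) * (\<integral>\<^sup>+t. ennreal (normal_density m s t) \<partial>lborel)"
    unfolding e using c by (subst nn_integral_cmult[symmetric]) (auto simp: ennreal_mult')
  also have "(\<integral>\<^sup>+t. ennreal (normal_density m s t) \<partial>lborel) = 1"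
    using prob_space.emeasure_space_1[OF prob_space_normal_density[OF s(1), of m]]
    by (simp add: emeasure_density)
  finally show ?thesis by simp
qed

lemma nn_integral_gaussian:
  fixes c :: real assumes I: "finite I" and c: "0 < c"
  shows "(\<integral>\<^sup>+x. ennreal (exp (\<Sum>i\<in>I. - c * (x i)\<^sup>2 + V i * x i)) \<partial>leb I)
    = ennreal (sqrt (pi / c) ^ card I * exp ((\<Sum>i\<in>I. (V i)\<^sup>2) / (4 * c)))"
proof -
  interpret product_sigma_finite "\<lambda>_::'a. lborel :: real measure" by (rule product_sigma_finite_lb)
  have "(\<integral>\<^sup>+x. ennreal (exp (\<Sum>i\<in>I. - c * (x i)\<^sup>2 + V i * x i)) \<partial>leb I)
    = (\<integral>\<^sup>+x. (\<Prod>i\<in>I. ennreal (exp (- c * (x i)\<^sup>2 + V i * x i))) \<partial>leb I)"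
    using I by (simp add: exp_sum prod_ennreal)
  also have "\<dots> = (\<Prod>i\<in>I. \<integral>\<^sup>+t. ennreal (exp (- c * t\<^sup>2 + V i * t)) \<partial>lborel)"
    by (rule product_nn_integral_prod[OF I]) auto
  also have "\<dots> = (\<Prod>i\<in>I. ennreal (sqrt (pi / c) * exp ((V i)\<^sup>2 / (4 * c))))"
    by (simp only: nn_integral_gaussian_1d[OF c])
  also have "\<dots> = ennreal (sqrt (pi / c) ^ card I * exp ((\<Sum>i\<in>I. (V i)\<^sup>2) / (4 * c)))"
    using I c by (subst prod_ennreal) (auto simp: prod.distrib exp_sum sum_divide_distrib)
  finally show ?thesis .
qed

text \<open>
  The function \<open>r\<^sup>N exp (- (N - 1) r\<^sup>2 / 2)\<close> is largest near \<open>r = 1\<close>.  One factor \<open>exp (- r\<^sup>2 / 2)\<close> is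
  kept to have an integrable bound.
\<close>

lemma radial_max:
  fixes r :: real assumes N: "2 \<le> N" and r: "0 \<le> r"
  shows "real N * r * exp (- real N * r\<^sup>2 / 2) * r ^ N \<le> real N * exp (1 - real N / 2) * (r * exp (- r\<^sup>2 / 2))"
proof (cases "r = 0")
  case False
  hence r: "0 < r" using r by simp
  have N1: "0 < real N - 1" using N by simp
  let ?y = "r\<^sup>2 * ((real N - 1) / real N)"
  have y: "0 < ?y" using r N N1 by simp
  have "ln (r\<^sup>2) = ln ?y + ln (real N / (real N - 1))"
    using r N N1 by (subst ln_mult_pos[symmetric]) auto
  also have "\<dots> \<le> (?y - 1) + (real N / (real N - 1) - 1)"
    using y N N1 by (intro add_mono ln_le_minus_one) auto
  also have "real N / (real N - 1) - 1 = 1 / (real N - 1)" using N1 by (simp add: field_simps)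
  finally have "real N / 2 * ln (r\<^sup>2) \<le> real N / 2 * ((?y - 1) + 1 / (real N - 1))" by (intro mult_left_mono) auto
  also have "\<dots> = (real N - 1) * r\<^sup>2 / 2 - real N / 2 + real N / (2 * (real N - 1))"
    using N by (simp add: field_simps)
  also have "real N / (2 * (real N - 1)) \<le> 1" using N by (simp add: field_simps)
  also have "real N / 2 * ln (r\<^sup>2) = real N * ln r" using r by (simp add: ln_realpow)
  finally have "real N * ln r - real N * r\<^sup>2 / 2 \<le> (1 - real N / 2) + (- r\<^sup>2 / 2)" by (simp add: field_simps)
  hence "exp (real N * ln r) * exp (- real N * r\<^sup>2 / 2) \<le> exp (1 - real N / 2) * exp (- r\<^sup>2 / 2)"
    by (simp add: exp_add[symmetric])
  moreover have "exp (real N * ln r) = r ^ N" using r by (simp add: exp_of_nat_mult)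
  ultimately have "(real N * r) * (r ^ N * exp (- real N * r\<^sup>2 / 2)) \<le> (real N * r) * (exp (1 - real N / 2) * exp (- r\<^sup>2 / 2))"
    using r by (intro mult_left_mono) auto
  thus ?thesis by (simp add: mult_ac)
qed simp

lemma nn_integral_radial_tail:
  fixes c s :: real assumes c: "0 < c" and s: "0 \<le> s"
  shows "(\<integral>\<^sup>+r. ennreal (c * r * exp (- c * r\<^sup>2 / 2)) * indicator {s..} r \<partial>lborel) = ennreal (exp (- c * s\<^sup>2 / 2))"
proof -
  have "(\<integral>\<^sup>+r. ennreal (c * r * exp (- c * r\<^sup>2 / 2)) * indicator {s..} r \<partial>lborel) = ennreal (0 - (- exp (- c * s\<^sup>2 / 2)))"
  proof (rule nn_integral_FTC_atLeast)
    show "DERIV (\<lambda>r. - exp (- c * r\<^sup>2 / 2)) r :> c * r * exp (- c * r\<^sup>2 / 2)" for r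
      by (auto intro!: derivative_eq_intros)
    show "0 \<le> c * r * exp (- c * r\<^sup>2 / 2)" if "s \<le> r" for r using that c s by simp
    have "filterlim (\<lambda>r. c / 2 * r\<^sup>2) at_top at_top"
      using c by (intro filterlim_tendsto_pos_mult_at_top[OF tendsto_const] filterlim_pow_at_top filterlim_ident) auto
    hence "((\<lambda>r. exp (- (c / 2 * r\<^sup>2))) \<longlongrightarrow> 0) at_top"
      by (intro filterlim_compose[OF exp_at_bot] filterlim_uminus_at_top[THEN iffD1]) auto
    thus "((\<lambda>r. - exp (- c * r\<^sup>2 / 2)) \<longlongrightarrow> 0) at_top"
      using tendsto_minus by fastforce
  qed auto
  thus ?thesis by simp
qed

text \<open>
  The Gaussian integral is a mixture of volumes of balls: \<open>exp (- N |x|\<^sup>2 / 2)\<close> is the integral of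
  \<open>N r exp (- N r\<^sup>2 / 2)\<close> over \<open>r \<ge> |x|\<close>, and balls of radius \<open>r\<close> have volume \<open>r\<^sup>N vol N\<close>.
\<close>

lemma vol_lower:
  assumes N: "2 \<le> N" shows "sqrt (2 * pi / real N) ^ N \<le> vol N * (real N * exp (1 - real N / 2))"
proof -
  let ?I = "{1..N}"
  define k where "k r = ennreal (real N * r * exp (- real N * r\<^sup>2 / 2))" for r
  interpret sigma_finite_measure "leb ?I"
    by (rule product_sigma_finite.sigma_finite[OF product_sigma_finite_lb]) simp
  interpret pair_sigma_finite "leb ?I" lborel ..
  have km [measurable]: "k \<in> borel_measurable borel" unfolding k_def by measurable
  have "ennreal (sqrt (2 * pi / real N) ^ N) = (\<integral>\<^sup>+x. ennreal (exp (\<Sum>i\<in>?I. - (real N / 2) * (x i)\<^sup>2 + 0 * x i)) \<partial>leb ?I)"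
    using N by (subst nn_integral_gaussian) (auto simp: mult.commute)
  also have "\<dots> = (\<integral>\<^sup>+x. ennreal (exp (- real N * (L2_set x ?I)\<^sup>2 / 2)) \<partial>leb ?I)"
    unfolding L2_square by (intro nn_integral_cong) (simp add: sum_distrib_left sum_divide_distrib sum_negf)
  also have "\<dots> = (\<integral>\<^sup>+x. (\<integral>\<^sup>+r. k r * indicator {L2_set x ?I..} r \<partial>lborel) \<partial>leb ?I)"
    unfolding k_def using N by (intro nn_integral_cong nn_integral_radial_tail[symmetric]) (auto simp: L2_set_nonneg)
  also have "\<dots> = (\<integral>\<^sup>+r. (\<integral>\<^sup>+x. k r * indicator {L2_set x ?I..} r \<partial>leb ?I) \<partial>lborel)"
  proof (rule Fubini'[symmetric])
    have "(\<lambda>p. k (snd p) * indicator {p. L2_set (fst p) ?I \<le> snd p} p) \<in> borel_measurable (leb ?I \<Otimes>\<^sub>M lborel)"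
      by measurable
    thus "(\<lambda>(x, r). k r * indicator {L2_set x ?I..} r) \<in> borel_measurable (leb ?I \<Otimes>\<^sub>M lborel)"
      by (simp add: case_prod_beta' indicator_def)
  qed
  also have "\<dots> \<le> (\<integral>\<^sup>+r. ennreal (vol N * (real N * exp (1 - real N / 2))) * (ennreal (1 * r * exp (- 1 * r\<^sup>2 / 2)) * indicator {0..} r) \<partial>lborel)"
  proof (rule nn_integral_mono)
    fix r :: real
    show "(\<integral>\<^sup>+x. k r * indicator {L2_set x ?I..} r \<partial>leb ?I)
        \<le> ennreal (vol N * (real N * exp (1 - real N / 2))) * (ennreal (1 * r * exp (- 1 * r\<^sup>2 / 2)) * indicator {0..} r)"
    proof (cases "0 < r")
      case True
      have "(\<integral>\<^sup>+x. k r * indicator {L2_set x ?I..} r \<partial>leb ?I) = (\<integral>\<^sup>+x. k r * indicator {x. L2_set x ?I \<le> r} x \<partial>leb ?I)"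
        by (intro nn_integral_cong) (simp add: indicator_def)
      also have "\<dots> = ennreal (r ^ N * vol N) * (\<integral>\<^sup>+x. k r \<partial>uball N)"
        by (rule nn_integral_cone_scale[OF True]) auto
      also have "(\<integral>\<^sup>+x. k r \<partial>uball N) = k r"
        using prob_space.emeasure_space_1[OF prob_space_uball[of N]] by simp
      also have "ennreal (r ^ N * vol N) * k r = ennreal (vol N * (real N * r * exp (- real N * r\<^sup>2 / 2) * r ^ N))"
        using True vol_pos[of N] unfolding k_def by (subst ennreal_mult''[symmetric]) (auto simp: mult_ac)
      also have "\<dots> \<le> ennreal (vol N * (real N * exp (1 - real N / 2) * (r * exp (- r\<^sup>2 / 2))))"
        using True vol_pos[of N] by (intro ennreal_leI mult_left_mono radial_max N) auto
      also have "\<dots> = ennreal (vol N * (real N * exp (1 - real N / 2))) * (ennreal (1 * r * exp (- 1 * r\<^sup>2 / 2)) * indicator {0..} r)"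
        using True vol_pos[of N] by (simp add: ennreal_mult''[symmetric] mult_ac)
      finally show ?thesis .
    next
      case False
      have z: "k r * indicator {L2_set x ?I..} r = 0" for x
      proof (cases "r = 0")
        case r0: False
        have "\<not> L2_set x ?I \<le> r" using False r0 L2_set_nonneg[of x ?I] by linarith
        thus ?thesis by simp
      qed (simp add: k_def)
      show ?thesis unfolding z by simp
    qed
  qed
  also have "\<dots> = ennreal (vol N * (real N * exp (1 - real N / 2)))"
    by (subst nn_integral_cmult) (use nn_integral_radial_tail[of 1 0] in auto)
  finally show ?thesis using vol_pos[of N] by (subst (asm) ennreal_le_iff) auto
qed

lemma bdm_sph: "i \<in> {1..N} \<Longrightarrow> bdm (uball N) (\<lambda>x. sph N x i)"
  by (rule bdmI[where B = 1]) (simp_all add: measurable_uball measurable_sph sph_abs)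

lemma bdm_sph_linear: "bdm (uball N) (\<lambda>x. \<Sum>i=1..N. V i * sph N x i)"
  by (intro bdm_sum bdm_cmult bdm_sph)

lemma cauchy_schwarz_sum:
  fixes f g :: "'i \<Rightarrow> real" shows "\<bar>\<Sum>i\<in>A. f i * g i\<bar> \<le> L2_set f A * L2_set g A"
  using L2_set_mult_ineq[of f g A] by (simp add: order_trans[OF sum_abs] abs_mult)

lemma sph_linear_abs: assumes "1 \<le> N" shows "\<bar>\<Sum>i=1..N. V i * sph N x i\<bar> \<le> L2_set V {1..N}"
  using cauchy_schwarz_sum[of V "sph N x" "{1..N}"] sph_norm[OF assms, of x]
  by (simp add: L2_set_def[of "sph N x"])

lemma sph_linear_hom: "0 < r \<Longrightarrow> (\<Sum>i=1..N. V i * sph N (\<lambda>i\<in>{1..N}. r * x i) i) = (\<Sum>i=1..N. V i * sph N x i)"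
  by (intro sum.cong refl) (simp only: sph_scale)

text \<open>
  The exponential is compared with a Gaussian of precision \<open>z N\<close> on the shell between the radii \<open>1\<close>
  and \<open>1 + 1/N\<close>, where the Gaussian weight is almost constant.  The bound is quadratic in \<open>V\<close>, so it
  can be averaged over a random field; for the best \<open>z\<close> it is sharp to exponential order.
\<close>

lemma sphere_linear:
  assumes N: "2 \<le> N" and z: "0 < z"
  shows "log_avg (uball N) (\<lambda>x. \<Sum>i=1..N. V i * sph N x i)
    \<le> real N * (z - 1/2 - ln (2 * z) / 2) + (\<Sum>i=1..N. (V i)\<^sup>2) / (4 * z * real N)
      + L2_set V {1..N} / real N + 3 * z + 1 + ln (real N)"
proof -
  let ?I = "{1..N}" and ?S = "\<lambda>x. \<Sum>i=1..N. V i * sph N x i"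
  define v where "v = L2_set V ?I"
  have v: "0 \<le> v" by (simp add: v_def L2_set_nonneg)
  have N0: "0 < real N" using N by simp
  define W where "W = (\<integral>x. exp (?S x) \<partial>uball N)"
  have W0: "0 < W" unfolding W_def by (rule exp_avg_pos[OF prob_space_uball bdm_sph_linear])
  have W: "(\<integral>\<^sup>+x. ennreal (exp (?S x)) \<partial>uball N) = ennreal W"
    unfolding W_def by (intro nn_integral_eq_integral bdm_integrable[OF prob_space_uball] bdm_exp bdm_sph_linear) simp
  define D where "D = v / real N + z * real N * (1 + 1 / real N)\<^sup>2"
  define G where "G = sqrt (pi / (z * real N)) ^ N * exp ((\<Sum>i\<in>?I. (V i)\<^sup>2) / (4 * (z * real N)))"
  have two: "2 \<le> (1 + 1 / real N) ^ N"
  proof -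
    have "- 1 \<le> 1 / real N" by (rule order_trans[of _ 0]) auto
    from Bernoulli_inequality[OF this, of N] show ?thesis using N by simp
  qed
  have Sm: "(\<lambda>x. ennreal (exp (?S x))) \<in> borel_measurable (leb ?I)"
    using bdm_meas[OF bdm_exp[OF bdm_sph_linear[of N V]]] unfolding measurable_uball by simp
  have "ennreal (vol N * W) \<le> ennreal (((1 + 1 / real N) ^ N - 1 ^ N) * vol N) * ennreal W"
    using two vol_pos[of N] W0 by (subst ennreal_mult''[symmetric]) (auto intro!: ennreal_leI)
  also have "\<dots> = (\<integral>\<^sup>+x. ennreal (exp (?S x)) * indicator {x. 1 < L2_set x ?I \<and> L2_set x ?I \<le> 1 + 1 / real N} x \<partial>leb ?I)"
    unfolding W[symmetric]
  proof (rule nn_integral_annulus[symmetric])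
    show "ennreal (exp (?S (\<lambda>i\<in>{1..N}. r * x i))) = ennreal (exp (?S x))" if "0 < r" for r x
      by (simp only: sph_linear_hom[OF that])
  qed (use N0 Sm W in auto)
  also have "\<dots> \<le> (\<integral>\<^sup>+x. ennreal (exp D) * ennreal (exp (\<Sum>i\<in>?I. - (z * real N) * (x i)\<^sup>2 + V i * x i)) \<partial>leb ?I)"
  proof (rule nn_integral_mono)
    fix x :: "nat \<Rightarrow> real"
    show "ennreal (exp (?S x)) * indicator {x. 1 < L2_set x ?I \<and> L2_set x ?I \<le> 1 + 1 / real N} x
      \<le> ennreal (exp D) * ennreal (exp (\<Sum>i\<in>?I. - (z * real N) * (x i)\<^sup>2 + V i * x i))"
    proof (cases "1 < L2_set x ?I \<and> L2_set x ?I \<le> 1 + 1 / real N")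
      case True
      let ?r = "L2_set x ?I"
      have "(\<Sum>i\<in>?I. V i * x i) = ?r * ?S x"
        using True by (simp add: sum_distrib_left sph_def)
      moreover have "- v \<le> ?S x" using sph_linear_abs[of N V x] N unfolding v_def by linarith
      hence "(?r - 1) * (- v) \<le> (?r - 1) * ?S x" using True by (intro mult_left_mono) auto
      moreover have "(?r - 1) * v \<le> 1 / real N * v" using True v by (intro mult_right_mono) auto
      ultimately have 1: "?S x \<le> (\<Sum>i\<in>?I. V i * x i) + v / real N" by (simp add: algebra_simps)
      have "?r\<^sup>2 \<le> (1 + 1 / real N)\<^sup>2" using True by (intro power_mono) auto
      hence "z * real N * ?r\<^sup>2 \<le> z * real N * (1 + 1 / real N)\<^sup>2" using z by (intro mult_left_mono) auto
      moreover have sumid: "(\<Sum>i\<in>?I. - (z * real N) * (x i)\<^sup>2 + V i * x i) = (\<Sum>i\<in>?I. V i * x i) - z * real N * (\<Sum>i\<in>?I. (x i)\<^sup>2)"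
        by (simp add: sum_subtractf sum_distrib_left)
      ultimately have "?S x \<le> D + (\<Sum>i\<in>?I. - (z * real N) * (x i)\<^sup>2 + V i * x i)"
        using 1 sumid unfolding D_def L2_square by linarith
      thus ?thesis using True by (simp flip: ennreal_mult' exp_add)
    qed simp
  qed
  also have "\<dots> = ennreal (exp D) * ennreal G"
    unfolding G_def using z N0 nn_integral_gaussian[of ?I "z * real N" V]
    by (subst nn_integral_cmult) auto
  finally have "vol N * W \<le> exp D * G"
    using vol_pos[of N] W0 z by (subst (asm) ennreal_mult''[symmetric]) (auto simp: G_def ennreal_le_iff)
  hence "sqrt (2 * pi / real N) ^ N * W \<le> (real N * exp (1 - real N / 2)) * (exp D * G)"
  proof -
    assume h: "vol N * W \<le> exp D * G"
    have "sqrt (2 * pi / real N) ^ N * W \<le> vol N * (real N * exp (1 - real N / 2)) * W"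
      using W0 by (intro mult_right_mono vol_lower N) auto
    also have "\<dots> = (real N * exp (1 - real N / 2)) * (vol N * W)" by simp
    also have "\<dots> \<le> (real N * exp (1 - real N / 2)) * (exp D * G)" using h by (intro mult_left_mono) auto
    finally show ?thesis .
  qed
  hence "ln (sqrt (2 * pi / real N) ^ N * W) \<le> ln ((real N * exp (1 - real N / 2)) * (exp D * G))"
    using W0 N0 by (subst ln_le_cancel_iff) (auto simp: G_def z)
  moreover have "ln (sqrt (2 * pi / real N) ^ N * W) = real N * (ln (2 * pi / real N) / 2) + ln W"
    using W0 N0 by (simp add: ln_mult ln_realpow ln_sqrt)
  moreover have "ln G = real N * (ln (pi / (z * real N)) / 2) + (\<Sum>i\<in>?I. (V i)\<^sup>2) / (4 * (z * real N))"
    unfolding G_def using z N0 by (simp add: ln_mult ln_realpow ln_sqrt)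
  moreover have "0 < G" using z N0 by (simp add: G_def)
  hence "ln ((real N * exp (1 - real N / 2)) * (exp D * G)) = ln (real N) + (1 - real N / 2) + (D + ln G)"
    using N0 by (simp add: ln_mult)
  moreover have "ln (pi / (z * real N)) = ln (2 * pi / real N) - ln (2 * z)"
    using z N0 by (simp add: ln_mult ln_div)
  moreover have "D \<le> v / real N + z * real N + 3 * z"
  proof -
    have "z * real N * (1 + 1 / real N)\<^sup>2 = z * real N + 2 * z + z / real N"
      using N0 by (simp add: power2_eq_square field_simps)
    moreover have "z / real N \<le> z" using z N by (simp add: field_simps)
    ultimately show ?thesis unfolding D_def by simp
  qed
  ultimately have "ln W \<le> ln (real N) + (1 - real N / 2) + (v / real N + z * real N + 3 * z)
     + (real N * ((- ln (2 * z)) / 2) + (\<Sum>i\<in>?I. (V i)\<^sup>2) / (4 * (z * real N)))"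
    by (simp add: algebra_simps add_divide_distrib diff_divide_distrib)
  thus ?thesis unfolding log_avg_def W_def[symmetric] v_def[symmetric] by (simp add: algebra_simps)
qed

subsection \<open>Reflections and slices\<close>

lemma L2_refl:
  assumes "finite I" "(\<Sum>i\<in>I. (w i)\<^sup>2) = 1" shows "L2_set (refl I w x) I = L2_set x I"
  unfolding L2_set_def sum_squares_refl[OF assms] ..

lemma sph_refl:
  assumes "(\<Sum>i=1..N. (w i)\<^sup>2) = 1" "L2_set x {1..N} \<noteq> 0" "i \<in> {1..N}"
  shows "sph N (refl {1..N} w x) i = refl {1..N} w (sph N x) i"
proof -
  have "(\<Sum>j=1..N. w j * sph N x j) = (\<Sum>j=1..N. w j * x j) / L2_set x {1..N}"
    using assms(2) by (simp add: sph_def sum_divide_distrib)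
  hence "refl {1..N} w (sph N x) i = sph N x i - 2 * ((\<Sum>j=1..N. w j * x j) / L2_set x {1..N}) * w i"
    using assms(3) by (simp add: refl_def)
  also have "\<dots> = refl {1..N} w x i / L2_set x {1..N}"
    using assms(2,3) by (simp add: sph_def refl_def diff_divide_distrib)
  also have "\<dots> = sph N (refl {1..N} w x) i"
    using assms(2) L2_refl[OF _ assms(1), of x] by (simp add: sph_def)
  finally show ?thesis by (rule sym)
qed

lemma log_avg_refl:
  fixes F :: "(nat \<Rightarrow> real) \<Rightarrow> real"
  assumes N: "1 \<le> N" and w: "(\<Sum>i=1..N. (w i)\<^sup>2) = 1"
    and b: "bdm (uball N) (\<lambda>x. F (sph N x))" "bdm (uball N) (\<lambda>x. F (refl {1..N} w (sph N x)))"
    and dep: "\<And>x y. (\<And>i. i \<in> {1..N} \<Longrightarrow> x i = y i) \<Longrightarrow> F x = F y"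
  shows "log_avg (uball N) (\<lambda>x. F (refl {1..N} w (sph N x))) = log_avg (uball N) (\<lambda>x. F (sph N x))"
proof -
  let ?R = "refl {1..N} w"
  have m: "(\<lambda>x. ennreal (exp (F (sph N x)))) \<in> borel_measurable (leb {1..N})"
    "(\<lambda>x. ennreal (exp (F (?R (sph N x))))) \<in> borel_measurable (leb {1..N})"
    using b[THEN bdm_exp, THEN bdm_meas] unfolding measurable_uball by auto
  have "ennreal (vol N) * (\<integral>\<^sup>+x. ennreal (exp (F (?R (sph N x)))) \<partial>uball N)
     = (\<integral>\<^sup>+x. ennreal (exp (F (?R (sph N x)))) * indicator {x. L2_set x {1..N} \<le> 1} x \<partial>leb {1..N})"
    by (rule nn_integral_cone[symmetric, OF m(2)])
  also have "\<dots> = (\<integral>\<^sup>+x. ennreal (exp (F (sph N (?R x)))) * indicator {x. L2_set x {1..N} \<le> 1} (?R x) \<partial>leb {1..N})"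
  proof (rule nn_integral_cong_AE)
    show "AE x in leb {1..N}. ennreal (exp (F (?R (sph N x)))) * indicator {x. L2_set x {1..N} \<le> 1} x
       = ennreal (exp (F (sph N (?R x)))) * indicator {x. L2_set x {1..N} \<le> 1} (?R x)"
      using AE_leb_norm[OF N]
    proof eventually_elim
      case (elim x)
      have "F (?R (sph N x)) = F (sph N (?R x))" by (rule dep) (simp only: sph_refl[OF w elim])
      thus ?case using w by (simp add: indicator_def L2_refl)
    qed
  qed
  also have "\<dots> = (\<integral>\<^sup>+x. ennreal (exp (F (sph N x))) * indicator {x. L2_set x {1..N} \<le> 1} x \<partial>leb {1..N})"
    using m(1) w by (intro nn_integral_leb_refl) auto
  also have "\<dots> = ennreal (vol N) * (\<integral>\<^sup>+x. ennreal (exp (F (sph N x))) \<partial>uball N)"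
    by (rule nn_integral_cone[OF m(1)])
  finally have "(\<integral>\<^sup>+x. ennreal (exp (F (?R (sph N x)))) \<partial>uball N) = (\<integral>\<^sup>+x. ennreal (exp (F (sph N x))) \<partial>uball N)"
    using vol_pos[of N] by (simp add: ennreal_mult_cancel_left)
  hence "(\<integral>x. exp (F (?R (sph N x))) \<partial>uball N) = (\<integral>x. exp (F (sph N x)) \<partial>uball N)"
    using b[THEN bdm_exp, THEN bdm_meas] by (simp add: integral_eq_nn_integral)
  thus ?thesis unfolding log_avg_def by simp
qed

lemma L2_Suc: "L2_set x {1..Suc n} = sqrt ((L2_set x {1..n})\<^sup>2 + (x (Suc n))\<^sup>2)"
  unfolding L2_square by (simp add: L2_set_def)

lemma L2_upd: "L2_set (x(Suc n := r)) {1..n} = L2_set x {1..n}"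
  by (rule L2_set_cong) auto

lemma borel_measurable_L2_indicator':
  "(indicator {x. L2_set x {1..N::nat} \<le> r} :: _ \<Rightarrow> ennreal) \<in> borel_measurable (leb {1..N})"
  using measurable_L2_indicator(1) .

text \<open>
  The ball of dimension \<open>n + 1\<close> lies in the product of the ball of dimension \<open>n\<close> and an interval of
  length \<open>2\<close>.
\<close>

lemma vol_Suc: "vol (Suc n) \<le> 2 * vol n"
proof -
  interpret product_sigma_finite "\<lambda>_::nat. lborel :: real measure" by (rule product_sigma_finite_lb)
  have I: "insert (Suc n) {1..n} = {1..Suc n}" by auto
  have u: "emeasure (uball k) (space (uball k)) = 1" for k
    using prob_space.emeasure_space_1[OF prob_space_uball] .
  have v: "ennreal (vol k) = (\<integral>\<^sup>+x. indicator {x. L2_set x {1..k} \<le> 1} x \<partial>leb {1..k})" for k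
    using nn_integral_cone[of "\<lambda>_. 1" k] u[of k] by simp
  have le: "indicator {x. L2_set x {1..Suc n} \<le> 1} (x(Suc n := r))
      \<le> indicator {x. L2_set x {1..n} \<le> 1} x * (indicator {-1..1} r :: ennreal)" for x :: "nat \<Rightarrow> real" and r :: real
  proof -
    have "L2_set x {1..n} \<le> 1 \<and> \<bar>r\<bar> \<le> 1" if "L2_set (x(Suc n := r)) {1..Suc n} \<le> 1"
    proof -
      have *: "(L2_set x {1..n})\<^sup>2 + r\<^sup>2 \<le> 1" using that unfolding L2_Suc L2_upd by simp
      have "(L2_set x {1..n})\<^sup>2 \<le> 1" "r\<^sup>2 \<le> 1"
        using * zero_le_power2[of r] zero_le_power2[of "L2_set x {1..n}"] by linarith+
      thus ?thesis using abs_square_le_1[of r] abs_square_le_1[of "L2_set x {1..n}"] by auto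
    qed
    thus ?thesis by (auto simp: indicator_def abs_le_iff split: if_splits)
  qed
  have "ennreal (vol (Suc n)) = (\<integral>\<^sup>+x. (\<integral>\<^sup>+r. indicator {x. L2_set x {1..Suc n} \<le> 1} (x(Suc n := r)) \<partial>lborel) \<partial>leb {1..n})"
    unfolding v
    by (rule product_nn_integral_insert[of "{1..n}" "Suc n" "indicator {x. L2_set x {1..Suc n} \<le> 1}", unfolded I])
       (auto intro: measurable_L2_indicator)
  also have "\<dots> \<le> (\<integral>\<^sup>+x. (\<integral>\<^sup>+r. indicator {x. L2_set x {1..n} \<le> 1} x * indicator {-1..1::real} r \<partial>lborel) \<partial>leb {1..n})"
    by (rule nn_integral_mono, rule nn_integral_mono, rule le)
  also have "\<dots> = (\<integral>\<^sup>+x. 2 * indicator {x. L2_set x {1..n} \<le> 1} x \<partial>leb {1..n})"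
    by (intro nn_integral_cong, subst nn_integral_cmult) (simp_all add: mult.commute)
  also have "\<dots> = 2 * ennreal (vol n)" unfolding v
    by (rule nn_integral_cmult) (rule borel_measurable_L2_indicator')
  also have "\<dots> = ennreal (2 * vol n)" using vol_pos[of n] by (simp add: ennreal_mult')
  finally show ?thesis using vol_pos[of n] by (simp add: ennreal_le_iff)
qed

text \<open>
  The unit vector whose last coordinate is in ratio \<open>t\<close> to the norm of the others.
\<close>

definition tilted :: "nat \<Rightarrow> real \<Rightarrow> (nat \<Rightarrow> real) \<Rightarrow> nat \<Rightarrow> real" where
  "tilted n t \<tau> i = (if i = Suc n then t / sqrt (1 + t\<^sup>2) else \<tau> i / sqrt (1 + t\<^sup>2))"

lemma sph_tilted:
  assumes y: "L2_set y {1..n} \<noteq> 0" and i: "i \<in> {1..Suc n}"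
  shows "sph (Suc n) (y(Suc n := L2_set y {1..n} * t)) i = tilted n t (sph n y) i"
proof -
  let ?r = "L2_set y {1..n}"
  have r: "0 < ?r" using y L2_set_nonneg[of y "{1..n}"] by linarith
  have "(?r)\<^sup>2 + (?r * t)\<^sup>2 = ?r\<^sup>2 * (1 + t\<^sup>2)" by (simp add: algebra_simps power_mult_distrib)
  hence L: "L2_set (y(Suc n := ?r * t)) {1..Suc n} = ?r * sqrt (1 + t\<^sup>2)"
    unfolding L2_Suc L2_upd using r by (simp add: real_sqrt_mult)
  have "sqrt (1 + t\<^sup>2) \<noteq> 0" by (simp add: add_nonneg_eq_0_iff)
  thus ?thesis using r by (auto simp: sph_def L tilted_def)
qed

text \<open>
  Of the points \<open>(y, r)\<close> of the ball only those are kept for which \<open>r / |y|\<close> lies between \<open>t0\<close> and \<open>t1\<close> and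
  \<open>|y|\<close> between \<open>\<rho>/2\<close> and \<open>\<rho> = 1 / sqrt (1 + t1\<^sup>2)\<close>; they do lie in the ball, and substituting
  \<open>r = |y| t\<close> costs a factor of at least \<open>\<rho>/2\<close>.  The loss of a constant factor does not matter.
\<close>

lemma slice_lower:
  fixes F :: "(nat \<Rightarrow> real) \<Rightarrow> real"
  assumes n: "1 \<le> n" and t: "0 \<le> t0" "t0 \<le> t1"
    and F0: "\<And>x. 0 \<le> F x"
    and Fm: "(\<lambda>x. F (sph (Suc n) x)) \<in> borel_measurable (leb {1..Suc n})"
    and Fm2: "(\<lambda>(t, y). F (tilted n t (sph n y))) \<in> borel_measurable (lborel \<Otimes>\<^sub>M leb {1..n})"
    and dep: "\<And>x y. (\<And>i. i \<in> {1..Suc n} \<Longrightarrow> x i = y i) \<Longrightarrow> F x = F y"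
    and fin: "\<And>t. (\<integral>\<^sup>+y. ennreal (F (tilted n t (sph n y))) \<partial>uball n) < \<infinity>"
  shows "ennreal ((1 / sqrt (1 + t1\<^sup>2)) ^ Suc n / 8) * (\<integral>\<^sup>+t. (\<integral>\<^sup>+y. ennreal (F (tilted n t (sph n y))) \<partial>uball n) * indicator {t0..t1} t \<partial>lborel)
    \<le> (\<integral>\<^sup>+x. ennreal (F (sph (Suc n) x)) \<partial>uball (Suc n))"
proof -
  interpret product_sigma_finite "\<lambda>_::nat. lborel :: real measure" by (rule product_sigma_finite_lb)
  interpret sigma_finite_measure "leb {1..n}" by (rule sigma_finite) simp
  interpret P: pair_sigma_finite lborel "leb {1..n}" ..
  have I: "insert (Suc n) {1..n} = {1..Suc n}" by auto
  define \<rho> where "\<rho> = 1 / sqrt (1 + t1\<^sup>2)"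
  have \<rho>: "0 < \<rho>" "\<rho>\<^sup>2 * (1 + t1\<^sup>2) = 1"
    unfolding \<rho>_def by (auto simp: power_divide add_pos_nonneg add_nonneg_eq_0_iff)
  let ?n = "\<lambda>y. L2_set y {1..n}"
  define A where "A = {y. \<rho> / 2 < ?n y \<and> ?n y \<le> \<rho>}"
  have A [measurable]: "(\<lambda>y. indicator A y :: ennreal) \<in> borel_measurable (leb {1..n})"
    unfolding A_def by (rule measurable_L2_indicator)
  define f where "f t y = ennreal (F (tilted n t (sph n y)))" for t y
  have fm [measurable]: "(\<lambda>(t, y). f t y) \<in> borel_measurable (lborel \<Otimes>\<^sub>M leb {1..n})"
    unfolding f_def using Fm2 by measurable
  have fm2 [measurable]: "(\<lambda>y. f t y) \<in> borel_measurable (leb {1..n})" for t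
    using measurable_compose[OF measurable_Pair1' fm, of t] by simp
  have fm1 [measurable]: "(\<lambda>t. f t y) \<in> borel_measurable borel" if "y \<in> space (leb {1..n})" for y
    using measurable_compose[OF measurable_Pair2'[OF that, of lborel] fm] by simp
  define E where "E t = (\<integral>\<^sup>+y. f t y \<partial>uball n)" for t
  have dil: "tilted n t (sph n (\<lambda>i\<in>{1..n}. r * x i)) i = tilted n t (sph n x) i" if "0 < r" "i \<in> {1..Suc n}" for t r x i
    using sph_scale[OF that(1), of i n x] that(2) by (auto simp: tilted_def)
  have ann: "(\<integral>\<^sup>+y. f t y * indicator A y \<partial>leb {1..n}) = ennreal ((\<rho> ^ n - (\<rho> / 2) ^ n) * vol n) * E t" for t
    unfolding A_def E_def
  proof (rule nn_integral_annulus)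
    show "f t (\<lambda>i\<in>{1..n}. r * x i) = f t x" if "0 < r" for r x
      unfolding f_def by (intro arg_cong[where f = ennreal] dep dil that)
  qed (use \<rho> fin in \<open>auto simp: f_def[abs_def] intro: fm2[unfolded f_def]\<close>)
  have half: "\<rho> ^ n / 2 \<le> \<rho> ^ n - (\<rho> / 2) ^ n"
  proof -
    have "(1 / 2 :: real) ^ n \<le> (1 / 2) ^ 1" using n by (intro power_decreasing) auto
    hence "\<rho> ^ n * (1 / 2) ^ n \<le> \<rho> ^ n * (1 / 2)" using \<rho> by (intro mult_left_mono) auto
    thus ?thesis by (simp add: power_divide)
  qed
  have vv: "vol (Suc n) * (\<rho> ^ Suc n / 8) \<le> \<rho> / 2 * ((\<rho> ^ n - (\<rho> / 2) ^ n) * vol n)"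
  proof -
    have "vol (Suc n) * (\<rho> ^ Suc n / 8) \<le> 2 * vol n * (\<rho> ^ Suc n / 8)"
      using vol_Suc[of n] \<rho> by (intro mult_right_mono) auto
    also have "\<dots> = \<rho> / 2 * (\<rho> ^ n / 2 * vol n)" by simp
    also have "\<dots> \<le> \<rho> / 2 * ((\<rho> ^ n - (\<rho> / 2) ^ n) * vol n)"
      using half \<rho> vol_pos[of n] by (intro mult_left_mono mult_right_mono) auto
    finally show ?thesis .
  qed
  have "ennreal (vol (Suc n)) * (ennreal (\<rho> ^ Suc n / 8) * (\<integral>\<^sup>+t. E t * indicator {t0..t1} t \<partial>lborel))
      = ennreal (vol (Suc n) * (\<rho> ^ Suc n / 8)) * (\<integral>\<^sup>+t. E t * indicator {t0..t1} t \<partial>lborel)"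
  proof -
    have "ennreal (vol (Suc n) * (\<rho> ^ Suc n / 8)) = ennreal (vol (Suc n)) * ennreal (\<rho> ^ Suc n / 8)"
      by (rule ennreal_mult) (use vol_pos[of "Suc n"] \<rho> in auto)
    thus ?thesis by (simp only: mult.assoc)
  qed
  also have "\<dots> \<le> ennreal (\<rho> / 2 * ((\<rho> ^ n - (\<rho> / 2) ^ n) * vol n)) * (\<integral>\<^sup>+t. E t * indicator {t0..t1} t \<partial>lborel)"
    by (intro mult_right_mono ennreal_leI vv) auto
  also have "\<dots> = ennreal (\<rho> / 2) * (\<integral>\<^sup>+t. (\<integral>\<^sup>+y. f t y * indicator A y \<partial>leb {1..n}) * indicator {t0..t1} t \<partial>lborel)"
  proof -
    have Em: "E \<in> borel_measurable lborel"
    proof -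
      interpret u: prob_space "uball n" by (rule prob_space_uball)
      have "sets (lborel \<Otimes>\<^sub>M uball n) = sets (lborel \<Otimes>\<^sub>M leb {1..n})"
        by (intro sets_pair_measure_cong sets_uball refl)
      hence "(\<lambda>(t, y). f t y) \<in> borel_measurable (lborel \<Otimes>\<^sub>M uball n)"
        using fm measurable_cong_sets by blast
      thus ?thesis unfolding E_def by (rule u.borel_measurable_nn_integral)
    qed
    have "0 \<le> \<rho> ^ n - (\<rho> / 2) ^ n" using half \<rho> zero_le_power[of \<rho> n] by linarith
    hence "ennreal (\<rho> / 2 * ((\<rho> ^ n - (\<rho> / 2) ^ n) * vol n)) = ennreal (\<rho> / 2) * ennreal ((\<rho> ^ n - (\<rho> / 2) ^ n) * vol n)"
      using \<rho> vol_pos[of n] by (intro ennreal_mult) auto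
    moreover have "(\<integral>\<^sup>+t. ennreal ((\<rho> ^ n - (\<rho> / 2) ^ n) * vol n) * (E t * indicator {t0..t1} t) \<partial>lborel)
        = ennreal ((\<rho> ^ n - (\<rho> / 2) ^ n) * vol n) * (\<integral>\<^sup>+t. E t * indicator {t0..t1} t \<partial>lborel)"
      using Em by (intro nn_integral_cmult) auto
    ultimately show ?thesis unfolding ann by (simp only: mult.assoc)
  qed
  also have "(\<integral>\<^sup>+t. (\<integral>\<^sup>+y. f t y * indicator A y \<partial>leb {1..n}) * indicator {t0..t1} t \<partial>lborel)
     = (\<integral>\<^sup>+t. (\<integral>\<^sup>+y. f t y * indicator A y * indicator {t0..t1} t \<partial>leb {1..n}) \<partial>lborel)"
    by (intro nn_integral_cong nn_integral_multc[symmetric]) auto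
  also have "\<dots> = (\<integral>\<^sup>+y. (\<integral>\<^sup>+t. f t y * indicator A y * indicator {t0..t1} t \<partial>lborel) \<partial>leb {1..n})"
    by (rule P.Fubini'[symmetric]) measurable
  also have "ennreal (\<rho> / 2) * \<dots> = (\<integral>\<^sup>+y. ennreal (\<rho> / 2) * (\<integral>\<^sup>+t. f t y * indicator A y * indicator {t0..t1} t \<partial>lborel) \<partial>leb {1..n})"
    by (intro nn_integral_cmult[symmetric] lborel.borel_measurable_nn_integral) measurable
  also have "\<dots> \<le> (\<integral>\<^sup>+y. (\<integral>\<^sup>+r. ennreal (F (sph (Suc n) (y(Suc n := r)))) * indicator {x. L2_set x {1..Suc n} \<le> 1} (y(Suc n := r)) \<partial>lborel) \<partial>leb {1..n})"
  proof (rule nn_integral_mono)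
    fix y assume y: "y \<in> space (leb {1..n})"
    have upd: "(\<lambda>r. y(Suc n := r)) \<in> measurable borel (leb {1..Suc n})"
      by (rule measurable_fun_upd[where J = "{1..n}"]) (use y in auto)
    define g where "g r = ennreal (F (sph (Suc n) (y(Suc n := r)))) * indicator {x. L2_set x {1..Suc n} \<le> 1} (y(Suc n := r))" for r
    have g [measurable]: "g \<in> borel_measurable borel" unfolding g_def
      using measurable_compose[OF upd, of "\<lambda>x. ennreal (F (sph (Suc n) x)) * indicator {x. L2_set x {1..Suc n} \<le> 1} x"] Fm by simp
    show "ennreal (\<rho> / 2) * (\<integral>\<^sup>+t. f t y * indicator A y * indicator {t0..t1} t \<partial>lborel) \<le> (\<integral>\<^sup>+r. g r \<partial>lborel)"
    proof (cases "y \<in> A")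
      case True
      hence r: "\<rho> / 2 < ?n y" "?n y \<le> \<rho>" by (auto simp: A_def)
      hence r0: "0 < ?n y" using \<rho> by linarith
      have le: "f t y * indicator {t0..t1} t \<le> g (0 + ?n y * t)" for t
      proof (cases "t \<in> {t0..t1}")
        case tt: True
        hence t2: "t\<^sup>2 \<le> t1\<^sup>2" using t by (intro power_mono) auto
        have "(?n y)\<^sup>2 + (?n y * t)\<^sup>2 = (?n y)\<^sup>2 * (1 + t\<^sup>2)" by (simp add: algebra_simps power_mult_distrib)
        also have "\<dots> \<le> \<rho>\<^sup>2 * (1 + t1\<^sup>2)" using r r0 t2 by (intro mult_mono power_mono) auto
        finally have "L2_set (y(Suc n := ?n y * t)) {1..Suc n} \<le> 1"
          unfolding L2_Suc L2_upd using \<rho>(2) by simp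
        moreover have "F (sph (Suc n) (y(Suc n := ?n y * t))) = F (tilted n t (sph n y))"
          by (rule dep, rule sph_tilted) (use r0 in auto)
        ultimately show ?thesis using tt by (simp add: g_def f_def)
      qed simp
      have "ennreal (\<rho> / 2) * (\<integral>\<^sup>+t. f t y * indicator A y * indicator {t0..t1} t \<partial>lborel)
          \<le> ennreal \<bar>?n y\<bar> * (\<integral>\<^sup>+t. g (0 + ?n y * t) \<partial>lborel)"
        using r True le by (intro mult_mono ennreal_leI nn_integral_mono) auto
      also have "\<dots> = (\<integral>\<^sup>+r. g r \<partial>lborel)"
        using r0 g by (intro nn_integral_real_affine[symmetric]) auto
      finally show ?thesis .
    qed simp
  qed
  also have "\<dots> = (\<integral>\<^sup>+x. ennreal (F (sph (Suc n) x)) * indicator {x. L2_set x {1..Suc n} \<le> 1} x \<partial>leb {1..Suc n})"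
    using Fm by (intro product_nn_integral_insert[of "{1..n}" "Suc n"
        "\<lambda>x. ennreal (F (sph (Suc n) x)) * indicator {x. L2_set x {1..Suc n} \<le> 1} x", unfolded I, symmetric]) auto
  also have "\<dots> = ennreal (vol (Suc n)) * (\<integral>\<^sup>+x. ennreal (F (sph (Suc n) x)) \<partial>uball (Suc n))"
    by (rule nn_integral_cone) (use Fm in auto)
  finally show ?thesis unfolding E_def f_def \<rho>_def
    using vol_pos[of "Suc n"] by (simp add: ennreal_mult_le_mult_iff)
qed

section \<open>The free energy as a function of the disorder\<close>

definition idx :: "nat \<Rightarrow> (nat \<times> nat) set" where
  "idx n = {1..n} \<times> {1..n}"

definition bil :: "nat \<Rightarrow> (nat \<times> nat \<Rightarrow> real) \<Rightarrow> (nat \<Rightarrow> real) \<Rightarrow> (nat \<Rightarrow> real) \<Rightarrow> real" where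
  "bil n x \<sigma> \<tau> = (\<Sum>i=1..n. \<Sum>j=1..n. x (i, j) * \<sigma> i * \<tau> j)"

definition energy :: "nat \<Rightarrow> real \<Rightarrow> (nat \<Rightarrow> real) \<Rightarrow> (nat \<times> nat \<Rightarrow> real) \<Rightarrow> (nat \<Rightarrow> real) \<Rightarrow> real" where
  "energy n b v x \<tau> = b * bil n x \<tau> \<tau> + (\<Sum>i=1..n. v i * \<tau> i)"

definition Phi :: "nat \<Rightarrow> real \<Rightarrow> (nat \<Rightarrow> real) \<Rightarrow> (nat \<times> nat \<Rightarrow> real) \<Rightarrow> real" where
  "Phi n b v x = log_avg (uball n) (\<lambda>y. energy n b v x (sph n y))"

text \<open>
  Lower bounds for the free energy are bounds on the mean shortfall below a level \<open>c\<close>.  This quantity is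
  Lipschitz in \<open>c\<close> and in the field, which makes the recursion over dimensions stable, and it suffices
  for convergence in the mean.
\<close>

definition shortfall :: "nat \<Rightarrow> real \<Rightarrow> (nat \<Rightarrow> real) \<Rightarrow> real \<Rightarrow> real" where
  "shortfall n b v c = (\<integral>x. max 0 (c - Phi n b v x) \<partial>gauss (idx n))"

lemma finite_idx [simp]: "finite (idx n)"
  by (simp add: idx_def)

lemma idxI: "i \<in> {1..n} \<Longrightarrow> j \<in> {1..n} \<Longrightarrow> (i, j) \<in> idx n"
  by (simp add: idx_def)

lemma energy_cong: "(\<And>i. i \<in> {1..n} \<Longrightarrow> \<sigma> i = \<tau> i) \<Longrightarrow> energy n b v x \<sigma> = energy n b v x \<tau>"
  unfolding energy_def bil_def by (intro arg_cong2[where f = "(+)"] arg_cong2[where f = "(*)"] sum.cong refl) auto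

lemma Phi_cong:
  assumes "\<And>i. i \<in> {1..n} \<Longrightarrow> v i = w i" "\<And>p. p \<in> idx n \<Longrightarrow> x p = y p"
  shows "Phi n b v x = Phi n b w y"
proof -
  have "energy n b v x \<tau> = energy n b w y \<tau>" for \<tau>
    unfolding energy_def bil_def using assms
    by (intro arg_cong2[where f = "(+)"] arg_cong2[where f = "(*)"] sum.cong refl) (auto simp: idx_def)
  thus ?thesis unfolding Phi_def by simp
qed

lemma bdm_energy: "bdm (uball n) (\<lambda>y. energy n b v x (sph n y))"
  unfolding energy_def bil_def by (intro bdm_intros bdm_sph)

lemma energy_abs:
  "\<bar>energy n b v x (sph n y)\<bar> \<le> \<bar>b\<bar> * (\<Sum>p\<in>idx n. \<bar>x p\<bar>) + (\<Sum>i=1..n. \<bar>v i\<bar>)"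
proof -
  let ?s = "sph n y"
  have "\<bar>bil n x ?s ?s\<bar> \<le> (\<Sum>i=1..n. \<Sum>j=1..n. \<bar>x (i, j)\<bar>)"
    unfolding bil_def
  proof (rule order_trans[OF sum_abs], rule sum_mono, rule order_trans[OF sum_abs], rule sum_mono)
    fix i j assume ij: "i \<in> {1..n}" "j \<in> {1..n}"
    have "\<bar>x (i, j)\<bar> * \<bar>?s i\<bar> * \<bar>?s j\<bar> \<le> \<bar>x (i, j)\<bar> * 1 * 1"
      by (intro mult_mono sph_abs ij) auto
    thus "\<bar>x (i, j) * ?s i * ?s j\<bar> \<le> \<bar>x (i, j)\<bar>" by (simp add: abs_mult)
  qed
  also have "\<dots> = (\<Sum>p\<in>idx n. \<bar>x p\<bar>)" unfolding idx_def by (simp add: sum.cartesian_product)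
  finally have "\<bar>b * bil n x ?s ?s\<bar> \<le> \<bar>b\<bar> * (\<Sum>p\<in>idx n. \<bar>x p\<bar>)"
    unfolding abs_mult by (intro mult_left_mono) auto
  moreover have "\<bar>\<Sum>i=1..n. v i * ?s i\<bar> \<le> (\<Sum>i=1..n. \<bar>v i\<bar>)"
    by (rule order_trans[OF sum_abs], rule sum_mono) (use sph_abs in \<open>auto simp: abs_mult intro!: mult_left_le\<close>)
  ultimately show ?thesis unfolding energy_def by linarith
qed

lemma Phi_abs: "\<bar>Phi n b v x\<bar> \<le> \<bar>b\<bar> * (\<Sum>p\<in>idx n. \<bar>x p\<bar>) + (\<Sum>i=1..n. \<bar>v i\<bar>)"
  unfolding Phi_def by (rule log_avg_abs[OF prob_space_uball bdm_meas[OF bdm_energy] energy_abs])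

lemma Phi_measurable:
  assumes X: "\<And>p. p \<in> idx n \<Longrightarrow> (\<lambda>z. X z p) \<in> borel_measurable N"
    and V: "\<And>i. i \<in> {1..n} \<Longrightarrow> (\<lambda>z. V z i) \<in> borel_measurable N"
  shows "(\<lambda>z. Phi n b (V z) (X z)) \<in> borel_measurable N"
proof -
  interpret u: prob_space "uball n" by (rule prob_space_uball)
  have 1: "(\<lambda>p. X (fst p) k) \<in> borel_measurable (N \<Otimes>\<^sub>M uball n)" if "k \<in> idx n" for k
    by (rule measurable_compose[OF measurable_fst X[OF that]])
  have 2: "(\<lambda>p. V (fst p) k) \<in> borel_measurable (N \<Otimes>\<^sub>M uball n)" if "k \<in> {1..n}" for k
    by (rule measurable_compose[OF measurable_fst V[OF that]])
  have 3: "(\<lambda>p. sph n (snd p) k) \<in> borel_measurable (N \<Otimes>\<^sub>M uball n)" if "k \<in> {1..n}" for k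
    by (rule measurable_compose[OF measurable_snd bdm_meas[OF bdm_sph[OF that]]])
  have "(\<lambda>(z, y). exp (energy n b (V z) (X z) (sph n y))) \<in> borel_measurable (N \<Otimes>\<^sub>M uball n)"
    unfolding energy_def bil_def case_prod_beta'
    by (intro borel_measurable_exp[THEN measurable_compose[rotated]] borel_measurable_add borel_measurable_sum
          borel_measurable_times borel_measurable_const 1 2 3 idxI)
  hence "(\<lambda>z. \<integral>y. exp (energy n b (V z) (X z) (sph n y)) \<partial>uball n) \<in> borel_measurable N"
    by (rule u.borel_measurable_lebesgue_integral)
  thus ?thesis unfolding Phi_def log_avg_def by measurable
qed

lemma Phi_meas_gauss: "idx n \<subseteq> I \<Longrightarrow> (\<lambda>x. Phi n b v x) \<in> borel_measurable (gauss I)"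
  by (rule Phi_measurable) (auto intro: measurable_gauss_component)

lemma integrable_gauss_abs_sum: "J \<subseteq> I \<Longrightarrow> integrable (gauss I) (\<lambda>x. \<Sum>p\<in>J. \<bar>x p\<bar>)"
  using integrable_gauss_abs_power[of _ I 1] by (intro Bochner_Integration.integrable_sum) auto

lemma integrable_Phi: assumes "idx n \<subseteq> I" shows "integrable (gauss I) (\<lambda>x. Phi n b v x)"
proof (rule Bochner_Integration.integrable_bound)
  interpret prob_space "gauss I" by (rule prob_space_gauss)
  show "integrable (gauss I) (\<lambda>x. \<bar>b\<bar> * (\<Sum>p\<in>idx n. \<bar>x p\<bar>) + (\<Sum>i=1..n. \<bar>v i\<bar>))"
    using integrable_gauss_abs_sum[OF assms] by simp
  have "\<bar>Phi n b v x\<bar> \<le> \<bar>\<bar>b\<bar> * (\<Sum>p\<in>idx n. \<bar>x p\<bar>) + (\<Sum>i=1..n. \<bar>v i\<bar>)\<bar>" for x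
    using Phi_abs[of n b v x] by linarith
  thus "AE x in gauss I. norm (Phi n b v x) \<le> norm (\<bar>b\<bar> * (\<Sum>p\<in>idx n. \<bar>x p\<bar>) + (\<Sum>i=1..n. \<bar>v i\<bar>))" by simp
qed (rule Phi_meas_gauss[OF assms])

lemma integrable_shortfall: "idx n \<subseteq> I \<Longrightarrow> integrable (gauss I) (\<lambda>x. max 0 (c - Phi n b v x))"
proof -
  assume I: "idx n \<subseteq> I"
  interpret prob_space "gauss I" by (rule prob_space_gauss)
  show ?thesis using integrable_Phi[OF I] by (intro integrable_max) auto
qed

lemma shortfall_nonneg: "0 \<le> shortfall n b v c"
  unfolding shortfall_def by (rule Bochner_Integration.integral_nonneg) simp

lemma Phi_lipschitz:
  assumes n: "1 \<le> n" shows "Phi n b w x \<le> Phi n b v x + L2_set (\<lambda>i. w i - v i) {1..n}"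
  unfolding Phi_def
proof (rule log_avg_le[OF prob_space_uball bdm_energy bdm_energy])
  fix y
  have "\<bar>\<Sum>i=1..n. (w i - v i) * sph n y i\<bar> \<le> L2_set (\<lambda>i. w i - v i) {1..n}" by (rule sph_linear_abs[OF n])
  thus "energy n b w x (sph n y) \<le> energy n b v x (sph n y) + L2_set (\<lambda>i. w i - v i) {1..n}"
    unfolding energy_def by (simp add: left_diff_distrib sum_subtractf)
qed

lemma shortfall_lipschitz:
  assumes n: "1 \<le> n"
  shows "shortfall n b v c \<le> shortfall n b w d + L2_set (\<lambda>i. w i - v i) {1..n} + \<bar>c - d\<bar>"
proof -
  interpret prob_space "gauss (idx n)" by (rule prob_space_gauss)
  have "shortfall n b v c \<le> (\<integral>x. max 0 (d - Phi n b w x) + (L2_set (\<lambda>i. w i - v i) {1..n} + \<bar>c - d\<bar>) \<partial>gauss (idx n))"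
    unfolding shortfall_def
  proof (rule integral_mono)
    fix x
    show "max 0 (c - Phi n b v x) \<le> max 0 (d - Phi n b w x) + (L2_set (\<lambda>i. w i - v i) {1..n} + \<bar>c - d\<bar>)"
      using Phi_lipschitz[OF n, of b w x v] L2_set_nonneg[of "\<lambda>i. w i - v i" "{1..n}"] by linarith
  qed (use integrable_shortfall in auto)
  also have "\<dots> = shortfall n b w d + (L2_set (\<lambda>i. w i - v i) {1..n} + \<bar>c - d\<bar>)"
    unfolding shortfall_def using integrable_shortfall[OF subset_refl] by (simp add: prob_space)
  finally show ?thesis by simp
qed

subsection \<open>Rotation invariance\<close>

lemma sum_refl_swap:
  assumes w: "(\<Sum>i\<in>I. (w i)\<^sup>2) = 1" and I: "finite I"
  shows "(\<Sum>i\<in>I. v i * refl I w u i) = (\<Sum>i\<in>I. refl I w v i * u i)"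
  using sum_mult_refl[OF I w, of v u] sum_mult_refl[OF I w, of u v] by (simp add: mult.commute mult.left_commute)

text \<open>
  Reflecting every row is a product of reflections along orthonormal directions, one for each row; the
  same holds for the columns.
\<close>

lemma nn_integral_row_refl:
  assumes w: "(\<Sum>i=1..n. (w i)\<^sup>2) = 1" and f: "f \<in> borel_measurable (gauss (idx n))"
  shows "(\<integral>\<^sup>+x. f (\<lambda>p\<in>idx n. refl {1..n} w (\<lambda>j. x (fst p, j)) (snd p)) \<partial>gauss (idx n)) = (\<integral>\<^sup>+x. f x \<partial>gauss (idx n))"
    and "(\<integral>\<^sup>+x. f (\<lambda>p\<in>idx n. refl {1..n} w (\<lambda>i. x (i, snd p)) (fst p)) \<partial>gauss (idx n)) = (\<integral>\<^sup>+x. f x \<partial>gauss (idx n))"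
proof -
  define R where "R a p = (if fst p = a then w (snd p) else 0)" for a and p :: "nat \<times> nat"
  define C where "C a p = (if snd p = a then w (fst p) else 0)" for a and p :: "nat \<times> nat"
  have R: "(\<Sum>p\<in>idx n. R a p * g p) = (\<Sum>j=1..n. w j * g (a, j))" if "a \<in> {1..n}" for a g
  proof -
    have "(\<Sum>p\<in>idx n. R a p * g p) = (\<Sum>i=1..n. \<Sum>j=1..n. if i = a then w j * g (i, j) else 0)"
      unfolding idx_def sum.cartesian_product by (intro sum.cong refl) (auto simp: R_def)
    also have "\<dots> = (\<Sum>i=1..n. if i = a then (\<Sum>j=1..n. w j * g (i, j)) else 0)"
      by (intro sum.cong refl) auto
    finally show ?thesis using that by simp
  qed
  have C: "(\<Sum>p\<in>idx n. C a p * g p) = (\<Sum>i=1..n. w i * g (i, a))" if "a \<in> {1..n}" for a g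
  proof -
    have "(\<Sum>p\<in>idx n. C a p * g p) = (\<Sum>i=1..n. \<Sum>j=1..n. if j = a then w i * g (i, j) else 0)"
      unfolding idx_def sum.cartesian_product by (intro sum.cong refl) (auto simp: C_def)
    thus ?thesis using that by simp
  qed
  have e1: "(\<lambda>p\<in>idx n. x p - 2 * (\<Sum>a=1..n. (\<Sum>q\<in>idx n. R a q * x q) * R a p))
      = (\<lambda>p\<in>idx n. refl {1..n} w (\<lambda>j. x (fst p, j)) (snd p))" for x
  proof (rule restrict_ext)
    fix p assume p: "p \<in> idx n"
    have "(\<Sum>a=1..n. (\<Sum>q\<in>idx n. R a q * x q) * R a p) = (\<Sum>a=1..n. if a = fst p then (\<Sum>j=1..n. w j * x (a, j)) * w (snd p) else 0)"
      by (intro sum.cong refl) (simp only: R, simp add: R_def)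
    thus "x p - 2 * (\<Sum>a=1..n. (\<Sum>q\<in>idx n. R a q * x q) * R a p) = refl {1..n} w (\<lambda>j. x (fst p, j)) (snd p)"
      using p by (auto simp: idx_def refl_def)
  qed
  have e2: "(\<lambda>p\<in>idx n. x p - 2 * (\<Sum>a=1..n. (\<Sum>q\<in>idx n. C a q * x q) * C a p))
      = (\<lambda>p\<in>idx n. refl {1..n} w (\<lambda>i. x (i, snd p)) (fst p))" for x
  proof (rule restrict_ext)
    fix p assume p: "p \<in> idx n"
    have "(\<Sum>a=1..n. (\<Sum>q\<in>idx n. C a q * x q) * C a p) = (\<Sum>a=1..n. if a = snd p then (\<Sum>i=1..n. w i * x (i, a)) * w (fst p) else 0)"
      by (intro sum.cong refl) (simp only: C, simp add: C_def)
    thus "x p - 2 * (\<Sum>a=1..n. (\<Sum>q\<in>idx n. C a q * x q) * C a p) = refl {1..n} w (\<lambda>i. x (i, snd p)) (fst p)"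
      using p by (auto simp: idx_def refl_def)
  qed
  show "(\<integral>\<^sup>+x. f (\<lambda>p\<in>idx n. refl {1..n} w (\<lambda>j. x (fst p, j)) (snd p)) \<partial>gauss (idx n)) = (\<integral>\<^sup>+x. f x \<partial>gauss (idx n))"
    unfolding e1[symmetric]
  proof (rule nn_integral_gauss_orthonormal_refl[OF _ _ _ _ f])
    show "(\<Sum>p\<in>idx n. (R a p)\<^sup>2) = 1" if "a \<in> {1..n}" for a
      using R[OF that, of "R a"] w by (simp add: power2_eq_square R_def)
    show "(\<Sum>p\<in>idx n. R a p * R b p) = 0" if "a \<in> {1..n}" "b \<in> {1..n}" "a \<noteq> b" for a b
      using R[OF that(1), of "R b"] that by (simp add: R_def)
  qed auto
  show "(\<integral>\<^sup>+x. f (\<lambda>p\<in>idx n. refl {1..n} w (\<lambda>i. x (i, snd p)) (fst p)) \<partial>gauss (idx n)) = (\<integral>\<^sup>+x. f x \<partial>gauss (idx n))"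
    unfolding e2[symmetric]
  proof (rule nn_integral_gauss_orthonormal_refl[OF _ _ _ _ f])
    show "(\<Sum>p\<in>idx n. (C a p)\<^sup>2) = 1" if "a \<in> {1..n}" for a
      using C[OF that, of "C a"] w by (simp add: power2_eq_square C_def)
    show "(\<Sum>p\<in>idx n. C a p * C b p) = 0" if "a \<in> {1..n}" "b \<in> {1..n}" "a \<noteq> b" for a b
      using C[OF that(1), of "C b"] that by (simp add: C_def)
  qed auto
qed

lemma measurable_restrict_gauss:
  assumes "\<And>p. p \<in> I \<Longrightarrow> (\<lambda>z. X z p) \<in> borel_measurable N"
  shows "(\<lambda>z. \<lambda>p\<in>I. X z p) \<in> measurable N (gauss I)"
  by (subst measurable_cong_sets[OF refl sets_gauss], rule measurable_restrict) (rule assms)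

text \<open>
  Reflecting all rows and all columns of the disorder does not change its law, and amounts to
  reflecting the spins.
\<close>

lemma shortfall_refl:
  assumes n: "1 \<le> n" and w: "(\<Sum>i=1..n. (w i)\<^sup>2) = 1"
  shows "shortfall n b v c = shortfall n b (refl {1..n} w v) c"
proof -
  let ?R = "refl {1..n} w"
  define row where "row x = (\<lambda>p\<in>idx n. ?R (\<lambda>j. x (fst p, j)) (snd p))" for x :: "nat \<times> nat \<Rightarrow> real"
  define col where "col x = (\<lambda>p\<in>idx n. ?R (\<lambda>i. x (i, snd p)) (fst p))" for x :: "nat \<times> nat \<Rightarrow> real"
  have r: "bil n (row x) \<sigma> \<tau> = bil n x \<sigma> (?R \<tau>)" for x \<sigma> \<tau>
  proof -
    have "(\<Sum>j=1..n. row x (i, j) * \<sigma> i * \<tau> j) = (\<Sum>j=1..n. x (i, j) * \<sigma> i * ?R \<tau> j)" if "i \<in> {1..n}" for i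
    proof -
      have "(\<Sum>j=1..n. row x (i, j) * \<sigma> i * \<tau> j) = \<sigma> i * (\<Sum>j=1..n. ?R (\<lambda>j. x (i, j)) j * \<tau> j)"
        unfolding sum_distrib_left using that by (intro sum.cong refl) (auto simp: row_def idx_def)
      also have "(\<Sum>j=1..n. ?R (\<lambda>j. x (i, j)) j * \<tau> j) = (\<Sum>j=1..n. x (i, j) * ?R \<tau> j)"
        using sum_refl_swap[OF w, of "\<lambda>j. x (i, j)" \<tau>] by simp
      finally show ?thesis unfolding sum_distrib_left by (simp add: mult_ac)
    qed
    thus ?thesis unfolding bil_def by (rule sum.cong[OF refl])
  qed
  have k: "bil n (col x) \<sigma> \<tau> = bil n x (?R \<sigma>) \<tau>" for x \<sigma> \<tau>
  proof -
    have sw: "bil n x \<sigma> \<tau> = (\<Sum>j=1..n. \<Sum>i=1..n. x (i, j) * \<sigma> i * \<tau> j)" for x \<sigma> \<tau>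
      unfolding bil_def by (rule sum.swap)
    have "(\<Sum>i=1..n. col x (i, j) * \<sigma> i * \<tau> j) = (\<Sum>i=1..n. x (i, j) * ?R \<sigma> i * \<tau> j)" if "j \<in> {1..n}" for j
    proof -
      have "(\<Sum>i=1..n. col x (i, j) * \<sigma> i * \<tau> j) = \<tau> j * (\<Sum>i=1..n. ?R (\<lambda>i. x (i, j)) i * \<sigma> i)"
        unfolding sum_distrib_left using that by (intro sum.cong refl) (auto simp: col_def idx_def)
      also have "(\<Sum>i=1..n. ?R (\<lambda>i. x (i, j)) i * \<sigma> i) = (\<Sum>i=1..n. x (i, j) * ?R \<sigma> i)"
        using sum_refl_swap[OF w, of "\<lambda>i. x (i, j)" \<sigma>] by simp
      finally show ?thesis unfolding sum_distrib_left by (simp add: mult_ac)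
    qed
    thus ?thesis unfolding sw by (rule sum.cong[OF refl])
  qed
  define F where "F x \<tau> = energy n b (?R v) x \<tau>" for x \<tau>
  have FR: "F x (?R \<tau>) = energy n b v (col (row x)) \<tau>" for x \<tau>
  proof -
    have "(\<Sum>i=1..n. ?R v i * ?R \<tau> i) = (\<Sum>i=1..n. ?R (?R v) i * \<tau> i)" by (rule sum_refl_swap[OF w]) simp
    also have "\<dots> = (\<Sum>i=1..n. v i * \<tau> i)"
    proof (rule sum.cong[OF refl])
      fix i assume i: "i \<in> {1..n}"
      have "?R (?R v) i = v i" using sum_mult_refl[OF _ w, of w v] w i
        unfolding refl_def[of "{1..n}" w "?R v"] by (simp add: refl_def power2_eq_square)
      thus "?R (?R v) i * \<tau> i = v i * \<tau> i" by simp
    qed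
    finally show ?thesis unfolding F_def energy_def k r by simp
  qed
  have P: "Phi n b v (col (row x)) = Phi n b (?R v) x" for x
  proof -
    have "Phi n b v (col (row x)) = log_avg (uball n) (\<lambda>y. F x (?R (sph n y)))" unfolding FR Phi_def ..
    also have "\<dots> = log_avg (uball n) (\<lambda>y. F x (sph n y))"
    proof (rule log_avg_refl[OF n w])
      show "bdm (uball n) (\<lambda>y. F x (?R (sph n y)))" unfolding FR by (rule bdm_energy)
      show "bdm (uball n) (\<lambda>y. F x (sph n y))" unfolding F_def by (rule bdm_energy)
    qed (auto simp: F_def intro: energy_cong)
    finally show ?thesis unfolding F_def Phi_def .
  qed
  define G where "G v x = ennreal (max 0 (c - Phi n b v x))" for v x
  have Gm: "G v \<in> borel_measurable (gauss (idx n))" for v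
    unfolding G_def using Phi_meas_gauss[of n "idx n" b v] by measurable
  have colm: "col \<in> measurable (gauss (idx n)) (gauss (idx n))"
    unfolding col_def
  proof (rule measurable_restrict_gauss)
    fix p assume p: "p \<in> idx n"
    hence s: "(\<lambda>x. ?R (\<lambda>i. x (i, snd p)) (fst p)) = (\<lambda>x. x p - 2 * (\<Sum>j=1..n. w j * x (j, snd p)) * w (fst p))"
      by (auto simp: refl_def idx_def)
    show "(\<lambda>x. ?R (\<lambda>i. x (i, snd p)) (fst p)) \<in> borel_measurable (gauss (idx n))"
      unfolding s using p
      by (intro borel_measurable_diff borel_measurable_times borel_measurable_sum borel_measurable_const measurable_gauss_component)
         (auto simp: idx_def)
  qed
  have "(\<integral>\<^sup>+x. G v x \<partial>gauss (idx n)) = (\<integral>\<^sup>+x. G v (col x) \<partial>gauss (idx n))"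
    unfolding col_def by (rule nn_integral_row_refl(2)[OF w Gm, symmetric])
  also have "\<dots> = (\<integral>\<^sup>+x. G v (col (row x)) \<partial>gauss (idx n))"
    unfolding row_def by (rule nn_integral_row_refl(1)[OF w measurable_compose[OF colm Gm], symmetric])
  also have "\<dots> = (\<integral>\<^sup>+x. G (?R v) x \<partial>gauss (idx n))" unfolding G_def P ..
  finally show ?thesis unfolding shortfall_def G_def
    by (subst (1 2) integral_eq_nn_integral) (auto intro!: borel_measurable_integrable integrable_shortfall)
qed

lemma shortfall_cong: "(\<And>i. i \<in> {1..n} \<Longrightarrow> v i = w i) \<Longrightarrow> shortfall n b v c = shortfall n b w c"
  unfolding shortfall_def by (intro Bochner_Integration.integral_cong refl arg_cong2[where f = max] arg_cong2[where f = "(-)"] Phi_cong) auto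

text \<open>
  Two vectors of the same length are exchanged by the reflection along their difference.
\<close>

lemma shortfall_rotation:
  assumes n: "1 \<le> n" and vw: "L2_set v {1..n} = L2_set w {1..n}"
  shows "shortfall n b v c = shortfall n b w c"
proof (cases "\<forall>i\<in>{1..n}. v i = w i")
  case True thus ?thesis by (intro shortfall_cong) auto
next
  case False
  define d where "d i = v i - w i" for i
  define D where "D = (\<Sum>i=1..n. (d i)\<^sup>2)"
  obtain i where i: "i \<in> {1..n}" "d i \<noteq> 0" using False by (auto simp: d_def)
  have "0 < (d i)\<^sup>2" using i by simp
  also have "\<dots> \<le> D" unfolding D_def using i by (intro member_le_sum) auto
  finally have D: "0 < D" .
  define u where "u i = d i / sqrt D" for i
  have u: "(\<Sum>i=1..n. (u i)\<^sup>2) = 1"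
    using D by (simp add: u_def power_divide sum_divide_distrib[symmetric] D_def[symmetric])
  have sq: "(\<Sum>i=1..n. (v i)\<^sup>2) = (\<Sum>i=1..n. (w i)\<^sup>2)" unfolding L2_square[symmetric] vw ..
  have "D = (\<Sum>i=1..n. (v i)\<^sup>2) + (\<Sum>i=1..n. (w i)\<^sup>2) - 2 * (\<Sum>i=1..n. v i * w i)"
    unfolding D_def d_def power2_diff by (simp add: sum.distrib sum_subtractf sum_distrib_left mult.assoc)
  moreover have dv: "(\<Sum>i=1..n. d i * v i) = (\<Sum>i=1..n. (v i)\<^sup>2) - (\<Sum>i=1..n. v i * w i)"
    by (simp add: d_def algebra_simps sum_subtractf power2_eq_square)
  ultimately have dD: "2 * (\<Sum>i=1..n. d i * v i) = D" using sq by simp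
  have "refl {1..n} u v i = w i" if "i \<in> {1..n}" for i
  proof -
    have uv: "(\<Sum>j=1..n. u j * v j) = (\<Sum>j=1..n. d j * v j) / sqrt D"
      by (simp add: u_def sum_divide_distrib)
    have "refl {1..n} u v i = v i - 2 * (\<Sum>j=1..n. u j * v j) * u i"
      unfolding refl_def using that by (rule restrict_apply')
    also have "\<dots> = v i - (2 * (\<Sum>j=1..n. d j * v j)) * d i / (sqrt D * sqrt D)"
      unfolding uv u_def[of i] by (simp only: times_divide_eq_left times_divide_eq_right divide_divide_eq_left mult.assoc)
    also have "\<dots> = w i" unfolding dD using D by (simp add: d_def)
    finally show ?thesis .
  qed
  hence "shortfall n b (refl {1..n} u v) c = shortfall n b w c" by (rule shortfall_cong)
  thus ?thesis using shortfall_refl[OF n u, of b v c] by (simp only:)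
qed

subsection \<open>One step of the recursion\<close>

text \<open>
  The relative thickness of the slice will be \<open>1/n\<close>: too little to be felt to exponential order, while
  functions of \<open>t\<close> become constant on the slice.
\<close>

definition window :: "real \<Rightarrow> real \<Rightarrow> real measure" where
  "window \<delta> T = uniform_measure lborel {T * (1 - \<delta>)..T}"

lemma window_emeasure: "0 < \<delta> \<Longrightarrow> 0 < T \<Longrightarrow> emeasure lborel {T * (1 - \<delta>)..T} = ennreal (T * \<delta>)"
  by (simp add: algebra_simps)

lemma prob_space_window: "0 < \<delta> \<Longrightarrow> 0 < T \<Longrightarrow> prob_space (window \<delta> T)"
  unfolding window_def by (rule prob_space_uniform_measure) (simp_all add: window_emeasure del: emeasure_lborel_Icc)

lemma measurable_window: "measurable (window \<delta> T) M = measurable borel M"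
  by (rule measurable_cong_sets) (auto simp: window_def)

lemma nn_integral_window:
  assumes "0 < \<delta>" "0 < T" "f \<in> borel_measurable borel"
  shows "(\<integral>\<^sup>+t. f t * indicator {T * (1 - \<delta>)..T} t \<partial>lborel) = ennreal (T * \<delta>) * (\<integral>\<^sup>+t. f t \<partial>window \<delta> T)"
proof -
  have "(\<integral>\<^sup>+t. f t \<partial>window \<delta> T) = (\<integral>\<^sup>+t. f t * indicator {T * (1 - \<delta>)..T} t \<partial>lborel) / ennreal (T * \<delta>)"
    unfolding window_def window_emeasure[OF assms(1,2), symmetric] using assms(3)
    by (intro nn_integral_uniform_measure) auto
  thus ?thesis using assms(1,2)
    by (simp add: ennreal_times_divide mult.commute[of "ennreal (T * \<delta>)"] ennreal_mult_divide_eq)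
qed

lemma window_average_limit:
  fixes f :: "real \<Rightarrow> real"
  assumes T: "0 < T" and f: "continuous_on UNIV f" and b: "\<And>t. \<bar>f t\<bar> \<le> 1"
  shows "(\<lambda>n. \<integral>t. f t \<partial>window (1 / real (Suc n)) T) \<longlonglongrightarrow> f T"
proof (rule LIMSEQ_I)
  fix e :: real assume e: "0 < e"
  have "isCont f T" using f by (simp add: continuous_on_eq_continuous_at)
  then obtain d where d: "0 < d" "\<And>t. \<bar>t - T\<bar> < d \<Longrightarrow> \<bar>f t - f T\<bar> < e / 2"
    using e unfolding continuous_at_eps_delta dist_real_def by (meson half_gt_zero)
  obtain n0 where n0: "T / d < real n0" using reals_Archimedean2 by blast
  show "\<exists>no. \<forall>n\<ge>no. norm ((\<integral>t. f t \<partial>window (1 / real (Suc n)) T) - f T) < e"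
  proof (intro exI allI impI)
    fix n assume n: "n0 \<le> n"
    note of_nat_Suc [simp del]
    interpret U: prob_space "window (1 / real (Suc n)) T" by (rule prob_space_window) (use T in auto)
    have Td: "T / real (Suc n) < d"
    proof -
      have "T / d < real (Suc n)" using n0 n by (simp add: of_nat_Suc)
      thus ?thesis using d by (simp add: field_simps)
    qed
    have fm: "f \<in> borel_measurable borel" using f by (rule borel_measurable_continuous_onI)
    have fi: "integrable (window (1 / real (Suc n)) T) f"
      by (rule bdm_integrable[OF U.prob_space_axioms bdmI[where B = 1]]) (simp_all add: measurable_window fm b)
    have "AE t in window (1 / real (Suc n)) T. t \<in> {T * (1 - 1 / real (Suc n))..T}"
      unfolding window_def using T
      by (subst AE_uniform_measure) (auto simp: window_emeasure simp del: emeasure_lborel_Icc)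
    hence AE: "AE t in window (1 / real (Suc n)) T. \<bar>f t - f T\<bar> \<le> e / 2"
    proof eventually_elim
      case (elim t)
      hence "\<bar>t - T\<bar> \<le> T / real (Suc n)" by (simp add: algebra_simps)
      hence "\<bar>t - T\<bar> < d" using Td by linarith
      thus ?case using d(2) by (simp add: less_imp_le)
    qed
    have "\<bar>(\<integral>t. f t \<partial>window (1 / real (Suc n)) T) - f T\<bar> = \<bar>\<integral>t. f t - f T \<partial>window (1 / real (Suc n)) T\<bar>"
      using fi by (simp add: U.prob_space del: of_nat_Suc)
    also have "\<dots> \<le> (\<integral>t. \<bar>f t - f T\<bar> \<partial>window (1 / real (Suc n)) T)" by (rule integral_abs_bound)
    also have "\<dots> \<le> (\<integral>t. e / 2 \<partial>window (1 / real (Suc n)) T)"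
      using fi AE by (intro integral_mono_AE) auto
    also have "\<dots> < e" using e by (simp add: U.prob_space)
    finally show "norm ((\<integral>t. f t \<partial>window (1 / real (Suc n)) T) - f T) < e" by simp
  qed
qed

text \<open>
  These are the functions of \<open>t\<close> in the energy of \<open>tilted n t \<tau>\<close>, see \<open>energy_tilted\<close>.
\<close>

definition slice_coeff :: "nat \<Rightarrow> real \<Rightarrow> real" where
  "slice_coeff k t = (if k = 0 then 1 / (1 + t\<^sup>2) else if k = 1 then t / sqrt (1 + t\<^sup>2)
    else if k = 2 then t\<^sup>2 / (1 + t\<^sup>2) else t / (1 + t\<^sup>2))"

lemma one_plus_square_pos: "0 < 1 + (t::real)\<^sup>2"
  by (simp add: add_pos_nonneg)

lemma slice_coeff_continuous: "continuous_on UNIV (slice_coeff k)"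
proof -
  have "1 + t\<^sup>2 \<noteq> 0" for t :: real using one_plus_square_pos[of t] by linarith
  thus ?thesis unfolding slice_coeff_def
    by (cases "k = 0"; cases "k = 1"; cases "k = 2") (auto intro!: continuous_intros)
qed

lemma slice_coeff_abs: "\<bar>slice_coeff k t\<bar> \<le> 1"
proof -
  note p = one_plus_square_pos[of t]
  have 1: "\<bar>t\<bar> \<le> sqrt (1 + t\<^sup>2)" by (rule real_le_rsqrt) simp
  have 2: "\<bar>t\<bar> \<le> 1 + t\<^sup>2" using zero_le_power2[of "\<bar>t\<bar> - 1"] by (simp add: power2_diff)
  show ?thesis using p 1 2 by (simp add: slice_coeff_def)
qed

lemma slice_coeff_meas [measurable]: "slice_coeff k \<in> borel_measurable borel"
  by (rule borel_measurable_continuous_onI[OF slice_coeff_continuous])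

definition last_field :: "nat \<Rightarrow> real \<Rightarrow> nat \<Rightarrow> real" where
  "last_field N r i = (if i = N then r else 0)"

text \<open>
  The last row and column of the disorder act as a field on the other spins.
\<close>

definition cross :: "nat \<Rightarrow> (nat \<times> nat \<Rightarrow> real) \<Rightarrow> nat \<Rightarrow> real" where
  "cross n x j = x (j, Suc n) + x (Suc n, j)"

lemma energy_tilted:
  "energy (Suc n) b (last_field (Suc n) r) x (tilted n t \<tau>)
    = b * (slice_coeff 0 t * bil n x \<tau> \<tau> + slice_coeff 3 t * (\<Sum>j=1..n. cross n x j * \<tau> j) + slice_coeff 2 t * x (Suc n, Suc n)) + r * slice_coeff 1 t"
proof -
  define u where "u = 1 / sqrt (1 + t\<^sup>2)"
  have uu: "u * u = slice_coeff 0 t" using one_plus_square_pos[of t] by (simp add: u_def slice_coeff_def)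
  have slice_coeff: "slice_coeff 3 t = t * (u * u)" "slice_coeff 2 t = t * t * (u * u)" "slice_coeff 1 t = t * u"
    unfolding uu by (simp_all add: slice_coeff_def u_def power2_eq_square)
  have t1: "tilted n t \<tau> (Suc n) = t * u" and t2: "\<And>i. i \<in> {1..n} \<Longrightarrow> tilted n t \<tau> i = \<tau> i * u"
    by (auto simp: tilted_def u_def)
  have "bil (Suc n) x (tilted n t \<tau>) (tilted n t \<tau>)
      = (\<Sum>i=1..n. \<Sum>j=1..n. x (i, j) * (\<tau> i * u) * (\<tau> j * u)) + (\<Sum>i=1..n. x (i, Suc n) * (\<tau> i * u) * (t * u))
        + ((\<Sum>j=1..n. x (Suc n, j) * (t * u) * (\<tau> j * u)) + x (Suc n, Suc n) * (t * u) * (t * u))"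
    unfolding bil_def by (simp add: t1 t2 sum.distrib)
  also have "\<dots> = u * u * bil n x \<tau> \<tau> + t * (u * u) * (\<Sum>j=1..n. cross n x j * \<tau> j) + t * t * (u * u) * x (Suc n, Suc n)"
    unfolding bil_def cross_def by (simp add: sum_distrib_left sum.distrib distrib_left distrib_right mult_ac)
  finally show ?thesis
    unfolding energy_def slice_coeff uu[symmetric] by (simp add: last_field_def t1 sum.If_cases if_distrib cong: if_cong)
qed

text \<open>
  Jensen's inequality in \<open>t\<close>, inside the exponential average over the slice, leaves an energy on the
  sphere of dimension one less whose coefficients are averages over the window.
\<close>

lemma slice_Phi:
  assumes n: "1 \<le> n" and T: "0 < T"
  defines "A k \<equiv> \<integral>t. slice_coeff k t \<partial>window (1 / real (Suc n)) T"
  shows "real (Suc n) / 2 * ln (1 / (1 + T\<^sup>2)) - ln 8 + ln (T / real (Suc n)) + b * A 2 * x (Suc n, Suc n) + r * A 1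
     + Phi n (b * A 0) (\<lambda>j. b * A 3 * cross n x j) x \<le> Phi (Suc n) b (last_field (Suc n) r) x"
proof -
  let ?N = "real (Suc n)"
  let ?U = "window (1 / ?N) T"
  interpret U: prob_space ?U by (rule prob_space_window) (use T in auto)
  interpret Y: prob_space "uball n" by (rule prob_space_uball)
  interpret P: pair_sigma_finite ?U "uball n" ..
  define H where "H \<tau> = energy (Suc n) b (last_field (Suc n) r) x \<tau>" for \<tau>
  have bco: "bdm ?U (slice_coeff k)" for k by (rule bdmI[where B = 1]) (simp_all add: measurable_window slice_coeff_abs)
  have ico: "integrable ?U (slice_coeff k)" for k by (rule bdm_integrable[OF U.prob_space_axioms bco])
  define e where "e y = energy n (b * A 0) (\<lambda>j. b * A 3 * cross n x j) x (sph n y)" for y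
  define k where "k = b * A 2 * x (Suc n, Suc n) + r * A 1"
  have Ht: "H (tilted n t \<tau>) = b * (slice_coeff 0 t * bil n x \<tau> \<tau> + slice_coeff 3 t * (\<Sum>j=1..n. cross n x j * \<tau> j) + slice_coeff 2 t * x (Suc n, Suc n)) + r * slice_coeff 1 t" for t \<tau>
    unfolding H_def by (rule energy_tilted)
  have avg: "(\<integral>t. H (tilted n t (sph n y)) \<partial>?U) = e y + k" for y
    unfolding Ht using ico
    by (simp add: e_def k_def A_def energy_def sum_distrib_left algebra_simps)
  have bH: "bdm ?U (\<lambda>t. H (tilted n t (sph n y)))" for y
    unfolding Ht by (intro bdm_intros bco)
  have jensen: "exp (e y + k) \<le> (\<integral>t. exp (H (tilted n t (sph n y))) \<partial>?U)" for y
    using log_avg_ge_integral[OF U.prob_space_axioms bH[of y]] exp_avg_pos[OF U.prob_space_axioms bH[of y]]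
    unfolding log_avg_def avg by (simp add: ln_ge_iff)
  have bY: "bdm (uball n) (\<lambda>y. H (tilted n t (sph n y)))" for t
    unfolding Ht bil_def by (intro bdm_intros bdm_sph)
  have sphm: "(\<lambda>p. sph n (snd p) i) \<in> borel_measurable (M \<Otimes>\<^sub>M leb {1..n})" if "i \<in> {1..n}" for i and M :: "real measure"
    by (rule measurable_compose[OF measurable_snd measurable_sph[OF that]])
  have com: "(\<lambda>p. slice_coeff k (fst p)) \<in> borel_measurable (lborel \<Otimes>\<^sub>M leb {1..n})" for k
    by (rule measurable_compose[OF measurable_fst]) simp
  have Fm2: "(\<lambda>(t, y). exp (H (tilted n t (sph n y)))) \<in> borel_measurable (lborel \<Otimes>\<^sub>M leb {1..n})"
    unfolding Ht bil_def case_prod_beta'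
    by (intro borel_measurable_exp[THEN measurable_compose[rotated]] borel_measurable_add borel_measurable_sum
          borel_measurable_times borel_measurable_const sphm com)
  have sets: "sets (?U \<Otimes>\<^sub>M uball n) = sets (lborel \<Otimes>\<^sub>M leb {1..n})"
    by (intro sets_pair_measure_cong sets_uball) (simp add: window_def)
  have Fm3: "(\<lambda>(t, y). ennreal (exp (H (tilted n t (sph n y))))) \<in> borel_measurable (?U \<Otimes>\<^sub>M uball n)"
    using Fm2 measurable_cong_sets[OF sets refl] by (auto simp: case_prod_beta')
  define Z where "Z = (\<integral>y. exp (H (sph (Suc n) y)) \<partial>uball (Suc n))"
  define z where "z = (\<integral>y. exp (e y) \<partial>uball n)"
  have be: "bdm (uball n) e" unfolding e_def by (rule bdm_energy)
  have z0: "0 < z" unfolding z_def by (rule exp_avg_pos[OF prob_space_uball be])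
  have Z0: "0 < Z" unfolding Z_def H_def by (rule exp_avg_pos[OF prob_space_uball bdm_energy])
  define \<rho> where "\<rho> = 1 / sqrt (1 + T\<^sup>2)"
  have \<rho>: "0 < \<rho>" using one_plus_square_pos[of T] by (simp add: \<rho>_def)
  have inner: "(\<lambda>t. \<integral>\<^sup>+y. ennreal (exp (H (tilted n t (sph n y)))) \<partial>uball n) \<in> borel_measurable borel"
    using Y.borel_measurable_nn_integral[OF Fm3] unfolding measurable_window by simp
  have "ennreal (exp k * z) = (\<integral>\<^sup>+y. ennreal (exp (e y + k)) \<partial>uball n)"
    unfolding z_def using be
    by (subst nn_integral_eq_integral) (auto intro!: bdm_integrable[OF prob_space_uball] bdm_exp bdm_add simp: exp_add mult.commute)
  also have "\<dots> \<le> (\<integral>\<^sup>+y. (\<integral>\<^sup>+t. ennreal (exp (H (tilted n t (sph n y)))) \<partial>?U) \<partial>uball n)"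
  proof (rule nn_integral_mono)
    fix y
    have "(\<integral>\<^sup>+t. ennreal (exp (H (tilted n t (sph n y)))) \<partial>?U) = ennreal (\<integral>t. exp (H (tilted n t (sph n y))) \<partial>?U)"
      by (intro nn_integral_eq_integral bdm_integrable[OF U.prob_space_axioms] bdm_exp bH) simp
    thus "ennreal (exp (e y + k)) \<le> (\<integral>\<^sup>+t. ennreal (exp (H (tilted n t (sph n y)))) \<partial>?U)"
      using jensen[of y] by (simp add: ennreal_leI)
  qed
  also have "\<dots> = (\<integral>\<^sup>+t. (\<integral>\<^sup>+y. ennreal (exp (H (tilted n t (sph n y)))) \<partial>uball n) \<partial>?U)"
    by (rule P.Fubini'[OF Fm3])
  finally have 1: "ennreal (exp k * z) \<le> (\<integral>\<^sup>+t. (\<integral>\<^sup>+y. ennreal (exp (H (tilted n t (sph n y)))) \<partial>uball n) \<partial>?U)" .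
  have "ennreal (\<rho> ^ Suc n / 8 * (T * (1 / ?N)) * (exp k * z)) = ennreal (\<rho> ^ Suc n / 8) * (ennreal (T * (1 / ?N)) * ennreal (exp k * z))"
    using \<rho> T z0 by (simp only: mult.assoc) (simp add: ennreal_mult'[symmetric] ennreal_mult''[symmetric])
  also have "\<dots> \<le> ennreal (\<rho> ^ Suc n / 8) * (ennreal (T * (1 / ?N)) * (\<integral>\<^sup>+t. (\<integral>\<^sup>+y. ennreal (exp (H (tilted n t (sph n y)))) \<partial>uball n) \<partial>?U))"
    by (intro mult_left_mono 1) auto
  also have "ennreal (T * (1 / ?N)) * (\<integral>\<^sup>+t. (\<integral>\<^sup>+y. ennreal (exp (H (tilted n t (sph n y)))) \<partial>uball n) \<partial>?U)
     = (\<integral>\<^sup>+t. (\<integral>\<^sup>+y. ennreal (exp (H (tilted n t (sph n y)))) \<partial>uball n) * indicator {T * (1 - 1 / ?N)..T} t \<partial>lborel)"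
    by (rule nn_integral_window[symmetric, OF _ T inner]) simp
  also have "ennreal (\<rho> ^ Suc n / 8) * \<dots> \<le> (\<integral>\<^sup>+y. ennreal (exp (H (sph (Suc n) y))) \<partial>uball (Suc n))"
    unfolding \<rho>_def
  proof (rule slice_lower[OF n _ _ _ _ Fm2])
    show "(\<lambda>y. exp (H (sph (Suc n) y))) \<in> borel_measurable (leb {1..Suc n})"
      using bdm_meas[OF bdm_exp[OF bdm_energy]] unfolding measurable_uball H_def by blast
    show "exp (H \<sigma>) = exp (H \<tau>)" if "\<And>i. i \<in> {1..Suc n} \<Longrightarrow> \<sigma> i = \<tau> i" for \<sigma> \<tau>
      unfolding H_def using energy_cong[OF that] by simp
    show "(\<integral>\<^sup>+y. ennreal (exp (H (tilted n t (sph n y)))) \<partial>uball n) < \<infinity>" for t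
      by (subst nn_integral_eq_integral) (auto intro!: bdm_integrable[OF prob_space_uball] bdm_exp bY)
  qed (use T in auto)
  also have "\<dots> = ennreal Z" unfolding Z_def H_def
    by (intro nn_integral_eq_integral bdm_integrable[OF prob_space_uball] bdm_exp bdm_energy) simp
  finally have "\<rho> ^ Suc n / 8 * (T * (1 / ?N)) * (exp k * z) \<le> Z" using Z0 by (simp add: ennreal_le_iff)
  moreover have p: "0 < \<rho> ^ Suc n / 8" "0 < T * (1 / ?N)" "0 < exp k * z" using \<rho> T z0 by auto
  ultimately have "ln (\<rho> ^ Suc n / 8 * (T * (1 / ?N)) * (exp k * z)) \<le> ln Z"
    using Z0 by (subst ln_le_cancel_iff) (intro mult_pos_pos p | assumption)+
  moreover have "ln (\<rho> ^ Suc n / 8 * (T * (1 / ?N)) * (exp k * z)) = (ln (\<rho> ^ Suc n) - ln 8) + ln (T / ?N) + (k + ln z)"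
  proof -
    have "ln (\<rho> ^ Suc n / 8 * (T * (1 / ?N)) * (exp k * z)) = ln (\<rho> ^ Suc n / 8) + ln (T * (1 / ?N)) + ln (exp k * z)"
      using p by (simp only: ln_mult_pos mult_pos_pos)
    thus ?thesis using \<rho> z0 by (simp add: ln_div ln_mult_pos)
  qed
  moreover have "ln (\<rho> ^ Suc n) = ?N / 2 * ln (1 / (1 + T\<^sup>2))"
    using \<rho> one_plus_square_pos[of T] by (simp only: ln_realpow) (simp add: \<rho>_def ln_div ln_sqrt)
  ultimately show ?thesis
    unfolding Phi_def log_avg_def k_def Z_def H_def z_def e_def by simp
qed

lemma gauss_chi_square:
  assumes I: "finite I" and J: "J \<subseteq> I"
  shows "integrable (gauss I) (\<lambda>x. (\<Sum>k\<in>J. (x k)\<^sup>2 - 1)\<^sup>2)"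
    and "(\<integral>x. (\<Sum>k\<in>J. (x k)\<^sup>2 - 1)\<^sup>2 \<partial>gauss I) = 2 * real (card J)"
proof -
  have J': "finite J" using I J by (rule finite_subset[rotated])
  let ?g = "\<lambda>t::real. t\<^sup>2 - 1"
  interpret M: prob_space std_normal_distribution by (rule prob_space_normal_density) simp
  have 1: "integrable std_normal_distribution (\<lambda>t. t\<^sup>2)" "integrable std_normal_distribution (\<lambda>t. t ^ 4)"
    by (rule std_normal_moments(4))+
  have c1: "(\<integral>t. (1::real) \<partial>std_normal_distribution) = 1" using M.prob_space by simp
  have g: "integrable std_normal_distribution ?g" "(\<integral>t. ?g t \<partial>std_normal_distribution) = 0"
    using 1 std_normal_moments(2) M.prob_space by (simp_all add: c1)
  have gg: "?g t * ?g t = t ^ 4 - 2 * t\<^sup>2 + 1" for t by (simp add: power2_eq_square power4_eq_xxxx algebra_simps)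
  have g2: "integrable std_normal_distribution (\<lambda>t. ?g t * ?g t)" "(\<integral>t. ?g t * ?g t \<partial>std_normal_distribution) = 2"
    unfolding gg using 1 std_normal_moments(2,3) M.prob_space by (simp_all add: c1)
  have p: "integrable (gauss I) (\<lambda>x. ?g (x k) * ?g (x l))"
    "(\<integral>x. ?g (x k) * ?g (x l) \<partial>gauss I) = (if k = l then 2 else 0)" if "k \<in> J" "l \<in> J" for k l
  proof -
    have kl: "k \<in> I" "l \<in> I" using that J by auto
    have "integrable (gauss I) (\<lambda>x. ?g (x k) * ?g (x l)) \<and> (\<integral>x. ?g (x k) * ?g (x l) \<partial>gauss I) = (if k = l then 2 else 0)"
    proof (cases "k = l")
      case True
      thus ?thesis using integral_gauss_component[OF kl(1), of "\<lambda>t. ?g t * ?g t"] g2 by simp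
    next
      case False
      thus ?thesis using gauss_prod2[OF I kl False g(1) g(1)] unfolding g(2) by simp
    qed
    thus "integrable (gauss I) (\<lambda>x. ?g (x k) * ?g (x l))"
      "(\<integral>x. ?g (x k) * ?g (x l) \<partial>gauss I) = (if k = l then 2 else 0)" by blast+
  qed
  have e: "(\<Sum>k\<in>J. (x k)\<^sup>2 - 1)\<^sup>2 = (\<Sum>k\<in>J. \<Sum>l\<in>J. ?g (x k) * ?g (x l))" for x :: "'a \<Rightarrow> real"
    by (simp only: power2_eq_square[of "\<Sum>k\<in>J. (x k)\<^sup>2 - 1"] sum_product)
  show "integrable (gauss I) (\<lambda>x. (\<Sum>k\<in>J. (x k)\<^sup>2 - 1)\<^sup>2)"
    unfolding e by (intro Bochner_Integration.integrable_sum p)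
  have "(\<integral>x. (\<Sum>k\<in>J. (x k)\<^sup>2 - 1)\<^sup>2 \<partial>gauss I) = (\<Sum>k\<in>J. \<integral>x. (\<Sum>l\<in>J. ?g (x k) * ?g (x l)) \<partial>gauss I)"
    unfolding e by (intro Bochner_Integration.integral_sum Bochner_Integration.integrable_sum p)
  also have "\<dots> = (\<Sum>k\<in>J. \<Sum>l\<in>J. \<integral>x. ?g (x k) * ?g (x l) \<partial>gauss I)"
    by (intro sum.cong refl Bochner_Integration.integral_sum p)
  also have "\<dots> = (\<Sum>k\<in>J. \<Sum>l\<in>J. if k = l then 2 else 0)" by (intro sum.cong refl p)
  also have "\<dots> = 2 * real (card J)" using J' by simp
  finally show "(\<integral>x. (\<Sum>k\<in>J. (x k)\<^sup>2 - 1)\<^sup>2 \<partial>gauss I) = 2 * real (card J)" .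
qed

text \<open>
  The length \<open>L\<close> satisfies \<open>|L - sqrt n| \<le> |L\<^sup>2 - n| / sqrt n\<close>, and \<open>L\<^sup>2\<close> has mean \<open>n\<close> and variance
  \<open>2 n\<close>.
\<close>

lemma gauss_length:
  assumes I: "finite I" and h: "\<And>j. j \<in> {1..n} \<Longrightarrow> h j \<in> I" "inj_on h {1..n}" and n: "1 \<le> n"
  shows "integrable (gauss I) (\<lambda>x. \<bar>c * L2_set (\<lambda>j. x (h j)) {1..n} - m\<bar>)"
    and "(\<integral>x. \<bar>c * L2_set (\<lambda>j. x (h j)) {1..n} - m\<bar> \<partial>gauss I) \<le> 3 / 2 * \<bar>c\<bar> + \<bar>c * sqrt (real n) - m\<bar>"
proof -
  interpret prob_space "gauss I" by (rule prob_space_gauss)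
  let ?L = "\<lambda>x. L2_set (\<lambda>j. x (h j)) {1..n}"
  have n0: "0 < sqrt (real n)" using n by simp
  define Y where "Y x = (\<Sum>k\<in>h ` {1..n}. (x k)\<^sup>2 - 1)" for x :: "'a \<Rightarrow> real"
  have Ye: "Y x = (?L x)\<^sup>2 - real n" for x
    unfolding Y_def L2_square using h(2) by (simp add: sum.reindex sum_subtractf card_image)
  have Y2: "integrable (gauss I) (\<lambda>x. (Y x)\<^sup>2)" "(\<integral>x. (Y x)\<^sup>2 \<partial>gauss I) = 2 * real n"
  proof -
    have "card (h ` {1..n}) = n" by (simp add: card_image[OF h(2)])
    moreover have "h ` {1..n} \<subseteq> I" using h(1) by blast
    ultimately show "integrable (gauss I) (\<lambda>x. (Y x)\<^sup>2)" "(\<integral>x. (Y x)\<^sup>2 \<partial>gauss I) = 2 * real n"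
      unfolding Y_def using gauss_chi_square[OF I, of "h ` {1..n}"] by simp_all
  qed
  define B where "B x = \<bar>c\<bar> * (((Y x)\<^sup>2 / sqrt (real n) + sqrt (real n)) / 2 / sqrt (real n)) + \<bar>c * sqrt (real n) - m\<bar>" for x
  have iB: "integrable (gauss I) B" unfolding B_def using Y2(1) by simp
  have LB: "\<bar>c * ?L x - m\<bar> \<le> B x" for x
  proof -
    have L0: "0 \<le> ?L x" by (rule L2_set_nonneg)
    have "\<bar>?L x - sqrt (real n)\<bar> * sqrt (real n) \<le> \<bar>?L x - sqrt (real n)\<bar> * (?L x + sqrt (real n))"
      using L0 by (intro mult_left_mono) auto
    also have "\<dots> = \<bar>(?L x - sqrt (real n)) * (?L x + sqrt (real n))\<bar>" using L0 by (simp add: abs_mult)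
    also have "(?L x - sqrt (real n)) * (?L x + sqrt (real n)) = Y x" unfolding Ye by (simp add: algebra_simps power2_eq_square)
    finally have 1: "\<bar>?L x - sqrt (real n)\<bar> \<le> \<bar>Y x\<bar> / sqrt (real n)" using n0 by (simp add: field_simps)
    have "0 \<le> (Y x)\<^sup>2 + (sqrt (real n))\<^sup>2 - 2 * \<bar>Y x\<bar> * sqrt (real n)"
      using zero_le_power2[of "\<bar>Y x\<bar> - sqrt (real n)"] unfolding power2_diff power2_abs .
    hence "2 * \<bar>Y x\<bar> * sqrt (real n) \<le> (Y x)\<^sup>2 + sqrt (real n) * sqrt (real n)"
      unfolding power2_eq_square[of "sqrt (real n)"] by linarith
    hence "\<bar>Y x\<bar> \<le> ((Y x)\<^sup>2 / sqrt (real n) + sqrt (real n)) / 2" using n0 by (simp add: field_simps)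
    hence "\<bar>Y x\<bar> / sqrt (real n) \<le> ((Y x)\<^sup>2 / sqrt (real n) + sqrt (real n)) / 2 / sqrt (real n)"
      using n0 by (intro divide_right_mono) auto
    hence "\<bar>c\<bar> * \<bar>?L x - sqrt (real n)\<bar> \<le> \<bar>c\<bar> * (((Y x)\<^sup>2 / sqrt (real n) + sqrt (real n)) / 2 / sqrt (real n))"
      using 1 by (intro mult_left_mono) auto
    moreover have "\<bar>c * ?L x - m\<bar> \<le> \<bar>c\<bar> * \<bar>?L x - sqrt (real n)\<bar> + \<bar>c * sqrt (real n) - m\<bar>"
      unfolding abs_mult[symmetric] by (simp add: right_diff_distrib)
    ultimately show ?thesis unfolding B_def by linarith
  qed
  have "(\<lambda>x. \<Sum>i=1..n. (x (h i))\<^sup>2) \<in> borel_measurable (gauss I)"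
    by (intro borel_measurable_sum borel_measurable_power measurable_gauss_component h)
  hence Lm: "?L \<in> borel_measurable (gauss I)" unfolding L2_set_def by measurable
  show i: "integrable (gauss I) (\<lambda>x. \<bar>c * ?L x - m\<bar>)"
  proof (rule Bochner_Integration.integrable_bound[OF iB])
    show "(\<lambda>x. \<bar>c * ?L x - m\<bar>) \<in> borel_measurable (gauss I)" using Lm by measurable
    have "\<bar>\<bar>c * ?L x - m\<bar>\<bar> \<le> \<bar>B x\<bar>" for x using LB[of x] by linarith
    thus "AE x in gauss I. norm \<bar>c * ?L x - m\<bar> \<le> norm (B x)" by simp
  qed
  have "(\<integral>x. \<bar>c * ?L x - m\<bar> \<partial>gauss I) \<le> (\<integral>x. B x \<partial>gauss I)" by (intro integral_mono i iB LB)
  also have "\<dots> = \<bar>c\<bar> * ((2 * real n / sqrt (real n) + sqrt (real n)) / 2 / sqrt (real n)) + \<bar>c * sqrt (real n) - m\<bar>"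
    unfolding B_def using Y2 by (simp add: prob_space)
  also have "(2 * real n / sqrt (real n) + sqrt (real n)) / 2 / sqrt (real n) = 3 / 2"
    using n0 by (simp add: field_simps)
  finally show "(\<integral>x. \<bar>c * ?L x - m\<bar> \<partial>gauss I) \<le> 3 / 2 * \<bar>c\<bar> + \<bar>c * sqrt (real n) - m\<bar>" by simp
qed

text \<open>
  Up to the factor \<open>sqrt 2\<close> the field \<open>cross n x\<close> is a standard Gaussian vector: reflections in the planes
  of the coordinates \<open>(k, n + 1)\<close> and \<open>(n + 1, k)\<close> carry it to the last column.
\<close>

lemma cross_length:
  assumes n: "1 \<le> n"
  defines "I \<equiv> idx (Suc n)"
  shows "integrable (gauss I) (\<lambda>x. \<bar>L2_set (\<lambda>j. c * cross n x j) {1..n} - m\<bar>)"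
    and "(\<integral>x. \<bar>L2_set (\<lambda>j. c * cross n x j) {1..n} - m\<bar> \<partial>gauss I)
      \<le> 3 * \<bar>c\<bar> + \<bar>sqrt 2 * \<bar>c\<bar> * sqrt (real n) - m\<bar>"
proof -
  define a where "a = (1 / sqrt 2 :: real)"
  have a: "0 < a" "a \<le> 1" "a * a = 1 / 2" "sqrt 2 * a = 1" by (auto simp: a_def)
  \<comment> \<open>the reflection along \<open>(w1, w2)\<close> maps the first coordinate to \<open>a\<close> times the sum of both\<close>
  define w1 where "w1 = sqrt ((1 - a) / 2)"
  define w2 where "w2 = - sqrt ((1 + a) / 2)"
  have w: "w1 * w1 = (1 - a) / 2" "w2 * w2 = (1 + a) / 2" using a by (auto simp: w1_def w2_def)
  have w12: "w1 * w2 = - (a / 2)"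
  proof -
    have "(1 - a) / 2 * ((1 + a) / 2) = (a / 2)\<^sup>2" using a(3) by (simp add: power2_eq_square field_simps)
    thus ?thesis using a(1) unfolding w1_def w2_def by (simp flip: real_sqrt_mult)
  qed
  define W where "W k p = (if p = (k, Suc n) then w1 else if p = (Suc n, k) then w2 else 0)" for k p
  have I: "finite I" by (simp add: I_def)
  have mem: "(k, Suc n) \<in> I" "(Suc n, k) \<in> I" "(k, Suc n) \<noteq> (Suc n, k)" if "k \<in> {1..n}" for k
    using that by (auto simp: I_def idx_def)
  have W: "(\<Sum>p\<in>I. W k p * g p) = w1 * g (k, Suc n) + w2 * g (Suc n, k)" if k: "k \<in> {1..n}" for k g
  proof -
    have "(\<Sum>p\<in>I. W k p * g p) = (\<Sum>p\<in>{(k, Suc n), (Suc n, k)}. W k p * g p)"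
      using mem[OF k] I by (intro sum.mono_neutral_right) (auto simp: W_def)
    thus ?thesis using mem(3)[OF k] by (simp add: W_def)
  qed
  define T where "T x = (\<lambda>p\<in>I. x p - 2 * (\<Sum>k=1..n. (\<Sum>q\<in>I. W k q * x q) * W k p))" for x :: "nat \<times> nat \<Rightarrow> real"
  have T: "T x (k, Suc n) = a * cross n x k" if k: "k \<in> {1..n}" for x k
  proof -
    have "(\<Sum>l=1..n. (\<Sum>q\<in>I. W l q * x q) * W l (k, Suc n)) = (\<Sum>l=1..n. if l = k then (w1 * x (k, Suc n) + w2 * x (Suc n, k)) * w1 else 0)"
      by (intro sum.cong refl) (simp only: W, auto simp: W_def)
    hence "T x (k, Suc n) = x (k, Suc n) - 2 * ((w1 * x (k, Suc n) + w2 * x (Suc n, k)) * w1)"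
      using k mem(1)[OF k] by (simp add: T_def)
    also have "\<dots> = (1 - 2 * (w1 * w1)) * x (k, Suc n) - 2 * (w1 * w2) * x (Suc n, k)" by (simp add: algebra_simps)
    also have "\<dots> = a * cross n x k" unfolding w w12 by (simp add: cross_def field_simps)
    finally show ?thesis .
  qed
  define f where "f x = \<bar>sqrt 2 * \<bar>c\<bar> * L2_set (\<lambda>j. x (j, Suc n)) {1..n} - m\<bar>" for x :: "nat \<times> nat \<Rightarrow> real"
  have fT: "f (T x) = \<bar>L2_set (\<lambda>j. c * cross n x j) {1..n} - m\<bar>" for x
  proof -
    have "L2_set (\<lambda>j. c * cross n x j) {1..n} = \<bar>c\<bar> * L2_set (cross n x) {1..n}"
    proof -
      have "L2_set (\<lambda>j. c * cross n x j) {1..n} = L2_set (\<lambda>j. \<bar>c\<bar> * cross n x j) {1..n}"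
        by (simp add: L2_set_def power_mult_distrib)
      thus ?thesis by (simp add: L2_set_right_distrib)
    qed
    moreover have "L2_set (\<lambda>j. T x (j, Suc n)) {1..n} = a * L2_set (cross n x) {1..n}"
    proof -
      have "L2_set (\<lambda>j. T x (j, Suc n)) {1..n} = L2_set (\<lambda>j. a * cross n x j) {1..n}"
        by (rule L2_set_cong[OF refl]) (rule T)
      thus ?thesis using a(1) by (simp add: L2_set_right_distrib)
    qed
    ultimately show ?thesis unfolding f_def using a(4)
      by (metis (no_types, lifting) mult.assoc mult.commute mult_1)
  qed
  note L = gauss_length[OF I, of n "\<lambda>j. (j, Suc n)", OF mem(1) _ n, of "sqrt 2 * \<bar>c\<bar>" m, folded f_def]
  have fi: "integrable (gauss I) f" by (rule L(1)) (auto simp: inj_on_def)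
  have Tm: "T \<in> measurable (gauss I) (gauss I)"
    unfolding T_def
    by (rule measurable_restrict_gauss)
       (intro borel_measurable_diff borel_measurable_times borel_measurable_sum borel_measurable_const measurable_gauss_component)
  have nn: "(\<integral>\<^sup>+x. ennreal (f (T x)) \<partial>gauss I) = (\<integral>\<^sup>+x. ennreal (f x) \<partial>gauss I)"
    unfolding T_def
  proof (rule nn_integral_gauss_orthonormal_refl[OF I])
    show "(\<Sum>p\<in>I. (W k p)\<^sup>2) = 1" if "k \<in> {1..n}" for k
    proof -
      have "(\<Sum>p\<in>I. (W k p)\<^sup>2) = w1 * W k (k, Suc n) + w2 * W k (Suc n, k)"
        using W[OF that, of "W k"] by (simp only: power2_eq_square)
      also have "\<dots> = w1 * w1 + w2 * w2" using mem(3)[OF that] by (simp add: W_def)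
      also have "\<dots> = 1" unfolding w by (simp add: field_simps)
      finally show ?thesis .
    qed
    show "(\<Sum>p\<in>I. W k p * W l p) = 0" if "k \<in> {1..n}" "l \<in> {1..n}" "k \<noteq> l" for k l
      using W[OF that(1), of "W l"] that by (auto simp: W_def)
    show "(\<lambda>x. ennreal (f x)) \<in> borel_measurable (gauss I)" using borel_measurable_integrable[OF fi] by measurable
  qed simp
  have f0: "0 \<le> f x" for x by (simp add: f_def)
  have fTm: "(\<lambda>x. f (T x)) \<in> borel_measurable (gauss I)"
    by (rule measurable_compose[OF Tm borel_measurable_integrable[OF fi]])
  have "(\<integral>\<^sup>+x. ennreal (f x) \<partial>gauss I) < \<infinity>"
    using fi f0 by (simp add: nn_integral_eq_integral)
  hence "(\<integral>\<^sup>+x. ennreal (norm (f (T x))) \<partial>gauss I) < \<infinity>" unfolding nn[symmetric] using f0 by simp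
  hence fTi: "integrable (gauss I) (\<lambda>x. f (T x))" using fTm by (simp add: integrable_iff_bounded)
  thus "integrable (gauss I) (\<lambda>x. \<bar>L2_set (\<lambda>j. c * cross n x j) {1..n} - m\<bar>)" unfolding fT .
  have "(\<integral>x. f (T x) \<partial>gauss I) = (\<integral>x. f x \<partial>gauss I)"
    using nn fTm borel_measurable_integrable[OF fi] f0 by (simp add: integral_eq_nn_integral)
  also have "\<dots> \<le> 3 / 2 * \<bar>sqrt 2 * \<bar>c\<bar>\<bar> + \<bar>sqrt 2 * \<bar>c\<bar> * sqrt (real n) - m\<bar>"
    by (rule L(2)) (auto simp: inj_on_def)
  also have "3 / 2 * \<bar>sqrt 2 * \<bar>c\<bar>\<bar> \<le> 3 * \<bar>c\<bar>"
  proof -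
    have "sqrt 2 \<le> sqrt 4" by (intro real_sqrt_le_mono) simp
    hence "sqrt 2 * \<bar>c\<bar> \<le> 2 * \<bar>c\<bar>" by (intro mult_right_mono) auto
    thus ?thesis by (simp add: abs_mult mult.commute)
  qed
  finally show "(\<integral>x. \<bar>L2_set (\<lambda>j. c * cross n x j) {1..n} - m\<bar> \<partial>gauss I)
      \<le> 3 * \<bar>c\<bar> + \<bar>sqrt 2 * \<bar>c\<bar> * sqrt (real n) - m\<bar>" unfolding fT by simp
qed

lemma L2_last_field: "1 \<le> n \<Longrightarrow> L2_set (last_field n r) {1..n} = \<bar>r\<bar>"
proof -
  assume n: "1 \<le> n"
  have "(\<Sum>i=1..n. (last_field n r i)\<^sup>2) = (\<Sum>i=1..n. if i = n then r\<^sup>2 else 0)"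
    by (intro sum.cong) (auto simp: last_field_def)
  thus ?thesis using n by (simp add: L2_set_def)
qed

text \<open>
  The minor of the disorder is independent of the last row and column, so the random field seen by
  the remaining spins may be replaced by a deterministic one of nearly the same length.
\<close>

lemma shortfall_cross:
  assumes n: "1 \<le> n" and m: "0 \<le> m"
  shows "(\<integral>x. max 0 (c - Phi n b (\<lambda>j. k * cross n x j) x) \<partial>gauss (idx (Suc n)))
    \<le> shortfall n b (last_field n m) c + 3 * \<bar>k\<bar> + \<bar>sqrt 2 * \<bar>k\<bar> * sqrt (real n) - m\<bar>"
    and "integrable (gauss (idx (Suc n))) (\<lambda>x. max 0 (c - Phi n b (\<lambda>j. k * cross n x j) x))"
proof -
  interpret product_prob_space "\<lambda>_::nat \<times> nat. std_normal_distribution" by (rule product_prob_space_gauss)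
  let ?I = "idx (Suc n)"
  define L where "L = ?I - idx n"
  interpret GL: prob_space "gauss L" by (rule prob_space_gauss)
  interpret GI: prob_space "gauss ?I" by (rule prob_space_gauss)
  interpret Gn: prob_space "gauss (idx n)" by (rule prob_space_gauss)
  have LI: "L \<inter> idx n = {}" "finite L" "L \<union> idx n = ?I" by (auto simp: L_def idx_def)
  have memL: "(j, Suc n) \<in> L" "(Suc n, j) \<in> L" if "j \<in> {1..n}" for j
    using that by (auto simp: L_def idx_def)
  define D where "D x = \<bar>L2_set (\<lambda>j. k * cross n x j) {1..n} - m\<bar>" for x
  have Di: "integrable (gauss ?I) D" unfolding D_def by (rule cross_length(1)[OF n])
  define G where "G x = max 0 (c - Phi n b (\<lambda>j. k * cross n x j) x)" for x
  have Gm: "G \<in> borel_measurable (gauss ?I)"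
  proof -
    have "(\<lambda>x. Phi n b (\<lambda>j. k * cross n x j) x) \<in> borel_measurable (gauss ?I)"
      unfolding cross_def
      by (rule Phi_measurable)
         (auto intro!: borel_measurable_times borel_measurable_add measurable_gauss_component simp: idx_def)
    thus ?thesis unfolding G_def by measurable
  qed
  have Gi: "integrable (gauss ?I) G"
  proof (rule Bochner_Integration.integrable_bound)
    show "integrable (gauss ?I) (\<lambda>x. \<bar>c\<bar> + \<bar>b\<bar> * (\<Sum>p\<in>idx n. \<bar>x p\<bar>) + (\<Sum>i=1..n. \<bar>k\<bar> * (\<bar>x (i, Suc n)\<bar> + \<bar>x (Suc n, i)\<bar>)))"
      using integrable_gauss_abs_sum[of "idx n" ?I]
      by (intro Bochner_Integration.integrable_add integrable_mult_right Bochner_Integration.integrable_sum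
            integrable_abs integrable_gauss_id GI.integrable_const) (auto simp: idx_def)
    have "\<bar>G x\<bar> \<le> \<bar>c\<bar> + \<bar>b\<bar> * (\<Sum>p\<in>idx n. \<bar>x p\<bar>) + (\<Sum>i=1..n. \<bar>k\<bar> * (\<bar>x (i, Suc n)\<bar> + \<bar>x (Suc n, i)\<bar>))" for x
    proof -
      have "(\<Sum>i=1..n. \<bar>k * cross n x i\<bar>) \<le> (\<Sum>i=1..n. \<bar>k\<bar> * (\<bar>x (i, Suc n)\<bar> + \<bar>x (Suc n, i)\<bar>))"
        unfolding abs_mult cross_def by (intro sum_mono mult_left_mono abs_triangle_ineq) auto
      thus ?thesis using Phi_abs[of n b "\<lambda>j. k * cross n x j" x] unfolding G_def by linarith
    qed
    thus "AE x in gauss ?I. norm (G x) \<le> norm (\<bar>c\<bar> + \<bar>b\<bar> * (\<Sum>p\<in>idx n. \<bar>x p\<bar>) + (\<Sum>i=1..n. \<bar>k\<bar> * (\<bar>x (i, Suc n)\<bar> + \<bar>x (Suc n, i)\<bar>)))"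
      by (intro AE_I2) (smt (verit) real_norm_def)
  qed (rule Gm)
  thus "integrable (gauss ?I) (\<lambda>x. max 0 (c - Phi n b (\<lambda>j. k * cross n x j) x))" unfolding G_def .
  have fold: "(\<integral>x. F x \<partial>gauss ?I) = (\<integral>z. (\<integral>y. F (merge L (idx n) (z, y)) \<partial>gauss (idx n)) \<partial>gauss L)"
    and foldi: "integrable (gauss L) (\<lambda>z. \<integral>y. F (merge L (idx n) (z, y)) \<partial>gauss (idx n))"
    if F: "integrable (gauss ?I) F" for F :: "(nat \<times> nat \<Rightarrow> real) \<Rightarrow> real"
  proof -
    show "(\<integral>x. F x \<partial>gauss ?I) = (\<integral>z. (\<integral>y. F (merge L (idx n) (z, y)) \<partial>gauss (idx n)) \<partial>gauss L)"
      using product_integral_fold[of L "idx n" F] LI F unfolding gauss_def by simp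
    interpret PP: pair_prob_space "gauss L" "gauss (idx n)" ..
    have dm: "distr (gauss L \<Otimes>\<^sub>M gauss (idx n)) (gauss ?I) (merge L (idx n)) = gauss ?I"
      unfolding gauss_def using distr_merge[of L "idx n"] LI by simp
    have "merge L (idx n) \<in> measurable (gauss L \<Otimes>\<^sub>M gauss (idx n)) (gauss ?I)"
      unfolding gauss_def LI(3)[symmetric] by (rule measurable_merge)
    hence "integrable (gauss L \<Otimes>\<^sub>M gauss (idx n)) (\<lambda>p. F (merge L (idx n) p))"
      by (rule integrable_distr) (simp add: dm F)
    thus "integrable (gauss L) (\<lambda>z. \<integral>y. F (merge L (idx n) (z, y)) \<partial>gauss (idx n))"
      by (rule PP.integrable_fst')
  qed
  have cm: "cross n (merge L (idx n) (z, y)) j = cross n z j" if "j \<in> {1..n}" for z y j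
    unfolding cross_def using memL[OF that] by (simp add: merge_def)
  have Dm: "D (merge L (idx n) (z, y)) = D z" for z y
  proof -
    have "L2_set (\<lambda>j. k * cross n (merge L (idx n) (z, y)) j) {1..n} = L2_set (\<lambda>j. k * cross n z j) {1..n}"
      by (rule L2_set_cong[OF refl]) (simp only: cm)
    thus ?thesis unfolding D_def by simp
  qed
  have inner: "(\<integral>y. G (merge L (idx n) (z, y)) \<partial>gauss (idx n)) \<le> shortfall n b (last_field n m) c + D z" for z
  proof -
    let ?v = "\<lambda>j. k * cross n z j"
    have "G (merge L (idx n) (z, y)) = max 0 (c - Phi n b ?v y)" for y
      unfolding G_def using LI(1) cm
      by (intro arg_cong2[where f = max] arg_cong2[where f = "(-)"] refl Phi_cong) auto
    hence "(\<integral>y. G (merge L (idx n) (z, y)) \<partial>gauss (idx n)) = shortfall n b ?v c"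
      unfolding shortfall_def by simp
    also have "\<dots> = shortfall n b (last_field n (L2_set ?v {1..n})) c"
      by (rule shortfall_rotation[OF n]) (simp add: L2_last_field[OF n] L2_set_nonneg)
    also have "\<dots> \<le> shortfall n b (last_field n m) c
        + L2_set (\<lambda>i. last_field n m i - last_field n (L2_set ?v {1..n}) i) {1..n} + \<bar>c - c\<bar>"
      by (rule shortfall_lipschitz[OF n])
    also have "(\<lambda>i. last_field n m i - last_field n (L2_set ?v {1..n}) i) = last_field n (m - L2_set ?v {1..n})"
      by (auto simp: last_field_def)
    finally show ?thesis unfolding L2_last_field[OF n] D_def by (simp add: abs_minus_commute)
  qed
  have DL: "integrable (gauss L) D"
    using foldi[OF Di] Gn.prob_space unfolding Dm by simp
  have "(\<integral>x. G x \<partial>gauss ?I) = (\<integral>z. (\<integral>y. G (merge L (idx n) (z, y)) \<partial>gauss (idx n)) \<partial>gauss L)"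
    by (rule fold[OF Gi])
  also have "\<dots> \<le> (\<integral>z. shortfall n b (last_field n m) c + D z \<partial>gauss L)"
    using foldi[OF Gi] DL inner by (intro integral_mono) auto
  also have "\<dots> = shortfall n b (last_field n m) c + (\<integral>z. D z \<partial>gauss L)"
    using DL by (simp add: GL.prob_space)
  also have "(\<integral>z. D z \<partial>gauss L) = (\<integral>x. D x \<partial>gauss ?I)"
    using fold[OF Di] Gn.prob_space unfolding Dm by simp
  also have "\<dots> \<le> 3 * \<bar>k\<bar> + \<bar>sqrt 2 * \<bar>k\<bar> * sqrt (real n) - m\<bar>"
    unfolding D_def by (rule cross_length(2)[OF n])
  finally show "(\<integral>x. max 0 (c - Phi n b (\<lambda>j. k * cross n x j) x) \<partial>gauss ?I)
    \<le> shortfall n b (last_field n m) c + 3 * \<bar>k\<bar> + \<bar>sqrt 2 * \<bar>k\<bar> * sqrt (real n) - m\<bar>"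
    unfolding G_def by simp
qed

text \<open>
  \<open>lower_limit \<beta> h c\<close> means that \<open>c\<close> is a lower bound for the limiting free energy at inverse
  temperature \<open>\<beta>\<close> and field strength \<open>h\<close>.  Admitting all asymptotically equivalent parameters makes
  the notion insensitive to the passage from dimension \<open>n\<close> to \<open>n + 1\<close>.
\<close>

definition lower_limit :: "real \<Rightarrow> real \<Rightarrow> real \<Rightarrow> bool" where
  "lower_limit \<beta> h c \<longleftrightarrow> (\<forall>b v. (\<lambda>n. b n / sqrt (real n)) \<longlonglongrightarrow> \<beta> \<longrightarrow> (\<lambda>n. L2_set (v n) {1..n} / real n) \<longlonglongrightarrow> h
     \<longrightarrow> (\<lambda>n. shortfall n (b n) (v n) (real n * c) / real n) \<longlonglongrightarrow> 0)"

lemma shortfall_step: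
  assumes n: "1 \<le> n" and T: "0 < T" and m: "0 \<le> m"
  defines "A k \<equiv> \<integral>t. slice_coeff k t \<partial>window (1 / real (Suc n)) T"
  shows "shortfall (Suc n) b (last_field (Suc n) r) c
    \<le> shortfall n (b * A 0) (last_field n m) d + 3 * \<bar>b * A 3\<bar> + \<bar>sqrt 2 * \<bar>b * A 3\<bar> * sqrt (real n) - m\<bar> + \<bar>b * A 2\<bar>
      + \<bar>c - (real (Suc n) / 2 * ln (1 / (1 + T\<^sup>2)) - ln 8 + ln (T / real (Suc n)) + r * A 1) - d\<bar>"
proof -
  let ?I = "idx (Suc n)"
  interpret prob_space "gauss ?I" by (rule prob_space_gauss)
  define E where "E = \<bar>c - (real (Suc n) / 2 * ln (1 / (1 + T\<^sup>2)) - ln 8 + ln (T / real (Suc n)) + r * A 1) - d\<bar>"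
  define G where "G x = max 0 (d - Phi n (b * A 0) (\<lambda>j. (b * A 3) * cross n x j) x)" for x
  have N: "(Suc n, Suc n) \<in> ?I" by (simp add: idx_def)
  have Gi: "integrable (gauss ?I) G" unfolding G_def by (rule shortfall_cross(2)[OF n m])
  have iN: "integrable (gauss ?I) (\<lambda>x. \<bar>b * A 2\<bar> * \<bar>x (Suc n, Suc n)\<bar>)" using N by simp
  have "shortfall (Suc n) b (last_field (Suc n) r) c \<le> (\<integral>x. G x + \<bar>b * A 2\<bar> * \<bar>x (Suc n, Suc n)\<bar> + E \<partial>gauss ?I)"
    unfolding shortfall_def
  proof (rule integral_mono)
    fix x
    have "b * A 2 * x (Suc n, Suc n) \<ge> - (\<bar>b * A 2\<bar> * \<bar>x (Suc n, Suc n)\<bar>)"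
      unfolding abs_mult[symmetric] by linarith
    thus "max 0 (c - Phi (Suc n) b (last_field (Suc n) r) x) \<le> G x + \<bar>b * A 2\<bar> * \<bar>x (Suc n, Suc n)\<bar> + E"
      using slice_Phi[OF n T, of b x r] mult_nonneg_nonneg[OF abs_ge_zero abs_ge_zero, of "b * A 2" "x (Suc n, Suc n)"]
      unfolding A_def[symmetric] G_def E_def by linarith
  qed (use Gi iN integrable_shortfall in auto)
  also have "\<dots> = (\<integral>x. G x \<partial>gauss ?I) + \<bar>b * A 2\<bar> * (\<integral>x. \<bar>x (Suc n, Suc n)\<bar> \<partial>gauss ?I) + E"
    using Gi iN N by (simp add: prob_space)
  also have "\<dots> \<le> (shortfall n (b * A 0) (last_field n m) d + 3 * \<bar>b * A 3\<bar> + \<bar>sqrt 2 * \<bar>b * A 3\<bar> * sqrt (real n) - m\<bar>) + \<bar>b * A 2\<bar> * 1 + E"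
    unfolding G_def by (intro add_mono mult_left_mono shortfall_cross(1)[OF n m] gauss_abs_le N) auto
  finally show ?thesis unfolding E_def by simp
qed

lemma shift_lim: "f \<longlonglongrightarrow> (l::real) \<Longrightarrow> (\<lambda>n. f (Suc n)) \<longlonglongrightarrow> l"
  by (rule LIMSEQ_Suc)

text \<open>
  The last coordinate is fixed to \<open>s\<close>, that is, \<open>T = s / sqrt (1 - s\<^sup>2)\<close>.  The field contributes the energy
  \<open>h s\<close>, the volume of the slice \<open>ln (1 - s\<^sup>2) / 2\<close>, and the level \<open>c\<close> belongs to the remaining spins.
\<close>

lemma lower_limit_step:
  assumes s: "0 < s" "s < 1" and \<beta>: "0 < \<beta>"
    and L: "lower_limit (\<beta> * (1 - s\<^sup>2)) (sqrt 2 * \<beta> * (s * sqrt (1 - s\<^sup>2))) c"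
  shows "lower_limit \<beta> h (h * s + ln (1 - s\<^sup>2) / 2 + c)"
  unfolding lower_limit_def
proof (intro allI impI)
  fix b :: "nat \<Rightarrow> real" and v :: "nat \<Rightarrow> nat \<Rightarrow> real"
  assume b: "(\<lambda>n. b n / sqrt (real n)) \<longlonglongrightarrow> \<beta>" and v: "(\<lambda>n. L2_set (v n) {1..n} / real n) \<longlonglongrightarrow> h"
  define h' where "h' = sqrt 2 * \<beta> * (s * sqrt (1 - s\<^sup>2))"
  define c' where "c' = h * s + ln (1 - s\<^sup>2) / 2 + c"
  have s2: "0 < 1 - s\<^sup>2" using s by (simp add: power_less_one_iff)
  define T where "T = s / sqrt (1 - s\<^sup>2)"
  have T: "0 < T" using s s2 by (simp add: T_def)
  have T2: "1 / (1 + T\<^sup>2) = 1 - s\<^sup>2" using s2 by (simp add: T_def power_divide field_simps)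
  have T2': "1 + T\<^sup>2 = 1 / (1 - s\<^sup>2)" using T2 one_plus_square_pos[of T] s2 by (simp add: field_simps)
  have co0: "slice_coeff 0 T = 1 - s\<^sup>2" using T2 by (simp add: slice_coeff_def)
  have co1: "slice_coeff 1 T = s" unfolding slice_coeff_def T2' using s2 by (simp add: T_def real_sqrt_divide)
  have co3: "slice_coeff 3 T = s * sqrt (1 - s\<^sup>2)"
  proof -
    have "slice_coeff 3 T = T * (1 - s\<^sup>2)" unfolding slice_coeff_def T2' by simp
    also have "\<dots> = s * ((1 - s\<^sup>2) / sqrt (1 - s\<^sup>2))" by (simp add: T_def)
    also have "(1 - s\<^sup>2) / sqrt (1 - s\<^sup>2) = sqrt (1 - s\<^sup>2)" using s2 by (simp add: real_div_sqrt)
    finally show ?thesis .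
  qed
  define A where "A k n = (\<integral>t. slice_coeff k t \<partial>window (1 / real (Suc n)) T)" for k n
  have A: "(\<lambda>n. A k n) \<longlonglongrightarrow> slice_coeff k T" for k
    unfolding A_def by (rule window_average_limit[OF T slice_coeff_continuous slice_coeff_abs])
  define B where "B n = b (Suc n) / sqrt (real (Suc n))" for n
  have B: "B \<longlonglongrightarrow> \<beta>" unfolding B_def by (rule shift_lim[OF b])
  have bB: "b (Suc n) = B n * sqrt (real (Suc n))" for n by (simp add: B_def)
  define r where "r n = L2_set (v (Suc n)) {1..Suc n}" for n
  have r: "(\<lambda>n. r n / real (Suc n)) \<longlonglongrightarrow> h" unfolding r_def by (rule shift_lim[OF v])
  have nN: "(\<lambda>n. real n / real (Suc n)) \<longlonglongrightarrow> 1" by (rule LIMSEQ_n_over_Suc_n)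
  have Nn: "(\<lambda>n. sqrt (real (Suc n) / real n)) \<longlonglongrightarrow> 1"
    using tendsto_real_sqrt[OF LIMSEQ_Suc_n_over_n] by simp
  have iN: "(\<lambda>n. 1 / real (Suc n)) \<longlonglongrightarrow> 0" using LIMSEQ_inverse_real_of_nat by (simp add: inverse_eq_divide)
  have isN: "(\<lambda>n. 1 / sqrt (real (Suc n))) \<longlonglongrightarrow> 0"
    using tendsto_real_sqrt[OF iN] by (simp add: real_sqrt_divide)
  have lnN: "(\<lambda>n. ln (real (Suc n)) / real (Suc n)) \<longlonglongrightarrow> 0" by (rule shift_lim[OF lim_ln_over_n])
  define b' where "b' n = b (Suc n) * A 0 n" for n
  define X where "X n = shortfall n (b' n) (last_field n (real n * h')) (real n * c) / real n" for n
  have h'0: "0 \<le> h'" using s s2 \<beta> by (simp add: h'_def)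
  have X: "X \<longlonglongrightarrow> 0"
  proof -
    have "(\<lambda>n. B n * sqrt (real (Suc n) / real n) * A 0 n) \<longlonglongrightarrow> \<beta> * 1 * slice_coeff 0 T"
      by (intro tendsto_mult B Nn A)
    moreover have "b' n / sqrt (real n) = B n * sqrt (real (Suc n) / real n) * A 0 n" for n
      unfolding b'_def bB by (simp add: real_sqrt_divide)
    ultimately have "(\<lambda>n. b' n / sqrt (real n)) \<longlonglongrightarrow> \<beta> * (1 - s\<^sup>2)" by (simp add: co0)
    moreover have "(\<lambda>n. L2_set (last_field n (real n * h')) {1..n} / real n) \<longlonglongrightarrow> h'"
    proof (rule tendsto_eventually, rule eventually_sequentiallyI[of 1])
      show "L2_set (last_field n (real n * h')) {1..n} / real n = h'" if "1 \<le> n" for n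
        using L2_last_field[OF that] that h'0 by simp
    qed
    ultimately show ?thesis
      using L[folded h'_def, unfolded lower_limit_def, THEN spec[of _ b'], THEN spec[of _ "\<lambda>n. last_field n (real n * h')"]]
      unfolding X_def by simp
  qed
  define e1 where "e1 n = 3 * (\<bar>B n\<bar> * \<bar>A 3 n\<bar> * (1 / sqrt (real (Suc n))))" for n
  define e2 where "e2 n = \<bar>sqrt 2 * (\<bar>B n\<bar> * \<bar>A 3 n\<bar>) * sqrt (real n / real (Suc n)) - real n / real (Suc n) * h'\<bar>" for n
  define e3 where "e3 n = \<bar>B n\<bar> * \<bar>A 2 n\<bar> * (1 / sqrt (real (Suc n)))" for n
  define e4 where "e4 n = \<bar>c' - ln (1 - s\<^sup>2) / 2 + ln 8 * (1 / real (Suc n)) - ln T * (1 / real (Suc n)) + ln (real (Suc n)) / real (Suc n)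
      - r n / real (Suc n) * A 1 n - real n / real (Suc n) * c\<bar>" for n
  have "e1 \<longlonglongrightarrow> 3 * (\<bar>\<beta>\<bar> * \<bar>slice_coeff 3 T\<bar> * 0)"
    unfolding e1_def by (intro tendsto_intros B A isN)
  hence e1: "e1 \<longlonglongrightarrow> 0" by simp
  have "e3 \<longlonglongrightarrow> \<bar>\<beta>\<bar> * \<bar>slice_coeff 2 T\<bar> * 0"
    unfolding e3_def by (intro tendsto_intros B A isN)
  hence e3: "e3 \<longlonglongrightarrow> 0" by simp
  have "e2 \<longlonglongrightarrow> \<bar>sqrt 2 * (\<bar>\<beta>\<bar> * \<bar>slice_coeff 3 T\<bar>) * sqrt 1 - 1 * h'\<bar>"
    unfolding e2_def by (intro tendsto_intros B A nN)
  hence e2: "e2 \<longlonglongrightarrow> 0" using \<beta> s s2 by (simp add: co3 h'_def abs_mult)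
  have "e4 \<longlonglongrightarrow> \<bar>c' - ln (1 - s\<^sup>2) / 2 + ln 8 * 0 - ln T * 0 + 0 - h * slice_coeff 1 T - 1 * c\<bar>"
    unfolding e4_def by (intro tendsto_intros A nN iN lnN r)
  hence e4: "e4 \<longlonglongrightarrow> 0" by (simp add: co1 c'_def)
  have bound: "shortfall (Suc n) (b (Suc n)) (v (Suc n)) (real (Suc n) * c') / real (Suc n) \<le> X n + e1 n + e2 n + e3 n + e4 n"
    if n: "1 \<le> n" for n
  proof -
    let ?N = "real (Suc n)"
    have N0: "0 < ?N" by simp
    have sN: "sqrt ?N / ?N = 1 / sqrt ?N" by (simp add: real_div_sqrt field_simps)
    have "shortfall (Suc n) (b (Suc n)) (v (Suc n)) (?N * c') = shortfall (Suc n) (b (Suc n)) (last_field (Suc n) (r n)) (?N * c')"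
      by (rule shortfall_rotation) (simp_all add: L2_last_field r_def L2_set_nonneg)
    also have "\<dots> \<le> shortfall n (b' n) (last_field n (real n * h')) (real n * c) + 3 * \<bar>b (Suc n) * A 3 n\<bar>
        + \<bar>sqrt 2 * \<bar>b (Suc n) * A 3 n\<bar> * sqrt (real n) - real n * h'\<bar> + \<bar>b (Suc n) * A 2 n\<bar>
        + \<bar>?N * c' - (?N / 2 * ln (1 / (1 + T\<^sup>2)) - ln 8 + ln (T / ?N) + r n * A 1 n) - real n * c\<bar>"
      unfolding b'_def A_def by (rule shortfall_step[OF n T]) (use h'0 in simp)
    finally have "shortfall (Suc n) (b (Suc n)) (v (Suc n)) (?N * c') / ?N
      \<le> (shortfall n (b' n) (last_field n (real n * h')) (real n * c) + 3 * \<bar>b (Suc n) * A 3 n\<bar>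
        + \<bar>sqrt 2 * \<bar>b (Suc n) * A 3 n\<bar> * sqrt (real n) - real n * h'\<bar> + \<bar>b (Suc n) * A 2 n\<bar>
        + \<bar>?N * c' - (?N / 2 * ln (1 / (1 + T\<^sup>2)) - ln 8 + ln (T / ?N) + r n * A 1 n) - real n * c\<bar>) / ?N"
      using N0 by (intro divide_right_mono) auto
    also have "\<dots> = shortfall n (b' n) (last_field n (real n * h')) (real n * c) / ?N + 3 * \<bar>b (Suc n) * A 3 n\<bar> / ?N
        + \<bar>sqrt 2 * \<bar>b (Suc n) * A 3 n\<bar> * sqrt (real n) - real n * h'\<bar> / ?N + \<bar>b (Suc n) * A 2 n\<bar> / ?N
        + \<bar>?N * c' - (?N / 2 * ln (1 / (1 + T\<^sup>2)) - ln 8 + ln (T / ?N) + r n * A 1 n) - real n * c\<bar> / ?N"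
      by (simp only: add_divide_distrib)
    also have "shortfall n (b' n) (last_field n (real n * h')) (real n * c) / ?N \<le> X n"
      unfolding X_def using n shortfall_nonneg by (intro divide_left_mono) auto
    also have "3 * \<bar>b (Suc n) * A 3 n\<bar> / ?N = e1 n"
      unfolding e1_def bB sN[symmetric] by (simp add: abs_mult)
    also have "\<bar>b (Suc n) * A 2 n\<bar> / ?N = e3 n"
      unfolding e3_def bB sN[symmetric] by (simp add: abs_mult)
    also have "\<bar>sqrt 2 * \<bar>b (Suc n) * A 3 n\<bar> * sqrt (real n) - real n * h'\<bar> / ?N = e2 n"
    proof -
      have "\<bar>sqrt 2 * \<bar>b (Suc n) * A 3 n\<bar> * sqrt (real n) - real n * h'\<bar> / ?N
        = \<bar>(sqrt 2 * \<bar>b (Suc n) * A 3 n\<bar> * sqrt (real n) - real n * h') / ?N\<bar>" by (simp only: abs_divide abs_of_pos[OF N0])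
      also have "(sqrt 2 * \<bar>b (Suc n) * A 3 n\<bar> * sqrt (real n) - real n * h') / ?N
        = sqrt 2 * (\<bar>B n\<bar> * \<bar>A 3 n\<bar>) * (sqrt (real n) * (sqrt ?N / ?N)) - real n / ?N * h'"
        unfolding bB by (simp add: abs_mult diff_divide_distrib)
      also have "sqrt (real n) * (sqrt ?N / ?N) = sqrt (real n / ?N)" unfolding sN by (simp add: real_sqrt_divide)
      finally show ?thesis unfolding e2_def .
    qed
    also have "\<bar>?N * c' - (?N / 2 * ln (1 / (1 + T\<^sup>2)) - ln 8 + ln (T / ?N) + r n * A 1 n) - real n * c\<bar> / ?N = e4 n"
    proof -
      have lT: "ln (T / ?N) = ln T - ln ?N" using T by (simp add: ln_div)
      have "\<bar>?N * c' - (?N / 2 * ln (1 / (1 + T\<^sup>2)) - ln 8 + ln (T / ?N) + r n * A 1 n) - real n * c\<bar> / ?N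
        = \<bar>(?N * c' - (?N / 2 * ln (1 / (1 + T\<^sup>2)) - ln 8 + ln (T / ?N) + r n * A 1 n) - real n * c) / ?N\<bar>"
        by (simp only: abs_divide abs_of_pos[OF N0])
      also have "(?N * c' - (?N / 2 * ln (1 / (1 + T\<^sup>2)) - ln 8 + ln (T / ?N) + r n * A 1 n) - real n * c) / ?N
        = c' - ln (1 - s\<^sup>2) / 2 + ln 8 * (1 / ?N) - ln T * (1 / ?N) + ln ?N / ?N - r n / ?N * A 1 n - real n / ?N * c"
        unfolding T2 lT by (simp add: diff_divide_distrib add_divide_distrib del: of_nat_Suc)
      finally show ?thesis unfolding e4_def .
    qed
    finally show ?thesis by simp
  qed
  have "(\<lambda>n. X n + e1 n + e2 n + e3 n + e4 n) \<longlonglongrightarrow> 0 + 0 + 0 + 0 + 0"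
    by (intro tendsto_add X e1 e2 e3 e4)
  hence lim: "(\<lambda>n. X n + e1 n + e2 n + e3 n + e4 n) \<longlonglongrightarrow> 0" by simp
  have "(\<lambda>n. shortfall (Suc n) (b (Suc n)) (v (Suc n)) (real (Suc n) * c') / real (Suc n)) \<longlonglongrightarrow> 0"
  proof (rule tendsto_sandwich[OF _ _ tendsto_const lim])
    show "\<forall>\<^sub>F n in sequentially. 0 \<le> shortfall (Suc n) (b (Suc n)) (v (Suc n)) (real (Suc n) * c') / real (Suc n)"
      using shortfall_nonneg by (intro always_eventually allI divide_nonneg_nonneg) auto
    show "\<forall>\<^sub>F n in sequentially. shortfall (Suc n) (b (Suc n)) (v (Suc n)) (real (Suc n) * c') / real (Suc n)
        \<le> X n + e1 n + e2 n + e3 n + e4 n"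
      by (rule eventually_sequentiallyI[of 1]) (rule bound)
  qed
  thus "(\<lambda>n. shortfall n (b n) (v n) (real n * (h * s + ln (1 - s\<^sup>2) / 2 + c)) / real n) \<longlonglongrightarrow> 0"
    unfolding c'_def[symmetric] by (rule LIMSEQ_imp_Suc)
qed

section \<open>The upper bound\<close>

lemma sum_idx: "(\<Sum>p\<in>idx n. f (fst p) (snd p)) = (\<Sum>i=1..n. \<Sum>j=1..n. f i j)"
  unfolding idx_def by (simp add: sum.cartesian_product case_prod_beta')

text \<open>
  The coefficient of the disorder variable \<open>x p\<close> in the energy of the spin.
\<close>

definition pairing :: "nat \<Rightarrow> real \<Rightarrow> nat \<times> nat \<Rightarrow> (nat \<Rightarrow> real) \<Rightarrow> real" where
  "pairing n b p y = b * (sph n y (fst p) * sph n y (snd p))"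

lemma sph_product_abs: "i \<in> {1..n} \<Longrightarrow> j \<in> {1..n} \<Longrightarrow> \<bar>sph n y i * sph n y j\<bar> \<le> 1"
  unfolding abs_mult using mult_mono[OF sph_abs sph_abs, of i n j n y y] by simp

lemma gfamily_pairing: "gfamily (uball n) (idx n) (pairing n b) \<bar>b\<bar>"
proof -
  interpret prob_space "uball n" by (rule prob_space_uball)
  show ?thesis
  proof
    fix p assume p: "p \<in> idx n"
    show "pairing n b p \<in> borel_measurable (uball n)"
      unfolding pairing_def[abs_def] using p
      by (intro borel_measurable_times borel_measurable_const bdm_meas bdm_sph) (auto simp: idx_def)
    show "\<bar>pairing n b p y\<bar> \<le> \<bar>b\<bar>" for y
      unfolding pairing_def abs_mult[of b] using sph_product_abs[of "fst p" n "snd p" y] p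
      by (intro mult_left_le) (auto simp: idx_def)
  qed auto
qed

lemma lin_pairing: "gfamily.lin (idx n) (pairing n b) x y = b * bil n x (sph n y) (sph n y)"
proof -
  interpret gfamily "uball n" "idx n" "pairing n b" "\<bar>b\<bar>" by (rule gfamily_pairing)
  show ?thesis unfolding lin_def bil_def pairing_def
    using sum_idx[of "\<lambda>i j. x (i, j) * (b * (sph n y i * sph n y j))" n]
    by (simp add: sum_distrib_left mult_ac)
qed

lemma heat_pairing: "gfamily.heat (uball n) (idx n) (pairing n b) 1 (\<lambda>y. \<Sum>i=1..n. v i * sph n y i)
    = (\<integral>x. Phi n b v x \<partial>gauss (idx n))"
proof -
  interpret gfamily "uball n" "idx n" "pairing n b" "\<bar>b\<bar>" by (rule gfamily_pairing)
  show ?thesis unfolding heat_def lin_pairing Phi_def energy_def by (simp add: add.commute)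
qed

text \<open>
  The Gibbs averages of the products of two spins; their squares sum to the mean square overlap of two
  replicas.
\<close>

definition corr :: "nat \<Rightarrow> (nat \<Rightarrow> real) measure \<Rightarrow> nat \<Rightarrow> nat \<Rightarrow> real" where
  "corr n \<nu> i j = (\<integral>y. sph n y i * sph n y j \<partial>\<nu>)"

lemma gvar_pairing:
  assumes n: "1 \<le> n" and g: "bdm (uball n) g"
  shows "gfamily.gvar (uball n) (idx n) (pairing n b) g
    = b\<^sup>2 * (1 - (\<Sum>i=1..n. \<Sum>j=1..n. (corr n (tilt (uball n) g) i j)\<^sup>2))"
proof -
  interpret gfamily "uball n" "idx n" "pairing n b" "\<bar>b\<bar>" by (rule gfamily_pairing)
  let ?\<nu> = "tilt (uball n) g"
  interpret T: prob_space ?\<nu> by (rule prob_space_tilt[OF prob_space_uball g])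
  have s: "integrable ?\<nu> (\<lambda>y. (sph n y i * sph n y j) ^ k)" if "i \<in> {1..n}" "j \<in> {1..n}" for i j k
    by (rule bdm_integrable[OF T.prob_space_axioms], unfold bdm_tilt, intro bdm_power bdm_mult bdm_sph that)
  have "(\<Sum>p\<in>idx n. (\<integral>y. (pairing n b p y)\<^sup>2 \<partial>?\<nu>)) = b\<^sup>2 * (\<Sum>i=1..n. \<Sum>j=1..n. \<integral>y. (sph n y i * sph n y j)\<^sup>2 \<partial>?\<nu>)"
    using sum_idx[of "\<lambda>i j. \<integral>y. (b * (sph n y i * sph n y j))\<^sup>2 \<partial>?\<nu>" n]
    unfolding pairing_def by (simp add: power_mult_distrib sum_distrib_left)
  also have "(\<Sum>i=1..n. \<Sum>j=1..n. \<integral>y. (sph n y i * sph n y j)\<^sup>2 \<partial>?\<nu>)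
      = (\<integral>y. (\<Sum>i=1..n. \<Sum>j=1..n. (sph n y i * sph n y j)\<^sup>2) \<partial>?\<nu>)"
  proof -
    note s2 = s[of _ _ 2]
    have "(\<integral>y. (\<Sum>i=1..n. \<Sum>j=1..n. (sph n y i * sph n y j)\<^sup>2) \<partial>?\<nu>) = (\<Sum>i=1..n. \<integral>y. (\<Sum>j=1..n. (sph n y i * sph n y j)\<^sup>2) \<partial>?\<nu>)"
      by (intro Bochner_Integration.integral_sum Bochner_Integration.integrable_sum s2)
    also have "\<dots> = (\<Sum>i=1..n. \<Sum>j=1..n. \<integral>y. (sph n y i * sph n y j)\<^sup>2 \<partial>?\<nu>)"
      by (intro sum.cong refl Bochner_Integration.integral_sum s2)
    finally show ?thesis by (rule sym)
  qed
  also have "(\<lambda>y. \<Sum>i=1..n. \<Sum>j=1..n. (sph n y i * sph n y j)\<^sup>2) = (\<lambda>y. 1)"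
  proof
    fix y
    have "(\<Sum>i=1..n. \<Sum>j=1..n. (sph n y i * sph n y j)\<^sup>2) = (\<Sum>i=1..n. (sph n y i)\<^sup>2) * (\<Sum>j=1..n. (sph n y j)\<^sup>2)"
      unfolding sum_product power_mult_distrib ..
    thus "(\<Sum>i=1..n. \<Sum>j=1..n. (sph n y i * sph n y j)\<^sup>2) = 1" unfolding sph_norm[OF n] by simp
  qed
  finally have 1: "(\<Sum>p\<in>idx n. (\<integral>y. (pairing n b p y)\<^sup>2 \<partial>?\<nu>)) = b\<^sup>2" using T.prob_space by simp
  have 2: "(\<Sum>p\<in>idx n. (\<integral>y. pairing n b p y \<partial>?\<nu>)\<^sup>2) = b\<^sup>2 * (\<Sum>i=1..n. \<Sum>j=1..n. (corr n ?\<nu> i j)\<^sup>2)"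
    using sum_idx[of "\<lambda>i j. (\<integral>y. b * (sph n y i * sph n y j) \<partial>?\<nu>)\<^sup>2" n]
    unfolding pairing_def corr_def by (simp add: power_mult_distrib sum_distrib_left)
  show ?thesis unfolding gvar_def sum_subtractf 1 2 by (simp add: right_diff_distrib)
qed

lemma gfamily_field: "gfamily (uball n) {1..n} (\<lambda>i y. k * sph n y i) \<bar>k\<bar>"
proof -
  interpret prob_space "uball n" by (rule prob_space_uball)
  show ?thesis
  proof
    fix i assume i: "i \<in> {1..n}"
    show "(\<lambda>y. k * sph n y i) \<in> borel_measurable (uball n)"
      by (intro borel_measurable_times borel_measurable_const bdm_meas bdm_sph i)
    show "\<bar>k * sph n y i\<bar> \<le> \<bar>k\<bar>" for y
      unfolding abs_mult using sph_abs[OF i, of y] by (intro mult_left_le) auto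
  qed auto
qed

lemma gvar_field:
  assumes n: "1 \<le> n" and g: "bdm (uball n) g"
  shows "gfamily.gvar (uball n) {1..n} (\<lambda>i y. k * sph n y i) g
    = k\<^sup>2 * (1 - (\<Sum>i=1..n. (\<integral>y. sph n y i \<partial>tilt (uball n) g)\<^sup>2))"
proof -
  interpret gfamily "uball n" "{1..n}" "\<lambda>i y. k * sph n y i" "\<bar>k\<bar>" by (rule gfamily_field)
  let ?\<nu> = "tilt (uball n) g"
  interpret T: prob_space ?\<nu> by (rule prob_space_tilt[OF prob_space_uball g])
  have s: "integrable ?\<nu> (\<lambda>y. (sph n y i)\<^sup>2)" if "i \<in> {1..n}" for i
    by (rule bdm_integrable[OF T.prob_space_axioms], unfold bdm_tilt, intro bdm_power bdm_sph that)
  have "(\<Sum>i=1..n. (\<integral>y. (sph n y i)\<^sup>2 \<partial>?\<nu>)) = (\<integral>y. (\<Sum>i=1..n. (sph n y i)\<^sup>2) \<partial>?\<nu>)"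
    by (intro Bochner_Integration.integral_sum[symmetric] s)
  also have "\<dots> = 1" unfolding sph_norm[OF n] using T.prob_space by simp
  finally have 1: "(\<Sum>i=1..n. (\<integral>y. (sph n y i)\<^sup>2 \<partial>?\<nu>)) = 1" .
  have "gvar g = k\<^sup>2 * (\<Sum>i=1..n. (\<integral>y. (sph n y i)\<^sup>2 \<partial>?\<nu>)) - k\<^sup>2 * (\<Sum>i=1..n. (\<integral>y. sph n y i \<partial>?\<nu>)\<^sup>2)"
    unfolding gvar_def by (simp add: power_mult_distrib sum_subtractf sum_distrib_left)
  thus ?thesis unfolding 1 by (simp add: right_diff_distrib)
qed

text \<open>
  For two independent replicas with overlap \<open>R\<close> this is \<open>(E R)\<^sup>2 \<le> E R\<^sup>2\<close>.  In terms of one replica: the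
  projection of the spin to its mean has nonnegative variance, and the Cauchy-Schwarz inequality brings in
  the matrix norm of the correlations.
\<close>

lemma corr_square_lower:
  assumes g: "bdm (uball n) g"
  defines "\<nu> \<equiv> tilt (uball n) g"
  defines "M \<equiv> (\<Sum>i=1..n. (\<integral>y. sph n y i \<partial>\<nu>)\<^sup>2)"
  shows "M\<^sup>2 \<le> (\<Sum>i=1..n. \<Sum>j=1..n. (corr n \<nu> i j)\<^sup>2)"
proof -
  interpret T: prob_space \<nu> unfolding \<nu>_def by (rule prob_space_tilt[OF prob_space_uball g])
  define m where "m i = (\<integral>y. sph n y i \<partial>\<nu>)" for i
  define S where "S = (\<Sum>i=1..n. \<Sum>j=1..n. (corr n \<nu> i j)\<^sup>2)"
  have M: "M = (\<Sum>i=1..n. (m i)\<^sup>2)" unfolding M_def m_def ..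
  have M0: "0 \<le> M" unfolding M by (intro sum_nonneg) auto
  have S0: "0 \<le> S" unfolding S_def by (intro sum_nonneg) auto
  have i1: "integrable \<nu> (\<lambda>y. sph n y i)" if "i \<in> {1..n}" for i
    by (rule bdm_integrable[OF T.prob_space_axioms], unfold \<nu>_def bdm_tilt, intro bdm_sph that)
  have i2: "integrable \<nu> (\<lambda>y. sph n y i * sph n y j)" if "i \<in> {1..n}" "j \<in> {1..n}" for i j
    by (rule bdm_integrable[OF T.prob_space_axioms], unfold \<nu>_def bdm_tilt, intro bdm_mult bdm_sph that)
  define X where "X y = (\<Sum>i=1..n. m i * sph n y i)" for y
  have Xb: "bdm \<nu> X" unfolding X_def[abs_def] \<nu>_def by (simp add: bdm_sph_linear)
  have EX: "(\<integral>y. X y \<partial>\<nu>) = M"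
    unfolding X_def M power2_eq_square using i1
    by (subst Bochner_Integration.integral_sum) (auto simp: m_def)
  have X2: "(X y)\<^sup>2 = (\<Sum>i=1..n. \<Sum>j=1..n. (m i * m j) * (sph n y i * sph n y j))" for y
    unfolding X_def power2_eq_square sum_product by (simp only: mult_ac)
  have EX2: "(\<integral>y. (X y)\<^sup>2 \<partial>\<nu>) = (\<Sum>i=1..n. \<Sum>j=1..n. (m i * m j) * corr n \<nu> i j)"
    unfolding X2 corr_def using i2
    by (subst Bochner_Integration.integral_sum, (intro Bochner_Integration.integrable_sum integrable_mult_right; simp),
        intro sum.cong refl, subst Bochner_Integration.integral_sum) auto
  have iX: "integrable \<nu> X" "integrable \<nu> (\<lambda>y. (X y)\<^sup>2)"
    using bdm_integrable[OF T.prob_space_axioms Xb] bdm_integrable[OF T.prob_space_axioms bdm_power[OF Xb]] by auto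
  have "0 \<le> (\<integral>y. (X y - M)\<^sup>2 \<partial>\<nu>)" by (rule Bochner_Integration.integral_nonneg) simp
  also have "\<dots> = (\<integral>y. (X y)\<^sup>2 \<partial>\<nu>) - M\<^sup>2" using T.variance_eq[OF iX] unfolding EX .
  finally have 1: "M\<^sup>2 \<le> (\<Sum>i=1..n. \<Sum>j=1..n. (m i * m j) * corr n \<nu> i j)" unfolding EX2 by simp
  have "(\<Sum>i=1..n. \<Sum>j=1..n. (m i * m j) * corr n \<nu> i j) = (\<Sum>p\<in>idx n. (m (fst p) * m (snd p)) * corr n \<nu> (fst p) (snd p))"
    by (rule sum_idx[symmetric])
  also have "\<dots> \<le> L2_set (\<lambda>p. m (fst p) * m (snd p)) (idx n) * L2_set (\<lambda>p. corr n \<nu> (fst p) (snd p)) (idx n)"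
    using cauchy_schwarz_sum[of "\<lambda>p. m (fst p) * m (snd p)" "\<lambda>p. corr n \<nu> (fst p) (snd p)" "idx n"] by linarith
  also have "L2_set (\<lambda>p. corr n \<nu> (fst p) (snd p)) (idx n) = sqrt S"
    unfolding L2_set_def S_def sum_idx[of "\<lambda>i j. (corr n \<nu> i j)\<^sup>2"] ..
  also have "L2_set (\<lambda>p. m (fst p) * m (snd p)) (idx n) = sqrt (M\<^sup>2)"
    unfolding L2_set_def power_mult_distrib sum_idx[of "\<lambda>i j. (m i)\<^sup>2 * (m j)\<^sup>2"] M power2_eq_square[of "sum _ _"] sum_product ..
  finally have "M * M \<le> M * sqrt S" using 1 M0 by (simp add: power2_eq_square)
  hence "M \<le> sqrt S" using M0 S0 by (cases "M = 0") auto
  hence "M\<^sup>2 \<le> (sqrt S)\<^sup>2" using M0 by (intro power_mono) auto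
  thus ?thesis using S0 unfolding S_def[symmetric] by simp
qed

lemma field_sum:
  "(\<Sum>i\<in>I. (v i + k * y i) * s i) = (\<Sum>i\<in>I. v i * s i) + (\<Sum>i\<in>I. y i * (k * s i))" for k :: real
  by (simp add: algebra_simps sum.distrib)

text \<open>
  With \<open>M = E R\<close> and \<open>S = E R\<^sup>2\<close> for the overlap \<open>R\<close> of two replicas, the disorder and the random field
  change the free energy at the rates \<open>b\<^sup>2 (1 - S) / 2\<close> and \<open>b\<^sup>2 q (1 - M)\<close>, and
  \<open>(1 - S) - 2 q (1 - M) \<le> (1 - q)\<^sup>2 - (M - q)\<^sup>2\<close> because \<open>M\<^sup>2 \<le> S\<close>.
\<close>

lemma guerra_bound:
  assumes n: "1 \<le> n" and q: "0 \<le> q"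
  shows "(\<integral>x. Phi n b v x \<partial>gauss (idx n))
    \<le> (\<integral>y. log_avg (uball n) (\<lambda>z. \<Sum>i=1..n. (v i + sqrt (2 * b\<^sup>2 * q) * y i) * sph n z i) \<partial>gauss {1..n}) + b\<^sup>2 * (1 - q)\<^sup>2 / 2"
proof -
  let ?k = "sqrt (2 * b\<^sup>2 * q)"
  have "gfamily.heat (uball n) (idx n) (pairing n b) 1 (\<lambda>y. \<Sum>i=1..n. v i * sph n y i)
     \<le> gfamily.heat (uball n) {1..n} (\<lambda>i y. ?k * sph n y i) 1 (\<lambda>y. \<Sum>i=1..n. v i * sph n y i) + b\<^sup>2 * (1 - q)\<^sup>2 / 2"
  proof (rule gaussian_comparison[OF gfamily_pairing gfamily_field bdm_sph_linear])
    fix g assume g: "bdm (uball n) g"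
    define M where "M = (\<Sum>i=1..n. (\<integral>y. sph n y i \<partial>tilt (uball n) g)\<^sup>2)"
    define S where "S = (\<Sum>i=1..n. \<Sum>j=1..n. (corr n (tilt (uball n) g) i j)\<^sup>2)"
    have "M\<^sup>2 \<le> S" unfolding M_def S_def by (rule corr_square_lower[OF g])
    moreover have "0 \<le> (M - q)\<^sup>2" by simp
    ultimately have "(1 - S) - 2 * q * (1 - M) \<le> (1 - q)\<^sup>2" by (simp add: power2_diff algebra_simps)
    hence "b\<^sup>2 * ((1 - S) - 2 * q * (1 - M)) \<le> b\<^sup>2 * (1 - q)\<^sup>2" by (intro mult_left_mono) auto
    thus "(gfamily.gvar (uball n) (idx n) (pairing n b) g - gfamily.gvar (uball n) {1..n} (\<lambda>i y. ?k * sph n y i) g) / 2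
        \<le> b\<^sup>2 * (1 - q)\<^sup>2 / 2"
      unfolding gvar_pairing[OF n g] gvar_field[OF n g] M_def[symmetric] S_def[symmetric]
      using q by (simp add: algebra_simps)
  qed
  moreover have "gfamily.heat (uball n) {1..n} (\<lambda>i y. ?k * sph n y i) 1 (\<lambda>y. \<Sum>i=1..n. v i * sph n y i)
    = (\<integral>y. log_avg (uball n) (\<lambda>z. \<Sum>i=1..n. (v i + ?k * y i) * sph n z i) \<partial>gauss {1..n})"
  proof -
    interpret gfamily "uball n" "{1..n}" "\<lambda>i y. ?k * sph n y i" "\<bar>?k\<bar>" by (rule gfamily_field)
    show ?thesis unfolding heat_def lin_def field_sum by simp
  qed
  ultimately show ?thesis unfolding heat_pairing by simp
qed

text \<open>
  Once the term \<open>L2_set V / n\<close> in \<open>sphere_linear\<close> is bounded by the arithmetic-geometric mean inequality,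
  only the mean square length of the random field is needed.
\<close>

lemma Phi_upper:
  assumes n: "2 \<le> n" and q: "0 \<le> q" and z: "0 < z"
  shows "(\<integral>x. Phi n b v x \<partial>gauss (idx n))
    \<le> real n * (z - 1/2 - ln (2 * z) / 2) + ((L2_set v {1..n})\<^sup>2 + 2 * b\<^sup>2 * q * real n) * (1 / (4 * z * real n) + 1 / (2 * (real n)\<^sup>2))
      + 1 / 2 + 3 * z + 1 + ln (real n) + b\<^sup>2 * (1 - q)\<^sup>2 / 2"
proof -
  interpret prob_space "gauss {1..n}" by (rule prob_space_gauss)
  let ?k = "sqrt (2 * b\<^sup>2 * q)"
  have n0: "0 < real n" using n by simp
  have n1: "1 \<le> n" using n by simp
  define V where "V y i = v i + ?k * y i" for y i
  define W where "W y = (\<Sum>i=1..n. (V y i)\<^sup>2)" for y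
  define d where "d = real n * (z - 1/2 - ln (2 * z) / 2) + 1 / 2 + 3 * z + 1 + ln (real n)"
  have sq: "(V y i)\<^sup>2 = (v i)\<^sup>2 + 2 * v i * ?k * y i + ?k\<^sup>2 * (y i)\<^sup>2" for y i
    unfolding V_def by (simp add: power2_sum power_mult_distrib)
  have iW: "integrable (gauss {1..n}) W"
    unfolding W_def sq using integrable_gauss_power[of _ "{1..n}" 2]
    by (intro Bochner_Integration.integrable_sum Bochner_Integration.integrable_add integrable_mult_right) auto
  have "(\<integral>y. W y \<partial>gauss {1..n}) = (\<Sum>i=1..n. \<integral>y. (v i)\<^sup>2 + 2 * v i * ?k * y i + ?k\<^sup>2 * (y i)\<^sup>2 \<partial>gauss {1..n})"
    unfolding W_def sq using integrable_gauss_power[of _ "{1..n}" 2]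
    by (intro Bochner_Integration.integral_sum Bochner_Integration.integrable_add integrable_mult_right) auto
  also have "\<dots> = (\<Sum>i=1..n. (v i)\<^sup>2 + ?k\<^sup>2)"
    using integrable_gauss_power[of _ "{1..n}" 2]
    by (intro sum.cong refl) (simp add: gauss_mean gauss_square prob_space)
  also have "\<dots> = (L2_set v {1..n})\<^sup>2 + 2 * b\<^sup>2 * q * real n"
    using q by (simp add: sum.distrib L2_square)
  finally have EW: "(\<integral>y. W y \<partial>gauss {1..n}) = (L2_set v {1..n})\<^sup>2 + 2 * b\<^sup>2 * q * real n" .
  have pt: "log_avg (uball n) (\<lambda>z. \<Sum>i=1..n. (v i + ?k * y i) * sph n z i)
      \<le> d + W y * (1 / (4 * z * real n) + 1 / (2 * (real n)\<^sup>2))" for y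
  proof -
    have "0 \<le> (L2_set (V y) {1..n} / real n - 1)\<^sup>2" by simp
    hence "L2_set (V y) {1..n} / real n \<le> W y / (2 * (real n)\<^sup>2) + 1 / 2"
      unfolding W_def L2_square[symmetric] by (simp add: power2_diff power_divide field_simps)
    moreover have "log_avg (uball n) (\<lambda>z. \<Sum>i=1..n. V y i * sph n z i)
        \<le> real n * (z - 1/2 - ln (2 * z) / 2) + W y / (4 * z * real n) + L2_set (V y) {1..n} / real n + 3 * z + 1 + ln (real n)"
      unfolding W_def by (rule sphere_linear[OF n z])
    ultimately show ?thesis unfolding V_def d_def by (simp add: distrib_left)
  qed
  have "(\<integral>y. log_avg (uball n) (\<lambda>z. \<Sum>i=1..n. (v i + ?k * y i) * sph n z i) \<partial>gauss {1..n})
     \<le> (\<integral>y. d + W y * (1 / (4 * z * real n) + 1 / (2 * (real n)\<^sup>2)) \<partial>gauss {1..n})"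
  proof (rule integral_mono)
    interpret F: gfamily "uball n" "{1..n}" "\<lambda>i y. ?k * sph n y i" "\<bar>?k\<bar>" by (rule gfamily_field)
    have "integrable (gauss {1..n}) (\<lambda>x. log_avg (uball n) (\<lambda>z. (\<Sum>i=1..n. v i * sph n z i) + F.lin (\<lambda>i. 1 * x i) z))"
      by (rule F.integrable_log_avg[OF bdm_sph_linear])
    thus "integrable (gauss {1..n}) (\<lambda>y. log_avg (uball n) (\<lambda>z. \<Sum>i=1..n. (v i + ?k * y i) * sph n z i))"
      unfolding F.lin_def field_sum by simp
    show "integrable (gauss {1..n}) (\<lambda>y. d + W y * (1 / (4 * z * real n) + 1 / (2 * (real n)\<^sup>2)))"
      using iW by simp
  qed (rule pt)
  also have "\<dots> = d + ((L2_set v {1..n})\<^sup>2 + 2 * b\<^sup>2 * q * real n) * (1 / (4 * z * real n) + 1 / (2 * (real n)\<^sup>2))"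
    using iW by (simp add: prob_space EW)
  finally show ?thesis using guerra_bound[OF n1 q, of b v] unfolding d_def by linarith
qed

section \<open>The lower bound at high temperature\<close>

definition uball2 :: "nat \<Rightarrow> ((nat \<Rightarrow> real) \<times> (nat \<Rightarrow> real)) measure" where
  "uball2 n = uball n \<Otimes>\<^sub>M uball n"

definition overlap :: "nat \<Rightarrow> (nat \<Rightarrow> real) \<times> (nat \<Rightarrow> real) \<Rightarrow> real" where
  "overlap n p = (\<Sum>i=1..n. sph n (fst p) i * sph n (snd p) i)"

definition pairing2 :: "nat \<Rightarrow> real \<Rightarrow> nat \<times> nat \<Rightarrow> (nat \<Rightarrow> real) \<times> (nat \<Rightarrow> real) \<Rightarrow> real" where
  "pairing2 n b k p = pairing n b k (fst p) + pairing n b k (snd p)"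

lemma prob_space_uball2: "prob_space (uball2 n)"
proof -
  interpret prob_space "uball n" by (rule prob_space_uball)
  interpret P: pair_prob_space "uball n" "uball n" ..
  show ?thesis unfolding uball2_def by (rule P.prob_space_axioms)
qed

lemma bdm_fst: "bdm (uball n) f \<Longrightarrow> bdm (uball2 n) (\<lambda>p. f (fst p))"
  unfolding bdm_def uball2_def by (auto simp: space_pair_measure intro: measurable_compose[OF measurable_fst])

lemma bdm_snd: "bdm (uball n) f \<Longrightarrow> bdm (uball2 n) (\<lambda>p. f (snd p))"
  unfolding bdm_def uball2_def by (auto simp: space_pair_measure intro: measurable_compose[OF measurable_snd])

lemma bdm_overlap: "bdm (uball2 n) (overlap n)"
  unfolding overlap_def[abs_def] by (intro bdm_sum bdm_mult bdm_fst bdm_snd bdm_sph)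

lemma gfamily_pairing2: "gfamily (uball2 n) (idx n) (pairing2 n b) (2 * \<bar>b\<bar>)"
proof -
  interpret G: gfamily "uball n" "idx n" "pairing n b" "\<bar>b\<bar>" by (rule gfamily_pairing)
  interpret prob_space "uball2 n" by (rule prob_space_uball2)
  show ?thesis
  proof
    fix k assume k: "k \<in> idx n"
    show "pairing2 n b k \<in> borel_measurable (uball2 n)"
      unfolding pairing2_def[abs_def]
      by (intro borel_measurable_add bdm_meas[OF bdm_fst[OF G.bdm_a[OF k]]] bdm_meas[OF bdm_snd[OF G.bdm_a[OF k]]])
    fix p assume "p \<in> space (uball2 n)"
    hence "fst p \<in> space (uball n)" "snd p \<in> space (uball n)" by (auto simp: uball2_def space_pair_measure)
    thus "\<bar>pairing2 n b k p\<bar> \<le> 2 * \<bar>b\<bar>"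
      unfolding pairing2_def using G.a_bound[OF k, of "fst p"] G.a_bound[OF k, of "snd p"] by linarith
  qed auto
qed

lemma lin_pairing2:
  "gfamily.lin (idx n) (pairing2 n b) x p = gfamily.lin (idx n) (pairing n b) x (fst p) + gfamily.lin (idx n) (pairing n b) x (snd p)"
proof -
  interpret G: gfamily "uball n" "idx n" "pairing n b" "\<bar>b\<bar>" by (rule gfamily_pairing)
  interpret H: gfamily "uball2 n" "idx n" "pairing2 n b" "2 * \<bar>b\<bar>" by (rule gfamily_pairing2)
  show ?thesis unfolding G.lin_def H.lin_def pairing2_def by (simp add: distrib_left sum.distrib)
qed

lemma pairing2_squares:
  assumes n: "1 \<le> n"
  shows "(\<Sum>k\<in>idx n. (pairing2 n b k p)\<^sup>2) = b\<^sup>2 * (2 + 2 * (overlap n p)\<^sup>2)"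
proof -
  let ?s = "sph n (fst p)" and ?t = "sph n (snd p)"
  have "(\<Sum>k\<in>idx n. (pairing2 n b k p)\<^sup>2) = (\<Sum>i=1..n. \<Sum>j=1..n. (b * (?s i * ?s j) + b * (?t i * ?t j))\<^sup>2)"
    using sum_idx[of "\<lambda>i j. (b * (?s i * ?s j) + b * (?t i * ?t j))\<^sup>2" n] unfolding pairing2_def pairing_def .
  also have "\<dots> = (\<Sum>i=1..n. \<Sum>j=1..n. b\<^sup>2 * ((?s i)\<^sup>2 * (?s j)\<^sup>2) + b\<^sup>2 * ((?t i)\<^sup>2 * (?t j)\<^sup>2) + 2 * b\<^sup>2 * ((?s i * ?t i) * (?s j * ?t j)))"
    by (intro sum.cong refl) (simp add: power2_eq_square algebra_simps)
  also have "\<dots> = b\<^sup>2 * ((\<Sum>i=1..n. (?s i)\<^sup>2) * (\<Sum>j=1..n. (?s j)\<^sup>2)) + b\<^sup>2 * ((\<Sum>i=1..n. (?t i)\<^sup>2) * (\<Sum>j=1..n. (?t j)\<^sup>2))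
      + 2 * b\<^sup>2 * ((\<Sum>i=1..n. ?s i * ?t i) * (\<Sum>j=1..n. ?s j * ?t j))"
    unfolding sum_product by (simp only: sum.distrib sum_distrib_left)
  finally show ?thesis unfolding sph_norm[OF n] overlap_def by (simp add: power2_eq_square algebra_simps)
qed

text \<open>
  During a time \<open>r\<close> the disorder adds half of the Gibbs variances, at most \<open>r b\<^sup>2 (1 + E R\<^sup>2)\<close> for two
  replicas with overlap \<open>R\<close> if the squared means are dropped.  By Jensen's inequality \<open>r b\<^sup>2 E R\<^sup>2\<close> is at
  most what \<open>log_avg\<close> gains when \<open>r b\<^sup>2 R\<^sup>2\<close> is added to the energy.
\<close>

lemma coupling_bound:
  assumes n: "1 \<le> n" and f: "bdm (uball2 n) f" and t: "0 \<le> t"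
  shows "gfamily.heat (uball2 n) (idx n) (pairing2 n b) t f
    \<le> log_avg (uball2 n) (\<lambda>p. f p + t * b\<^sup>2 * (overlap n p)\<^sup>2) + t * b\<^sup>2"
proof -
  interpret H: gfamily "uball2 n" "idx n" "pairing2 n b" "2 * \<bar>b\<bar>" by (rule gfamily_pairing2)
  interpret GG: prob_space "gauss (idx n)" by (rule prob_space_gauss)
  let ?R = "\<lambda>c p. c * b\<^sup>2 * (overlap n p)\<^sup>2"
  have bR: "bdm (uball2 n) (?R c)" for c by (intro bdm_cmult bdm_power bdm_overlap)
  have step: "H.heat r g \<le> log_avg (uball2 n) (\<lambda>p. g p + ?R r p) + (r * b\<^sup>2 + H.err * (r * sqrt r))"
    if g: "bdm (uball2 n) g" and r: "0 \<le> r" for g r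
  proof -
    let ?\<nu> = "tilt (uball2 n) g"
    interpret T: prob_space ?\<nu> by (rule prob_space_tilt[OF prob_space_uball2 g])
    have i: "integrable ?\<nu> h" if "bdm (uball2 n) h" for h
      using that by (intro bdm_integrable[OF T.prob_space_axioms]) simp
    have "H.gvar g \<le> (\<Sum>k\<in>idx n. \<integral>p. (pairing2 n b k p)\<^sup>2 \<partial>?\<nu>)"
      unfolding H.gvar_def by (intro sum_mono) simp
    also have "\<dots> = (\<integral>p. (\<Sum>k\<in>idx n. (pairing2 n b k p)\<^sup>2) \<partial>?\<nu>)"
      by (intro Bochner_Integration.integral_sum[symmetric] i bdm_power H.bdm_a)
    also have "\<dots> = (\<integral>p. 2 * b\<^sup>2 + 2 * ?R 1 p \<partial>?\<nu>)"
      unfolding pairing2_squares[OF n] by (simp add: algebra_simps)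
    also have "\<dots> = 2 * b\<^sup>2 + 2 * (\<integral>p. ?R 1 p \<partial>?\<nu>)"
      using i[OF bR[of 1]] T.prob_space by simp
    finally have "r / 2 * H.gvar g \<le> r / 2 * (2 * b\<^sup>2 + 2 * (\<integral>p. ?R 1 p \<partial>?\<nu>))"
      using r by (intro mult_left_mono) auto
    also have "\<dots> = r * b\<^sup>2 + r * (\<integral>p. ?R 1 p \<partial>?\<nu>)" by (simp add: algebra_simps)
    also have "r * (\<integral>p. ?R 1 p \<partial>?\<nu>) = (\<integral>p. ?R r p \<partial>?\<nu>)" by (simp add: mult.assoc)
    also have "(\<integral>p. ?R r p \<partial>?\<nu>) \<le> log_avg ?\<nu> (?R r)"
      by (rule log_avg_ge_integral[OF T.prob_space_axioms]) (simp add: bR)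
    finally have "r / 2 * H.gvar g \<le> r * b\<^sup>2 + log_avg ?\<nu> (?R r)" by simp
    thus ?thesis using H.heat_step[OF g r] log_avg_add[OF prob_space_uball2 g bR[of r]] by linarith
  qed
  have main: "H.heat (real m * r) g \<le> log_avg (uball2 n) (\<lambda>p. g p + ?R (real m * r) p) + real m * (r * b\<^sup>2 + H.err * (r * sqrt r))"
    if g: "bdm (uball2 n) g" and r: "0 \<le> r" for g r m
    using g
  proof (induction m arbitrary: g)
    case 0 show ?case by (simp add: H.heat_0)
  next
    case (Suc m)
    let ?e = "r * b\<^sup>2 + H.err * (r * sqrt r)"
    have mr: "0 \<le> real m * r" using r by simp
    have S: "real (Suc m) * r = real m * r + r" by (simp add: algebra_simps)
    let ?g = "\<lambda>x p. g p + H.lin (\<lambda>k. sqrt (real m * r) * x k) p"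
    have bg: "bdm (uball2 n) (?g x)" for x by (intro bdm_add Suc.prems H.bdm_lin)
    have bgR: "bdm (uball2 n) (\<lambda>p. g p + ?R r p)" by (intro bdm_add Suc.prems bR)
    have e: "(\<lambda>p. g p + ?R r p + H.lin (\<lambda>k. sqrt (real m * r) * x k) p) = (\<lambda>p. ?g x p + ?R r p)" for x
      by (simp add: algebra_simps)
    have I: "integrable (gauss (idx n)) (\<lambda>x. log_avg (uball2 n) (\<lambda>p. ?g x p + ?R r p))"
      using H.integrable_log_avg[OF bgR, of "sqrt (real m * r)"] by (simp only: e)
    have "H.heat (real (Suc m) * r) g = (\<integral>x. H.heat r (?g x) \<partial>gauss (idx n))"
      unfolding S by (rule H.heat_add[OF Suc.prems mr r])
    also have "\<dots> \<le> (\<integral>x. log_avg (uball2 n) (\<lambda>p. ?g x p + ?R r p) + ?e \<partial>gauss (idx n))"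
    proof (rule integral_mono)
      show "integrable (gauss (idx n)) (\<lambda>x. H.heat r (?g x))" by (rule H.heat_add[OF Suc.prems mr r])
      show "integrable (gauss (idx n)) (\<lambda>x. log_avg (uball2 n) (\<lambda>p. ?g x p + ?R r p) + ?e)" using I by simp
    qed (rule step[OF bg r])
    also have "\<dots> = H.heat (real m * r) (\<lambda>p. g p + ?R r p) + ?e"
      using I by (simp only: H.heat_def e) (simp add: GG.prob_space)
    also have "\<dots> \<le> log_avg (uball2 n) (\<lambda>p. g p + ?R r p + ?R (real m * r) p) + real m * ?e + ?e"
      using Suc.IH[OF bgR] by simp
    also have "(\<lambda>p. g p + ?R r p + ?R (real m * r) p) = (\<lambda>p. g p + ?R (real (Suc m) * r) p)"
      unfolding S by (simp add: algebra_simps)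
    finally show ?case by (simp add: algebra_simps)
  qed
  show ?thesis
  proof (rule real_le_by_inverse_sqrt)
    fix N :: nat assume N: "1 \<le> N"
    have "real N * (t / real N * b\<^sup>2 + H.err * (t / real N * sqrt (t / real N))) = t * b\<^sup>2 + H.err * (t * sqrt t) / sqrt (real N)"
      using N by (simp add: real_sqrt_divide field_simps)
    thus "H.heat t f \<le> log_avg (uball2 n) (\<lambda>p. f p + ?R t p) + t * b\<^sup>2 + (H.err * (t * sqrt t)) / sqrt (real N)"
      using main[OF f, of "t / real N" N] N t by simp
  qed
qed

lemma uball2_product:
  assumes f: "bdm (uball n) f" and g: "bdm (uball n) g"
  shows "(\<integral>p. f (fst p) * g (snd p) \<partial>uball2 n) = (\<integral>y. f y \<partial>uball n) * (\<integral>y. g y \<partial>uball n)"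
proof -
  interpret prob_space "uball n" by (rule prob_space_uball)
  interpret P: pair_prob_space "uball n" "uball n" ..
  have "integrable (uball2 n) (\<lambda>p. f (fst p) * g (snd p))"
    by (intro bdm_integrable[OF prob_space_uball2] bdm_mult bdm_fst bdm_snd f g)
  hence "(\<integral>p. f (fst p) * g (snd p) \<partial>uball2 n) = (\<integral>x. (\<integral>y. f x * g y \<partial>uball n) \<partial>uball n)"
    unfolding uball2_def using P.integral_fst'[of "\<lambda>p. f (fst p) * g (snd p)"] by simp
  thus ?thesis by simp
qed

text \<open>
  Jensen's inequality for two independent copies of the Gibbs measure of \<open>g\<close>, under which the sum is the
  mean square overlap.
\<close>

lemma overlap_jensen:
  assumes g: "bdm (uball n) g"
  shows "2 * log_avg (uball n) g + c * (\<Sum>i=1..n. \<Sum>j=1..n. (corr n (tilt (uball n) g) i j)\<^sup>2)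
    \<le> log_avg (uball2 n) (\<lambda>p. (g (fst p) + g (snd p)) + c * (overlap n p)\<^sup>2)"
proof -
  let ?G = "\<lambda>p. g (fst p) + g (snd p)"
  let ?\<nu> = "tilt (uball2 n) ?G"
  have bG: "bdm (uball2 n) ?G" by (intro bdm_add bdm_fst bdm_snd g)
  have bR: "bdm (uball2 n) (\<lambda>p. c * (overlap n p)\<^sup>2)" by (intro bdm_cmult bdm_power bdm_overlap)
  interpret T: prob_space ?\<nu> by (rule prob_space_tilt[OF prob_space_uball2 bG])
  define Z where "Z = (\<integral>y. exp (g y) \<partial>uball n)"
  have Z: "0 < Z" unfolding Z_def by (rule exp_avg_pos[OF prob_space_uball g])
  have Z2: "(\<integral>p. exp (?G p) \<partial>uball2 n) = Z * Z"
    unfolding exp_add Z_def by (rule uball2_product) (intro bdm_exp g)+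
  have l: "log_avg (uball2 n) ?G = 2 * log_avg (uball n) g"
    unfolding log_avg_def Z2 Z_def[symmetric] using Z by (simp add: ln_mult)
  define s where "s i j y = sph n y i * sph n y j" for i j y
  have bs: "bdm (uball n) (s i j)" if "i \<in> {1..n}" "j \<in> {1..n}" for i j
    unfolding s_def[abs_def] by (intro bdm_mult bdm_sph that)
  have bss: "bdm (uball2 n) (\<lambda>p. s i j (fst p) * s i j (snd p))" if "i \<in> {1..n}" "j \<in> {1..n}" for i j
    by (intro bdm_mult bdm_fst bdm_snd bs that)
  have ov: "(overlap n p)\<^sup>2 = (\<Sum>i=1..n. \<Sum>j=1..n. s i j (fst p) * s i j (snd p))" for p
    unfolding overlap_def power2_eq_square sum_product s_def by (simp add: mult_ac)
  have i: "integrable ?\<nu> h" if "bdm (uball2 n) h" for h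
    using that by (intro bdm_integrable[OF T.prob_space_axioms]) simp
  have one: "(\<integral>p. s i j (fst p) * s i j (snd p) \<partial>?\<nu>) = (corr n (tilt (uball n) g) i j)\<^sup>2"
    if ij: "i \<in> {1..n}" "j \<in> {1..n}" for i j
  proof -
    have "(\<integral>p. exp (?G p) * (s i j (fst p) * s i j (snd p)) \<partial>uball2 n)
      = (\<integral>p. (exp (g (fst p)) * s i j (fst p)) * (exp (g (snd p)) * s i j (snd p)) \<partial>uball2 n)"
      by (simp add: exp_add mult_ac)
    also have "\<dots> = (\<integral>y. exp (g y) * s i j y \<partial>uball n) * (\<integral>y. exp (g y) * s i j y \<partial>uball n)"
      by (rule uball2_product) (intro bdm_mult bdm_exp g bs ij)+
    finally show ?thesis
      unfolding integral_tilt[OF prob_space_uball2 bG bss[OF ij]] Z2 corr_def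
      using integral_tilt[OF prob_space_uball g bs[OF ij]] unfolding Z_def[symmetric] s_def
      by (simp add: power2_eq_square)
  qed
  have "c * (\<Sum>i=1..n. \<Sum>j=1..n. (corr n (tilt (uball n) g) i j)\<^sup>2) = (\<integral>p. c * (overlap n p)\<^sup>2 \<partial>?\<nu>)"
  proof -
    have "(\<integral>p. (overlap n p)\<^sup>2 \<partial>?\<nu>) = (\<Sum>i=1..n. \<integral>p. (\<Sum>j=1..n. s i j (fst p) * s i j (snd p)) \<partial>?\<nu>)"
      unfolding ov by (intro Bochner_Integration.integral_sum i bdm_sum bss)
    also have "\<dots> = (\<Sum>i=1..n. \<Sum>j=1..n. \<integral>p. s i j (fst p) * s i j (snd p) \<partial>?\<nu>)"
      by (intro sum.cong refl Bochner_Integration.integral_sum i bss)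
    also have "\<dots> = (\<Sum>i=1..n. \<Sum>j=1..n. (corr n (tilt (uball n) g) i j)\<^sup>2)"
      by (intro sum.cong refl one)
    finally show ?thesis by simp
  qed
  also have "\<dots> \<le> log_avg ?\<nu> (\<lambda>p. c * (overlap n p)\<^sup>2)"
    by (rule log_avg_ge_integral[OF T.prob_space_axioms]) (simp add: bR)
  finally show ?thesis unfolding log_avg_add[OF prob_space_uball2 bG bR] l by simp
qed

definition overlap_const :: "real \<Rightarrow> real" where
  "overlap_const \<theta> = 5 / 2 + 1 / (4 * ((1/2 - \<theta>) / 2)) + ln (sqrt (pi / ((1/2 - \<theta>) / 2)))"

text \<open>
  The square is linearised with an auxiliary Gaussian variable \<open>g\<close>; given one replica the exponent is then
  linear in the other one, and \<open>sphere_linear\<close> applies.  For \<open>\<theta> < 1/2\<close> the Gaussian weight of \<open>g\<close> dominates.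
\<close>

lemma overlap_moment:
  assumes n: "2 \<le> n" and \<theta>: "0 \<le> \<theta>" "\<theta> < 1 / 2"
  shows "log_avg (uball2 n) (\<lambda>p. \<theta> * real n * (overlap n p)\<^sup>2) \<le> ln (real n) + overlap_const \<theta>"
proof -
  interpret Y: prob_space "uball n" by (rule prob_space_uball)
  interpret P: pair_prob_space "uball n" "uball n" ..
  interpret Q: pair_sigma_finite lborel "uball n" ..
  define \<epsilon> where "\<epsilon> = (1/2 - \<theta>) / 2"
  have \<epsilon>: "0 < \<epsilon>" "\<theta> + \<epsilon> + \<epsilon> = 1 / 2" using \<theta> by (auto simp: \<epsilon>_def)
  define k where "k = sqrt (2 * \<theta> * real n)"
  have k: "0 \<le> k" "k\<^sup>2 = 2 * \<theta> * real n" using \<theta> by (auto simp: k_def)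
  have n0: "0 < real n" "1 \<le> n" "1 \<le> real n" using n by auto
  have kn: "k / real n \<le> 1"
  proof -
    have "k \<le> sqrt ((real n)\<^sup>2)" unfolding k_def
    proof (rule real_sqrt_le_mono)
      have "2 * \<theta> * real n \<le> 1 * real n" using \<theta> by (intro mult_right_mono) auto
      also have "1 * real n \<le> real n * real n" using n0 by (intro mult_right_mono) auto
      finally show "2 * \<theta> * real n \<le> (real n)\<^sup>2" by (simp add: power2_eq_square)
    qed
    thus ?thesis using n0 by simp
  qed
  define D where "D = 1 / (4 * \<epsilon>) + 5 / 2 + ln (real n)"
  have inner: "(\<integral>\<^sup>+y. ennreal (exp (\<theta> * real n * (\<Sum>i=1..n. sph n w i * sph n y i)\<^sup>2)) \<partial>uball n)
      \<le> ennreal (exp D * sqrt (pi / \<epsilon>))" for w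
  proof -
    define c where "c y = (\<Sum>i=1..n. sph n w i * sph n y i)" for y
    have cm: "bdm (uball n) c" unfolding c_def[abs_def] by (rule bdm_sph_linear)
    have jm: "(\<lambda>(g, y). ennreal (exp (- (1/2) * g\<^sup>2 + k * c y * g))) \<in> borel_measurable (lborel \<Otimes>\<^sub>M uball n)"
    proof -
      have [measurable]: "c \<in> borel_measurable (uball n)" by (rule bdm_meas[OF cm])
      show ?thesis by measurable
    qed
    have "ennreal (exp (\<theta> * real n * (c y)\<^sup>2)) \<le> (\<integral>\<^sup>+g. ennreal (exp (- (1/2) * g\<^sup>2 + k * c y * g)) \<partial>lborel)" for y
    proof -
      have "(\<integral>\<^sup>+g. ennreal (exp (- (1/2) * g\<^sup>2 + k * c y * g)) \<partial>lborel) = ennreal (sqrt (pi / (1/2)) * exp ((k * c y)\<^sup>2 / (4 * (1/2))))"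
        by (rule nn_integral_gaussian_1d) simp
      moreover have "(k * c y)\<^sup>2 / (4 * (1/2)) = \<theta> * real n * (c y)\<^sup>2" using k by (simp add: power_mult_distrib)
      moreover have "1 \<le> sqrt (pi / (1/2))" using pi_gt3 by (intro real_le_rsqrt) auto
      ultimately show ?thesis by (simp only:) (intro ennreal_leI, simp)
    qed
    hence "(\<integral>\<^sup>+y. ennreal (exp (\<theta> * real n * (c y)\<^sup>2)) \<partial>uball n)
        \<le> (\<integral>\<^sup>+y. (\<integral>\<^sup>+g. ennreal (exp (- (1/2) * g\<^sup>2 + k * c y * g)) \<partial>lborel) \<partial>uball n)"
      by (intro nn_integral_mono)
    also have "\<dots> = (\<integral>\<^sup>+g. (\<integral>\<^sup>+y. ennreal (exp (- (1/2) * g\<^sup>2 + k * c y * g)) \<partial>uball n) \<partial>lborel)"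
      by (rule Q.Fubini'[OF jm])
    also have "\<dots> \<le> (\<integral>\<^sup>+g. ennreal (exp D) * ennreal (exp (- \<epsilon> * g\<^sup>2 + 0 * g)) \<partial>lborel)"
    proof (rule nn_integral_mono)
      fix g :: real
      define V where "V i = k * g * sph n w i" for i
      have Vc: "k * c y * g = (\<Sum>i=1..n. V i * sph n y i)" for y
        unfolding V_def c_def by (simp add: sum_distrib_left mult_ac)
      have V2: "(\<Sum>i=1..n. (V i)\<^sup>2) = k\<^sup>2 * g\<^sup>2"
        unfolding V_def power_mult_distrib by (simp add: sum_distrib_left[symmetric] sph_norm[OF n0(2)])
      have VL: "L2_set V {1..n} = k * \<bar>g\<bar>" 
        unfolding L2_set_def V2 using k(1) by (simp only: real_sqrt_mult real_sqrt_abs abs_of_nonneg)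
      have "(\<integral>\<^sup>+y. ennreal (exp (- (1/2) * g\<^sup>2 + k * c y * g)) \<partial>uball n)
          = (\<integral>\<^sup>+y. ennreal (exp (- (1/2) * g\<^sup>2)) * ennreal (exp (\<Sum>i=1..n. V i * sph n y i)) \<partial>uball n)"
        unfolding Vc exp_add by (simp add: ennreal_mult)
      also have "\<dots> = ennreal (exp (- (1/2) * g\<^sup>2)) * ennreal (\<integral>y. exp (\<Sum>i=1..n. V i * sph n y i) \<partial>uball n)"
      proof -
        have b: "bdm (uball n) (\<lambda>y. exp (\<Sum>i=1..n. V i * sph n y i))" by (intro bdm_exp bdm_sph_linear)
        have "(\<integral>\<^sup>+y. ennreal (exp (\<Sum>i=1..n. V i * sph n y i)) \<partial>uball n) = ennreal (\<integral>y. exp (\<Sum>i=1..n. V i * sph n y i) \<partial>uball n)"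
          by (intro nn_integral_eq_integral bdm_integrable[OF prob_space_uball b]) simp
        thus ?thesis using bdm_meas[OF b] by (subst nn_integral_cmult) auto
      qed
      also have "\<dots> \<le> ennreal (exp (- (1/2) * g\<^sup>2)) * ennreal (exp (\<theta> * g\<^sup>2 + \<bar>g\<bar> + 5 / 2 + ln (real n)))"
      proof (intro mult_left_mono ennreal_leI)
        have "log_avg (uball n) (\<lambda>y. \<Sum>i=1..n. V i * sph n y i)
          \<le> real n * (1/2 - 1/2 - ln (2 * (1/2)) / 2) + (\<Sum>i=1..n. (V i)\<^sup>2) / (4 * (1/2) * real n) + L2_set V {1..n} / real n + 3 * (1/2) + 1 + ln (real n)"
          by (rule sphere_linear[OF n]) simp
        also have "\<dots> = \<theta> * g\<^sup>2 + (k / real n) * \<bar>g\<bar> + 5 / 2 + ln (real n)"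
          unfolding V2 VL k(2) using n0 by simp
        also have "(k / real n) * \<bar>g\<bar> \<le> 1 * \<bar>g\<bar>" using kn by (intro mult_right_mono) auto
        finally have "log_avg (uball n) (\<lambda>y. \<Sum>i=1..n. V i * sph n y i) \<le> \<theta> * g\<^sup>2 + \<bar>g\<bar> + 5 / 2 + ln (real n)" by simp
        moreover have "0 < (\<integral>y. exp (\<Sum>i=1..n. V i * sph n y i) \<partial>uball n)"
          by (rule exp_avg_pos[OF prob_space_uball bdm_sph_linear])
        ultimately show "(\<integral>y. exp (\<Sum>i=1..n. V i * sph n y i) \<partial>uball n) \<le> exp (\<theta> * g\<^sup>2 + \<bar>g\<bar> + 5 / 2 + ln (real n))"
          unfolding log_avg_def by (simp only: exp_le_cancel_iff[symmetric, of "ln _"] exp_ln)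
      qed auto
      also have "\<dots> = ennreal (exp (- (1/2) * g\<^sup>2 + (\<theta> * g\<^sup>2 + \<bar>g\<bar> + 5 / 2 + ln (real n))))"
        by (simp only: exp_add) (simp add: ennreal_mult)
      also have "\<dots> \<le> ennreal (exp (D + (- \<epsilon> * g\<^sup>2 + 0 * g)))"
      proof (intro ennreal_leI, subst exp_le_cancel_iff)
        have "0 \<le> (2 * \<epsilon> * \<bar>g\<bar> - 1)\<^sup>2" by simp
        hence "4 * \<epsilon> * \<bar>g\<bar> \<le> 4 * \<epsilon> * (\<epsilon> * g\<^sup>2) + 1" by (simp add: power2_diff power_mult_distrib power2_eq_square algebra_simps)
        hence "\<bar>g\<bar> \<le> \<epsilon> * g\<^sup>2 + 1 / (4 * \<epsilon>)" using \<epsilon> by (simp add: field_simps)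
        moreover have "\<theta> * g\<^sup>2 + \<epsilon> * g\<^sup>2 + \<epsilon> * g\<^sup>2 = 1 / 2 * g\<^sup>2" using \<epsilon>(2) by (simp add: distrib_right[symmetric])
        ultimately show "- (1/2) * g\<^sup>2 + (\<theta> * g\<^sup>2 + \<bar>g\<bar> + 5 / 2 + ln (real n)) \<le> D + (- \<epsilon> * g\<^sup>2 + 0 * g)"
          unfolding D_def by simp
      qed
      also have "\<dots> = ennreal (exp D) * ennreal (exp (- \<epsilon> * g\<^sup>2 + 0 * g))"
        by (simp only: exp_add) (simp add: ennreal_mult)
      finally show "(\<integral>\<^sup>+y. ennreal (exp (- (1/2) * g\<^sup>2 + k * c y * g)) \<partial>uball n) \<le> ennreal (exp D) * ennreal (exp (- \<epsilon> * g\<^sup>2 + 0 * g))" .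
    qed
    also have "\<dots> = ennreal (exp D) * (\<integral>\<^sup>+g. ennreal (exp (- \<epsilon> * g\<^sup>2 + 0 * g)) \<partial>lborel)"
      by (rule nn_integral_cmult) measurable
    also have "\<dots> = ennreal (exp D * sqrt (pi / \<epsilon>))"
      unfolding nn_integral_gaussian_1d[OF \<epsilon>(1)] using \<epsilon> by (simp add: ennreal_mult)
    finally show ?thesis unfolding c_def .
  qed
  have bR: "bdm (uball2 n) (\<lambda>p. \<theta> * real n * (overlap n p)\<^sup>2)" by (intro bdm_cmult bdm_power bdm_overlap)
  define Z where "Z = (\<integral>p. exp (\<theta> * real n * (overlap n p)\<^sup>2) \<partial>uball2 n)"
  have Z0: "0 < Z" unfolding Z_def by (rule exp_avg_pos[OF prob_space_uball2 bR])
  have m: "(\<lambda>p. ennreal (exp (\<theta> * real n * (overlap n p)\<^sup>2))) \<in> borel_measurable (uball n \<Otimes>\<^sub>M uball n)"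
    using bdm_meas[OF bdm_exp[OF bR]] unfolding uball2_def by measurable
  have "ennreal Z = (\<integral>\<^sup>+p. ennreal (exp (\<theta> * real n * (overlap n p)\<^sup>2)) \<partial>uball2 n)"
    unfolding Z_def by (intro nn_integral_eq_integral[symmetric] bdm_integrable[OF prob_space_uball2] bdm_exp bR) simp
  also have "\<dots> = (\<integral>\<^sup>+w. (\<integral>\<^sup>+y. ennreal (exp (\<theta> * real n * (overlap n (w, y))\<^sup>2)) \<partial>uball n) \<partial>uball n)"
    unfolding uball2_def by (rule Y.nn_integral_fst[OF m, symmetric])
  also have "\<dots> \<le> (\<integral>\<^sup>+w. ennreal (exp D * sqrt (pi / \<epsilon>)) \<partial>uball n)"
    unfolding overlap_def fst_conv snd_conv by (intro nn_integral_mono inner)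
  also have "\<dots> = ennreal (exp D * sqrt (pi / \<epsilon>))" by (simp add: Y.emeasure_space_1)
  finally have "Z \<le> exp D * sqrt (pi / \<epsilon>)" using \<epsilon> by (subst (asm) ennreal_le_iff) auto
  hence "ln Z \<le> ln (exp D * sqrt (pi / \<epsilon>))" using Z0 \<epsilon> by (subst ln_le_cancel_iff) auto
  also have "\<dots> = D + ln (sqrt (pi / \<epsilon>))" using \<epsilon> by (subst ln_mult_pos) auto
  finally show ?thesis unfolding log_avg_def Z_def[symmetric] D_def overlap_const_def \<epsilon>_def by simp
qed

text \<open>
  Let \<open>f t\<close> be the free energy after time \<open>t\<close>.  Its growth rate is \<open>b\<^sup>2/2\<close> minus \<open>b\<^sup>2/2\<close> times the mean
  square overlap, and by \<open>overlap_jensen\<close> and \<open>coupling_bound\<close> the latter is at most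
  \<open>(\<kappa> + t b\<^sup>2 - 2 f t) / (l n)\<close>.  So the deficit \<open>\<Delta> t = t b\<^sup>2/2 - f t + \<kappa>/2\<close> grows at most at the rate
  \<open>c \<Delta> t\<close>, and a discrete Gronwall argument keeps it of the order of its initial value \<open>\<kappa>/2\<close>.
\<close>

lemma high_temperature:
  assumes n: "2 \<le> n" and l: "0 < l" and \<theta>: "b\<^sup>2 / real n + l \<le> \<theta>" "\<theta> < 1 / 2"
  shows "b\<^sup>2 / 2 - exp (b\<^sup>2 / (l * real n)) * ((ln (real n) + overlap_const \<theta>) / 2)
    \<le> (\<integral>x. Phi n b (\<lambda>_. 0) x \<partial>gauss (idx n))"
proof -
  interpret G: gfamily "uball n" "idx n" "pairing n b" "\<bar>b\<bar>" by (rule gfamily_pairing)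
  interpret H: gfamily "uball2 n" "idx n" "pairing2 n b" "2 * \<bar>b\<bar>" by (rule gfamily_pairing2)
  interpret GG: prob_space "gauss (idx n)" by (rule prob_space_gauss)
  have n0: "0 < real n" "1 \<le> n" using n by auto
  have \<theta>0: "0 \<le> \<theta>" 
  proof -
    have "0 \<le> b\<^sup>2 / real n" by simp
    thus ?thesis using \<theta>(1) l by linarith
  qed
  define \<kappa> where "\<kappa> = log_avg (uball2 n) (\<lambda>p. \<theta> * real n * (overlap n p)\<^sup>2)"
  have \<kappa>: "\<kappa> \<le> ln (real n) + overlap_const \<theta>" unfolding \<kappa>_def by (rule overlap_moment[OF n \<theta>0 \<theta>(2)])
  have bR: "bdm (uball2 n) (\<lambda>p. c * (overlap n p)\<^sup>2)" for c by (intro bdm_cmult bdm_power bdm_overlap)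
  have \<kappa>0: "0 \<le> \<kappa>"
  proof -
    have "0 \<le> (\<integral>p. \<theta> * real n * (overlap n p)\<^sup>2 \<partial>uball2 n)"
      using \<theta>0 by (intro Bochner_Integration.integral_nonneg mult_nonneg_nonneg) auto
    also have "\<dots> \<le> \<kappa>" unfolding \<kappa>_def by (rule log_avg_ge_integral[OF prob_space_uball2 bR])
    finally show ?thesis .
  qed
  define z where "z = (\<lambda>_ :: nat \<Rightarrow> real. 0 :: real)"
  define f where "f t = G.heat t z" for t
  have bz: "bdm (uball n) z" by (simp add: z_def)
  have coup: "H.heat t (\<lambda>p. l * real n * (overlap n p)\<^sup>2) \<le> \<kappa> + t * b\<^sup>2" if t: "0 \<le> t" "t \<le> 1" for t
  proof -
    have "H.heat t (\<lambda>p. l * real n * (overlap n p)\<^sup>2)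
        \<le> log_avg (uball2 n) (\<lambda>p. l * real n * (overlap n p)\<^sup>2 + t * b\<^sup>2 * (overlap n p)\<^sup>2) + t * b\<^sup>2"
      by (rule coupling_bound[OF n0(2) bR t(1)])
    also have "log_avg (uball2 n) (\<lambda>p. l * real n * (overlap n p)\<^sup>2 + t * b\<^sup>2 * (overlap n p)\<^sup>2) \<le> \<kappa> + 0"
      unfolding \<kappa>_def
    proof (intro log_avg_le[OF prob_space_uball2] bdm_add bR)
      fix p
      have "t * b\<^sup>2 \<le> 1 * b\<^sup>2" using t by (intro mult_right_mono) auto
      moreover have "b\<^sup>2 + l * real n \<le> \<theta> * real n"
        using mult_right_mono[OF \<theta>(1), of "real n"] n0 by (simp add: distrib_right)
      ultimately have "(l * real n + t * b\<^sup>2) * (overlap n p)\<^sup>2 \<le> \<theta> * real n * (overlap n p)\<^sup>2"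
        by (intro mult_right_mono) auto
      thus "l * real n * (overlap n p)\<^sup>2 + t * b\<^sup>2 * (overlap n p)\<^sup>2 \<le> \<theta> * real n * (overlap n p)\<^sup>2 + 0"
        by (simp add: distrib_right)
    qed
    finally show ?thesis by simp
  qed
  define c where "c = b\<^sup>2 / (l * real n)"
  have c0: "0 \<le> c" using l n0 by (simp add: c_def)
  have step: "f t + r / 2 * b\<^sup>2 - r / 2 * c * (\<kappa> + t * b\<^sup>2 - 2 * f t) - G.err * (r * sqrt r) \<le> f (t + r)"
    if t: "0 \<le> t" "t \<le> 1" and r: "0 \<le> r" for t r
  proof -
    let ?g = "\<lambda>x y. z y + G.lin (\<lambda>k. sqrt t * x k) y"
    let ?h = "\<lambda>x p. l * real n * (overlap n p)\<^sup>2 + H.lin (\<lambda>k. sqrt t * x k) p"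
    have bg: "bdm (uball n) (?g x)" for x by (intro bdm_add bz G.bdm_lin)
    define L1 where "L1 x = log_avg (uball n) (?g x)" for x
    define L2 where "L2 x = log_avg (uball2 n) (?h x)" for x
    have i1: "integrable (gauss (idx n)) L1" unfolding L1_def by (rule G.integrable_log_avg[OF bz])
    have i2: "integrable (gauss (idx n)) L2" unfolding L2_def by (rule H.integrable_log_avg[OF bR])
    have pt: "L1 x + r / 2 * b\<^sup>2 - r / 2 * c * (L2 x - 2 * L1 x) - G.err * (r * sqrt r) \<le> G.heat r (?g x)" for x
    proof -
      define S where "S = (\<Sum>i=1..n. \<Sum>j=1..n. (corr n (tilt (uball n) (?g x)) i j)\<^sup>2)"
      have "2 * L1 x + l * real n * S \<le> log_avg (uball2 n) (\<lambda>p. (?g x (fst p) + ?g x (snd p)) + l * real n * (overlap n p)\<^sup>2)"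
        unfolding L1_def S_def by (rule overlap_jensen[OF bg])
      also have "\<dots> = L2 x" unfolding L2_def lin_pairing2 z_def by (simp add: algebra_simps)
      finally have "S \<le> (L2 x - 2 * L1 x) / (l * real n)" using l n0 by (simp add: pos_le_divide_eq mult.commute)
      hence "b\<^sup>2 * S \<le> b\<^sup>2 * ((L2 x - 2 * L1 x) / (l * real n))" by (intro mult_left_mono) auto
      hence "b\<^sup>2 * S \<le> c * (L2 x - 2 * L1 x)" by (simp add: c_def)
      hence "b\<^sup>2 - c * (L2 x - 2 * L1 x) \<le> G.gvar (?g x)"
        unfolding gvar_pairing[OF n0(2) bg] S_def[symmetric] by (simp add: right_diff_distrib)
      hence "r / 2 * (b\<^sup>2 - c * (L2 x - 2 * L1 x)) \<le> r / 2 * G.gvar (?g x)" using r by (intro mult_left_mono) auto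
      thus ?thesis using G.heat_step[OF bg r, of x] unfolding L1_def[symmetric] by (simp add: right_diff_distrib mult.assoc)
    qed
    have "f t + r / 2 * b\<^sup>2 - r / 2 * c * (H.heat t (\<lambda>p. l * real n * (overlap n p)\<^sup>2) - 2 * f t) - G.err * (r * sqrt r)
      = (\<integral>x. L1 x + r / 2 * b\<^sup>2 - r / 2 * c * (L2 x - 2 * L1 x) - G.err * (r * sqrt r) \<partial>gauss (idx n))"

    proof -
      have ft: "f t = (\<integral>x. L1 x \<partial>gauss (idx n))" unfolding f_def G.heat_def L1_def ..
      have ht: "H.heat t (\<lambda>p. l * real n * (overlap n p)\<^sup>2) = (\<integral>x. L2 x \<partial>gauss (idx n))"
        unfolding H.heat_def L2_def ..
      show ?thesis unfolding ft ht using i1 i2 by (simp add: GG.prob_space)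
    qed
    also have "\<dots> \<le> (\<integral>x. G.heat r (?g x) \<partial>gauss (idx n))"
      using i1 i2 by (intro integral_mono pt G.heat_add(2)[OF bz t(1) r]) auto
    also have "\<dots> = f (t + r)" unfolding f_def by (rule G.heat_add(1)[OF bz t(1) r, symmetric])
    finally have 1: "f t + r / 2 * b\<^sup>2 - r / 2 * c * (H.heat t (\<lambda>p. l * real n * (overlap n p)\<^sup>2) - 2 * f t) - G.err * (r * sqrt r) \<le> f (t + r)" .
    have "r / 2 * c * (H.heat t (\<lambda>p. l * real n * (overlap n p)\<^sup>2) - 2 * f t) \<le> r / 2 * c * (\<kappa> + t * b\<^sup>2 - 2 * f t)"
      using coup[OF t] r c0 by (intro mult_left_mono) auto
    thus ?thesis using 1 by linarith
  qed
  define \<Delta> where "\<Delta> t = t * b\<^sup>2 / 2 - f t + \<kappa> / 2" for t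
  have step\<Delta>: "\<Delta> (t + r) \<le> (1 + c * r) * \<Delta> t + G.err * (r * sqrt r)"
    if t: "0 \<le> t" "t \<le> 1" and r: "0 \<le> r" for t r
  proof -
    have "(1 + c * r) * \<Delta> t = \<Delta> t + r / 2 * c * (\<kappa> + t * b\<^sup>2 - 2 * f t)"
      unfolding \<Delta>_def by (simp add: algebra_simps add_divide_distrib diff_divide_distrib)
    moreover have "\<Delta> (t + r) = (t * b\<^sup>2 / 2 + r / 2 * b\<^sup>2) - f (t + r) + \<kappa> / 2"
      unfolding \<Delta>_def by (simp add: distrib_right add_divide_distrib)
    ultimately show ?thesis using step[OF t r] unfolding \<Delta>_def by linarith
  qed
  have alg: "Q * (Q ^ m * (k + real m * e)) + Q ^ Suc m * e = Q ^ Suc m * (k + real (Suc m) * e)" for Q k e :: real and m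
    by (simp add: algebra_simps)
  have iter: "\<Delta> (real m / real N) \<le> (1 + c / real N) ^ m * (\<kappa> / 2 + real m * (G.err * (1 / real N * sqrt (1 / real N))))"
    if N: "1 \<le> N" and mN: "m \<le> N" for m N :: nat
    using mN
  proof (induction m)
    case 0
    have "f 0 = 0" unfolding f_def G.heat_0 z_def log_avg_def by (simp add: G.prob_space)
    thus ?case by (simp add: \<Delta>_def)
  next
    case (Suc m)
    let ?t = "real m / real N" and ?r = "1 / real N"
    let ?e = "G.err * (?r * sqrt ?r)"
    have t: "0 \<le> ?t" "?t \<le> 1" and r: "0 \<le> ?r" using Suc.prems N by auto
    have e0: "0 \<le> ?e" using G.err_nonneg by simp
    have q: "1 \<le> 1 + c / real N" using c0 by simp
    have S: "real (Suc m) / real N = ?t + ?r" by (simp add: add_divide_distrib)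
    have "\<Delta> (?t + ?r) \<le> (1 + c * ?r) * \<Delta> ?t + ?e"
      by (rule step\<Delta>[OF t r])
    also have "\<dots> = (1 + c / real N) * \<Delta> ?t + ?e" by simp
    also have "\<dots> \<le> (1 + c / real N) * ((1 + c / real N) ^ m * (\<kappa> / 2 + real m * ?e)) + (1 + c / real N) ^ Suc m * ?e"
    proof (intro add_mono mult_left_mono)
      show "\<Delta> ?t \<le> (1 + c / real N) ^ m * (\<kappa> / 2 + real m * ?e)" using Suc by simp
      show "?e \<le> (1 + c / real N) ^ Suc m * ?e"
        using mult_right_mono[OF one_le_power[OF q, of "Suc m"] e0] by simp
    qed (use q in auto)
    also have "\<dots> = (1 + c / real N) ^ Suc m * (\<kappa> / 2 + real (Suc m) * ?e)" by (rule alg)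
    finally show ?case unfolding S .
  qed
  have fin: "\<Delta> 1 \<le> exp c * (\<kappa> / 2) + exp c * G.err / sqrt (real N)" if N: "1 \<le> N" for N :: nat
  proof -
    have "\<Delta> 1 \<le> (1 + c / real N) ^ N * (\<kappa> / 2 + real N * (G.err * (1 / real N * sqrt (1 / real N))))"
      using iter[OF N order_refl] N by simp
    also have "\<dots> \<le> exp c * (\<kappa> / 2 + real N * (G.err * (1 / real N * sqrt (1 / real N))))"
    proof (rule mult_right_mono)
      have "(1 + c / real N) ^ N \<le> exp (c / real N) ^ N"
        using c0 by (intro power_mono) (auto simp: add.commute intro: exp_ge_add_one_self)
      also have "\<dots> = exp c" using N by (simp add: exp_of_nat_mult[symmetric])
      finally show "(1 + c / real N) ^ N \<le> exp c" .
    qed (use \<kappa>0 G.err_nonneg in auto)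
    also have "real N * (G.err * (1 / real N * sqrt (1 / real N))) = G.err / sqrt (real N)"
      using N by (simp add: real_sqrt_divide)
    finally show ?thesis by (simp add: distrib_left)
  qed
  have "\<Delta> 1 \<le> exp c * (\<kappa> / 2)" by (rule real_le_by_inverse_sqrt) (rule fin)
  also have "\<dots> \<le> exp c * ((ln (real n) + overlap_const \<theta>) / 2)" using \<kappa> by (intro mult_left_mono) auto
  finally have "b\<^sup>2 / 2 - exp c * ((ln (real n) + overlap_const \<theta>) / 2) \<le> f 1"
    using \<kappa>0 unfolding \<Delta>_def by simp
  also have "f 1 = (\<integral>x. Phi n b (\<lambda>_. 0) x \<partial>gauss (idx n))"
    using heat_pairing[of n b "\<lambda>_. 0"] unfolding f_def z_def by simp
  finally show ?thesis unfolding c_def .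
qed

lemma nn_integral_gauss_exp:
  assumes I: "finite I"
  shows "(\<integral>\<^sup>+x. ennreal (exp (\<Sum>p\<in>I. x p * u p)) \<partial>gauss I) = ennreal (exp ((\<Sum>p\<in>I. (u p)\<^sup>2) / 2))"
proof -
  interpret product_prob_space "\<lambda>_::'a. std_normal_distribution" by (rule product_prob_space_gauss)
  have 1: "(\<integral>\<^sup>+t. ennreal (exp (t * c)) \<partial>std_normal_distribution) = ennreal (exp (c\<^sup>2 / 2))" for c :: real
  proof -
    have "(\<integral>\<^sup>+t. ennreal (exp (t * c)) \<partial>std_normal_distribution) = (\<integral>\<^sup>+t. ennreal (std_normal_density t) * ennreal (exp (t * c)) \<partial>lborel)"
      by (rule nn_integral_density) auto
    also have "\<dots> = (\<integral>\<^sup>+t. ennreal (1 / sqrt (2 * pi)) * ennreal (exp (- (1/2) * t\<^sup>2 + c * t)) \<partial>lborel)"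
      by (intro nn_integral_cong) (simp add: std_normal_density_def ennreal_mult'[symmetric] exp_add[symmetric] mult.commute)
    also have "\<dots> = ennreal (1 / sqrt (2 * pi)) * ennreal (sqrt (pi / (1/2)) * exp (c\<^sup>2 / (4 * (1/2))))"
      by (subst nn_integral_cmult, measurable, subst nn_integral_gaussian_1d) auto
    also have "\<dots> = ennreal (exp (c\<^sup>2 / 2))"
      by (subst ennreal_mult'[symmetric]) (auto simp: real_sqrt_mult mult.commute)
    finally show ?thesis .
  qed
  have "(\<integral>\<^sup>+x. ennreal (exp (\<Sum>p\<in>I. x p * u p)) \<partial>gauss I) = (\<integral>\<^sup>+x. (\<Prod>p\<in>I. ennreal (exp (x p * u p))) \<partial>gauss I)"
    using I by (simp add: exp_sum prod_ennreal)
  also have "\<dots> = (\<Prod>p\<in>I. \<integral>\<^sup>+t. ennreal (exp (t * u p)) \<partial>std_normal_distribution)"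
    unfolding gauss_def by (rule product_nn_integral_prod[OF I]) auto
  also have "\<dots> = ennreal (exp ((\<Sum>p\<in>I. (u p)\<^sup>2) / 2))"
    unfolding 1 using I by (simp add: prod_ennreal exp_sum sum_divide_distrib)
  finally show ?thesis .
qed

text \<open>
  \<open>max 0 u \<le> exp u\<close>, and \<open>exp (Phi n b 0 x)\<close> has mean \<open>exp (b\<^sup>2/2)\<close>.
\<close>

lemma annealed_bound:
  assumes n: "1 \<le> n"
  shows "(\<integral>x. max 0 (Phi n b (\<lambda>_. 0) x - b\<^sup>2 / 2) \<partial>gauss (idx n)) \<le> 1"
proof -
  interpret GG: prob_space "gauss (idx n)" by (rule prob_space_gauss)
  interpret Y: prob_space "uball n" by (rule prob_space_uball)
  interpret P: pair_sigma_finite "gauss (idx n)" "uball n" ..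
  let ?e = "\<lambda>x y. energy n b (\<lambda>_. 0) x (sph n y)"
  have xm: "(\<lambda>p. fst p k) \<in> borel_measurable (gauss (idx n) \<Otimes>\<^sub>M uball n)" if "k \<in> idx n" for k
    by (rule measurable_compose[OF measurable_fst measurable_gauss_component[OF that]])
  have sm: "(\<lambda>p. sph n (snd p) k) \<in> borel_measurable (gauss (idx n) \<Otimes>\<^sub>M uball n)" if "k \<in> {1..n}" for k
    by (rule measurable_compose[OF measurable_snd bdm_meas[OF bdm_sph[OF that]]])
  have "(\<lambda>p. exp (?e (fst p) (snd p))) \<in> borel_measurable (gauss (idx n) \<Otimes>\<^sub>M uball n)"
    unfolding energy_def bil_def
    by (intro borel_measurable_exp[THEN measurable_compose[rotated]] borel_measurable_add borel_measurable_sum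
          borel_measurable_times borel_measurable_const xm sm idxI)
  hence jm: "(\<lambda>(x, y). ennreal (exp (?e x y))) \<in> borel_measurable (gauss (idx n) \<Otimes>\<^sub>M uball n)"
    by (simp add: case_prod_beta')
  have e: "?e x y = (\<Sum>p\<in>idx n. x p * pairing n b p y)" for x y
    using lin_pairing[of n b x y] unfolding gfamily.lin_def[OF gfamily_pairing] energy_def by simp
  have u: "(\<Sum>p\<in>idx n. (pairing n b p y)\<^sup>2) = b\<^sup>2" for y
  proof -
    have "(\<Sum>p\<in>idx n. (pairing n b p y)\<^sup>2) = (\<Sum>i=1..n. \<Sum>j=1..n. b\<^sup>2 * ((sph n y i)\<^sup>2 * (sph n y j)\<^sup>2))"
      using sum_idx[of "\<lambda>i j. b\<^sup>2 * ((sph n y i)\<^sup>2 * (sph n y j)\<^sup>2)" n] unfolding pairing_def power_mult_distrib .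
    also have "\<dots> = b\<^sup>2 * ((\<Sum>i=1..n. (sph n y i)\<^sup>2) * (\<Sum>j=1..n. (sph n y j)\<^sup>2))"
      unfolding sum_product by (simp only: sum_distrib_left)
    finally show ?thesis unfolding sph_norm[OF n] by simp
  qed
  have "(\<integral>\<^sup>+x. ennreal (exp (Phi n b (\<lambda>_. 0) x)) \<partial>gauss (idx n)) = (\<integral>\<^sup>+x. (\<integral>\<^sup>+y. ennreal (exp (?e x y)) \<partial>uball n) \<partial>gauss (idx n))"
  proof (rule nn_integral_cong)
    fix x
    have "exp (Phi n b (\<lambda>_. 0) x) = (\<integral>y. exp (?e x y) \<partial>uball n)"
      unfolding Phi_def log_avg_def by (rule exp_ln[OF exp_avg_pos[OF prob_space_uball bdm_energy]])
    moreover have "(\<integral>\<^sup>+y. ennreal (exp (?e x y)) \<partial>uball n) = ennreal (\<integral>y. exp (?e x y) \<partial>uball n)"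
      by (intro nn_integral_eq_integral bdm_integrable[OF prob_space_uball] bdm_exp bdm_energy) simp
    ultimately show "ennreal (exp (Phi n b (\<lambda>_. 0) x)) = (\<integral>\<^sup>+y. ennreal (exp (?e x y)) \<partial>uball n)" by simp
  qed
  also have "\<dots> = (\<integral>\<^sup>+y. (\<integral>\<^sup>+x. ennreal (exp (?e x y)) \<partial>gauss (idx n)) \<partial>uball n)"
    by (rule P.Fubini'[OF jm, symmetric])
  also have "\<dots> = ennreal (exp (b\<^sup>2 / 2))"
    unfolding e nn_integral_gauss_exp[OF finite_idx] u by (simp add: Y.emeasure_space_1)
  finally have E: "(\<integral>\<^sup>+x. ennreal (exp (Phi n b (\<lambda>_. 0) x)) \<partial>gauss (idx n)) = ennreal (exp (b\<^sup>2 / 2))" .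
  have Pm: "(\<lambda>x. Phi n b (\<lambda>_. 0) x) \<in> borel_measurable (gauss (idx n))" by (rule Phi_meas_gauss) simp
  have i: "integrable (gauss (idx n)) (\<lambda>x. max 0 (Phi n b (\<lambda>_. 0) x - b\<^sup>2 / 2))"
    using integrable_Phi[OF subset_refl] by (intro integrable_max) auto
  have "ennreal (\<integral>x. max 0 (Phi n b (\<lambda>_. 0) x - b\<^sup>2 / 2) \<partial>gauss (idx n)) = (\<integral>\<^sup>+x. ennreal (max 0 (Phi n b (\<lambda>_. 0) x - b\<^sup>2 / 2)) \<partial>gauss (idx n))"
    by (rule nn_integral_eq_integral[OF i, symmetric]) simp
  also have "\<dots> \<le> (\<integral>\<^sup>+x. ennreal (exp (- (b\<^sup>2 / 2))) * ennreal (exp (Phi n b (\<lambda>_. 0) x)) \<partial>gauss (idx n))"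
  proof (rule nn_integral_mono)
    fix x
    have "max 0 (Phi n b (\<lambda>_. 0) x - b\<^sup>2 / 2) \<le> exp (Phi n b (\<lambda>_. 0) x - b\<^sup>2 / 2)"
      using exp_ge_add_one_self[of "Phi n b (\<lambda>_. 0) x - b\<^sup>2 / 2"] exp_ge_zero[of "Phi n b (\<lambda>_. 0) x - b\<^sup>2 / 2"] by linarith
    also have "\<dots> = exp (- (b\<^sup>2 / 2)) * exp (Phi n b (\<lambda>_. 0) x)" by (simp add: exp_add[symmetric])
    finally show "ennreal (max 0 (Phi n b (\<lambda>_. 0) x - b\<^sup>2 / 2)) \<le> ennreal (exp (- (b\<^sup>2 / 2))) * ennreal (exp (Phi n b (\<lambda>_. 0) x))"
      by (simp add: ennreal_mult'[symmetric] ennreal_leI)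
  qed
  also have "\<dots> = ennreal (exp (- (b\<^sup>2 / 2))) * ennreal (exp (b\<^sup>2 / 2))"
    using Pm by (subst nn_integral_cmult) (auto simp: E)
  also have "\<dots> = ennreal 1" by (simp add: ennreal_mult'[symmetric] exp_add[symmetric])
  finally show ?thesis by (subst (asm) ennreal_le_iff) auto
qed

text \<open>
  The shortfall of a variable is its mean deficit plus its mean excess.
\<close>

lemma shortfall_high_temperature:
  assumes n: "2 \<le> n" and l: "0 < l" and \<theta>: "b\<^sup>2 / real n + l \<le> \<theta>" "\<theta> < 1 / 2"
  shows "shortfall n b (\<lambda>_. 0) (b\<^sup>2 / 2) \<le> exp (\<theta> / l) * (\<bar>ln (real n) + overlap_const \<theta>\<bar> / 2) + 1"
proof -
  interpret GG: prob_space "gauss (idx n)" by (rule prob_space_gauss)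
  let ?F = "\<lambda>x. Phi n b (\<lambda>_. 0) x"
  have i: "integrable (gauss (idx n)) ?F" by (rule integrable_Phi) simp
  have i2: "integrable (gauss (idx n)) (\<lambda>x. max 0 (?F x - b\<^sup>2 / 2))" using i by (intro integrable_max) auto
  have "shortfall n b (\<lambda>_. 0) (b\<^sup>2 / 2) = (\<integral>x. (b\<^sup>2 / 2 - ?F x) + max 0 (?F x - b\<^sup>2 / 2) \<partial>gauss (idx n))"
    unfolding shortfall_def by (intro Bochner_Integration.integral_cong refl) (auto simp: max_def)
  also have "\<dots> = b\<^sup>2 / 2 - (\<integral>x. ?F x \<partial>gauss (idx n)) + (\<integral>x. max 0 (?F x - b\<^sup>2 / 2) \<partial>gauss (idx n))"
    using i i2 by (simp add: GG.prob_space)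
  also have "\<dots> \<le> exp (b\<^sup>2 / (l * real n)) * ((ln (real n) + overlap_const \<theta>) / 2) + 1"
    using high_temperature[OF n l \<theta>] annealed_bound[of n b] n by linarith
  also have "exp (b\<^sup>2 / (l * real n)) * ((ln (real n) + overlap_const \<theta>) / 2)
      \<le> exp (b\<^sup>2 / (l * real n)) * (\<bar>ln (real n) + overlap_const \<theta>\<bar> / 2)"
    by (intro mult_left_mono divide_right_mono abs_ge_self) auto
  also have "\<dots> \<le> exp (\<theta> / l) * (\<bar>ln (real n) + overlap_const \<theta>\<bar> / 2)"
  proof (rule mult_right_mono)
    have "b\<^sup>2 / real n / l \<le> \<theta> / l" using \<theta>(1) l by (intro divide_right_mono) auto
    thus "exp (b\<^sup>2 / (l * real n)) \<le> exp (\<theta> / l)" by (simp add: mult.commute)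
  qed auto
  finally show ?thesis by simp
qed

text \<open>
  A field changes the free energy by at most its length.
\<close>

lemma lower_limit_high_temperature:
  assumes \<beta>: "\<beta>\<^sup>2 < 1 / 2" shows "lower_limit \<beta> h (\<beta>\<^sup>2 / 2 - h)"
  unfolding lower_limit_def
proof (intro allI impI)
  fix b :: "nat \<Rightarrow> real" and v :: "nat \<Rightarrow> nat \<Rightarrow> real"
  assume b: "(\<lambda>n. b n / sqrt (real n)) \<longlonglongrightarrow> \<beta>" and v: "(\<lambda>n. L2_set (v n) {1..n} / real n) \<longlonglongrightarrow> h"
  define l where "l = (1/2 - \<beta>\<^sup>2) / 4"
  \<comment> \<open>any \<open>\<theta>\<close> strictly between \<open>\<beta>\<^sup>2\<close> and \<open>1/2\<close>, with room for a positive \<open>l\<close>\<close>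
  define \<theta> where "\<theta> = \<beta>\<^sup>2 + 2 * l"
  have l: "0 < l" "\<theta> < 1 / 2" using \<beta> by (auto simp: l_def \<theta>_def field_simps)
  define B where "B n = (b n)\<^sup>2 / real n" for n
  have "(\<lambda>n. (b n / sqrt (real n))\<^sup>2) \<longlonglongrightarrow> \<beta>\<^sup>2" by (intro tendsto_power b)
  hence B: "B \<longlonglongrightarrow> \<beta>\<^sup>2" unfolding B_def by (simp add: power_divide)
  have ev: "\<forall>\<^sub>F n in sequentially. B n < \<beta>\<^sup>2 + l" using B l(1) by (intro order_tendstoD(2)) auto
  define c where "c = \<beta>\<^sup>2 / 2 - h"
  define e where "e n = \<bar>c + L2_set (v n) {1..n} / real n - B n / 2\<bar>" for n
  have "e \<longlonglongrightarrow> \<bar>c + h - \<beta>\<^sup>2 / 2\<bar>" unfolding e_def by (intro tendsto_intros v B) simp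
  hence e: "e \<longlonglongrightarrow> 0" by (simp add: c_def)
  define d where "d n = exp (\<theta> / l) * (\<bar>ln (real n) / real n + overlap_const \<theta> * (1 / real n)\<bar> / 2) + 1 / real n" for n
  have "d \<longlonglongrightarrow> exp (\<theta> / l) * (\<bar>0 + overlap_const \<theta> * 0\<bar> / 2) + 0"
    unfolding d_def by (intro tendsto_intros lim_ln_over_n lim_1_over_n) simp_all
  hence d: "d \<longlonglongrightarrow> 0" by simp
  have bound: "shortfall n (b n) (v n) (real n * c) / real n \<le> d n + e n" if n: "2 \<le> n" and Bn: "B n < \<beta>\<^sup>2 + l" for n
  proof -
    interpret GG: prob_space "gauss (idx n)" by (rule prob_space_gauss)
    have n0: "0 < real n" "1 \<le> n" using n by auto
    let ?L = "L2_set (v n) {1..n}"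
    have i: "integrable (gauss (idx n)) (\<lambda>x. max 0 (a - Phi n (b n) w x))" for a w by (rule integrable_shortfall) simp
    have "shortfall n (b n) (v n) (real n * c) \<le> (\<integral>x. max 0 ((b n)\<^sup>2 / 2 - Phi n (b n) (\<lambda>_. 0) x) + real n * e n \<partial>gauss (idx n))"
      unfolding shortfall_def
    proof (rule integral_mono)
      fix x
      have "Phi n (b n) (\<lambda>_. 0) x \<le> Phi n (b n) (v n) x + ?L"
        using Phi_lipschitz[OF n0(2), of "b n" "\<lambda>_. 0" x "v n"] by (simp add: L2_set_def)
      moreover have "real n * e n = \<bar>real n * c + ?L - (b n)\<^sup>2 / 2\<bar>"
      proof -
        have "real n * e n = \<bar>real n * (c + ?L / real n - B n / 2)\<bar>" unfolding e_def abs_mult using n0 by simp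
        also have "real n * (c + ?L / real n - B n / 2) = real n * c + ?L - (b n)\<^sup>2 / 2"
          unfolding B_def using n0 by (simp add: field_simps)
        finally show ?thesis .
      qed
      ultimately show "max 0 (real n * c - Phi n (b n) (v n) x) \<le> max 0 ((b n)\<^sup>2 / 2 - Phi n (b n) (\<lambda>_. 0) x) + real n * e n"
        by linarith
    qed (use i in auto)
    also have "\<dots> = shortfall n (b n) (\<lambda>_. 0) ((b n)\<^sup>2 / 2) + real n * e n"
      unfolding shortfall_def using i by (simp add: GG.prob_space)
    also have "shortfall n (b n) (\<lambda>_. 0) ((b n)\<^sup>2 / 2) \<le> exp (\<theta> / l) * (\<bar>ln (real n) + overlap_const \<theta>\<bar> / 2) + 1"
      by (rule shortfall_high_temperature[OF n l(1) _ l(2)]) (use Bn in \<open>simp add: B_def \<theta>_def\<close>)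
    also have "\<dots> = real n * d n"
    proof -
      have "\<bar>ln (real n) / real n + overlap_const \<theta> * (1 / real n)\<bar> = \<bar>ln (real n) + overlap_const \<theta>\<bar> / real n"
        using n0 by (simp add: add_divide_distrib[symmetric] abs_divide)
      thus ?thesis unfolding d_def using n0 by (simp add: field_simps)
    qed
    finally have "shortfall n (b n) (v n) (real n * c) \<le> real n * (d n + e n)" by (simp add: distrib_left)
    thus ?thesis using n0 by (simp add: divide_le_eq mult.commute)
  qed
  have "(\<lambda>n. d n + e n) \<longlonglongrightarrow> 0 + 0" by (intro tendsto_add d e)
  hence lim: "(\<lambda>n. d n + e n) \<longlonglongrightarrow> 0" by simp
  show "(\<lambda>n. shortfall n (b n) (v n) (real n * (\<beta>\<^sup>2 / 2 - h)) / real n) \<longlonglongrightarrow> 0"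
    unfolding c_def[symmetric]
  proof (rule tendsto_sandwich[OF _ _ tendsto_const lim])
    show "\<forall>\<^sub>F n in sequentially. 0 \<le> shortfall n (b n) (v n) (real n * c) / real n"
      using shortfall_nonneg by (intro always_eventually allI divide_nonneg_nonneg) auto
    show "\<forall>\<^sub>F n in sequentially. shortfall n (b n) (v n) (real n * c) / real n \<le> d n + e n"
      using ev eventually_ge_at_top[of 2] by eventually_elim (rule bound)
  qed
qed

lemma shortfall_mono: assumes "c \<le> d" shows "shortfall n b v c \<le> shortfall n b v d"
  unfolding shortfall_def
proof (rule integral_mono)
  show "max 0 (c - Phi n b v x) \<le> max 0 (d - Phi n b v x)" for x using assms by linarith
qed (auto intro: integrable_shortfall)

lemma lower_limit_mono:
  assumes L: "lower_limit \<beta> h d" and cd: "c \<le> d" shows "lower_limit \<beta> h c"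
  unfolding lower_limit_def
proof (intro allI impI)
  fix b :: "nat \<Rightarrow> real" and v :: "nat \<Rightarrow> nat \<Rightarrow> real"
  assume "(\<lambda>n. b n / sqrt (real n)) \<longlonglongrightarrow> \<beta>" "(\<lambda>n. L2_set (v n) {1..n} / real n) \<longlonglongrightarrow> h"
  hence lim: "(\<lambda>n. shortfall n (b n) (v n) (real n * d) / real n) \<longlonglongrightarrow> 0" using L unfolding lower_limit_def by simp
  show "(\<lambda>n. shortfall n (b n) (v n) (real n * c) / real n) \<longlonglongrightarrow> 0"
  proof (rule tendsto_sandwich[OF _ _ tendsto_const lim])
    show "\<forall>\<^sub>F n in sequentially. 0 \<le> shortfall n (b n) (v n) (real n * c) / real n"
      using shortfall_nonneg by (intro always_eventually allI divide_nonneg_nonneg) auto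
    show "\<forall>\<^sub>F n in sequentially. shortfall n (b n) (v n) (real n * c) / real n \<le> shortfall n (b n) (v n) (real n * d) / real n"
      using cd by (intro always_eventually allI divide_right_mono shortfall_mono mult_left_mono) auto
  qed
qed

lemma lower_limit_closed:
  assumes L: "\<And>e. 0 < e \<Longrightarrow> lower_limit \<beta> h (c - e)" shows "lower_limit \<beta> h c"
  unfolding lower_limit_def
proof (intro allI impI)
  fix b :: "nat \<Rightarrow> real" and v :: "nat \<Rightarrow> nat \<Rightarrow> real"
  assume bv: "(\<lambda>n. b n / sqrt (real n)) \<longlonglongrightarrow> \<beta>" "(\<lambda>n. L2_set (v n) {1..n} / real n) \<longlonglongrightarrow> h"
  show "(\<lambda>n. shortfall n (b n) (v n) (real n * c) / real n) \<longlonglongrightarrow> 0"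
  proof (rule LIMSEQ_I)
    fix r :: real assume r: "0 < r"
    have "(\<lambda>n. shortfall n (b n) (v n) (real n * (c - r / 2)) / real n) \<longlonglongrightarrow> 0"
      using L[OF half_gt_zero[OF r]] bv unfolding lower_limit_def by blast
    then obtain n0 where n0: "\<And>n. n0 \<le> n \<Longrightarrow> norm (shortfall n (b n) (v n) (real n * (c - r / 2)) / real n - 0) < r / 2"
      using LIMSEQ_D[of _ _ "r / 2"] half_gt_zero[OF r] by blast
    show "\<exists>no. \<forall>n\<ge>no. norm (shortfall n (b n) (v n) (real n * c) / real n - 0) < r"
    proof (intro exI allI impI)
      fix n assume n: "max 1 n0 \<le> n"
      hence n1: "1 \<le> n" "0 < real n" "n0 \<le> n" by auto
      have "L2_set (\<lambda>i. v n i - v n i) {1..n} = 0" by (simp add: L2_set_def)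
      hence "shortfall n (b n) (v n) (real n * c) \<le> shortfall n (b n) (v n) (real n * (c - r / 2)) + \<bar>real n * c - real n * (c - r / 2)\<bar>"
        using shortfall_lipschitz[OF n1(1), of "b n" "v n" "real n * c" "v n" "real n * (c - r / 2)"] by simp
      also have "\<bar>real n * c - real n * (c - r / 2)\<bar> = real n * (r / 2)" using r by (simp add: right_diff_distrib)
      finally have "shortfall n (b n) (v n) (real n * c) / real n \<le> (shortfall n (b n) (v n) (real n * (c - r / 2)) + real n * (r / 2)) / real n"
        using n1 by (intro divide_right_mono) auto
      also have "\<dots> = shortfall n (b n) (v n) (real n * (c - r / 2)) / real n + r / 2"
        using n1 by (simp add: add_divide_distrib)
      also have "\<dots> < r" using n0[OF n1(3)] unfolding diff_0_right real_norm_def by linarith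
      finally show "norm (shortfall n (b n) (v n) (real n * c) / real n - 0) < r"
        using shortfall_nonneg[of n "b n" "v n" "real n * c"] n1 by simp
    qed
  qed
qed

section \<open>The limiting value\<close>

text \<open>
  The function \<open>tap\<close> at a critical point, where its square root equals \<open>q / (1 - q)\<close>.
\<close>

definition value_at :: "real \<Rightarrow> real \<Rightarrow> real" where
  "value_at \<beta> q = q / (1 - q) + ln (1 - q) / 2 + \<beta>\<^sup>2 / 2 * (1 - q)\<^sup>2"

text \<open>
  The step with \<open>s = h (1 - q)\<close> leads to a critical point \<open>q'\<close> with \<open>q' \<le> \<rho> q\<close>, with the same
  \<open>\<beta> (1 - q) = u\<close>, and such that the gain in the step makes up exactly for the difference of the values.
  At the end of the chain \<open>q \<le> \<delta>\<close>, and the bound for high temperature loses only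
  \<open>h + q / (1 - q)\<close>.
\<close>

lemma lower_limit_chain:
  assumes u: "2 * u\<^sup>2 < 1" and q0: "0 < q0" "q0 < 1" and \<delta>: "0 < \<delta>" "u\<^sup>2 / (1 - \<delta>)\<^sup>2 < 1 / 2" "\<delta> \<le> q0"
  defines "\<rho> \<equiv> 2 * u\<^sup>2 / (1 - (1 - 2 * u\<^sup>2) * q0)"
  assumes \<beta>: "0 < \<beta>" and h: "0 < h" and q: "0 < q" "q \<le> q0" and eq: "q / (1 - q)\<^sup>2 = h\<^sup>2 + 2 * \<beta>\<^sup>2 * q" and uq: "\<beta> * (1 - q) = u"
    and k: "\<rho> ^ k * q \<le> \<delta>"
  shows "lower_limit \<beta> h (value_at \<beta> q - 2 * sqrt \<delta> / (1 - q0))"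
  using \<beta> h q eq uq k
proof (induction k arbitrary: \<beta> h q)
  case 0
  hence q: "0 < q" "q \<le> \<delta>" "q < 1" "0 < 1 - q" using q0 by auto
  have \<delta>1: "\<delta> < 1" using \<delta> q0 by simp
  have \<beta>u: "\<beta> = u / (1 - q)" using 0 q by (simp add: field_simps)
  have u0: "0 < u" using 0 q by auto
  have "(1 - \<delta>)\<^sup>2 \<le> (1 - q)\<^sup>2" using q \<delta>1 by (intro power_mono) auto
  hence "u\<^sup>2 / (1 - q)\<^sup>2 \<le> u\<^sup>2 / (1 - \<delta>)\<^sup>2" using \<delta>1 q by (intro divide_left_mono mult_pos_pos) auto
  hence "u\<^sup>2 / (1 - q)\<^sup>2 < 1 / 2" using \<delta>(2) by linarith
  hence b2: "\<beta>\<^sup>2 < 1 / 2" unfolding \<beta>u power_divide .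
  have sq: "sqrt q \<le> sqrt \<delta>" using q by simp
  have "h\<^sup>2 \<le> q / (1 - q)\<^sup>2" using 0 by (simp add: mult_nonneg_nonneg)
  hence "h\<^sup>2 \<le> (sqrt q / (1 - q))\<^sup>2" using q by (simp add: power_divide)
  hence "h \<le> sqrt q / (1 - q)" by (rule power2_le_imp_le) (use q in simp)
  moreover have "q \<le> sqrt q" using q by (intro real_le_rsqrt) (simp add: power2_eq_square mult_left_le)
  hence "q / (1 - q) \<le> sqrt q / (1 - q)" using q by (intro divide_right_mono) auto
  moreover have "sqrt q / (1 - q) \<le> sqrt \<delta> / (1 - q0)"
    using sq 0 q0 by (intro frac_le) auto
  ultimately have loss: "h + q / (1 - q) \<le> 2 * sqrt \<delta> / (1 - q0)" by simp
  have "ln (1 - q) \<le> 0" using q by simp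
  moreover have "\<beta>\<^sup>2 / 2 * (1 - q)\<^sup>2 \<le> \<beta>\<^sup>2 / 2 * 1" using q by (intro mult_left_mono) (auto simp: power_le_one)
  ultimately have "value_at \<beta> q - 2 * sqrt \<delta> / (1 - q0) \<le> \<beta>\<^sup>2 / 2 - h"
    using loss unfolding value_at_def by linarith
  thus ?case by (rule lower_limit_mono[OF lower_limit_high_temperature[OF b2]])
next
  case (Suc k)
  define s where "s = h * (1 - q)"
  have q: "0 < q" "q < 1" "0 < 1 - q" "q \<le> q0" using Suc.prems q0 by auto
  have u0: "0 < u" using Suc.prems q by auto
  have s2: "s\<^sup>2 = q * (1 - 2 * u\<^sup>2)"
  proof -
    have "q = (h\<^sup>2 + 2 * \<beta>\<^sup>2 * q) * (1 - q)\<^sup>2" using Suc.prems(5) q by (simp add: field_simps)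
    also have "\<dots> = s\<^sup>2 + 2 * u\<^sup>2 * q" unfolding s_def Suc.prems(6)[symmetric] by algebra
    finally show ?thesis by (simp add: algebra_simps)
  qed
  have s0: "0 < s" using Suc.prems q by (simp add: s_def)
  have "s\<^sup>2 \<le> q * 1" unfolding s2 using q by (intro mult_left_mono) auto
  hence s2q: "s\<^sup>2 < 1" using q by simp
  have s1: "s < 1" using s2q s0 by (simp add: power_less_one_iff abs_square_less_1)
  have d: "0 < 1 - s\<^sup>2" using s2q by simp
  define q' where "q' = (q - s\<^sup>2) / (1 - s\<^sup>2)"
  define \<beta>' where "\<beta>' = \<beta> * (1 - s\<^sup>2)"
  define h' where "h' = sqrt 2 * \<beta> * (s * sqrt (1 - s\<^sup>2))"
  have qs: "q - s\<^sup>2 = 2 * u\<^sup>2 * q" unfolding s2 by (simp add: algebra_simps)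
  have q'1: "1 - q' = (1 - q) / (1 - s\<^sup>2)" using d by (simp add: q'_def field_simps)
  have q'0: "0 < q'" unfolding q'_def qs using d q u0 by simp
  have \<rho>: "q' \<le> \<rho> * q"
  proof -
    have "1 - (1 - 2 * u\<^sup>2) * q0 \<le> 1 - s\<^sup>2" unfolding s2 using u q by (simp add: mult.commute mult_right_mono)
    moreover have "(1 - 2 * u\<^sup>2) * q0 < 1 * 1" using u q0 u0 by (intro mult_strict_mono) auto
    ultimately have "2 * u\<^sup>2 / (1 - s\<^sup>2) \<le> \<rho>" unfolding \<rho>_def using d by (intro divide_left_mono) auto
    hence "2 * u\<^sup>2 / (1 - s\<^sup>2) * q \<le> \<rho> * q" using q by (intro mult_right_mono) auto
    thus ?thesis unfolding q'_def qs by simp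
  qed
  have q'q: "q' \<le> q"
  proof -
    have "(1 - q) / (1 - s\<^sup>2) \<ge> (1 - q) / 1" using d q by (intro divide_left_mono) auto
    thus ?thesis using q'1 by simp
  qed
  have \<rho>0: "0 \<le> \<rho>" using \<rho> q'0 q by (metis less_le_not_le linorder_not_le mult_nonpos_nonneg order_trans)
  have bs: "\<beta>' * (1 - q') = u" unfolding \<beta>'_def q'1 Suc.prems(6)[symmetric] using d by simp
  have h2: "h'\<^sup>2 = 2 * \<beta>\<^sup>2 * s\<^sup>2 * (1 - s\<^sup>2)" unfolding h'_def using d by (simp add: power_mult_distrib)
  have eq': "q' / (1 - q')\<^sup>2 = h'\<^sup>2 + 2 * \<beta>'\<^sup>2 * q'"
  proof -
    have "q' / (1 - q')\<^sup>2 = (q - s\<^sup>2) * (1 - s\<^sup>2) / (1 - q)\<^sup>2"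
    proof -
      have "q' / (1 - q')\<^sup>2 = ((q - s\<^sup>2) / (1 - s\<^sup>2)) / ((1 - q) / (1 - s\<^sup>2))\<^sup>2"
        by (simp only: q'1) (simp only: q'_def)
      moreover have "(a / D) / (c / D)\<^sup>2 = a * D / c\<^sup>2" if "D \<noteq> 0" for a c D :: real
        using that by (simp add: power2_eq_square)
      ultimately show ?thesis using d by simp
    qed
    also have "\<dots> = 2 * \<beta>\<^sup>2 * q * (1 - s\<^sup>2)"
      unfolding qs Suc.prems(6)[symmetric] using q by (simp add: power_mult_distrib)
    also have "\<dots> = h'\<^sup>2 + 2 * \<beta>'\<^sup>2 * q'"
      unfolding h2 q'_def \<beta>'_def using d by (simp add: power_mult_distrib power2_eq_square field_simps)
    finally show ?thesis .
  qed
  have "\<rho> ^ k * q' \<le> \<rho> ^ k * (\<rho> * q)" using \<rho> \<rho>0 by (intro mult_left_mono) auto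
  also have "\<dots> \<le> \<delta>" using Suc.prems(7) by (simp add: mult_ac)
  finally have k': "\<rho> ^ k * q' \<le> \<delta>" .
  have "lower_limit \<beta>' h' (value_at \<beta>' q' - 2 * sqrt \<delta> / (1 - q0))"
  proof (rule Suc.IH[OF _ _ q'0 _ eq' bs k'])
    show "0 < \<beta>'" using Suc.prems d by (simp add: \<beta>'_def)
    show "0 < h'" using Suc.prems d s0 by (simp add: h'_def)
    show "q' \<le> q0" using q'q q by simp
  qed
  from lower_limit_step[OF s0 s1 Suc.prems(1) this[unfolded \<beta>'_def h'_def], of h]
  have "lower_limit \<beta> h (h * s + ln (1 - s\<^sup>2) / 2 + (value_at \<beta>' q' - 2 * sqrt \<delta> / (1 - q0)))"
    unfolding \<beta>'_def .
  moreover have "h * s + ln (1 - s\<^sup>2) / 2 + value_at \<beta>' q' = value_at \<beta> q"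
  proof -
    have "q' / (1 - q') = (q - s\<^sup>2) / (1 - q)"
      using d by (simp only: q'1) (simp add: q'_def)
    moreover have "h * s = s\<^sup>2 / (1 - q)" unfolding s_def using q by (simp add: power2_eq_square)
    ultimately have 1: "h * s + q' / (1 - q') = q / (1 - q)" by (simp add: add_divide_distrib[symmetric])
    have 2: "ln (1 - q') = ln (1 - q) - ln (1 - s\<^sup>2)" unfolding q'1 using d q by (simp add: ln_div)
    have 3: "\<beta>'\<^sup>2 / 2 * (1 - q')\<^sup>2 = \<beta>\<^sup>2 / 2 * (1 - q)\<^sup>2"
      using bs Suc.prems(6) by (metis power_mult_distrib times_divide_eq_left)
    show ?thesis unfolding value_at_def 2 3 using 1 by (simp add: diff_divide_distrib)
  qed
  ultimately show ?case by (simp add: algebra_simps)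
qed

text \<open>
  The equation says \<open>q (1 - 2 (\<beta> (1 - q))\<^sup>2) = h\<^sup>2 (1 - q)\<^sup>2\<close>.
\<close>

lemma critical_bound:
  fixes \<beta> h q :: real
  assumes h: "0 < h" and q: "0 < q" "q < 1" and eq: "q / (1 - q)\<^sup>2 = h\<^sup>2 + 2 * \<beta>\<^sup>2 * q"
  shows "2 * (\<beta> * (1 - q))\<^sup>2 < 1"
proof -
  have "q = (h\<^sup>2 + 2 * \<beta>\<^sup>2 * q) * (1 - q)\<^sup>2" using eq q by (simp add: field_simps)
  hence "q * (1 - 2 * (\<beta> * (1 - q))\<^sup>2) = h\<^sup>2 * (1 - q)\<^sup>2" by algebra
  moreover have "0 < h\<^sup>2 * (1 - q)\<^sup>2" using h q by simp
  ultimately have "0 < q * (1 - 2 * (\<beta> * (1 - q))\<^sup>2)" by simp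
  thus ?thesis using q by (simp add: zero_less_mult_iff)
qed

lemma lower_limit_value:
  assumes \<beta>: "0 < \<beta>" and h: "0 < h" and q: "0 < q" "q < 1" and eq: "q / (1 - q)\<^sup>2 = h\<^sup>2 + 2 * \<beta>\<^sup>2 * q"
  shows "lower_limit \<beta> h (value_at \<beta> q)"
proof (rule lower_limit_closed)
  fix e :: real assume e: "0 < e"
  define u where "u = \<beta> * (1 - q)"
  have u: "2 * u\<^sup>2 < 1" unfolding u_def by (rule critical_bound[OF h q eq])
  have u0: "0 < u" using \<beta> q by (simp add: u_def)
  define \<rho> where "\<rho> = 2 * u\<^sup>2 / (1 - (1 - 2 * u\<^sup>2) * q)"
  have den: "2 * u\<^sup>2 < 1 - (1 - 2 * u\<^sup>2) * q"
  proof -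
    have "0 < (1 - 2 * u\<^sup>2) * (1 - q)" using u q by simp
    thus ?thesis by (simp add: algebra_simps)
  qed
  have den0: "0 < 1 - (1 - 2 * u\<^sup>2) * q" using den zero_le_power2[of u] by linarith
  have \<rho>: "0 \<le> \<rho>" "\<rho> < 1" using den den0 unfolding \<rho>_def by (auto simp: divide_less_eq)
  define f where "f \<delta> = u\<^sup>2 / (1 - \<delta>)\<^sup>2" for \<delta>
  have "isCont f 0" unfolding f_def by (intro continuous_intros) auto
  hence "(f \<longlongrightarrow> f 0) (at 0)" by (simp add: isCont_def)
  moreover have "f 0 < 1 / 2" using u by (simp add: f_def)
  ultimately have "\<forall>\<^sub>F \<delta> in at 0. f \<delta> < 1 / 2" by (rule order_tendstoD(2))
  then obtain r where r: "0 < r" "\<And>\<delta>. \<delta> \<noteq> 0 \<Longrightarrow> dist \<delta> 0 < r \<Longrightarrow> f \<delta> < 1 / 2"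
    unfolding eventually_at by auto
  define \<delta> where "\<delta> = min (min (r / 2) q) ((e * (1 - q) / 2)\<^sup>2)"
  have \<delta>: "0 < \<delta>" "\<delta> < r" "\<delta> \<le> q" "\<delta> \<le> (e * (1 - q) / 2)\<^sup>2" using r q e by (auto simp: \<delta>_def min_less_iff_disj)
  have "(\<lambda>k. \<rho> ^ k * q) \<longlonglongrightarrow> 0 * q" using \<rho> by (intro tendsto_mult LIMSEQ_power_zero tendsto_const) auto
  hence "\<forall>\<^sub>F k in sequentially. \<rho> ^ k * q < \<delta>" using \<delta> by (intro order_tendstoD(2)[of _ "0 * q"]) auto
  then obtain k where k: "\<rho> ^ k * q < \<delta>" by (auto simp: eventually_sequentially)
  have "lower_limit \<beta> h (value_at \<beta> q - 2 * sqrt \<delta> / (1 - q))"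
  proof (rule lower_limit_chain[OF u q \<delta>(1) _ \<delta>(3) \<beta> h q(1) order_refl eq u_def[symmetric]])
    show "u\<^sup>2 / (1 - \<delta>)\<^sup>2 < 1 / 2" using r(2)[of \<delta>] \<delta> unfolding f_def by simp
    show "(2 * u\<^sup>2 / (1 - (1 - 2 * u\<^sup>2) * q)) ^ k * q \<le> \<delta>" using k unfolding \<rho>_def by simp
  qed
  moreover have "2 * sqrt \<delta> / (1 - q) \<le> e"
  proof -
    have "sqrt \<delta> \<le> e * (1 - q) / 2" using \<delta>(4) e q by (intro real_le_lsqrt) auto
    thus ?thesis using q by (simp add: divide_le_eq)
  qed
  ultimately show "lower_limit \<beta> h (value_at \<beta> q - e)" by (elim lower_limit_mono) simp
qed

lemma critical_exists:
  fixes \<beta> h :: real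
  assumes h: "0 < h" shows "\<exists>q. 0 < q \<and> q < 1 \<and> q / (1 - q)\<^sup>2 = h\<^sup>2 + 2 * \<beta>\<^sup>2 * q"
proof -
  define g where "g q = q - (1 - q)\<^sup>2 * (h\<^sup>2 + 2 * \<beta>\<^sup>2 * q)" for q
  have "continuous_on {0..1} g" unfolding g_def by (intro continuous_intros)
  hence "\<exists>q\<ge>0. q \<le> 1 \<and> g q = 0" by (intro IVT') (auto simp: g_def)
  then obtain q where q: "0 \<le> q" "q \<le> 1" "g q = 0" by blast
  have "q \<noteq> 0" using q h by (auto simp: g_def)
  moreover have "q \<noteq> 1" using q by (auto simp: g_def)
  ultimately have "0 < q" "q < 1" using q by auto
  moreover have "q / (1 - q)\<^sup>2 = h\<^sup>2 + 2 * \<beta>\<^sup>2 * q" using q(3) \<open>q < 1\<close> by (simp add: g_def field_simps)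
  ultimately show ?thesis by blast
qed

subsection \<open>The supremum\<close>

definition tap :: "real \<Rightarrow> real \<Rightarrow> real \<Rightarrow> real" where
  "tap \<beta> h q = sqrt (h\<^sup>2 * q + 2 * \<beta>\<^sup>2 * q\<^sup>2) + ln (1 - q) / 2 + \<beta>\<^sup>2 / 2 * (1 - q)\<^sup>2"

lemma TAP_fun_eq: "q < 1 \<Longrightarrow> TAP_fun \<beta> h q = ereal (tap \<beta> h q)"
  by (simp add: TAP_fun_def log_ext_def tap_def)

lemma TAP_fun_1: "TAP_fun \<beta> h 1 = -\<infinity>"
  by (simp add: TAP_fun_def log_ext_def)

lemma tap_critical:
  assumes q: "0 < q" "q < 1" and eq: "q / (1 - q)\<^sup>2 = h\<^sup>2 + 2 * \<beta>\<^sup>2 * q"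
  shows "tap \<beta> h q = value_at \<beta> q"
proof -
  have "h\<^sup>2 * q + 2 * \<beta>\<^sup>2 * q\<^sup>2 = (h\<^sup>2 + 2 * \<beta>\<^sup>2 * q) * q" by (simp add: power2_eq_square algebra_simps)
  also have "\<dots> = (q / (1 - q))\<^sup>2" unfolding eq[symmetric] by (simp add: power_divide power2_eq_square)
  finally have "sqrt (h\<^sup>2 * q + 2 * \<beta>\<^sup>2 * q\<^sup>2) = q / (1 - q)" using q by simp
  thus ?thesis by (simp add: tap_def value_at_def)
qed

lemma ln_le_quadratic:
  fixes y :: real assumes "0 < y" "y \<le> 1"
  shows "ln y + 1 - y + (1 - y)\<^sup>2 / 2 \<le> 0"
proof -
  define g where "g y = ln y + 1 - y + (1 - y)\<^sup>2 / 2" for y :: real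
  have "g y \<le> g 1"
  proof (rule DERIV_nonneg_imp_nondecreasing[OF assms(2)])
    fix x assume x: "y \<le> x" "x \<le> 1"
    hence x0: "0 < x" using assms by simp
    have "(g has_real_derivative (1 / x - 1 - (1 - x))) (at x)"
      unfolding g_def using x0 by (auto intro!: derivative_eq_intros) (simp add: field_simps)
    moreover have "0 \<le> 1 / x - 1 - (1 - x)"
    proof -
      have "1 / x - 1 - (1 - x) = (1 - x)\<^sup>2 / x" using x0 by (simp add: power2_eq_square field_simps)
      thus ?thesis using x0 by simp
    qed
    ultimately show "\<exists>y. (g has_real_derivative y) (at x) \<and> 0 \<le> y" by blast
  qed
  thus ?thesis by (simp add: g_def)
qed

lemma ln_le_quadratic_inverse:
  fixes y :: real assumes "1 \<le> y"
  shows "ln y + 1 - y + (1 - 1 / y)\<^sup>2 / 2 \<le> 0"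
proof -
  define g where "g y = ln y + 1 - y + (1 - 1 / y)\<^sup>2 / 2" for y :: real
  have "g y \<le> g 1"
  proof (rule DERIV_nonpos_imp_nonincreasing[OF assms])
    fix x assume x: "1 \<le> x" "x \<le> y"
    hence x0: "0 < x" by simp
    have "(g has_real_derivative (1 / x - 1 + (1 - 1 / x) / x\<^sup>2)) (at x)"
      unfolding g_def using x0 by (auto intro!: derivative_eq_intros simp: power2_eq_square) (simp add: field_simps)
    moreover have "1 / x - 1 + (1 - 1 / x) / x\<^sup>2 \<le> 0"
    proof -
      have "(1 - 1 / x) / x\<^sup>2 \<le> (1 - 1 / x) / 1" using x x0 by (intro divide_left_mono) (auto simp: one_le_power)
      thus ?thesis by simp
    qed
    ultimately show "\<exists>y. (g has_real_derivative y) (at x) \<and> y \<le> 0" by blast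
  qed
  thus ?thesis by (simp add: g_def)
qed

text \<open>
  With \<open>A = 1 - q\<close> and \<open>x = 1 - p\<close>, the arithmetic-geometric mean inequality for
  \<open>A (h\<^sup>2 + 2 \<beta>\<^sup>2 p)\<close> and \<open>p / A\<close>, which are equal at \<open>p = q\<close>, bounds the square root.  What remains is
  \<open>ln (x / A) + 1 - x / A + \<beta>\<^sup>2 (x - A)\<^sup>2 \<le> 0\<close>; here \<open>\<beta> A\<close> and \<open>\<beta> x\<close> are at most \<open>1 / sqrt 2\<close>, and
  the larger of the two is used.
\<close>

lemma tap_le_value:
  assumes \<beta>: "0 < \<beta>" and h: "0 < h" and q: "0 < q" "q < 1" and eq: "q / (1 - q)\<^sup>2 = h\<^sup>2 + 2 * \<beta>\<^sup>2 * q"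
    and p: "0 \<le> p" "p < 1" "\<beta> * (1 - p) \<le> 1 / sqrt 2"
  shows "tap \<beta> h p \<le> value_at \<beta> q"
proof -
  define A where "A = 1 - q"
  define x where "x = 1 - p"
  have A: "0 < A" and x: "0 < x" using q p by (auto simp: A_def x_def)
  have bA: "\<beta>\<^sup>2 * A\<^sup>2 \<le> 1 / 2"
    using critical_bound[OF h q eq] unfolding A_def by (simp add: power_mult_distrib)
  have bx: "\<beta>\<^sup>2 * x\<^sup>2 \<le> 1 / 2"
  proof -
    have "(\<beta> * x)\<^sup>2 \<le> (1 / sqrt 2)\<^sup>2" using p(3) \<beta> x unfolding x_def by (intro power_mono) auto
    thus ?thesis by (simp add: power_mult_distrib power_divide)
  qed
  let ?a = "h\<^sup>2 + 2 * \<beta>\<^sup>2 * p"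
  have a0: "0 \<le> ?a" using p by simp
  have "sqrt (h\<^sup>2 * p + 2 * \<beta>\<^sup>2 * p\<^sup>2) \<le> (A * ?a + p / A) / 2"
  proof -
    have "h\<^sup>2 * p + 2 * \<beta>\<^sup>2 * p\<^sup>2 = (A * ?a) * (p / A)" using A by (simp add: power2_eq_square algebra_simps)
    thus ?thesis using arith_geo_mean_sqrt[of "A * ?a" "p / A"] A a0 p by simp
  qed
  hence 1: "tap \<beta> h p \<le> (A * ?a + p / A) / 2 + ln x / 2 + \<beta>\<^sup>2 / 2 * x\<^sup>2"
    unfolding tap_def x_def by simp
  have 2: "value_at \<beta> q - ((A * ?a + p / A) / 2 + ln x / 2 + \<beta>\<^sup>2 / 2 * x\<^sup>2)
      = - (ln (x / A) + 1 - x / A + \<beta>\<^sup>2 * (x - A)\<^sup>2) / 2"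
  proof -
    have pq: "p = 1 - x" "q = 1 - A" by (auto simp: x_def A_def)
    have h2: "h\<^sup>2 = q / A\<^sup>2 - 2 * \<beta>\<^sup>2 * q" using eq by (simp add: A_def)
    have "A * ?a = q / A + 2 * \<beta>\<^sup>2 * (p - q) * A" unfolding h2 using A by (simp add: power2_eq_square field_simps)
    hence 1: "(A * ?a + p / A) / 2 = (q + p) / (2 * A) + \<beta>\<^sup>2 * (p - q) * A" using A by (simp add: field_simps)
    have 2: "ln (x / A) = ln x - ln A" using x A by (simp add: ln_div)
    have 3: "q / (1 - q) - (q + p) / (2 * A) = - (1 - x / A) / 2" unfolding pq using A by (simp add: field_simps)
    have 4: "\<beta>\<^sup>2 / 2 * (1 - q)\<^sup>2 - \<beta>\<^sup>2 * (p - q) * A - \<beta>\<^sup>2 / 2 * x\<^sup>2 = - (\<beta>\<^sup>2 * (x - A)\<^sup>2) / 2"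
      unfolding pq by (simp add: power2_eq_square algebra_simps)
    have "ln (1 - q) = ln A" by (simp add: A_def)
    thus ?thesis unfolding value_at_def 1 2 using 3 4 by (simp add: algebra_simps add_divide_distrib diff_divide_distrib)
  qed
  have "ln (x / A) + 1 - x / A + \<beta>\<^sup>2 * (x - A)\<^sup>2 \<le> 0"
  proof (cases "x \<le> A")
    case True
    have "\<beta>\<^sup>2 * (x - A)\<^sup>2 = (\<beta>\<^sup>2 * A\<^sup>2) * (1 - x / A)\<^sup>2" using A by (simp add: power2_eq_square field_simps)
    also have "\<dots> \<le> 1 / 2 * (1 - x / A)\<^sup>2" using bA by (intro mult_right_mono) auto
    finally show ?thesis using ln_le_quadratic[of "x / A"] A x True by simp
  next
    case False
    have "\<beta>\<^sup>2 * (x - A)\<^sup>2 = (\<beta>\<^sup>2 * x\<^sup>2) * (1 - 1 / (x / A))\<^sup>2" using A x by (simp add: power2_eq_square field_simps)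
    also have "\<dots> \<le> 1 / 2 * (1 - 1 / (x / A))\<^sup>2" using bx by (intro mult_right_mono) auto
    finally show ?thesis using ln_le_quadratic_inverse[of "x / A"] A x False by simp
  qed
  hence "0 \<le> - (ln (x / A) + 1 - x / A + \<beta>\<^sup>2 * (x - A)\<^sup>2) / 2" by simp
  with 2 have "(A * ?a + p / A) / 2 + ln x / 2 + \<beta>\<^sup>2 / 2 * x\<^sup>2 \<le> value_at \<beta> q" by (metis diff_ge_0_iff_ge)
  with 1 show ?thesis by (rule order_trans)
qed

lemma tap_field_mono:
  assumes h: "0 \<le> h" "0 \<le> \<eta>" and q: "0 \<le> q" "q \<le> 1"
  shows "tap \<beta> h q \<le> tap \<beta> (h + \<eta>) q" "tap \<beta> (h + \<eta>) q \<le> tap \<beta> h q + \<eta>"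
proof -
  let ?X = "h\<^sup>2 * q + 2 * \<beta>\<^sup>2 * q\<^sup>2"
  have X0: "0 \<le> ?X" using q by simp
  have "h\<^sup>2 * q \<le> (h + \<eta>)\<^sup>2 * q" using h q by (intro mult_right_mono power_mono) auto
  thus "tap \<beta> h q \<le> tap \<beta> (h + \<eta>) q" unfolding tap_def by simp
  have "h * sqrt q \<le> sqrt ?X"
  proof (rule real_le_rsqrt)
    show "(h * sqrt q)\<^sup>2 \<le> ?X" using q by (simp add: power_mult_distrib)
  qed
  moreover have "sqrt q * sqrt q \<le> sqrt q * 1" using q by (intro mult_left_mono) auto
  hence "h * q \<le> h * sqrt q" using h q by (intro mult_left_mono) auto
  ultimately have hq: "h * q \<le> sqrt ?X" by linarith
  have "(h + \<eta>)\<^sup>2 * q + 2 * \<beta>\<^sup>2 * q\<^sup>2 = ?X + 2 * \<eta> * (h * q) + \<eta>\<^sup>2 * q" by (simp add: power2_eq_square algebra_simps)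
  also have "\<dots> \<le> ?X + 2 * \<eta> * sqrt ?X + \<eta>\<^sup>2 * 1"
    using hq h q by (intro add_mono mult_left_mono) auto
  also have "\<dots> = (sqrt ?X + \<eta>)\<^sup>2" using X0 by (simp add: power2_sum)
  finally have "sqrt ((h + \<eta>)\<^sup>2 * q + 2 * \<beta>\<^sup>2 * q\<^sup>2) \<le> sqrt ?X + \<eta>"
    by (rule real_le_lsqrt[rotated -1]) (use X0 h in auto)
  thus "tap \<beta> (h + \<eta>) q \<le> tap \<beta> h q + \<eta>" unfolding tap_def by simp
qed

section \<open>Convergence in probability\<close>

text \<open>
  As \<open>|u - c| = (u - c) + 2 max 0 (c - u)\<close>, an upper bound on the mean and a bound on the shortfall give
  convergence in the mean.
\<close>

lemma mean_convergence:
  assumes \<beta>: "0 < \<beta>" and h: "0 < h" and q: "0 < q" "q < 1" and eq: "q / (1 - q)\<^sup>2 = h\<^sup>2 + 2 * \<beta>\<^sup>2 * q"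
    and w: "\<And>n. 1 \<le> n \<Longrightarrow> L2_set (w n) {1..n} = h"
  shows "(\<lambda>n. \<integral>x. \<bar>Phi n (\<beta> * sqrt (real n)) (\<lambda>i. real n * w n i) x / real n - value_at \<beta> q\<bar> \<partial>gauss (idx n)) \<longlonglongrightarrow> 0"
proof -
  define b where "b n = \<beta> * sqrt (real n)" for n
  define v where "v n i = real n * w n i" for n i
  define P where "P = value_at \<beta> q"
  \<comment> \<open>minimises the upper bound when \<open>q\<close> solves the critical point equation\<close>
  define z where "z = 1 / (2 * (1 - q))"
  define Q where "Q = q / (1 - q)"
  define H where "H = h\<^sup>2 + 2 * \<beta>\<^sup>2 * q"
  have z: "0 < z" using q by (simp add: z_def)
  have L: "L2_set (v n) {1..n} = real n * h" if "1 \<le> n" for n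
    using w[OF that] L2_set_right_distrib[of "real n" "w n" "{1..n}"] by (simp add: v_def[abs_def])
  have lb: "(\<lambda>n. b n / sqrt (real n)) \<longlonglongrightarrow> \<beta>"
    by (intro tendsto_eventually eventually_mono[OF eventually_gt_at_top[of 0]]) (simp add: b_def)
  have lv: "(\<lambda>n. L2_set (v n) {1..n} / real n) \<longlonglongrightarrow> h"
    by (intro tendsto_eventually eventually_mono[OF eventually_gt_at_top[of 0]]) (simp add: L)
  have sf: "(\<lambda>n. shortfall n (b n) (v n) (real n * P) / real n) \<longlonglongrightarrow> 0"
    using lower_limit_value[OF \<beta> h q eq] lb lv unfolding lower_limit_def P_def by blast
  define d where "d n = (1 / 2 + 3 * z + 1 + H / 2) * (1 / real n) + ln (real n) / real n" for n
  have "d \<longlonglongrightarrow> (1 / 2 + 3 * z + 1 + H / 2) * 0 + 0"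
    unfolding d_def by (intro tendsto_intros lim_1_over_n lim_ln_over_n)
  hence d: "d \<longlonglongrightarrow> 0" by simp
  have upper: "(\<integral>x. Phi n (b n) (v n) x \<partial>gauss (idx n)) \<le> real n * P + real n * d n" if n: "2 \<le> n" for n
  proof -
    have n0: "0 < real n" "1 \<le> n" using n by auto
    have "(L2_set (v n) {1..n})\<^sup>2 + 2 * (b n)\<^sup>2 * q * real n = (real n)\<^sup>2 * H"
      unfolding L[OF n0(2)] b_def H_def by (simp add: power_mult_distrib power2_eq_square algebra_simps)
    hence "(\<integral>x. Phi n (b n) (v n) x \<partial>gauss (idx n)) \<le> real n * (z - 1/2 - ln (2 * z) / 2)
        + (real n)\<^sup>2 * H * (1 / (4 * z * real n) + 1 / (2 * (real n)\<^sup>2)) + 1 / 2 + 3 * z + 1 + ln (real n) + (b n)\<^sup>2 * (1 - q)\<^sup>2 / 2"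
      using Phi_upper[OF n less_imp_le[OF q(1)] z, of "b n" "v n"] by simp
    also have "(real n)\<^sup>2 * H * (1 / (4 * z * real n) + 1 / (2 * (real n)\<^sup>2)) = real n * (H / (4 * z)) + H / 2"
      using n0 z by (simp add: power2_eq_square field_simps)
    also have "H / (4 * z) = Q / 2"
    proof -
      have a: "q / r\<^sup>2 / (4 * (1 / (2 * r))) = q / r / 2" if "r \<noteq> 0" for r
        using that by (simp add: power2_eq_square)
      have "1 - q \<noteq> 0" using q by simp
      from a[OF this] show ?thesis unfolding H_def eq[symmetric] z_def Q_def .
    qed
    also have "z - 1/2 - ln (2 * z) / 2 = Q / 2 + ln (1 - q) / 2"
    proof -
      have "2 * (1 / (2 * r)) = inverse r" for r :: real by (simp add: inverse_eq_divide)
      hence "2 * z = inverse (1 - q)" unfolding z_def .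
      hence "ln (2 * z) = - ln (1 - q)" using q by (simp add: ln_inverse)
      moreover have "z - 1/2 = Q / 2" using q by (simp add: z_def Q_def field_simps)
      ultimately show ?thesis by simp
    qed
    also have "(b n)\<^sup>2 * (1 - q)\<^sup>2 / 2 = real n * (\<beta>\<^sup>2 / 2 * (1 - q)\<^sup>2)"
      unfolding b_def by (simp add: power_mult_distrib)
    finally have "(\<integral>x. Phi n (b n) (v n) x \<partial>gauss (idx n))
        \<le> real n * P + (1 / 2 + 3 * z + 1 + H / 2 + ln (real n))"
      unfolding P_def value_at_def Q_def[symmetric] by (simp add: distrib_left right_diff_distrib mult.commute[of Q])
    also have "1 / 2 + 3 * z + 1 + H / 2 + ln (real n) = real n * d n"
      unfolding d_def using n0 by (simp add: field_simps)
    finally show ?thesis .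
  qed
  have bound: "(\<integral>x. \<bar>Phi n (b n) (v n) x / real n - P\<bar> \<partial>gauss (idx n))
      \<le> d n + 2 * (shortfall n (b n) (v n) (real n * P) / real n)" if n: "2 \<le> n" for n
  proof -
    interpret GG: prob_space "gauss (idx n)" by (rule prob_space_gauss)
    have n0: "0 < real n" using n by simp
    have i: "integrable (gauss (idx n)) (\<lambda>x. Phi n (b n) (v n) x)" by (rule integrable_Phi) simp
    have i2: "integrable (gauss (idx n)) (\<lambda>x. max 0 (real n * P - Phi n (b n) (v n) x))" by (rule integrable_shortfall) simp
    have "(\<integral>x. \<bar>Phi n (b n) (v n) x / real n - P\<bar> \<partial>gauss (idx n))
        = (\<integral>x. (Phi n (b n) (v n) x - real n * P + 2 * max 0 (real n * P - Phi n (b n) (v n) x)) / real n \<partial>gauss (idx n))"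
    proof (rule Bochner_Integration.integral_cong[OF refl])
      fix x
      have "\<bar>Phi n (b n) (v n) x / real n - P\<bar> = \<bar>(Phi n (b n) (v n) x - real n * P) / real n\<bar>"
        using n0 by (simp add: diff_divide_distrib)
      also have "\<dots> = \<bar>Phi n (b n) (v n) x - real n * P\<bar> / real n" by simp
      also have "\<bar>Phi n (b n) (v n) x - real n * P\<bar>
          = Phi n (b n) (v n) x - real n * P + 2 * max 0 (real n * P - Phi n (b n) (v n) x)"
        by (simp add: max_def abs_if)
      finally show "\<bar>Phi n (b n) (v n) x / real n - P\<bar>
          = (Phi n (b n) (v n) x - real n * P + 2 * max 0 (real n * P - Phi n (b n) (v n) x)) / real n" .
    qed
    also have "\<dots> = ((\<integral>x. Phi n (b n) (v n) x \<partial>gauss (idx n)) - real n * P + 2 * shortfall n (b n) (v n) (real n * P)) / real n"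
      unfolding shortfall_def using i i2 by (simp add: GG.prob_space)
    also have "\<dots> \<le> (real n * d n + 2 * shortfall n (b n) (v n) (real n * P)) / real n"
      using upper[OF n] by (intro divide_right_mono) auto
    also have "\<dots> = d n + 2 * (shortfall n (b n) (v n) (real n * P) / real n)"
      using n0 by (simp add: add_divide_distrib)
    finally show ?thesis .
  qed
  have "(\<lambda>n. d n + 2 * (shortfall n (b n) (v n) (real n * P) / real n)) \<longlonglongrightarrow> 0 + 2 * 0"
    by (intro tendsto_intros d sf)
  hence lim: "(\<lambda>n. d n + 2 * (shortfall n (b n) (v n) (real n * P) / real n)) \<longlonglongrightarrow> 0" by simp
  show ?thesis
    unfolding b_def[symmetric] v_def[symmetric] P_def[symmetric]
  proof (rule tendsto_sandwich[OF _ _ tendsto_const lim])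
    show "\<forall>\<^sub>F n in sequentially. 0 \<le> (\<integral>x. \<bar>Phi n (b n) (v n) x / real n - P\<bar> \<partial>gauss (idx n))"
      by (intro always_eventually allI Bochner_Integration.integral_nonneg) simp
    show "\<forall>\<^sub>F n in sequentially. (\<integral>x. \<bar>Phi n (b n) (v n) x / real n - P\<bar> \<partial>gauss (idx n))
        \<le> d n + 2 * (shortfall n (b n) (v n) (real n * P) / real n)"
      using eventually_ge_at_top[of 2] by eventually_elim (rule bound)
  qed
qed

lemma free_energy_eq:
  assumes N: "1 \<le> N"
  shows "free_energy J N \<beta> v = Phi N (\<beta> * sqrt (real N)) (\<lambda>i. real N * v i) (\<lambda>p. J (fst p) (snd p)) / real N"
proof -
  let ?F = "\<lambda>\<sigma>. exp (\<beta> * hamiltonian J N \<sigma> + real N * (\<Sum>i=1..N. v i * \<sigma> i))"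
  have F: "?F \<in> borel_measurable (lebesgue_R N)"
    unfolding hamiltonian_def
    by (intro borel_measurable_exp[THEN measurable_compose[rotated]] borel_measurable_add
          borel_measurable_times borel_measurable_sum borel_measurable_const
          measurable_component_lebesgue_R)
  have e: "\<beta> * hamiltonian J N \<sigma> + real N * (\<Sum>i=1..N. v i * \<sigma> i)
      = energy N (\<beta> * sqrt (real N)) (\<lambda>i. real N * v i) (\<lambda>p. J (fst p) (snd p)) \<sigma>" for \<sigma>
    unfolding hamiltonian_def energy_def bil_def by (simp add: sum_distrib_left mult_ac)
  have "(\<integral>\<sigma>. ?F \<sigma> \<partial>uniform_sphere N) = (\<integral>x. ?F (sph N x) \<partial>uball N)"
  proof (rule integral_uniform_sphere[OF N F])
    fix x y :: "nat \<Rightarrow> real" assume "\<And>i. i \<in> {1..N} \<Longrightarrow> x i = y i"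
    thus "?F x = ?F y" unfolding e by (intro arg_cong[where f = exp] energy_cong)
  qed
  thus ?thesis unfolding free_energy_def Phi_def log_avg_def e by simp
qed

locale disorder = prob_space M for M :: "'a measure" +
  fixes J :: "nat \<Rightarrow> nat \<Rightarrow> 'a \<Rightarrow> real"
  assumes indep: "indep_vars (\<lambda>_. borel) (\<lambda>(i, j). J i j) ({1..} \<times> {1..})"
    and normal: "\<And>i j. 1 \<le> i \<Longrightarrow> 1 \<le> j \<Longrightarrow> distributed M lborel (J i j) std_normal_density"
begin

lemma coupling_measurable: "1 \<le> i \<Longrightarrow> 1 \<le> j \<Longrightarrow> J i j \<in> borel_measurable M"
  using distributed_measurable[OF normal] by simp

lemma Phi_disorder_measurable: "(\<lambda>\<omega>. Phi n b v (\<lambda>p. J (fst p) (snd p) \<omega>)) \<in> borel_measurable M"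
  by (rule Phi_measurable) (auto simp: idx_def intro: coupling_measurable)

lemma disorder_law:
  assumes "1 \<le> n"
  shows "distr M (\<Pi>\<^sub>M p\<in>idx n. borel) (\<lambda>\<omega>. \<lambda>p\<in>idx n. J (fst p) (snd p) \<omega>) = gauss (idx n)"
proof -
  let ?X = "\<lambda>p. J (fst p) (snd p)"
  have ne: "idx n \<noteq> {}" using assms by (auto simp: idx_def)
  have rv: "?X p \<in> borel_measurable M" if "p \<in> idx n" for p
    using that by (intro coupling_measurable) (auto simp: idx_def)
  have d: "distr M borel (?X p) = std_normal_distribution" if "p \<in> idx n" for p
  proof -
    have "distr M borel (?X p) = distr M lborel (?X p)" by (rule distr_cong) auto
    also have "\<dots> = std_normal_distribution"
      using that by (intro distributed_distr_eq_density normal) (auto simp: idx_def)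
    finally show ?thesis .
  qed
  have "indep_vars (\<lambda>_. borel) (\<lambda>(i, j). J i j) (idx n)"
    by (rule indep_vars_subset[OF indep]) (auto simp: idx_def)
  hence "indep_vars (\<lambda>_. borel) ?X (idx n)" by (simp add: case_prod_beta')
  hence "distr M (\<Pi>\<^sub>M p\<in>idx n. borel) (\<lambda>\<omega>. \<lambda>p\<in>idx n. ?X p \<omega>) = (\<Pi>\<^sub>M p\<in>idx n. distr M borel (?X p))"
    using indep_vars_iff_distr_eq_PiM'[OF ne, where M' = "\<lambda>_. borel" and X = ?X] rv by blast
  also have "\<dots> = gauss (idx n)" unfolding gauss_def by (intro PiM_cong refl d)
  finally show ?thesis .
qed

lemma Phi_in_probability:
  assumes \<beta>: "0 < \<beta>" and h: "0 < h" and q: "0 < q" "q < 1" and eq: "q / (1 - q)\<^sup>2 = h\<^sup>2 + 2 * \<beta>\<^sup>2 * q"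
    and w: "\<And>n. 1 \<le> n \<Longrightarrow> L2_set (w n) {1..n} = h" and e: "0 < e"
  shows "(\<lambda>n. prob {\<omega> \<in> space M. e \<le> \<bar>Phi n (\<beta> * sqrt (real n)) (\<lambda>i. real n * w n i) (\<lambda>p. J (fst p) (snd p) \<omega>) / real n
      - value_at \<beta> q\<bar>}) \<longlonglongrightarrow> 0"
proof -
  define F where "F n x = \<bar>Phi n (\<beta> * sqrt (real n)) (\<lambda>i. real n * w n i) x / real n - value_at \<beta> q\<bar>" for n x
  have Fm: "F n \<in> borel_measurable (gauss (idx n))" for n
    unfolding F_def using Phi_meas_gauss[of n "idx n"] by simp
  have Fi: "integrable (gauss (idx n)) (F n)" for n
  proof -
    interpret GG: prob_space "gauss (idx n)" by (rule prob_space_gauss)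
    show ?thesis unfolding F_def using integrable_Phi[of n "idx n"] by simp
  qed
  let ?X = "\<lambda>n \<omega>. \<lambda>p\<in>idx n. J (fst p) (snd p) \<omega>"
  have Xm: "?X n \<in> measurable M (\<Pi>\<^sub>M p\<in>idx n. borel)" for n
    by (intro measurable_restrict coupling_measurable) (auto simp: idx_def)
  have FX: "F n (\<lambda>p. J (fst p) (snd p) \<omega>) = F n (?X n \<omega>)" for n \<omega>
  proof -
    have "Phi n b v (\<lambda>p. J (fst p) (snd p) \<omega>) = Phi n b v (?X n \<omega>)" for b v by (rule Phi_cong) auto
    thus ?thesis unfolding F_def by simp
  qed
  have bound: "prob {\<omega> \<in> space M. e \<le> F n (\<lambda>p. J (fst p) (snd p) \<omega>)} \<le> (\<integral>x. F n x \<partial>gauss (idx n)) / e" if n: "1 \<le> n" for n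
  proof -
    have Fm': "F n \<in> borel_measurable (\<Pi>\<^sub>M p\<in>idx n. borel)"
      using Fm[of n] by (simp cong: measurable_cong_sets add: sets_gauss)
    have "integrable (distr M (\<Pi>\<^sub>M p\<in>idx n. borel) (?X n)) (F n)" unfolding disorder_law[OF n] by (rule Fi)
    hence i: "integrable M (\<lambda>\<omega>. F n (?X n \<omega>))" by (subst (asm) integrable_distr_eq[OF Xm Fm'])
    have "prob {\<omega> \<in> space M. e \<le> F n (?X n \<omega>)} \<le> (\<integral>\<omega>. F n (?X n \<omega>) \<partial>M) / e"
      by (rule integral_Markov_inequality_measure[OF i sets.empty_sets _ e]) (simp add: F_def)
    also have "(\<integral>\<omega>. F n (?X n \<omega>) \<partial>M) = (\<integral>x. F n x \<partial>gauss (idx n))"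
      unfolding disorder_law[OF n, symmetric] by (rule integral_distr[OF Xm Fm', symmetric])
    finally show ?thesis unfolding FX .
  qed
  have "(\<lambda>n. (\<integral>x. F n x \<partial>gauss (idx n)) / e) \<longlonglongrightarrow> 0 / e"
    using mean_convergence[OF \<beta> h q eq w] e unfolding F_def by (intro tendsto_divide tendsto_const) auto
  hence lim: "(\<lambda>n. (\<integral>x. F n x \<partial>gauss (idx n)) / e) \<longlonglongrightarrow> 0" by simp
  show ?thesis unfolding F_def[symmetric]
  proof (rule tendsto_sandwich[OF _ _ tendsto_const lim])
    show "\<forall>\<^sub>F n in sequentially. prob {\<omega> \<in> space M. e \<le> F n (\<lambda>p. J (fst p) (snd p) \<omega>)} \<le> (\<integral>x. F n x \<partial>gauss (idx n)) / e"
      using eventually_ge_at_top[of 1] by eventually_elim (rule bound)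
  qed simp
qed

end

lemma enlarge_vector:
  fixes n :: nat
  assumes n: "1 \<le> n" and v: "L2_set v {1..n} = h" and \<eta>: "0 < \<eta>"
  shows "\<exists>w. L2_set w {1..n} = h + \<eta> \<and> L2_set (\<lambda>i. w i - v i) {1..n} = \<eta>"
proof (cases "h = 0")
  case True
  hence z: "v i = 0" if "i \<in> {1..n}" for i using v True L2_set_eq_0_iff[of "{1..n}" v] that by simp
  have "L2_set (\<lambda>i. last_field n \<eta> i - v i) {1..n} = L2_set (last_field n \<eta>) {1..n}"
    by (rule L2_set_cong) (auto simp: z)
  thus ?thesis using L2_last_field[OF n, of \<eta>] \<eta> True by (intro exI[of _ "last_field n \<eta>"]) simp
next
  case False
  have "0 \<le> h" unfolding v[symmetric] by (rule L2_set_nonneg)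
  hence h: "0 < h" using False by simp
  have m: "L2_set (\<lambda>i. c * v i) {1..n} = c * h" if "0 \<le> c" for c
    using L2_set_right_distrib[OF that, of v "{1..n}"] v by simp
  have "L2_set (\<lambda>i. (1 + \<eta> / h) * v i) {1..n} = h + \<eta>"
  proof -
    have "(1 + \<eta> / h) * h = h + \<eta>" using h by (simp add: distrib_right)
    thus ?thesis using m[of "1 + \<eta> / h"] h \<eta> by simp
  qed
  moreover have "L2_set (\<lambda>i. (1 + \<eta> / h) * v i - v i) {1..n} = \<eta>"
    using m[of "\<eta> / h"] h \<eta> unfolding distrib_right by simp
  ultimately show ?thesis by blast
qed

text \<open>
  The critical point belongs to the field strength \<open>h + \<eta>\<close>; returning to \<open>h\<close> changes the function by at
  most \<open>\<eta>\<close>.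
\<close>

lemma sup_TAP_bounds:
  assumes \<beta>: "0 < \<beta>" and h: "0 \<le> h" and \<eta>: "0 < \<eta>"
    and q: "0 < q" "q < 1" and eq: "q / (1 - q)\<^sup>2 = (h + \<eta>)\<^sup>2 + 2 * \<beta>\<^sup>2 * q"
  defines "L \<equiv> SUP q \<in> {q. 0 \<le> q \<and> q \<le> 1 \<and> \<beta> * (1 - q) \<le> 1 / sqrt 2}. TAP_fun \<beta> h q"
  shows "L \<le> ereal (value_at \<beta> q)" "ereal (value_at \<beta> q - \<eta>) \<le> L"
proof -
  have h\<eta>: "0 < h + \<eta>" using h \<eta> by simp
  show "L \<le> ereal (value_at \<beta> q)" unfolding L_def
  proof (rule SUP_least)
    fix p assume p: "p \<in> {q. 0 \<le> q \<and> q \<le> 1 \<and> \<beta> * (1 - q) \<le> 1 / sqrt 2}"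
    show "TAP_fun \<beta> h p \<le> ereal (value_at \<beta> q)"
    proof (cases "p = 1")
      case True thus ?thesis by (simp add: TAP_fun_1)
    next
      case False
      hence p1: "p < 1" using p by simp
      have "tap \<beta> h p \<le> tap \<beta> (h + \<eta>) p" using p h \<eta> by (intro tap_field_mono) auto
      also have "\<dots> \<le> value_at \<beta> q" using p p1 by (intro tap_le_value[OF \<beta> h\<eta> q eq]) auto
      finally show ?thesis using p1 by (simp add: TAP_fun_eq)
    qed
  qed
  have mem: "q \<in> {q. 0 \<le> q \<and> q \<le> 1 \<and> \<beta> * (1 - q) \<le> 1 / sqrt 2}"
  proof -
    have "(\<beta> * (1 - q))\<^sup>2 \<le> (1 / sqrt 2)\<^sup>2"
      using critical_bound[OF h\<eta> q eq] by (simp add: power_divide)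
    hence "\<beta> * (1 - q) \<le> 1 / sqrt 2" by (rule power2_le_imp_le) simp
    thus ?thesis using q by simp
  qed
  have "value_at \<beta> q = tap \<beta> (h + \<eta>) q" using tap_critical[OF q eq] by simp
  also have "\<dots> \<le> tap \<beta> h q + \<eta>" using h \<eta> q by (intro tap_field_mono) auto
  finally have "ereal (value_at \<beta> q - \<eta>) \<le> TAP_fun \<beta> h q" using q by (simp add: TAP_fun_eq)
  also have "\<dots> \<le> L" unfolding L_def by (rule SUP_upper[OF mem])
  finally show "ereal (value_at \<beta> q - \<eta>) \<le> L" .
qed

theorem mainTheorem3:
  fixes M :: "'a measure" and J :: "nat \<Rightarrow> nat \<Rightarrow> 'a \<Rightarrow> real"
    and \<beta> h :: real and h_vec :: "nat \<Rightarrow> nat \<Rightarrow> real"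
  assumes "prob_space M"
    and "prob_space.indep_vars M (\<lambda>_. borel) (\<lambda>(i, j). J i j) ({1..} \<times> {1..})"
    and "\<And>i j. i \<ge> 1 \<Longrightarrow> j \<ge> 1 \<Longrightarrow> distributed M lborel (J i j) std_normal_density"
    and "\<beta> > 0" and "h \<ge> 0"
    and "\<And>N. N \<ge> 1 \<Longrightarrow> L2_set (h_vec N) {1..N} = h"
  shows "converges_in_probability M
           (\<lambda>N \<omega>. free_energy (\<lambda>i j. J i j \<omega>) N \<beta> (h_vec N))
           (SUP q \<in> {q. 0 \<le> q \<and> q \<le> 1 \<and> \<beta> * (1 - q) \<le> 1 / sqrt 2}. TAP_fun \<beta> h q)"
proof -
  interpret disorder M J
    by (intro disorder.intro disorder_axioms.intro assms(1-3))
  note \<beta> = assms(4) and h = assms(5)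
  let ?X = "\<lambda>N \<omega>. free_energy (\<lambda>i j. J i j \<omega>) N \<beta> (h_vec N)"
  let ?G = "\<lambda>N v \<omega>. Phi N (\<beta> * sqrt (real N)) (\<lambda>i. real N * v i) (\<lambda>p. J (fst p) (snd p) \<omega>) / real N"
  define L where "L = (SUP q \<in> {q. 0 \<le> q \<and> q \<le> 1 \<and> \<beta> * (1 - q) \<le> 1 / sqrt 2}. TAP_fun \<beta> h q)"
  have X: "?X N \<omega> = ?G N (h_vec N) \<omega>" if "1 \<le> N" for N \<omega>
    by (rule free_energy_eq[OF that])
  have Gm: "(\<lambda>\<omega>. ?G N v \<omega>) \<in> borel_measurable M" for N v
    by (intro borel_measurable_divide Phi_disorder_measurable borel_measurable_const)
  have Xm: "?X N \<in> borel_measurable M" for N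
  proof (cases "N = 0")
    case True thus ?thesis by (simp add: free_energy_def)
  next
    case False
    hence "1 \<le> N" by simp
    thus ?thesis using Gm[of N "h_vec N"] by (simp add: X)
  qed
  have "(\<lambda>N. prob {\<omega> \<in> space M. ereal \<epsilon> \<le> \<bar>ereal (?X N \<omega>) - L\<bar>}) \<longlonglongrightarrow> 0" if \<epsilon>: "0 < \<epsilon>" for \<epsilon> :: real
  proof -
    define \<eta> where "\<eta> = \<epsilon> / 4"
    have \<eta>: "0 < \<eta>" using \<epsilon> by (simp add: \<eta>_def)
    have h\<eta>: "0 < h + \<eta>" using h \<eta> by simp
    obtain q where q: "0 < q" "q < 1" and eq: "q / (1 - q)\<^sup>2 = (h + \<eta>)\<^sup>2 + 2 * \<beta>\<^sup>2 * q"
      using critical_exists[OF h\<eta>] by blast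
    define P where "P = value_at \<beta> q"
    have LP: "L \<le> ereal P" "ereal (P - \<eta>) \<le> L"
      unfolding L_def P_def by (rule sup_TAP_bounds[OF \<beta> h \<eta> q eq])+
    then obtain l where l: "L = ereal l" by (cases L) auto
    have lP: "l \<le> P" "P - \<eta> \<le> l" using LP by (auto simp: l)
    have "\<forall>N. \<exists>w. 1 \<le> N \<longrightarrow> L2_set w {1..N} = h + \<eta> \<and> L2_set (\<lambda>i. w i - h_vec N i) {1..N} = \<eta>"
      using enlarge_vector[OF _ assms(6) \<eta>] by blast
    then obtain w where w: "\<And>N. 1 \<le> N \<Longrightarrow> L2_set (w N) {1..N} = h + \<eta>"
        "\<And>N. 1 \<le> N \<Longrightarrow> L2_set (\<lambda>i. w N i - h_vec N i) {1..N} = \<eta>"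
      by metis
    have close: "\<bar>?X N \<omega> - ?G N (w N) \<omega>\<bar> \<le> \<eta>" if N: "1 \<le> N" for N \<omega>
    proof -
      have N0: "0 < real N" using N by simp
      let ?P = "\<lambda>v. Phi N (\<beta> * sqrt (real N)) (\<lambda>i. real N * v i) (\<lambda>p. J (fst p) (snd p) \<omega>)"
      have d: "L2_set (\<lambda>i. real N * w N i - real N * h_vec N i) {1..N} = real N * \<eta>"
        using L2_set_right_distrib[of "real N" "\<lambda>i. w N i - h_vec N i" "{1..N}"] w(2)[OF N]
        by (simp add: right_diff_distrib)
      moreover have "L2_set (\<lambda>i. real N * h_vec N i - real N * w N i) {1..N} = real N * \<eta>"
        using d unfolding L2_set_def by (simp only: power2_commute[of "real N * h_vec N _"])
      ultimately have "\<bar>?P (h_vec N) - ?P (w N)\<bar> \<le> real N * \<eta>"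
        using Phi_lipschitz[OF N, of "\<beta> * sqrt (real N)" "\<lambda>i. real N * w N i" "\<lambda>p. J (fst p) (snd p) \<omega>" "\<lambda>i. real N * h_vec N i"]
          Phi_lipschitz[OF N, of "\<beta> * sqrt (real N)" "\<lambda>i. real N * h_vec N i" "\<lambda>p. J (fst p) (snd p) \<omega>" "\<lambda>i. real N * w N i"]
        by linarith
      hence "\<bar>?P (h_vec N) - ?P (w N)\<bar> / real N \<le> \<eta>" using N0 by (simp add: divide_le_eq mult.commute)
      moreover have "?X N \<omega> - ?G N (w N) \<omega> = (?P (h_vec N) - ?P (w N)) / real N"
        unfolding X[OF N] by (simp add: diff_divide_distrib)
      ultimately show ?thesis by simp
    qed
    have lim: "(\<lambda>N. prob {\<omega> \<in> space M. \<epsilon> / 2 \<le> \<bar>?G N (w N) \<omega> - P\<bar>}) \<longlonglongrightarrow> 0"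
      unfolding P_def by (rule Phi_in_probability[OF \<beta> h\<eta> q eq w(1)]) (use \<epsilon> in simp_all)
    show ?thesis
    proof (rule tendsto_sandwich[OF _ _ tendsto_const lim])
      show "\<forall>\<^sub>F N in sequentially. prob {\<omega> \<in> space M. ereal \<epsilon> \<le> \<bar>ereal (?X N \<omega>) - L\<bar>}
          \<le> prob {\<omega> \<in> space M. \<epsilon> / 2 \<le> \<bar>?G N (w N) \<omega> - P\<bar>}"
        using eventually_ge_at_top[of 1]
      proof eventually_elim
        case (elim N)
        show ?case
        proof (rule finite_measure_mono)
          show "{\<omega> \<in> space M. ereal \<epsilon> \<le> \<bar>ereal (?X N \<omega>) - L\<bar>} \<subseteq> {\<omega> \<in> space M. \<epsilon> / 2 \<le> \<bar>?G N (w N) \<omega> - P\<bar>}"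
          proof (intro subsetI CollectI conjI; elim CollectE conjE)
            fix \<omega> assume "ereal \<epsilon> \<le> \<bar>ereal (?X N \<omega>) - L\<bar>"
            hence "\<epsilon> \<le> \<bar>?X N \<omega> - l\<bar>" by (simp add: l)
            thus "\<epsilon> / 2 \<le> \<bar>?G N (w N) \<omega> - P\<bar>"
              using close[OF elim, of \<omega>] lP unfolding \<eta>_def by linarith
          qed
          have "(\<lambda>\<omega>. \<bar>?G N (w N) \<omega> - P\<bar>) \<in> borel_measurable M"
            by (intro borel_measurable_abs borel_measurable_diff Gm borel_measurable_const)
          thus "{\<omega> \<in> space M. \<epsilon> / 2 \<le> \<bar>?G N (w N) \<omega> - P\<bar>} \<in> sets M" by simp
        qed
      qed
    qed simp
  qed
  thus ?thesis unfolding converges_in_probability_def L_def[symmetric] using Xm by blast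
qed

end
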